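(* Let $d\ge 1$, $p\ge 2$, $q\in(0,2]$, $K<\infty$ and $\lambda_0>0$. There is a constant $C<\infty$, depending only on $d,p,q,K,\lambda_0$ (in particular not on $n$ or $M$), such that the following holds. Let $n\ge1$, let $M\ge 0$ be an integer, and let $\{X_i\}_{i=0}^{n-1}$ be an $M$-dependent collection of $\mathbb{R}^d$-valued random vectors with $\mathbb{E}[X_i]=0$. Let $S_n:=\sum_{i=0}^{n-1}X_i$ and $\Sigma_n:=\frac1n\operatorname{Var}(S_n)$. If $\lambda_{\min}(\Sigma_n)\ge\lambda_0$ and $\sup_{0\le i\le n-1}\mathbb{E}\big[\|X_i\|^{p+q}\big]\le K$, then $$\mathcal{W}_p\big(\mathcal{L}(S_n/\sqrt n),\mathcal{N}(0,\Sigma_n)\big)\le C\,\frac{\lambda_{\max}(\Sigma_n)^{1/2}}{\lambda_{\min}(\Sigma_n)^{1/2}}\,(M+1)^{1+\frac{2-q}{2(2p+q-2)}}\,n^{-\frac{p+q-2}{2(2p+q-2)}}.$$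
   Context: $\mathcal{L}(\cdot)$ denotes the law of a random variable, $\operatorname{Var}$ of a random vector is its covariance matrix, and $\mathcal{N}(0,\Sigma)$ is the centered Gaussian law with covariance $\Sigma$. $\lambda_{\min},\lambda_{\max}$ are the smallest and largest eigenvalues. For $p\ge1$ the Wasserstein-$p$ distance of probability measures $\nu,\mu$ on $\mathbb{R}^d$ is $\mathcal{W}_p(\nu,\mu)=\inf_{\gamma}\big(\mathbb{E}_{(X,Y)\sim\gamma}\|X-Y\|^p\big)^{1/p}$, the infimum over couplings $\gamma$ of $(\nu,\mu)$. The collection $\{X_i\}_{i=0}^{n-1}$ is $M$-dependent if the subcollections $\{X_i:i\in K\}$ and $\{X_j:j\in L\}$ are independent whenever $K,L\subseteq\{0,\dots,n-1\}$ satisfy $\min\{|i-j|:i\in K,\ j\in L\}>M$. $M$ may depend on $n$. *)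

theory Defs
  imports "HOL-Probability.Probability"
begin

text \<open>Powers with a positive real exponent on the extended nonnegative reals. The value \<open>\<infinity>\<close> has
  to be treated separately, because \<^const>\<open>enn2real\<close> sends it to \<open>0\<close>.\<close>

definition ennreal_powr :: "ennreal \<Rightarrow> real \<Rightarrow> ennreal"
  where "ennreal_powr x a = (if x = \<infinity> then \<infinity> else ennreal (enn2real x powr a))"

definition couplings ::
  "'a::euclidean_space measure \<Rightarrow> 'a measure \<Rightarrow> ('a \<times> 'a) measure set"
  where "couplings \<nu> \<mu> =
    {\<gamma>. sets \<gamma> = sets (borel \<Otimes>\<^sub>M borel) \<and> distr \<gamma> borel fst = \<nu> \<and> distr \<gamma> borel snd = \<mu>}"

text \<open>The distance is \<open>\<infinity>\<close> if no coupling has finite cost.\<close>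

definition wasserstein ::
  "real \<Rightarrow> 'a::euclidean_space measure \<Rightarrow> 'a measure \<Rightarrow> ennreal"
  where "wasserstein p \<nu> \<mu> =
    (INF \<gamma>\<in>couplings \<nu> \<mu>.
      ennreal_powr (\<integral>\<^sup>+ z. ennreal (norm (fst z - snd z) powr p) \<partial>\<gamma>) (1 / p))"

definition covariance_matrix :: "'a measure \<Rightarrow> ('a \<Rightarrow> real ^ 'd) \<Rightarrow> real ^ 'd ^ 'd"
  where "covariance_matrix P Y =
    (\<chi> i j. \<integral>\<omega>. (Y \<omega> $ i - (\<integral>\<omega>'. Y \<omega>' $ i \<partial>P)) * (Y \<omega> $ j - (\<integral>\<omega>'. Y \<omega>' $ j \<partial>P)) \<partial>P)"

definition real_eigenvalues :: "real ^ 'd ^ 'd \<Rightarrow> real set"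
  where "real_eigenvalues A = {l. \<exists>v. v \<noteq> 0 \<and> A *v v = l *\<^sub>R v}"

text \<open>Meant for symmetric matrices, whose set of real eigenvalues is finite and nonempty.\<close>

definition lambda_min :: "real ^ 'd ^ 'd \<Rightarrow> real"
  where "lambda_min A = Min (real_eigenvalues A)"

definition lambda_max :: "real ^ 'd ^ 'd \<Rightarrow> real"
  where "lambda_max A = Max (real_eigenvalues A)"

text \<open>The centered Gaussian law with covariance \<open>A\<close>, given by its Lebesgue density; meant for
  symmetric positive definite \<open>A\<close> only.\<close>

definition centered_gaussian :: "real ^ 'd ^ 'd \<Rightarrow> (real ^ 'd) measure"
  where "centered_gaussian A = density lborel
    (\<lambda>x. ennreal (exp (- (x \<bullet> (matrix_inv A *v x)) / 2) / sqrt ((2 * pi) ^ CARD('d) * det A)))"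

text \<open>Only \<open>X 0, \<dots>, X (n - 1)\<close> matter. The condition on \<open>I\<close> and \<open>J\<close> says that their
  distance exceeds \<open>M\<close>; it holds vacuously if one of them is empty, when independence is trivial.\<close>

definition m_dependent :: "'a measure \<Rightarrow> nat \<Rightarrow> nat \<Rightarrow> (nat \<Rightarrow> 'a \<Rightarrow> real ^ 'd) \<Rightarrow> bool"
  where "m_dependent P n M X \<longleftrightarrow>
    (\<forall>I J. I \<subseteq> {..<n} \<and> J \<subseteq> {..<n} \<and> (\<forall>i\<in>I. \<forall>j\<in>J. int M < \<bar>int i - int j\<bar>) \<longrightarrow>
      prob_space.indep_var P
        (Pi\<^sub>M I (\<lambda>_. borel)) (\<lambda>\<omega>. \<lambda>i\<in>I. X i \<omega>)
        (Pi\<^sub>M J (\<lambda>_. borel)) (\<lambda>\<omega>. \<lambda>j\<in>J. X j \<omega>))"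

definition partial_sum :: "(nat \<Rightarrow> 'a \<Rightarrow> real ^ 'd) \<Rightarrow> nat \<Rightarrow> 'a \<Rightarrow> real ^ 'd"
  where "partial_sum X n \<omega> = (\<Sum>i<n. X i \<omega>)"

definition Sigma_n :: "'a measure \<Rightarrow> (nat \<Rightarrow> 'a \<Rightarrow> real ^ 'd) \<Rightarrow> nat \<Rightarrow> real ^ 'd ^ 'd"
  where "Sigma_n P X n = (1 / real n) *\<^sub>R covariance_matrix P (partial_sum X n)"

text \<open>\<open>wasserstein_clt_constant TYPE('a) TYPE('d) p q K l0 C\<close> says that \<open>C\<close> is a valid constant in
  the Wasserstein bound for all \<open>n\<close>, all \<open>M\<close> and all \<open>M\<close>-dependent collections of random vectors
  in \<open>real ^ 'd\<close> that are defined on some probability space whose points have type \<open>'a\<close>.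
  The type of the points is a parameter because HOL cannot quantify over types inside a formula.\<close>

definition wasserstein_clt_constant ::
  "'a itself \<Rightarrow> 'd::finite itself \<Rightarrow> real \<Rightarrow> real \<Rightarrow> real \<Rightarrow> real \<Rightarrow> real \<Rightarrow> bool"
  where "wasserstein_clt_constant _ _ p q K l0 C \<longleftrightarrow>
    (\<forall>(P :: 'a measure) (X :: nat \<Rightarrow> 'a \<Rightarrow> real ^ 'd) (n :: nat) (M :: nat).
      prob_space P \<and> n \<ge> 1 \<and>
      (\<forall>i<n. X i \<in> borel_measurable P) \<and>
      m_dependent P n M X \<and>
      (\<forall>i<n. (\<integral>\<omega>. X i \<omega> \<partial>P) = 0) \<and>
      (\<forall>i<n. integrable P (\<lambda>\<omega>. norm (X i \<omega>) powr (p + q)) \<and>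
             (\<integral>\<omega>. norm (X i \<omega>) powr (p + q) \<partial>P) \<le> K) \<and>
      lambda_min (Sigma_n P X n) \<ge> l0
      \<longrightarrow>
      wasserstein p (distr P borel (\<lambda>\<omega>. (1 / sqrt (real n)) *\<^sub>R partial_sum X n \<omega>))
                    (centered_gaussian (Sigma_n P X n))
      \<le> ennreal (C * (sqrt (lambda_max (Sigma_n P X n)) / sqrt (lambda_min (Sigma_n P X n)))
           * (real M + 1) powr (1 + (2 - q) / (2 * (2 * p + q - 2)))
           * real n powr (- (p + q - 2) / (2 * (2 * p + q - 2)))))"

end

theory Submission
  imports Defs
begin

text \<open>Whiten the variables by a square root of \<open>\<Sigma>\<^sub>n\<close> and truncate them at level \<open>\<tau>\<close>, of order
  \<open>n powr -(p+q-2)/(2(2p+q-2))\<close>; put \<open>\<beta> = (M + 1) \<tau>\<close>. By Rosenthal's inequality for \<open>M\<close>-dependent sums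
  the discarded tails cost \<open>O(\<beta>)\<close>. The truncated sum \<open>W\<close> is transported along
  \<open>cos \<theta> W + sin \<theta> Z\<close>, with \<open>Z\<close> an independent standard Gaussian vector, from \<open>tan \<theta> = \<beta>\<close> to
  \<open>\<theta> = \<pi>/2\<close>; the missing initial piece costs \<open>O(\<beta>)\<close>.

  The cost of the transport is controlled by the \<open>L\<^sup>p\<close> norm of the velocity field
  \<open>v\<^sub>\<theta>(x) = E[d/d\<theta> (cos \<theta> W + sin \<theta> Z) | cos \<theta> W + sin \<theta> Z = x]\<close>. Since \<open>X\<^sub>i\<close> is independent of
  \<open>W - \<eta>\<^sub>i\<close>, where \<open>\<eta>\<^sub>i\<close> sums the \<open>X\<^sub>j\<close> with \<open>|i - j| \<le> M\<close>, and since \<open>cot \<theta> \<eta>\<^sub>i\<close> can be absorbed into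
  \<open>Z\<close> by the Cameron-Martin formula, \<open>v\<^sub>\<theta>\<close> is also a conditional expectation of
  \<open>cos \<theta> Z - sin \<theta> (\<Sum>i. X\<^sub>i (1 - exp(- cot \<theta> \<eta>\<^sub>i \<bullet> Z - |cot \<theta> \<eta>\<^sub>i|\<^sup>2/2)))\<close>. Given \<open>Z\<close>, this is a centred
  sum of local functions plus a small mean, and Rosenthal's inequality applies again.

  The flow of \<open>v\<close> is replaced by its Euler scheme. The weak error of the scheme and a little additional
  Gaussian noise make the final law close to the Gaussian law in density, and close densities are
  coupled by an explicit function of additional independent randomness, so that neither a flow nor a
  gluing lemma is needed. This gives the bound even with \<open>M + 1\<close> to the first power.\<close>

section \<open>Powers of norms\<close>

text \<open>The obstacle is that all smoothness bounds for the velocity degenerate with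
  \<open>n\<close>: they involve the deterministic bound on the truncated sum and the starting
  angle. They may do so because the number of Euler steps is chosen last. Only the
  \<open>L^p\<close> norm of the velocity survives; everything else is seen through expectations of
  test functions. The starting angle is dictated by the Cameron-Martin weights: it makes every shift
  cot \<theta> \<eta> have norm at most 1, so the weights are dominated by a function of Z alone.
  The linear parts of the weights add up to the covariance and cancel cos \<theta> Z; the quadratic
  parts cost third moments. No smallness of \<beta> is assumed. The fluctuation of the velocity has
  order \<beta>^2 and its mean has terms of order \<beta> and \<beta>^2. The remaining angle is
  arctan of the reciprocal of a multiple of \<beta>, hence bounded and at most 1/\<beta>, which
  turns \<beta>^2 into \<beta>. The level \<tau> is chosen so that \<open>n\<close> times the
  (p+q)-th moment of one normalised summand is at most \<tau>^(p+q), while \<open>n\<close> times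
  its truncated third and fourth moments are of order \<tau>^2 and \<tau>^4.\<close>

lemma powr_add_bound:
  fixes a b p :: real
  assumes "0 \<le> a" "0 \<le> b" "0 \<le> p"
  shows "(a + b) powr p \<le> 2 powr p * (a powr p + b powr p)"
proof -
  have "(a + b) powr p \<le> (2 * max a b) powr p"
    using assms by (intro powr_mono2) auto
  also have "\<dots> = 2 powr p * max a b powr p"
    using assms by (simp add: powr_mult)
  also have "max a b powr p \<le> a powr p + b powr p"
    by (auto simp: max_def)
  finally show ?thesis by simp
qed

lemma norm_add_powr_bound:
  fixes x y :: "'v::real_normed_vector"
  assumes "0 \<le> p"
  shows "norm (x + y) powr p \<le> 2 powr p * (norm x powr p + norm y powr p)"
  using powr_add_bound[of "norm x" "norm y" p] powr_mono2[of p "norm (x+y)" "norm x + norm y"]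
    norm_triangle_ineq[of x y] assms by force

text \<open>For \<open>0 < s < 1\<close> the power \<open>t powr s\<close> is not Lipschitz at 0;
  the extra factor \<open>t\<close> repairs this. If \<open>s \<le> 1\<close>, then
  \<open>t \<le> t powr s\<close> is enough; for larger \<open>s\<close>,
  \<open>1 - t powr s \<le> - s * ln t \<le> s * (1 / t - 1)\<close>, and the factor
  \<open>t\<close> cancels \<open>1 / t\<close>.\<close>

lemma one_minus_powr_le:
  fixes t s :: real
  assumes "0 \<le> t" "t \<le> 1" "0 \<le> s"
  shows "(1 - t powr s) * t \<le> (1 + s) * (1 - t)"
proof (cases "t = 0")
  case False
  then have t: "0 < t" using assms by simp
  show ?thesis
  proof (cases "s \<le> 1")
    case True
    have "t powr 1 \<le> t powr s" using t True assms by (intro powr_mono') auto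
    then have "1 - t powr s \<le> 1 - t" using t by simp
    moreover have "0 \<le> 1 - t powr s" using assms by (simp add: powr_le1)
    ultimately have "(1 - t powr s) * t \<le> (1 - t) * 1"
      using assms by (intro mult_mono) auto
    also have "\<dots> \<le> (1 + s) * (1 - t)"
      using mult_nonneg_nonneg[of s "1 - t"] assms by (simp add: algebra_simps)
    finally show ?thesis .
  next
    case False
    have "t powr s = exp (s * ln t)" using t by (simp add: powr_def)
    have "1 + s * ln t \<le> exp (s * ln t)" by (rule exp_ge_add_one_self)
    moreover have "- ln t \<le> 1 / t - 1" using ln_le_minus_one[of "1/t"] t by (simp add: ln_div)
    then have "s * - ln t \<le> s * (1 / t - 1)" using assms by (intro mult_left_mono) auto
    ultimately have "1 - t powr s \<le> s * (1 / t - 1)" using \<open>t powr s = _\<close> by linarith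
    then have "(1 - t powr s) * t \<le> s * (1 / t - 1) * t" using t by (intro mult_right_mono) auto
    also have "\<dots> = s * (1 - t)" using t by (simp add: field_simps)
    also have "\<dots> \<le> (1 + s) * (1 - t)" using assms by (simp add: algebra_simps)
    finally show ?thesis .
  qed
qed (use assms in auto)

lemma powr_diff_mult_le:
  fixes a b s :: real
  assumes "0 \<le> b" "b \<le> a" "0 \<le> s"
  shows "(a powr s - b powr s) * b \<le> (1 + s) * a powr s * (a - b)"
proof (cases "a = 0")
  case False
  then have a: "0 < a" using assms by simp
  have "(1 - (b / a) powr s) * (b / a) \<le> (1 + s) * (1 - b / a)"
    using assms a by (intro one_minus_powr_le) auto
  then have "(a * a powr s) * ((1 - (b / a) powr s) * (b / a)) \<le> (a * a powr s) * ((1 + s) * (1 - b / a))"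
    using a by (intro mult_left_mono) auto
  moreover have "(a * a powr s) * ((1 - (b / a) powr s) * (b / a)) = (a powr s - b powr s) * b"
    using assms a by (simp add: powr_divide field_simps)
  moreover have "(a * a powr s) * ((1 + s) * (1 - b / a)) = (1 + s) * a powr s * (a - b)"
    using a by (simp add: field_simps)
  ultimately show ?thesis by simp
qed (use assms in auto)

text \<open>The gradient of \<open>norm x powr p / p\<close>. The factor \<open>p\<close> is left
  out so that the inner product with \<open>x\<close> is exactly
  \<open>norm x powr p\<close>.\<close>

definition powr_grad :: "real \<Rightarrow> 'v::real_inner \<Rightarrow> 'v"
  where "powr_grad p x = (norm x powr (p - 2)) *\<^sub>R x"

lemma norm_powr_grad: "norm (powr_grad p x) = norm x powr (p - 1)"
  by (cases "x = 0") (auto simp: powr_grad_def powr_diff powr_numeral power2_eq_square field_simps)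

text \<open>With \<open>x\<close> the longer vector, the difference splits into its factor times
  \<open>x - y\<close> and the change of the factor times \<open>y\<close>. The second part is where
  \<open>powr_diff_mult_le\<close> is needed: for \<open>2 < p < 3\<close> the factor alone is not
  Lipschitz at 0.\<close>

lemma powr_grad_diff_le_aux:
  fixes x y :: "'v::real_inner"
  assumes p: "2 \<le> p" and "norm y \<le> norm x"
  shows "norm (powr_grad p x - powr_grad p y) \<le> p * norm x powr (p - 2) * norm (x - y)"
proof -
  have eq: "powr_grad p x - powr_grad p y
     = (norm x powr (p - 2)) *\<^sub>R (x - y) + (norm x powr (p - 2) - norm y powr (p - 2)) *\<^sub>R y"
    by (simp add: powr_grad_def algebra_simps)
  have "norm y powr (p - 2) \<le> norm x powr (p - 2)"
    using assms by (intro powr_mono2) auto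
  then have "norm (powr_grad p x - powr_grad p y)
     \<le> norm x powr (p - 2) * norm (x - y) + (norm x powr (p - 2) - norm y powr (p - 2)) * norm y"
    unfolding eq by (intro order.trans[OF norm_triangle_ineq]) auto
  also have "(norm x powr (p - 2) - norm y powr (p - 2)) * norm y
     \<le> (1 + (p - 2)) * norm x powr (p - 2) * (norm x - norm y)"
    using assms by (intro powr_diff_mult_le) auto
  also have "\<dots> \<le> (1 + (p - 2)) * norm x powr (p - 2) * norm (x - y)"
    using assms norm_triangle_ineq2[of x y] by (intro mult_left_mono) auto
  finally show ?thesis by (simp add: algebra_simps)
qed

lemma powr_grad_diff_le:
  fixes x y :: "'v::real_inner"
  assumes p: "2 \<le> p"
  shows "norm (powr_grad p x - powr_grad p y) \<le> p * max (norm x) (norm y) powr (p - 2) * norm (x - y)"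
  using powr_grad_diff_le_aux[OF p, of y x] powr_grad_diff_le_aux[OF p, of x y]
  by (cases "norm y \<le> norm x") (auto simp: max_def norm_minus_commute)

text \<open>Young's inequality with the conjugate exponents \<open>p\<close> and
  \<open>p / (p - 1)\<close>. It is the only form in which convexity of \<open>norm x powr p\<close>
  enters the estimates below.\<close>

lemma powr_grad_young:
  fixes x y :: "'v::real_inner"
  assumes p: "2 \<le> p"
  shows "p * (powr_grad p x \<bullet> y) \<le> (p - 1) * norm x powr p + norm y powr p"
proof -
  have "powr_grad p x \<bullet> y \<le> norm (powr_grad p x) * norm y"
    by (rule norm_cauchy_schwarz)
  also have "\<dots> = norm x powr (p - 1) * norm y" by (simp add: norm_powr_grad)
  also have "\<dots> = norm y * norm x powr (p - 1)" by simp
  also have "\<dots> \<le> norm y powr p / p + (norm x powr (p - 1)) powr (p / (p - 1)) / (p / (p - 1))"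
    using p by (intro Youngs_inequality) (auto simp: field_simps)
  also have "(norm x powr (p - 1)) powr (p / (p - 1)) = norm x powr p"
    using p by (simp add: powr_powr)
  finally have "p * (powr_grad p x \<bullet> y) \<le> p * (norm y powr p / p + norm x powr p / (p / (p - 1)))"
    using p by (intro mult_left_mono) auto
  also have "\<dots> = (p - 1) * norm x powr p + norm y powr p" using p by (simp add: field_simps)
  finally show ?thesis .
qed

lemma powr_grad_inner_self: "powr_grad p x \<bullet> x = norm x powr p"
  by (cases "x = 0") (auto simp: powr_grad_def powr_diff powr_numeral power2_norm_eq_inner field_simps)

text \<open>\<open>powr_grad_young\<close> applied to \<open>x\<close> and \<open>x + z\<close> is
  the tangent inequality of a convex function, obtained without differentiating.\<close>

lemma norm_powr_lower:
  fixes x z :: "'v::real_inner"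
  assumes p: "2 \<le> p"
  shows "norm x powr p + p * (powr_grad p x \<bullet> z) \<le> norm (x + z) powr p"
  using powr_grad_young[OF p, of x "x + z"]
  by (simp add: inner_add_right powr_grad_inner_self algebra_simps)

text \<open>The tangent inequality at \<open>x + z\<close> with increment \<open>- z\<close> gives
  an upper bound with the gradient at \<open>x + z\<close>; moving the gradient back to
  \<open>x\<close> costs the Lipschitz bound \<open>powr_grad_diff_le\<close>.\<close>

lemma norm_powr_upper:
  fixes x z :: "'v::real_inner"
  assumes p: "2 \<le> p"
  shows "norm (x + z) powr p
    \<le> norm x powr p + p * (powr_grad p x \<bullet> z) + p\<^sup>2 * (norm x + norm z) powr (p - 2) * (norm z)\<^sup>2"
proof -
  have "norm (x + z) powr p \<le> norm x powr p + p * (powr_grad p (x + z) \<bullet> z)"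
    using norm_powr_lower[OF p, of "x + z" "- z"] by simp
  also have "powr_grad p (x + z) \<bullet> z = powr_grad p x \<bullet> z + (powr_grad p (x + z) - powr_grad p x) \<bullet> z"
    by (simp add: inner_diff_left)
  also have "(powr_grad p (x + z) - powr_grad p x) \<bullet> z \<le> norm (powr_grad p (x + z) - powr_grad p x) * norm z"
    by (rule norm_cauchy_schwarz)
  also have "\<dots> \<le> (p * max (norm (x + z)) (norm x) powr (p - 2) * norm ((x + z) - x)) * norm z"
    by (intro mult_right_mono powr_grad_diff_le p) auto
  also have "\<dots> \<le> (p * (norm x + norm z) powr (p - 2) * norm ((x + z) - x)) * norm z"
    using p by (intro mult_right_mono mult_left_mono powr_mono2) (auto simp: norm_triangle_ineq le_max_iff_disj)
  finally show ?thesis using p by (simp add: algebra_simps power2_eq_square)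
qed

text \<open>Splitting the weight leaves only products of a function of \<open>x\<close> and a
  function of \<open>z\<close>; for independent arguments their expectations factorise.\<close>

lemma norm_powr_upper_split:
  fixes x z :: "'v::real_inner"
  assumes p: "2 \<le> p"
  shows "norm (x + z) powr p \<le> norm x powr p + p * (powr_grad p x \<bullet> z)
    + p\<^sup>2 * 2 powr (p - 2) * (norm x powr (p - 2) * (norm z)\<^sup>2 + norm z powr p)"
proof -
  have "norm z powr p = norm z powr (p - 2) * (norm z)\<^sup>2"
    by (cases "z = 0") (auto simp: powr_diff powr_numeral)
  moreover have "(norm x + norm z) powr (p - 2) * (norm z)\<^sup>2
    \<le> (2 powr (p - 2) * (norm x powr (p - 2) + norm z powr (p - 2))) * (norm z)\<^sup>2"
    using p by (intro mult_right_mono powr_add_bound) auto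
  then have "p\<^sup>2 * ((norm x + norm z) powr (p - 2) * (norm z)\<^sup>2)
    \<le> p\<^sup>2 * ((2 powr (p - 2) * (norm x powr (p - 2) + norm z powr (p - 2))) * (norm z)\<^sup>2)"
    by (intro mult_left_mono) auto
  ultimately show ?thesis using norm_powr_upper[OF p, of x z] by (simp add: algebra_simps)
qed

lemma convex_on_powr_nonneg:
  fixes p :: real
  assumes "1 \<le> p"
  shows "convex_on {0..} (\<lambda>x. x powr p)"
proof (rule convex_onI)
  fix t x y :: real
  assume t: "0 < t" "t < 1" and xy: "x \<in> {0..}" "y \<in> {0..}"
  have scale: "(u * z) powr p \<le> u * z powr p" if "0 < u" "u < 1" "0 \<le> z" for u z :: real
  proof -
    have "u powr p \<le> u powr 1" using that assms by (intro powr_mono') auto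
    then have "u powr p * z powr p \<le> u * z powr p" using that by (intro mult_right_mono) auto
    then show ?thesis using that by (simp add: powr_mult)
  qed
  consider "x = 0" | "y = 0" | "x > 0" "y > 0" using xy by force
  then show "((1 - t) *\<^sub>R x + t *\<^sub>R y) powr p \<le> (1 - t) * x powr p + t * y powr p"
  proof cases
    case 1 then show ?thesis using scale[of t y] t xy by simp
  next
    case 2 then show ?thesis using scale[of "1 - t" x] t xy by simp
  next
    case 3 then show ?thesis using convex_onD[OF powr_convex[OF assms], of t x y] t by simp
  qed
qed (rule convex_real_interval)

text \<open>Jensen's inequality for the uniform average of the norms; rescaling the average to the
  sum leaves \<open>card I powr (p - 1)\<close>.\<close>

lemma sum_norm_powr_le:
  fixes f :: "'i \<Rightarrow> 'v::real_normed_vector"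
  assumes "finite I" "1 \<le> p"
  shows "norm (\<Sum>i\<in>I. f i) powr p \<le> real (card I) powr (p - 1) * (\<Sum>i\<in>I. norm (f i) powr p)"
proof (cases "I = {}")
  case False
  define k where "k = real (card I)"
  have k: "k > 0" using False assms by (simp add: k_def card_gt_0_iff)
  have conv: "convex_on {0..} (\<lambda>x::real. x powr p)"
    using assms by (intro convex_on_powr_nonneg)
  have "(\<Sum>i\<in>I. (1 / k) *\<^sub>R norm (f i)) powr p \<le> (\<Sum>i\<in>I. (1 / k) * norm (f i) powr p)"
    using assms False k by (intro convex_on_sum[OF _ _ conv]) (auto simp: k_def)
  then have *: "((\<Sum>i\<in>I. norm (f i)) / k) powr p \<le> (\<Sum>i\<in>I. norm (f i) powr p) / k"
    by (simp add: sum_divide_distrib)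
  have "norm (\<Sum>i\<in>I. f i) powr p \<le> (\<Sum>i\<in>I. norm (f i)) powr p"
    using assms by (intro powr_mono2 norm_sum) auto
  also have "\<dots> = k powr p * ((\<Sum>i\<in>I. norm (f i)) / k) powr p"
    using k by (subst powr_mult[symmetric]) (auto simp: sum_nonneg)
  also have "\<dots> \<le> k powr p * ((\<Sum>i\<in>I. norm (f i) powr p) / k)"
    using * by (intro mult_left_mono) auto
  also have "\<dots> = k powr (p - 1) * (\<Sum>i\<in>I. norm (f i) powr p)"
    using k by (simp add: powr_diff)
  finally show ?thesis by (simp add: k_def)
qed auto

section \<open>Rosenthal's inequality\<close>

lemma (in prob_space) integrable_norm_powr_mono:
  fixes Y :: "'a \<Rightarrow> 'v::{real_normed_vector,second_countable_topology}"
  assumes [measurable]: "Y \<in> borel_measurable M" and "integrable M (\<lambda>w. norm (Y w) powr p)" "0 \<le> s" "s \<le> p"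
  shows "integrable M (\<lambda>w. norm (Y w) powr s)"
proof (rule Bochner_Integration.integrable_bound[where f = "\<lambda>w. 1 + norm (Y w) powr p"])
  show "AE w in M. norm (norm (Y w) powr s) \<le> norm (1 + norm (Y w) powr p)"
  proof (rule AE_I2)
    fix w
    show "norm (norm (Y w) powr s) \<le> norm (1 + norm (Y w) powr p)"
    proof (cases "norm (Y w) \<le> 1")
      case True
      then have "norm (Y w) powr s \<le> 1" using assms by (intro powr_le1) auto
      then show ?thesis by (simp add: add_increasing2)
    next
      case False
      then have "norm (Y w) powr s \<le> norm (Y w) powr p" using assms by (intro powr_mono) auto
      then show ?thesis by simp
    qed
  qed
qed (use assms in auto)

lemma (in prob_space) integrable_norm_powr_imp:
  fixes Y :: "'a \<Rightarrow> 'v::{banach,second_countable_topology}"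
  assumes [measurable]: "Y \<in> borel_measurable M" and "integrable M (\<lambda>w. norm (Y w) powr p)" "1 \<le> p"
  shows "integrable M Y"
proof -
  have "integrable M (\<lambda>w. norm (Y w) powr 1)"
    by (rule integrable_norm_powr_mono[OF assms(1,2)]) (use assms in auto)
  then show ?thesis using integrable_norm_cancel[of M Y] by simp
qed

lemma (in prob_space) integrable_norm_power2_imp:
  fixes Y :: "'a \<Rightarrow> 'v::{banach,second_countable_topology}"
  assumes [measurable]: "Y \<in> borel_measurable M" and "integrable M (\<lambda>w. norm (Y w) powr p)" "2 \<le> p"
  shows "integrable M (\<lambda>w. (norm (Y w))\<^sup>2)"
  using integrable_norm_powr_mono[OF assms(1,2), of 2] assms(3) by simp

lemma integrable_norm_powr_add:
  fixes A B :: "'a \<Rightarrow> 'v::{real_normed_vector,second_countable_topology}"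
  assumes [measurable]: "A \<in> borel_measurable M" "B \<in> borel_measurable M"
    and "integrable M (\<lambda>w. norm (A w) powr p)" "integrable M (\<lambda>w. norm (B w) powr p)" "0 \<le> p"
  shows "integrable M (\<lambda>w. norm (A w + B w) powr p)"
proof (rule Bochner_Integration.integrable_bound[where
      f = "\<lambda>w. 2 powr p * (norm (A w) powr p + norm (B w) powr p)"])
  show "AE w in M. norm (norm (A w + B w) powr p)
      \<le> norm (2 powr p * (norm (A w) powr p + norm (B w) powr p))"
    using norm_add_powr_bound[OF assms(5)] by (intro AE_I2) (simp add: abs_mult)
qed (use assms in auto)

lemma integrable_norm_powr_sum:
  fixes f :: "'i \<Rightarrow> 'a \<Rightarrow> 'v::{real_normed_vector,second_countable_topology}"
  assumes "\<And>i. i \<in> I \<Longrightarrow> f i \<in> borel_measurable M"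
    and "\<And>i. i \<in> I \<Longrightarrow> integrable M (\<lambda>w. norm (f i w) powr p)" "0 \<le> p"
  shows "integrable M (\<lambda>w. norm (\<Sum>i\<in>I. f i w) powr p)"
  using assms
proof (induction I rule: infinite_finite_induct)
  case (insert x F)
  have "integrable M (\<lambda>w. norm (f x w + (\<Sum>i\<in>F. f i w)) powr p)"
    by (rule integrable_norm_powr_add) (use insert in auto)
  then show ?case using insert by simp
qed auto

lemma (in prob_space) indep_var_inner:
  fixes A B :: "'a \<Rightarrow> 'v::euclidean_space"
  assumes ind: "indep_var borel A borel B" and int: "integrable M A" "integrable M B"
  shows "integrable M (\<lambda>w. A w \<bullet> B w)"
    and "expectation (\<lambda>w. A w \<bullet> B w) = expectation A \<bullet> expectation B"
proof -
  have i: "indep_var borel (\<lambda>w. A w \<bullet> b) borel (\<lambda>w. B w \<bullet> b)" for b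
    using indep_var_compose[OF ind, of "\<lambda>x. x \<bullet> b" borel "\<lambda>x. x \<bullet> b" borel] by (simp add: comp_def)
  have int': "integrable M (\<lambda>w. (A w \<bullet> b) * (B w \<bullet> b))" for b
    by (rule indep_var_integrable[OF i]) (use int in auto)
  show "integrable M (\<lambda>w. A w \<bullet> B w)"
    by (subst euclidean_inner) (intro Bochner_Integration.integrable_sum int')
  have "expectation (\<lambda>w. A w \<bullet> B w) = (\<Sum>b\<in>Basis. expectation (\<lambda>w. (A w \<bullet> b) * (B w \<bullet> b)))"
    by (subst euclidean_inner) (intro Bochner_Integration.integral_sum int')
  also have "\<dots> = (\<Sum>b\<in>Basis. (expectation A \<bullet> b) * (expectation B \<bullet> b))"
    using int by (intro sum.cong refl) (simp add: indep_var_lebesgue_integral[OF i])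
  finally show "expectation (\<lambda>w. A w \<bullet> B w) = expectation A \<bullet> expectation B"
    by (simp only: euclidean_inner[of "expectation A" "expectation B"])
qed

text \<open>Either \<open>A\<close> is at most \<open>s^2\<close> or \<open>s\<close> is at most the
  root of \<open>A\<close>. With \<open>A\<close> the total variance of a sum, this removes the
  mixed term of \<open>rosenthal_step\<close>: moments of order \<open>p - 2\<close> are traded for
  the moment of order \<open>p\<close> and a pure variance term.\<close>

lemma powr_young_two:
  fixes A s p :: real
  assumes "2 \<le> p" "0 \<le> A" "0 \<le> s"
  shows "A * s powr (p - 2) \<le> s powr p + A powr (p / 2)"
proof (cases "A \<le> s\<^sup>2")
  case True
  have "A * s powr (p - 2) \<le> s\<^sup>2 * s powr (p - 2)" using True by (intro mult_right_mono) auto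
  also have "\<dots> = s powr p" using assms by (cases "s = 0") (auto simp: powr_diff powr_numeral)
  finally show ?thesis by (simp add: add_increasing2)
next
  case False
  then have "0 < A" using zero_le_power2[of s] by linarith
  have "s \<le> sqrt A" using False real_le_rsqrt by fastforce
  then have "s powr (p - 2) \<le> sqrt A powr (p - 2)" using assms by (intro powr_mono2) auto
  then have "A * s powr (p - 2) \<le> A * sqrt A powr (p - 2)" using assms by (intro mult_left_mono) auto
  also have "\<dots> = A powr (p / 2)"
    using \<open>0 < A\<close> by (simp add: powr_half_sqrt[symmetric] powr_powr powr_diff field_simps)
  finally show ?thesis by (simp add: add_increasing)
qed

text \<open>The coefficient of the second-order terms in
  \<open>norm_powr_upper_split\<close>.\<close>

definition ros_const :: "real \<Rightarrow> real"
  where "ros_const p = p\<^sup>2 * 2 powr (p - 2)"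

text \<open>In the expansion around \<open>S\<close> the first-order term has expectation 0, since
  \<open>Y\<close> is centred and independent of the gradient at \<open>S\<close>. The other terms
  factorise.\<close>

lemma (in prob_space) rosenthal_step:
  fixes S Y :: "'a \<Rightarrow> 'v::euclidean_space"
  assumes p: "2 \<le> p" and ind: "indep_var borel S borel Y" and mean: "expectation Y = 0"
    and intS: "integrable M (\<lambda>w. norm (S w) powr p)" and intY: "integrable M (\<lambda>w. norm (Y w) powr p)"
  shows "expectation (\<lambda>w. norm (S w + Y w) powr p) \<le> expectation (\<lambda>w. norm (S w) powr p)
    + ros_const p * (expectation (\<lambda>w. norm (S w) powr (p - 2)) * expectation (\<lambda>w. (norm (Y w))\<^sup>2)
                     + expectation (\<lambda>w. norm (Y w) powr p))"
proof -
  have [measurable]: "S \<in> borel_measurable M" "Y \<in> borel_measurable M"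
    using indep_var_rv1[OF ind] indep_var_rv2[OF ind] by auto
  have intY1: "integrable M Y" by (rule integrable_norm_powr_imp[OF _ intY]) (use p in auto)
  have intY2: "integrable M (\<lambda>w. (norm (Y w))\<^sup>2)"
    by (rule integrable_norm_power2_imp[OF _ intY]) (use p in auto)
  have intS2: "integrable M (\<lambda>w. norm (S w) powr (p - 2))"
    by (rule integrable_norm_powr_mono[OF _ intS]) (use p in auto)
  have "integrable M (\<lambda>w. norm (powr_grad p (S w)))"
    unfolding norm_powr_grad by (rule integrable_norm_powr_mono[OF _ intS]) (use p in auto)
  then have intG: "integrable M (\<lambda>w. powr_grad p (S w))"
    by (rule integrable_norm_cancel) (simp add: powr_grad_def)
  have [measurable]: "powr_grad p \<in> borel_measurable (borel :: 'v measure)"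
    unfolding powr_grad_def by simp
  have ind1: "indep_var borel (\<lambda>w. powr_grad p (S w)) borel Y"
    by (rule indep_var_compose[OF ind, of "powr_grad p" borel "\<lambda>x. x" borel, unfolded comp_def]) auto
  have ind2: "indep_var borel (\<lambda>w. norm (S w) powr (p - 2)) borel (\<lambda>w. (norm (Y w))\<^sup>2)"
    by (rule indep_var_compose[OF ind, of "\<lambda>x. norm x powr (p - 2)" borel "\<lambda>x. (norm x)\<^sup>2" borel,
          unfolded comp_def]) auto
  have zero: "expectation (\<lambda>w. powr_grad p (S w) \<bullet> Y w) = 0"
    by (simp add: indep_var_inner(2)[OF ind1 intG intY1] mean)
  note int1 = indep_var_inner(1)[OF ind1 intG intY1]
  note int2 = indep_var_integrable[OF ind2 intS2 intY2]
  have "expectation (\<lambda>w. norm (S w + Y w) powr p)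
    \<le> expectation (\<lambda>w. norm (S w) powr p + p * (powr_grad p (S w) \<bullet> Y w)
        + ros_const p * (norm (S w) powr (p - 2) * (norm (Y w))\<^sup>2 + norm (Y w) powr p))"
    using int1 int2 intS intY p norm_powr_upper_split[OF p] unfolding ros_const_def
    by (intro integral_mono integrable_norm_powr_add) auto
  also have "\<dots> = expectation (\<lambda>w. norm (S w) powr p) + p * expectation (\<lambda>w. powr_grad p (S w) \<bullet> Y w)
     + ros_const p * (expectation (\<lambda>w. norm (S w) powr (p - 2) * (norm (Y w))\<^sup>2)
         + expectation (\<lambda>w. norm (Y w) powr p))"
    using int1 int2 intS intY by simp
  finally show ?thesis
    by (simp add: zero indep_var_lebesgue_integral[OF ind2 intS2 intY2])
qed

text \<open>A discrete Gronwall argument. By \<open>powr_young_two\<close> one summand multiplies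
  the p-th moment of the partial sum by at most \<open>1 + C / N\<close> and adds \<open>D\<close>,
  and \<open>N\<close> factors \<open>1 + C / N\<close> stay below \<open>exp C\<close>. The
  alternative \<open>U j = 0\<close> allows a sequence to be padded to a prescribed length.\<close>

lemma (in prob_space) rosenthal_sequence:
  fixes U :: "nat \<Rightarrow> 'a \<Rightarrow> 'v::euclidean_space"
  assumes p: "2 \<le> p" and N: "0 < N"
    and ind: "\<And>j. j < N \<Longrightarrow> U j = (\<lambda>_. 0) \<or> indep_var borel (\<lambda>w. \<Sum>k<j. U k w) borel (U j)"
    and mean: "\<And>j. j < N \<Longrightarrow> expectation (U j) = 0"
    and meas: "\<And>j. j < N \<Longrightarrow> U j \<in> borel_measurable M"
    and int: "\<And>j. j < N \<Longrightarrow> integrable M (\<lambda>w. norm (U j w) powr p)"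
    and y2: "\<And>j. j < N \<Longrightarrow> expectation (\<lambda>w. (norm (U j w))\<^sup>2) \<le> y2" "0 \<le> y2"
    and yp: "\<And>j. j < N \<Longrightarrow> expectation (\<lambda>w. norm (U j w) powr p) \<le> yp" "0 \<le> yp"
  shows "expectation (\<lambda>w. norm (\<Sum>k<N. U k w) powr p)
     \<le> exp (ros_const p) * ros_const p * ((real N * y2) powr (p / 2) + real N * yp)"
proof -
  define C where "C = ros_const p"
  have C: "0 \<le> C" by (simp add: C_def ros_const_def)
  define A where "A = real N * y2"
  have A: "0 \<le> A" using y2(2) by (simp add: A_def)
  define D where "D = C * (A powr (p / 2) / N + yp)"
  have D: "0 \<le> D" using C yp(2) by (simp add: D_def)
  define a where "a j = expectation (\<lambda>w. norm (\<Sum>k<j. U k w) powr p)" for j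
  have a0: "0 \<le> a j" for j by (simp add: a_def)
  have intS: "integrable M (\<lambda>w. norm (\<Sum>k<j. U k w) powr p)" if "j \<le> N" for j
    using that p by (intro integrable_norm_powr_sum meas int) auto
  have step: "a (Suc j) \<le> (1 + C / N) * a j + D" if j: "j < N" for j
    using ind[OF j]
  proof
    assume "U j = (\<lambda>_. 0)"
    then have "a (Suc j) = a j" by (simp add: a_def)
    then show ?thesis using C D a0[of j] by (simp add: algebra_simps)
  next
    assume i: "indep_var borel (\<lambda>w. \<Sum>k<j. U k w) borel (U j)"
    let ?S = "\<lambda>w. \<Sum>k<j. U k w"
    have [measurable]: "?S \<in> borel_measurable M" using j by (intro borel_measurable_sum meas) auto
    have int2: "integrable M (\<lambda>w. norm (?S w) powr (p - 2))"
      by (rule integrable_norm_powr_mono[OF _ intS]) (use p j in auto)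
    have "real N * y2 * expectation (\<lambda>w. norm (?S w) powr (p - 2))
      = expectation (\<lambda>w. A * norm (?S w) powr (p - 2))" using int2 by (simp add: A_def)
    also have "\<dots> \<le> expectation (\<lambda>w. norm (?S w) powr p + A powr (p / 2))"
      using int2 intS j p A by (intro integral_mono powr_young_two) auto
    also have "\<dots> = a j + A powr (p / 2)" using intS j by (simp add: a_def prob_space)
    finally have *: "y2 * expectation (\<lambda>w. norm (?S w) powr (p - 2)) \<le> a j / N + A powr (p / 2) / N"
      using N by (simp add: field_simps)
    have "a (Suc j) \<le> a j + C * (expectation (\<lambda>w. norm (?S w) powr (p - 2)) * expectation (\<lambda>w. (norm (U j w))\<^sup>2)
                     + expectation (\<lambda>w. norm (U j w) powr p))"
      using rosenthal_step[OF p i mean[OF j] intS int[OF j]] j by (simp add: a_def C_def)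
    also have "\<dots> \<le> a j + C * (expectation (\<lambda>w. norm (?S w) powr (p - 2)) * y2 + yp)"
      using C y2 yp j by (intro add_left_mono mult_left_mono add_mono) auto
    also have "\<dots> \<le> a j + C * (a j / N + A powr (p / 2) / N + yp)"
      using C * by (intro add_left_mono mult_left_mono) (auto simp: mult.commute)
    also have "\<dots> = (1 + C / N) * a j + D" by (simp add: D_def algebra_simps)
    finally show ?thesis .
  qed
  have bound: "a j \<le> real j * (1 + C / N) ^ j * D" if "j \<le> N" for j
    using that
  proof (induction j)
    case (Suc j)
    have "a (Suc j) \<le> (1 + C / N) * a j + D" using Suc by (intro step) auto
    also have "\<dots> \<le> (1 + C / N) * (real j * (1 + C / N) ^ j * D) + (1 + C / N) ^ Suc j * D"
    proof (rule add_mono)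
      have "1 * D \<le> (1 + C / N) ^ Suc j * D"
        using C D by (intro mult_right_mono one_le_power) auto
      then show "D \<le> (1 + C / N) ^ Suc j * D" by simp
    qed (use Suc C in \<open>auto intro!: mult_left_mono\<close>)
    also have "\<dots> = real (Suc j) * (1 + C / N) ^ Suc j * D"
      unfolding power_Suc of_nat_Suc by (simp only: distrib_right distrib_left mult_ac mult_1_left add_ac)
    finally show ?case .
  qed (simp add: a_def)
  have "(1 + C / N) ^ N \<le> exp (C / N) ^ N"
    using C by (intro power_mono) (auto simp: exp_ge_add_one_self add_increasing)
  also have "\<dots> = exp C" using N by (simp add: exp_of_nat_mult[symmetric])
  finally have e: "(1 + C / N) ^ N \<le> exp C" .
  have "a N \<le> real N * (1 + C / N) ^ N * D" by (rule bound) simp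
  also have "\<dots> \<le> real N * exp C * D" using e D by (intro mult_right_mono mult_left_mono) auto
  also have "\<dots> = exp C * C * (A powr (p / 2) + real N * yp)" using N by (simp add: D_def field_simps)
  finally show ?thesis by (simp add: a_def A_def C_def)
qed

text \<open>The indices are split into residue classes modulo \<open>b\<close>. Within a class each
  summand is independent of the sum of its predecessors, so \<open>rosenthal_sequence\<close>
  applies; adding up the \<open>b\<close> classes by convexity costs
  \<open>b powr (p - 1)\<close>.\<close>

lemma (in prob_space) rosenthal_classes:
  fixes Y :: "nat \<Rightarrow> 'a \<Rightarrow> 'v::euclidean_space"
  assumes p: "2 \<le> p" and b: "0 < b" "b \<le> n"
    and ind: "\<And>c j. c < b \<Longrightarrow> j * b + c < n \<Longrightarrow>
        indep_var borel (\<lambda>w. \<Sum>k<j. Y (k * b + c) w) borel (Y (j * b + c))"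
    and mean: "\<And>j. j < n \<Longrightarrow> expectation (Y j) = 0"
    and meas: "\<And>j. j < n \<Longrightarrow> Y j \<in> borel_measurable M"
    and int: "\<And>j. j < n \<Longrightarrow> integrable M (\<lambda>w. norm (Y j w) powr p)"
    and y2: "\<And>j. j < n \<Longrightarrow> expectation (\<lambda>w. (norm (Y j w))\<^sup>2) \<le> y2" "0 \<le> y2"
    and yp: "\<And>j. j < n \<Longrightarrow> expectation (\<lambda>w. norm (Y j w) powr p) \<le> yp" "0 \<le> yp"
  shows "expectation (\<lambda>w. norm (\<Sum>i<n. Y i w) powr p)
     \<le> exp (ros_const p) * ros_const p * 2 powr p * ((b * n * y2) powr (p / 2) + real b powr (p - 1) * n * yp)"
proof -
  \<comment> \<open>A common length for all classes, reached by padding with zeros. Because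
    \<open>b \<le> n\<close>, the padded total \<open>N * b\<close> is still at most
    \<open>2 * n\<close>.\<close>
  define N where "N = n div b + 1"
  have N: "0 < N" "n \<le> N * b"
    using b dividend_less_div_times[of b n] by (auto simp: N_def intro: less_imp_le)
  have Nn: "real N * b \<le> 2 * n"
  proof -
    have "N * b \<le> n + b" by (simp add: N_def algebra_simps)
    also have "\<dots> \<le> 2 * n" using b by simp
    finally show ?thesis by (metis of_nat_le_iff of_nat_mult of_nat_numeral)
  qed
  define Z where "Z i = (if i < n then Y i else (\<lambda>_. 0))" for i
  define E where "E = exp (ros_const p) * ros_const p"
  have E: "0 \<le> E" by (simp add: E_def ros_const_def)
  have Zsum: "(\<Sum>i<n. Y i w) = (\<Sum>c<b. \<Sum>k<N. Z (k * b + c) w)" for w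
  proof -
    have "(\<Sum>i<n. Y i w) = (\<Sum>i<n. Z i w)" by (simp add: Z_def)
    also have "\<dots> = (\<Sum>i<N * b. Z i w)"
      using N by (intro sum.mono_neutral_left) (auto simp: Z_def)
    also have "\<dots> = (\<Sum>k<N. \<Sum>i\<in>{k * b..<k * b + b}. Z i w)"
      by (rule sum.nat_group[symmetric])
    also have "\<dots> = (\<Sum>k<N. \<Sum>c<b. Z (k * b + c) w)"
    proof (rule sum.cong[OF refl])
      fix k
      show "(\<Sum>i\<in>{k * b..<k * b + b}. Z i w) = (\<Sum>c<b. Z (k * b + c) w)"
        using sum.shift_bounds_nat_ivl[of "\<lambda>i. Z i w" 0 "k * b" b]
        by (simp add: atLeast0LessThan add.commute)
    qed
    also have "\<dots> = (\<Sum>c<b. \<Sum>k<N. Z (k * b + c) w)" by (rule sum.swap)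
    finally show ?thesis .
  qed
  have cls: "expectation (\<lambda>w. norm (\<Sum>k<N. Z (k * b + c) w) powr p)
     \<le> E * ((real N * y2) powr (p / 2) + real N * yp)" if c: "c < b" for c
    unfolding E_def
  proof (rule rosenthal_sequence[OF p N(1)])
    fix j assume "j < N"
    show "Z (j * b + c) = (\<lambda>_. 0) \<or> indep_var borel (\<lambda>w. \<Sum>k<j. Z (k * b + c) w) borel (Z (j * b + c))"
    proof (cases "j * b + c < n")
      case True
      have "k * b + c < n" if "k < j" for k
        using mult_le_mono1[of k j b] that True by linarith
      then have "(\<lambda>w. \<Sum>k<j. Z (k * b + c) w) = (\<lambda>w. \<Sum>k<j. Y (k * b + c) w)"
        by (simp add: Z_def)
      then show ?thesis using ind[OF c True] True by (simp add: Z_def)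
    qed (simp add: Z_def)
  qed (use mean meas int y2 yp p in \<open>auto simp: Z_def\<close>)
  have measZ: "Z i \<in> borel_measurable M" for i using meas by (simp add: Z_def)
  have intZ: "integrable M (\<lambda>w. norm (Z i w) powr p)" for i using int p by (simp add: Z_def)
  have intc: "integrable M (\<lambda>w. norm (\<Sum>k<N. Z (k * b + c) w) powr p)" for c
    using p by (intro integrable_norm_powr_sum measZ intZ) auto
  have "expectation (\<lambda>w. norm (\<Sum>i<n. Y i w) powr p)
    \<le> expectation (\<lambda>w. real b powr (p - 1) * (\<Sum>c<b. norm (\<Sum>k<N. Z (k * b + c) w) powr p))"
  proof (rule integral_mono)
    show "integrable M (\<lambda>w. norm (\<Sum>i<n. Y i w) powr p)"
      using p by (intro integrable_norm_powr_sum meas int) auto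
    show "norm (\<Sum>i<n. Y i w) powr p
         \<le> real b powr (p - 1) * (\<Sum>c<b. norm (\<Sum>k<N. Z (k * b + c) w) powr p)" for w
      unfolding Zsum using sum_norm_powr_le[of "{..<b}" p] p by simp
  qed (use intc in auto)
  also have "\<dots> = real b powr (p - 1) * (\<Sum>c<b. expectation (\<lambda>w. norm (\<Sum>k<N. Z (k * b + c) w) powr p))"
    using intc by simp
  also have "\<dots> \<le> real b powr (p - 1) * (\<Sum>c<b. E * ((real N * y2) powr (p / 2) + real N * yp))"
    using cls by (intro mult_left_mono sum_mono) auto
  also have "\<dots> = E * (real b powr (p - 1) * b * (real N * y2) powr (p / 2) + real b powr (p - 1) * (real N * b * yp))"
    by (simp add: algebra_simps)
  \<comment> \<open>One half of \<open>b powr p\<close> is put next to \<open>N\<close>, so that the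
    variance term contains the class length only through \<open>N * b\<close>.\<close>
  also have "real b powr (p - 1) * b = real b powr (p / 2) * real b powr (p / 2)"
    using b by (simp add: powr_diff flip: powr_add)
  also have "\<dots> * (real N * y2) powr (p / 2) = real b powr (p / 2) * (real N * b * y2) powr (p / 2)"
    using y2(2) by (simp add: powr_mult mult_ac)
  also have "E * (real b powr (p / 2) * (real N * b * y2) powr (p / 2) + real b powr (p - 1) * (real N * b * yp))
    \<le> E * (real b powr (p / 2) * (2 * real n * y2) powr (p / 2) + real b powr (p - 1) * (2 * n * yp))"
    using E Nn y2(2) yp(2) p
    by (intro mult_left_mono add_mono powr_mono2 mult_right_mono) auto
  also have "real b powr (p / 2) * (2 * real n * y2) powr (p / 2) = 2 powr (p / 2) * (b * n * y2) powr (p / 2)"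
    using y2(2) by (simp add: powr_mult mult_ac)
  also have "E * (2 powr (p / 2) * (b * n * y2) powr (p / 2) + real b powr (p - 1) * (2 * n * yp))
    \<le> E * (2 powr p * (b * n * y2) powr (p / 2) + real b powr (p - 1) * (2 powr p * n * yp))"
  proof -
    have "(2::real) \<le> 2 powr p" using p powr_mono[of 1 p 2] by simp
    then have "2 * (n * yp) \<le> 2 powr p * (n * yp)" by (rule mult_right_mono) (use yp(2) in simp)
    then have A: "2 * n * yp \<le> 2 powr p * n * yp" by (simp only: mult.assoc)
    have B: "2 powr (p / 2) \<le> 2 powr p" using p by simp
    show ?thesis
      by (rule mult_left_mono[OF add_mono[OF mult_right_mono[OF B] mult_left_mono[OF A]] E]) simp_all
  qed
  also have "\<dots> = E * 2 powr p * ((b * n * y2) powr (p / 2) + real b powr (p - 1) * n * yp)"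
  proof -
    have "e * (c * u + v * (c * x * y)) = e * c * (u + v * x * y)" for e c u v x y :: real
      by (simp add: algebra_simps)
    then show ?thesis .
  qed
  finally show ?thesis by (simp add: E_def)
qed

section \<open>The standard Gaussian measure\<close>

definition gauss_pdf :: "'v::euclidean_space \<Rightarrow> real"
  where "gauss_pdf x = exp (- (x \<bullet> x) / 2) / sqrt (2 * pi) ^ DIM('v)"

definition std_gauss :: "'v::euclidean_space measure"
  where "std_gauss = density lborel (\<lambda>x. ennreal (gauss_pdf x))"

lemma gauss_pdf_nonneg [simp]: "0 \<le> gauss_pdf x"
  by (simp add: gauss_pdf_def)

lemma gauss_pdf_measurable [measurable]: "gauss_pdf \<in> borel_measurable borel"
  unfolding gauss_pdf_def by measurable

lemma sets_std_gauss [simp, measurable_cong]: "sets std_gauss = sets borel"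
  by (simp add: std_gauss_def)

lemma space_std_gauss [simp]: "space std_gauss = UNIV"
  by (simp add: std_gauss_def)

lemma gauss_pdf_prod: "gauss_pdf x = (\<Prod>b\<in>Basis. std_normal_density (x \<bullet> b))"
proof -
  have "(\<Prod>b\<in>Basis. std_normal_density (x \<bullet> b)) = (\<Prod>b\<in>Basis. exp (- (x \<bullet> b)\<^sup>2 / 2)) / sqrt (2 * pi) ^ DIM('a)"
    by (simp add: std_normal_density_def prod_dividef)
  also have "(\<Prod>b\<in>(Basis::'a set). exp (- (x \<bullet> b)\<^sup>2 / 2)) = exp (\<Sum>b\<in>Basis. - (x \<bullet> b)\<^sup>2 / 2)"
    by (simp add: exp_sum)
  also have "(\<Sum>b\<in>(Basis::'a set). - (x \<bullet> b)\<^sup>2 / 2) = - (x \<bullet> x) / 2"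
    by (subst euclidean_inner[of x x]) (simp add: sum_negf sum_divide_distrib power2_eq_square)
  finally show ?thesis by (simp add: gauss_pdf_def)
qed

lemma nn_integral_std_gauss:
  "f \<in> borel_measurable borel \<Longrightarrow> (\<integral>\<^sup>+x. f x \<partial>std_gauss) = (\<integral>\<^sup>+x. ennreal (gauss_pdf x) * f x \<partial>lborel)"
  by (simp add: std_gauss_def nn_integral_density)

interpretation std_gauss: prob_space std_gauss
proof
  have "emeasure std_gauss (space (std_gauss :: 'a measure)) = (\<integral>\<^sup>+(x::'a). ennreal (gauss_pdf x) \<partial>lborel)"
    by (simp add: std_gauss_def emeasure_density)
  also have "\<dots> = (\<integral>\<^sup>+(x::'a). (\<Prod>b\<in>Basis. ennreal (std_normal_density (x \<bullet> b))) \<partial>lborel)"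
    by (simp add: gauss_pdf_prod prod_ennreal)
  also have "\<dots> = (\<Prod>b\<in>(Basis::'a set). (\<integral>\<^sup>+x. ennreal (std_normal_density x) \<partial>lborel))"
    by (rule nn_integral_lborel_prod) auto
  also have "(\<integral>\<^sup>+x. ennreal (std_normal_density x) \<partial>lborel) = 1"
    by (subst nn_integral_eq_integral) auto
  finally show "emeasure std_gauss (space (std_gauss :: 'a measure)) = 1" by simp
qed

text \<open>Half of the Gaussian exponent pays for the exponential:
  \<open>k * \<bar>t\<bar> \<le> k^2 + t^2 / 4\<close> leaves a multiple of the normal density with
  variance 2.\<close>

lemma nn_integral_exp_abs_std_normal:
  fixes k :: real
  shows "(\<integral>\<^sup>+t. ennreal (std_normal_density t * exp (k * \<bar>t\<bar>)) \<partial>lborel) < \<infinity>"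
proof -
  have bound: "std_normal_density t * exp (k * \<bar>t\<bar>) \<le> (exp (k\<^sup>2) * sqrt 2) * normal_density 0 (sqrt 2) t" for t
  proof -
    have "k * \<bar>t\<bar> \<le> k\<^sup>2 + t\<^sup>2 / 4"
      using zero_le_power2[of "k - \<bar>t\<bar> / 2"] by (simp add: power2_eq_square algebra_simps)
    then have "exp (- t\<^sup>2 / 2 + k * \<bar>t\<bar>) \<le> exp (k\<^sup>2 + - t\<^sup>2 / 4)" by simp
    then have "exp (- t\<^sup>2 / 2) * exp (k * \<bar>t\<bar>) \<le> exp (k\<^sup>2) * exp (- t\<^sup>2 / 4)" by (simp only: exp_add)
    then have "exp (- t\<^sup>2 / 2) * exp (k * \<bar>t\<bar>) / sqrt (2 * pi) \<le> exp (k\<^sup>2) * exp (- t\<^sup>2 / 4) / sqrt (2 * pi)"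
      by (intro divide_right_mono) auto
    moreover have "normal_density 0 (sqrt 2) t = exp (- t\<^sup>2 / 4) / (sqrt 2 * sqrt (2 * pi))"
      unfolding normal_density_def by (simp add: real_sqrt_mult)
    ultimately show ?thesis by (simp add: std_normal_density_def)
  qed
  have "(\<integral>\<^sup>+t. ennreal (std_normal_density t * exp (k * \<bar>t\<bar>)) \<partial>lborel)
     \<le> (\<integral>\<^sup>+t. ennreal ((exp (k\<^sup>2) * sqrt 2) * normal_density 0 (sqrt 2) t) \<partial>lborel)"
    by (intro nn_integral_mono ennreal_leI bound)
  also have "\<dots> = ennreal (exp (k\<^sup>2) * sqrt 2)"
    by (subst nn_integral_eq_integral) auto
  also have "\<dots> < \<infinity>" by simp
  finally show ?thesis .
qed

text \<open>The source of most integrability claims below, whose integrands are dominated by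
  exponentials of the norm. Bounding the norm by the sum of the coordinates makes the integral a
  product of one-dimensional ones.\<close>

lemma integrable_exp_norm_std_gauss:
  fixes k :: real
  shows "integrable std_gauss (\<lambda>z::'v::euclidean_space. exp (k * norm z))"
proof (rule integrableI_bounded)
  let ?k = "\<bar>k\<bar>"
  have norm_le: "norm z \<le> (\<Sum>b\<in>Basis. \<bar>z \<bullet> b\<bar>)" for z :: 'v by (rule norm_le_l1)
  have "k * norm z \<le> ?k * norm z" for z :: 'v by (intro mult_right_mono) auto
  then have "k * norm z \<le> (\<Sum>b\<in>Basis. ?k * \<bar>z \<bullet> b\<bar>)" for z :: 'v
    using mult_left_mono[OF norm_le[of z], of ?k] unfolding sum_distrib_left[symmetric] by (meson abs_ge_zero order_trans)
  then have "exp (k * norm z) \<le> (\<Prod>b\<in>Basis. exp (?k * \<bar>z \<bullet> b\<bar>))" for z :: 'v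
    by (simp add: exp_sum[symmetric])
  then have "(\<integral>\<^sup>+(z::'v). norm (exp (k * norm z)) \<partial>std_gauss) \<le>
     (\<integral>\<^sup>+(z::'v). ennreal (gauss_pdf z) * ennreal (\<Prod>b\<in>Basis. exp (?k * \<bar>z \<bullet> b\<bar>)) \<partial>lborel)"
    by (subst nn_integral_std_gauss) (auto intro!: nn_integral_mono mult_left_mono ennreal_leI)
  also have "\<dots> = (\<integral>\<^sup>+(z::'v). (\<Prod>b\<in>Basis. ennreal (std_normal_density (z \<bullet> b) * exp (?k * \<bar>z \<bullet> b\<bar>))) \<partial>lborel)"
    by (simp add: gauss_pdf_prod prod_ennreal ennreal_mult'[symmetric] prod.distrib[symmetric] prod_nonneg)
  also have "\<dots> = (\<Prod>b\<in>(Basis::'v set). (\<integral>\<^sup>+t. ennreal (std_normal_density t * exp (?k * \<bar>t\<bar>)) \<partial>lborel))"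
    by (rule nn_integral_lborel_prod) auto
  also have "\<dots> < \<infinity>"
    using nn_integral_exp_abs_std_normal[of ?k]
    by (auto simp: power_less_top_ennreal)
  finally show "(\<integral>\<^sup>+(z::'v). norm (exp (k * norm z)) \<partial>std_gauss) < \<infinity>" .
qed measurable

lemma one_plus_powr_le_exp:
  fixes x s :: real
  assumes "0 \<le> x" "0 \<le> s"
  shows "(1 + x) powr s \<le> exp (s * x)"
proof -
  have "(1 + x) powr s \<le> exp x powr s"
    using assms by (intro powr_mono2) (auto simp: exp_ge_add_one_self)
  then show ?thesis by (simp add: powr_def mult.commute)
qed

lemma powr_le_exp:
  fixes x s :: real
  assumes "0 \<le> x" "0 \<le> s"
  shows "x powr s \<le> exp (s * x)"
  by (rule order_trans[OF powr_mono2 one_plus_powr_le_exp]) (use assms in auto)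

lemma integrable_norm_powr_std_gauss:
  fixes s :: real
  assumes "0 \<le> s"
  shows "integrable std_gauss (\<lambda>z::'v::euclidean_space. norm z powr s)"
  by (rule Bochner_Integration.integrable_bound[OF integrable_exp_norm_std_gauss[of s]])
     (use assms in \<open>auto intro!: AE_I2 powr_le_exp\<close>)

section \<open>Shifts, scalings and rotations of the Gaussian measure\<close>

lemma gauss_pdf_shift: "gauss_pdf (x - u) = gauss_pdf x * exp (x \<bullet> u - (u \<bullet> u) / 2)"
proof -
  have "exp (- ((x - u) \<bullet> (x - u)) / 2) = exp (- (x \<bullet> x) / 2 + (x \<bullet> u - (u \<bullet> u) / 2))"
    by (simp add: inner_diff_left inner_diff_right inner_commute field_simps)
  then show ?thesis unfolding exp_add gauss_pdf_def by simp
qed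

lemma nn_integral_lborel_translate:
  fixes f :: "'v::euclidean_space \<Rightarrow> ennreal"
  assumes [measurable]: "f \<in> borel_measurable borel"
  shows "(\<integral>\<^sup>+x. f (u + x) \<partial>lborel) = (\<integral>\<^sup>+x. f x \<partial>lborel)"
  by (subst (2) lborel_distr_plus[of u, symmetric]) (simp add: nn_integral_distr)

text \<open>The Cameron-Martin formula: translation invariance of Lebesgue measure, with the
  quotient of the two densities computed in \<open>gauss_pdf_shift\<close>.\<close>

lemma nn_integral_gauss_shift:
  fixes F :: "'v::euclidean_space \<Rightarrow> ennreal"
  assumes [measurable]: "F \<in> borel_measurable borel"
  shows "(\<integral>\<^sup>+z. F (z + u) \<partial>std_gauss) = (\<integral>\<^sup>+z. F z * ennreal (exp (z \<bullet> u - (u \<bullet> u) / 2)) \<partial>std_gauss)"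
proof -
  have "(\<integral>\<^sup>+z. F (z + u) \<partial>std_gauss) = (\<integral>\<^sup>+z. ennreal (gauss_pdf ((u + z) - u)) * F (u + z) \<partial>lborel)"
    by (subst nn_integral_std_gauss) (auto simp: add.commute)
  also have "\<dots> = (\<integral>\<^sup>+z. ennreal (gauss_pdf (z - u)) * F z \<partial>lborel)"
    by (rule nn_integral_lborel_translate[of "\<lambda>z. ennreal (gauss_pdf (z - u)) * F z"]) measurable
  also have "\<dots> = (\<integral>\<^sup>+z. F z * ennreal (exp (z \<bullet> u - (u \<bullet> u) / 2)) \<partial>std_gauss)"
    by (subst nn_integral_std_gauss) (auto simp: gauss_pdf_shift ennreal_mult' mult_ac intro!: nn_integral_cong)
  finally show ?thesis .
qed

lemma distr_gauss_shift:
  "distr std_gauss borel (\<lambda>z. z + u) = density std_gauss (\<lambda>z::'v::euclidean_space. ennreal (exp (z \<bullet> u - (u \<bullet> u) / 2)))"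
proof (rule measure_eqI)
  fix A assume "A \<in> sets (distr std_gauss borel (\<lambda>z::'v. z + u))"
  then have [measurable]: "A \<in> sets borel" by simp
  have "emeasure (distr std_gauss borel (\<lambda>z. z + u)) A = (\<integral>\<^sup>+z. indicator A z \<partial>distr std_gauss borel (\<lambda>z. z + u))"
    by simp
  also have "\<dots> = (\<integral>\<^sup>+z. indicator A (z + u) \<partial>std_gauss)"
    by (subst nn_integral_distr) auto
  also have "\<dots> = (\<integral>\<^sup>+z. indicator A z * ennreal (exp (z \<bullet> u - (u \<bullet> u) / 2)) \<partial>std_gauss)"
    by (rule nn_integral_gauss_shift) simp
  finally show "emeasure (distr std_gauss borel (\<lambda>z. z + u)) A
     = emeasure (density std_gauss (\<lambda>z. ennreal (exp (z \<bullet> u - (u \<bullet> u) / 2)))) A"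
    by (simp add: emeasure_density mult.commute)
qed simp

lemma integral_gauss_shift:
  fixes F :: "'v::euclidean_space \<Rightarrow> 'w::{banach,second_countable_topology}"
  assumes [measurable]: "F \<in> borel_measurable borel"
  shows "(\<integral>z. F (z + u) \<partial>std_gauss) = (\<integral>z. exp (z \<bullet> u - (u \<bullet> u) / 2) *\<^sub>R F z \<partial>std_gauss)"
proof -
  have "(\<integral>z. F (z + u) \<partial>std_gauss) = (\<integral>z. F z \<partial>distr std_gauss borel (\<lambda>z. z + u))"
    by (simp add: integral_distr)
  also have "\<dots> = (\<integral>z. exp (z \<bullet> u - (u \<bullet> u) / 2) *\<^sub>R F z \<partial>std_gauss)"
    unfolding distr_gauss_shift by (subst integral_density) auto
  finally show ?thesis .
qed

lemma nn_integral_lborel_scale: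
  fixes f :: "'v::euclidean_space \<Rightarrow> ennreal"
  assumes [measurable]: "f \<in> borel_measurable borel" and c: "0 < c"
  shows "(\<integral>\<^sup>+x. f x \<partial>lborel) = ennreal (c ^ DIM('v)) * (\<integral>\<^sup>+x. f (c *\<^sub>R x) \<partial>lborel)"
  by (subst lborel_affine[of c 0])
     (use c in \<open>simp_all add: nn_integral_density nn_integral_distr nn_integral_cmult\<close>)

text \<open>Taking the constant function 1 in the Cameron-Martin formula determines the Laplace
  transform without a Gaussian integral being evaluated.\<close>

lemma nn_integral_exp_inner_gauss:
  "(\<integral>\<^sup>+z. ennreal (exp (z \<bullet> u)) \<partial>std_gauss) = ennreal (exp ((u \<bullet> u) / 2))"
proof -
  have "1 = (\<integral>\<^sup>+z. 1 * ennreal (exp (z \<bullet> u - (u \<bullet> u) / 2)) \<partial>std_gauss)"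
    by (subst nn_integral_gauss_shift[symmetric, of "\<lambda>_. 1"]) (simp_all add: std_gauss.emeasure_space_1[simplified])
  also have "\<dots> = (\<integral>\<^sup>+z. ennreal (exp (- (u \<bullet> u) / 2)) * ennreal (exp (z \<bullet> u)) \<partial>std_gauss)"
    by (simp add: ennreal_mult'[symmetric] exp_add[symmetric])
  also have "\<dots> = ennreal (exp (- (u \<bullet> u) / 2)) * (\<integral>\<^sup>+z. ennreal (exp (z \<bullet> u)) \<partial>std_gauss)"
    by (rule nn_integral_cmult) simp
  finally have *: "1 = ennreal (exp (- (u \<bullet> u) / 2)) * (\<integral>\<^sup>+z. ennreal (exp (z \<bullet> u)) \<partial>std_gauss)" .
  have "ennreal (exp ((u \<bullet> u) / 2)) * 1 = ennreal (exp ((u \<bullet> u) / 2)) * ennreal (exp (- (u \<bullet> u) / 2)) * (\<integral>\<^sup>+z. ennreal (exp (z \<bullet> u)) \<partial>std_gauss)"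
    by (subst *) (simp add: mult.assoc)
  also have "ennreal (exp ((u \<bullet> u) / 2)) * ennreal (exp (- (u \<bullet> u) / 2)) = 1"
    by (simp add: ennreal_mult'[symmetric] exp_add[symmetric])
  finally show ?thesis by simp
qed

text \<open>No change of variables by a rotation is used. Writing
  \<open>c z + s y = s (y + k z)\<close>, the Cameron-Martin formula moves \<open>k z\<close> into a
  density; after exchanging the integrals the integral over \<open>z\<close> is an explicit Laplace
  transform, and the scaling by \<open>s\<close> restores the standard density.\<close>

lemma nn_integral_gauss_rotate:
  fixes G :: "'v::euclidean_space \<Rightarrow> ennreal"
  assumes [measurable]: "G \<in> borel_measurable borel" and s: "0 < s" and cs: "c\<^sup>2 + s\<^sup>2 = 1"
  shows "(\<integral>\<^sup>+z. (\<integral>\<^sup>+y. G (c *\<^sub>R z + s *\<^sub>R y) \<partial>std_gauss) \<partial>std_gauss) = (\<integral>\<^sup>+x. G x \<partial>std_gauss)"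
proof -
  interpret pair_sigma_finite "std_gauss :: 'v measure" "std_gauss :: 'v measure" ..
  define k where "k = c / s"
  have k: "1 + k\<^sup>2 = 1 / s\<^sup>2" using s cs by (simp add: k_def field_simps)
  have "(\<integral>\<^sup>+z. (\<integral>\<^sup>+y. G (c *\<^sub>R z + s *\<^sub>R y) \<partial>std_gauss) \<partial>std_gauss)
      = (\<integral>\<^sup>+z. (\<integral>\<^sup>+y. G (s *\<^sub>R (y + k *\<^sub>R z)) \<partial>std_gauss) \<partial>std_gauss)"
    using s by (simp add: k_def algebra_simps)
  also have "\<dots> = (\<integral>\<^sup>+z. (\<integral>\<^sup>+y. G (s *\<^sub>R y) * ennreal (exp (y \<bullet> (k *\<^sub>R z) - (k *\<^sub>R z) \<bullet> (k *\<^sub>R z) / 2)) \<partial>std_gauss) \<partial>std_gauss)"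
    by (subst nn_integral_gauss_shift[of "\<lambda>y. G (s *\<^sub>R y)"]) auto
  also have "\<dots> = (\<integral>\<^sup>+y. (\<integral>\<^sup>+z. G (s *\<^sub>R y) * ennreal (exp (y \<bullet> (k *\<^sub>R z) - (k *\<^sub>R z) \<bullet> (k *\<^sub>R z) / 2)) \<partial>std_gauss) \<partial>std_gauss)"
    by (rule Fubini'[symmetric]) measurable
  also have "\<dots> = (\<integral>\<^sup>+y. G (s *\<^sub>R y) * ennreal (s ^ DIM('v) * exp (c\<^sup>2 * (y \<bullet> y) / 2)) \<partial>std_gauss)"
  proof (rule nn_integral_cong)
    fix y :: 'v
    have "(\<integral>\<^sup>+z. ennreal (exp (y \<bullet> (k *\<^sub>R z) - (k *\<^sub>R z) \<bullet> (k *\<^sub>R z) / 2)) \<partial>std_gauss)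
       = (\<integral>\<^sup>+z. ennreal (exp (y \<bullet> (k *\<^sub>R z) - (k *\<^sub>R z) \<bullet> (k *\<^sub>R z) / 2 - (z \<bullet> z) / 2) / sqrt (2 * pi) ^ DIM('v)) \<partial>lborel)"
      by (subst nn_integral_std_gauss) (auto simp: gauss_pdf_def ennreal_mult'[symmetric] exp_add[symmetric] intro!: nn_integral_cong)
    also have "\<dots> = (\<integral>\<^sup>+z. ennreal (exp (k * (y \<bullet> z) - (1 + k\<^sup>2) * (z \<bullet> z) / 2) / sqrt (2 * pi) ^ DIM('v)) \<partial>lborel)"
      by (simp add: algebra_simps power2_eq_square add_divide_distrib)
    \<comment> \<open>Scaling \<open>z\<close> by \<open>s\<close> normalises the quadratic form,
      because \<open>1 + k^2 = 1 / s^2\<close>.\<close>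
    also have "\<dots> = ennreal (s ^ DIM('v)) * (\<integral>\<^sup>+z. ennreal (exp (k * (y \<bullet> (s *\<^sub>R z)) - (1 + k\<^sup>2) * ((s *\<^sub>R z) \<bullet> (s *\<^sub>R z)) / 2) / sqrt (2 * pi) ^ DIM('v)) \<partial>lborel)"
      by (rule nn_integral_lborel_scale) (use s in auto)
    also have "(\<lambda>z. ennreal (exp (k * (y \<bullet> (s *\<^sub>R z)) - (1 + k\<^sup>2) * ((s *\<^sub>R z) \<bullet> (s *\<^sub>R z)) / 2) / sqrt (2 * pi) ^ DIM('v)))
       = (\<lambda>z. ennreal (gauss_pdf z) * ennreal (exp (z \<bullet> (c *\<^sub>R y))))"
    proof
      fix z
      have "k * (y \<bullet> (s *\<^sub>R z)) - (1 + k\<^sup>2) * ((s *\<^sub>R z) \<bullet> (s *\<^sub>R z)) / 2 = - (z \<bullet> z) / 2 + z \<bullet> (c *\<^sub>R y)"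
        unfolding k using s by (simp add: k_def power2_eq_square inner_commute)
      then show "ennreal (exp (k * (y \<bullet> (s *\<^sub>R z)) - (1 + k\<^sup>2) * ((s *\<^sub>R z) \<bullet> (s *\<^sub>R z)) / 2) / sqrt (2 * pi) ^ DIM('v))
         = ennreal (gauss_pdf z) * ennreal (exp (z \<bullet> (c *\<^sub>R y)))"
        by (simp only: exp_add gauss_pdf_def) (simp add: ennreal_mult'[symmetric])
    qed
    also have "(\<integral>\<^sup>+z. ennreal (gauss_pdf z) * ennreal (exp (z \<bullet> (c *\<^sub>R y))) \<partial>lborel) = ennreal (exp (c\<^sup>2 * (y \<bullet> y) / 2))"
      using nn_integral_exp_inner_gauss[of "c *\<^sub>R y"]
      by (subst nn_integral_std_gauss[symmetric]) (simp_all add: power2_eq_square mult.assoc)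
    finally show "(\<integral>\<^sup>+z. G (s *\<^sub>R y) * ennreal (exp (y \<bullet> (k *\<^sub>R z) - (k *\<^sub>R z) \<bullet> (k *\<^sub>R z) / 2)) \<partial>std_gauss)
       = G (s *\<^sub>R y) * ennreal (s ^ DIM('v) * exp (c\<^sup>2 * (y \<bullet> y) / 2))"
      using s by (subst nn_integral_cmult) (auto simp: ennreal_mult')
  qed
  also have "\<dots> = (\<integral>\<^sup>+y. ennreal (s ^ DIM('v)) * (ennreal (gauss_pdf (s *\<^sub>R y)) * G (s *\<^sub>R y)) \<partial>lborel)"
  proof (subst nn_integral_std_gauss)
    have e: "gauss_pdf y * (s ^ DIM('v) * exp (c\<^sup>2 * (y \<bullet> y) / 2)) = s ^ DIM('v) * gauss_pdf (s *\<^sub>R y)" for y :: 'v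
    proof -
      have "- (y \<bullet> y) / 2 + c\<^sup>2 * (y \<bullet> y) / 2 = - ((1 - c\<^sup>2) * (y \<bullet> y)) / 2" by (simp add: field_simps)
      also have "1 - c\<^sup>2 = s\<^sup>2" using cs by simp
      finally have "exp (- (y \<bullet> y) / 2) * exp (c\<^sup>2 * (y \<bullet> y) / 2) = exp (- ((s *\<^sub>R y) \<bullet> (s *\<^sub>R y)) / 2)"
        by (simp add: exp_add[symmetric] power2_eq_square mult.assoc)
      then show ?thesis by (simp add: gauss_pdf_def field_simps)
    qed
    show "(\<integral>\<^sup>+y. ennreal (gauss_pdf y) * (G (s *\<^sub>R y) * ennreal (s ^ DIM('v) * exp (c\<^sup>2 * (y \<bullet> y) / 2))) \<partial>lborel)
      = (\<integral>\<^sup>+y. ennreal (s ^ DIM('v)) * (ennreal (gauss_pdf (s *\<^sub>R y)) * G (s *\<^sub>R y)) \<partial>lborel)"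
    proof (rule nn_integral_cong)
      fix y :: 'v
      have "ennreal (gauss_pdf y) * ennreal (s ^ DIM('v) * exp (c\<^sup>2 * (y \<bullet> y) / 2))
        = ennreal (s ^ DIM('v)) * ennreal (gauss_pdf (s *\<^sub>R y))"
        using s e[of y] by (simp add: ennreal_mult'[symmetric])
      then show "ennreal (gauss_pdf y) * (G (s *\<^sub>R y) * ennreal (s ^ DIM('v) * exp (c\<^sup>2 * (y \<bullet> y) / 2)))
        = ennreal (s ^ DIM('v)) * (ennreal (gauss_pdf (s *\<^sub>R y)) * G (s *\<^sub>R y))"
        by (metis mult.assoc mult.commute)
    qed
  qed auto
  also have "\<dots> = (\<integral>\<^sup>+x. ennreal (gauss_pdf x) * G x \<partial>lborel)"
    by (subst nn_integral_lborel_scale[of _ s]) (use s in \<open>auto simp: nn_integral_cmult\<close>)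
  also have "\<dots> = (\<integral>\<^sup>+x. G x \<partial>std_gauss)" by (simp add: nn_integral_std_gauss)
  finally show ?thesis .
qed

section \<open>Test functions and exponential tilting\<close>

lemma exp_minus_one_abs_le:
  fixes t :: real
  shows "\<bar>exp t - 1\<bar> \<le> \<bar>t\<bar> * exp \<bar>t\<bar>"
proof (cases "0 \<le> t")
  case True
  have "1 - t \<le> exp (- t)" using exp_ge_add_one_self[of "- t"] by simp
  then have "exp t * (1 - t) \<le> exp t * exp (- t)" by (intro mult_left_mono) auto
  then show ?thesis using True by (simp add: exp_minus algebra_simps)
next
  case False
  have "1 + t \<le> exp t" "exp t \<le> 1" using False by (auto intro: exp_ge_add_one_self)
  then have "\<bar>exp t - 1\<bar> \<le> \<bar>t\<bar> * 1" using False by linarith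
  also have "\<dots> \<le> \<bar>t\<bar> * exp \<bar>t\<bar>" by (intro mult_left_mono) auto
  finally show ?thesis .
qed

lemma exp_taylor_two_le:
  fixes t :: real
  shows "\<bar>exp t - 1 - t\<bar> \<le> t\<^sup>2 * exp \<bar>t\<bar>"
proof -
  obtain u where u: "\<bar>u\<bar> \<le> \<bar>t\<bar>" "exp t = (\<Sum>m<2. t ^ m / fact m) + exp u / fact 2 * t ^ 2"
    using Maclaurin_exp_le[of t 2] by auto
  then have "\<bar>exp t - 1 - t\<bar> = exp u / 2 * t\<^sup>2" by (simp add: numeral_2_eq_2)
  also have "\<dots> \<le> exp \<bar>t\<bar> * t\<^sup>2"
  proof (rule mult_right_mono)
    have "exp u \<le> exp \<bar>t\<bar>" using u(1) by simp
    then show "exp u / 2 \<le> exp \<bar>t\<bar>" using exp_gt_zero[of u] by linarith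
  qed simp
  finally show ?thesis by (simp add: mult.commute)
qed

text \<open>The test functions are stable under composition with \<open>x \<mapsto> x + h v(x)\<close> (lemma \<open>quad_test_comp\<close>), so
  one-step errors of the Euler scheme can be propagated to its end.\<close>

definition quad_map :: "real \<Rightarrow> ('v::euclidean_space \<Rightarrow> 'v) \<Rightarrow> ('v \<Rightarrow> 'v \<Rightarrow> 'v) \<Rightarrow> bool"
  where "quad_map L v Dv \<longleftrightarrow> 1 \<le> L \<and> v \<in> borel_measurable borel \<and>
    (\<forall>f\<in>borel_measurable borel. (\<lambda>x. Dv x (f x)) \<in> borel_measurable borel) \<and>
    (\<forall>x a b. a \<bullet> Dv x b = Dv x a \<bullet> b) \<and>
    (\<forall>x a. norm (Dv x a) \<le> L * norm a) \<and>
    (\<forall>x. norm (v x) \<le> L * (1 + norm x)) \<and>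
    (\<forall>x u. norm (v (x + u) - v x) \<le> L * norm u) \<and>
    (\<forall>x u. norm (v (x + u) - v x - Dv x u) \<le> L * (norm u)\<^sup>2)"

text \<open>The vector field \<open>g\<close> acts as the gradient of \<open>\<psi>\<close>, but
  only its growth and the quadratic remainder are recorded, so neither differentiability nor second
  derivatives have to be handled. The weight with exponent \<open>s\<close> admits moments as test
  functions; \<open>A\<close> measures size, and all weak errors below are linear in it.\<close>

definition quad_test :: "real \<Rightarrow> real \<Rightarrow> ('v::euclidean_space \<Rightarrow> real) \<Rightarrow> ('v \<Rightarrow> 'v) \<Rightarrow> bool"
  where "quad_test s A \<psi> g \<longleftrightarrow> 0 \<le> A \<and> \<psi> \<in> borel_measurable borel \<and> g \<in> borel_measurable borel \<and>
    (\<forall>x. norm (g x) \<le> A * (1 + norm x) powr s) \<and>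
    (\<forall>x u. \<bar>\<psi> (x + u) - \<psi> x - g x \<bullet> u\<bar> \<le> A * (norm u)\<^sup>2 * (1 + norm x + norm u) powr s)"

text \<open>The gradient of the composition is the transposed derivative of the map applied to
  \<open>g\<close>; symmetry of \<open>Dv\<close> makes the transpose disappear. With
  \<open>r = 1 + h * L\<close>, the weight costs \<open>r powr s\<close>, and the quadratic terms of
  \<open>\<psi>\<close> and of \<open>v\<close> together cost at most \<open>r^3\<close>. The total
  \<open>r powr (s + 3)\<close> is bounded by an exponential linear in \<open>h\<close>, so that
  many steps multiply to a bounded factor.\<close>

lemma quad_test_comp:
  fixes v :: "'v::euclidean_space \<Rightarrow> 'v"
  assumes v: "quad_map L v Dv" and t: "quad_test s A \<psi> g" and h: "0 \<le> h" and s: "0 \<le> s"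
  shows "quad_test s (A * exp (h * (L * (s + 3)))) (\<lambda>x. \<psi> (x + h *\<^sub>R v x))
           (\<lambda>x. g (x + h *\<^sub>R v x) + h *\<^sub>R Dv x (g (x + h *\<^sub>R v x)))"
proof -
  have L: "1 \<le> L" and vm [measurable]: "v \<in> borel_measurable borel"
    and Dm: "\<And>f. f \<in> borel_measurable borel \<Longrightarrow> (\<lambda>x. Dv x (f x)) \<in> borel_measurable borel"
    and sym: "\<And>x a b. a \<bullet> Dv x b = Dv x a \<bullet> b"
    and Db: "\<And>x a. norm (Dv x a) \<le> L * norm a"
    and vb: "\<And>x. norm (v x) \<le> L * (1 + norm x)"
    and vl: "\<And>x u. norm (v (x + u) - v x) \<le> L * norm u"
    and vq: "\<And>x u. norm (v (x + u) - v x - Dv x u) \<le> L * (norm u)\<^sup>2"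
    using v unfolding quad_map_def by auto
  have A: "0 \<le> A" and [measurable]: "\<psi> \<in> borel_measurable borel" "g \<in> borel_measurable borel"
    and gb: "\<And>x. norm (g x) \<le> A * (1 + norm x) powr s"
    and pq: "\<And>x u. \<bar>\<psi> (x + u) - \<psi> x - g x \<bullet> u\<bar> \<le> A * (norm u)\<^sup>2 * (1 + norm x + norm u) powr s"
    using t unfolding quad_test_def by auto
  define T where "T x = x + h *\<^sub>R v x" for x
  define r where "r = 1 + h * L"
  have r: "1 \<le> r" using h L by (simp add: r_def)
  have [measurable]: "T \<in> borel_measurable borel" unfolding T_def by measurable
  have [measurable]: "(\<lambda>x. Dv x (g (T x))) \<in> borel_measurable borel" by (rule Dm) measurable
  have rexp: "r powr (s + 3) \<le> exp (h * (L * (s + 3)))"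
    using one_plus_powr_le_exp[of "h * L" "s + 3"] h L s by (simp add: r_def mult_ac)
  have Tb: "1 + norm (T x) \<le> r * (1 + norm x)" for x
  proof -
    have "norm (T x) \<le> norm x + h * norm (v x)"
      unfolding T_def using h by (intro order.trans[OF norm_triangle_ineq]) auto
    also have "\<dots> \<le> norm x + h * (L * (1 + norm x))" using vb h by (intro add_left_mono mult_left_mono) auto
    finally show ?thesis by (simp add: r_def algebra_simps)
  qed
  have gT: "norm (g (T x)) \<le> A * (r powr s * (1 + norm x) powr s)" for x
  proof -
    have "norm (g (T x)) \<le> A * (1 + norm (T x)) powr s" by (rule gb)
    also have "\<dots> \<le> A * (r * (1 + norm x)) powr s"
      using A Tb s by (intro mult_left_mono powr_mono2) auto
    finally show ?thesis using r by (simp add: powr_mult)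
  qed
  have "norm (g (T x) + h *\<^sub>R Dv x (g (T x))) \<le> A * exp (h * (L * (s + 3))) * (1 + norm x) powr s" for x
  proof -
    have "norm (g (T x) + h *\<^sub>R Dv x (g (T x))) \<le> norm (g (T x)) + h * (L * norm (g (T x)))"
      using h Db[of x "g (T x)"] by (intro order.trans[OF norm_triangle_ineq] add_left_mono) (auto intro: mult_left_mono)
    also have "\<dots> = r * norm (g (T x))" by (simp add: r_def algebra_simps)
    also have "\<dots> \<le> r * (A * (r powr s * (1 + norm x) powr s))" using r gT by (intro mult_left_mono) auto
    also have "\<dots> = A * r powr (s + 1) * (1 + norm x) powr s" using r by (simp add: powr_add)
    also have "\<dots> \<le> A * exp (h * (L * (s + 3))) * (1 + norm x) powr s"
      using A r by (intro mult_right_mono mult_left_mono order.trans[OF powr_mono rexp]) auto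
    finally show ?thesis .
  qed
  moreover have "\<bar>\<psi> (T (x + u)) - \<psi> (T x) - (g (T x) + h *\<^sub>R Dv x (g (T x))) \<bullet> u\<bar>
      \<le> A * exp (h * (L * (s + 3))) * (norm u)\<^sup>2 * (1 + norm x + norm u) powr s" for x u
  proof -
    define u' where "u' = u + h *\<^sub>R (v (x + u) - v x)"
    define q where "q = 1 + norm x + norm u"
    have q: "1 \<le> q" by (simp add: q_def)
    have u': "norm u' \<le> r * norm u"
    proof -
      have "norm u' \<le> norm u + h * norm (v (x + u) - v x)"
        unfolding u'_def using h by (intro order.trans[OF norm_triangle_ineq]) auto
      also have "\<dots> \<le> norm u + h * (L * norm u)" using h vl by (intro add_left_mono mult_left_mono) auto
      finally show ?thesis by (simp add: r_def algebra_simps)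
    qed
    have Tu: "T (x + u) = T x + u'" by (simp add: T_def u'_def algebra_simps)
    have w1: "1 + norm (T x) + norm u' \<le> r * q" using Tb[of x] u' by (simp add: q_def algebra_simps)
    have 1: "\<bar>\<psi> (T x + u') - \<psi> (T x) - g (T x) \<bullet> u'\<bar> \<le> A * (r\<^sup>2 * (norm u)\<^sup>2) * (r powr s * q powr s)"
    proof -
      have "\<bar>\<psi> (T x + u') - \<psi> (T x) - g (T x) \<bullet> u'\<bar> \<le> A * (norm u')\<^sup>2 * (1 + norm (T x) + norm u') powr s"
        by (rule pq)
      also have "\<dots> \<le> A * (r * norm u)\<^sup>2 * (r * q) powr s"
        using A u' w1 s r q by (intro mult_mono mult_left_mono power_mono powr_mono2) auto
      finally show ?thesis using r q by (simp add: powr_mult power_mult_distrib)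
    qed
    \<comment> \<open>This is the only place where symmetry of \<open>Dv\<close> is used: what
      remains is \<open>g\<close> paired with the second-order remainder of
      \<open>v\<close>.\<close>
    have eq: "g (T x) \<bullet> u' - (g (T x) + h *\<^sub>R Dv x (g (T x))) \<bullet> u = h * (g (T x) \<bullet> (v (x + u) - v x - Dv x u))"
      using sym[of "g (T x)" x u] by (simp add: u'_def algebra_simps inner_add_left inner_diff_right)
    have 2: "\<bar>h * (g (T x) \<bullet> (v (x + u) - v x - Dv x u))\<bar> \<le> A * (h * L * (norm u)\<^sup>2) * (r powr s * q powr s)"
    proof -
      have "\<bar>g (T x) \<bullet> (v (x + u) - v x - Dv x u)\<bar> \<le> norm (g (T x)) * norm (v (x + u) - v x - Dv x u)"
        by (rule Cauchy_Schwarz_ineq2)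
      also have "\<dots> \<le> (A * (r powr s * (1 + norm x) powr s)) * (L * (norm u)\<^sup>2)"
        using gT vq A r by (intro mult_mono) auto
      also have "\<dots> \<le> (A * (r powr s * q powr s)) * (L * (norm u)\<^sup>2)"
        using A s L by (intro mult_right_mono mult_left_mono powr_mono2) (auto simp: q_def)
      finally have "h * \<bar>g (T x) \<bullet> (v (x + u) - v x - Dv x u)\<bar> \<le> h * ((A * (r powr s * q powr s)) * (L * (norm u)\<^sup>2))"
        using h by (intro mult_left_mono) auto
      then show ?thesis using h by (simp add: abs_mult mult_ac)
    qed
    have "\<bar>\<psi> (T (x + u)) - \<psi> (T x) - (g (T x) + h *\<^sub>R Dv x (g (T x))) \<bullet> u\<bar>
       \<le> A * (r\<^sup>2 * (norm u)\<^sup>2) * (r powr s * q powr s) + A * (h * L * (norm u)\<^sup>2) * (r powr s * q powr s)"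
      unfolding Tu using 1 2 eq by linarith
    also have "\<dots> = A * (r\<^sup>2 + h * L) * ((norm u)\<^sup>2 * r powr s * q powr s)" by (simp add: algebra_simps)
    also have "\<dots> \<le> A * r ^ 3 * ((norm u)\<^sup>2 * r powr s * q powr s)"
    proof -
      define k where "k = h * L"
      have k: "0 \<le> k" using h L by (simp add: k_def)
      have "(1 + k) ^ 3 - ((1 + k)\<^sup>2 + k) = k ^ 3 + 2 * k\<^sup>2"
        by (simp add: power2_eq_square power3_eq_cube algebra_simps)
      moreover have "0 \<le> k ^ 3 + 2 * k\<^sup>2" using k by simp
      ultimately have "r\<^sup>2 + h * L \<le> r ^ 3" by (simp add: r_def k_def)
      then show ?thesis using A by (intro mult_right_mono mult_left_mono) auto
    qed
    also have "\<dots> = A * (r powr (s + 3)) * (norm u)\<^sup>2 * q powr s"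
      using r by (simp add: powr_add powr_numeral)
    also have "\<dots> \<le> A * exp (h * (L * (s + 3))) * (norm u)\<^sup>2 * q powr s"
      using A rexp by (intro mult_right_mono mult_left_mono) auto
    finally show ?thesis by (simp add: q_def)
  qed
  ultimately show ?thesis
    unfolding quad_test_def T_def[symmetric] using A by auto
qed

text \<open>Makes the p-th power of a velocity admissible as a test function, and with the identity
  map also plain moments. The remainder consists of the second-order error of
  \<open>norm x powr p\<close> and that of \<open>v\<close> itself.\<close>

lemma quad_map_norm_powr:
  fixes v :: "'v::euclidean_space \<Rightarrow> 'v"
  assumes v: "quad_map L v Dv" and p: "2 \<le> p" "p \<le> s"
  shows "quad_test s (2 * p\<^sup>2 * L powr p) (\<lambda>x. norm (v x) powr p) (\<lambda>x. p *\<^sub>R Dv x (powr_grad p (v x)))"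
proof -
  have L: "1 \<le> L" and vm [measurable]: "v \<in> borel_measurable borel"
    and Dm: "\<And>f. f \<in> borel_measurable borel \<Longrightarrow> (\<lambda>x. Dv x (f x)) \<in> borel_measurable borel"
    and sym: "\<And>x a b. a \<bullet> Dv x b = Dv x a \<bullet> b"
    and Db: "\<And>x a. norm (Dv x a) \<le> L * norm a"
    and vb: "\<And>x. norm (v x) \<le> L * (1 + norm x)"
    and vl: "\<And>x u. norm (v (x + u) - v x) \<le> L * norm u"
    and vq: "\<And>x u. norm (v (x + u) - v x - Dv x u) \<le> L * (norm u)\<^sup>2"
    using v unfolding quad_map_def by auto
  have [measurable]: "powr_grad p \<in> borel_measurable (borel :: 'v measure)"
    unfolding powr_grad_def by simp
  have [measurable]: "(\<lambda>x. Dv x (powr_grad p (v x))) \<in> borel_measurable borel" by (rule Dm) measurable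
  have Lp: "L * L powr (p - 1) = L powr p" "L\<^sup>2 * L powr (p - 2) = L powr p"
    using L by (simp_all add: powr_diff powr_numeral)
  have pp: "p \<le> p\<^sup>2" using p by (simp add: power2_eq_square)
  have gr: "norm (powr_grad p (v x)) \<le> L powr (p - 1) * (1 + norm x) powr (p - 1)" for x
  proof -
    have "norm (powr_grad p (v x)) \<le> (L * (1 + norm x)) powr (p - 1)"
      unfolding norm_powr_grad using vb p by (intro powr_mono2) auto
    then show ?thesis using L by (simp add: powr_mult)
  qed
  have weight: "c powr t \<le> c powr s" if "1 \<le> c" "t \<le> p" for c t :: real
    using that p by (intro powr_mono) auto
  have "norm (p *\<^sub>R Dv x (powr_grad p (v x))) \<le> 2 * p\<^sup>2 * L powr p * (1 + norm x) powr s" for x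
  proof -
    have "norm (p *\<^sub>R Dv x (powr_grad p (v x))) = p * norm (Dv x (powr_grad p (v x)))" using p by simp
    also have "\<dots> \<le> p * (L * (L powr (p - 1) * (1 + norm x) powr (p - 1)))"
      using p L Db gr by (intro mult_left_mono order.trans[OF Db] mult_left_mono) auto
    also have "\<dots> = p * (L powr p * (1 + norm x) powr (p - 1))" by (simp flip: Lp(1))
    also have "\<dots> \<le> (2 * p\<^sup>2) * (L powr p * (1 + norm x) powr s)"
      using p pp weight[of "1 + norm x" "p - 1"] by (intro mult_mono mult_left_mono) auto
    finally show ?thesis by (simp add: mult_ac)
  qed
  moreover have "\<bar>norm (v (x + u)) powr p - norm (v x) powr p - (p *\<^sub>R Dv x (powr_grad p (v x))) \<bullet> u\<bar>
      \<le> 2 * p\<^sup>2 * L powr p * (norm u)\<^sup>2 * (1 + norm x + norm u) powr s" for x u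
  proof -
    define z where "z = v (x + u) - v x"
    define q where "q = 1 + norm x + norm u"
    have q: "1 \<le> q" by (simp add: q_def)
    have z: "norm z \<le> L * norm u" using vl by (simp add: z_def)
    have yz: "norm (v x) + norm z \<le> L * q" using vb[of x] z by (simp add: q_def algebra_simps)
    have a: "\<bar>norm (v x + z) powr p - norm (v x) powr p - p * (powr_grad p (v x) \<bullet> z)\<bar>
       \<le> p\<^sup>2 * (norm (v x) + norm z) powr (p - 2) * (norm z)\<^sup>2"
      using norm_powr_lower[OF p(1), of "v x" z] norm_powr_upper[OF p(1), of "v x" z] by linarith
    also have "\<dots> \<le> p\<^sup>2 * (L * q) powr (p - 2) * (L * norm u)\<^sup>2"
      using yz z p by (intro mult_mono mult_left_mono powr_mono2 power_mono) auto
    also have "\<dots> = p\<^sup>2 * (L\<^sup>2 * L powr (p - 2)) * (norm u)\<^sup>2 * q powr (p - 2)"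
      using L q by (simp add: powr_mult power_mult_distrib mult_ac)
    also have "\<dots> \<le> p\<^sup>2 * L powr p * (norm u)\<^sup>2 * q powr s"
      unfolding Lp(2) using q by (intro mult_left_mono weight) auto
    finally have 1: "\<bar>norm (v x + z) powr p - norm (v x) powr p - p * (powr_grad p (v x) \<bullet> z)\<bar>
      \<le> p\<^sup>2 * L powr p * (norm u)\<^sup>2 * q powr s" .
    have "\<bar>powr_grad p (v x) \<bullet> (z - Dv x u)\<bar> \<le> norm (powr_grad p (v x)) * norm (z - Dv x u)"
      by (rule Cauchy_Schwarz_ineq2)
    also have "\<dots> \<le> (L powr (p - 1) * (1 + norm x) powr (p - 1)) * (L * (norm u)\<^sup>2)"
      using gr vq[of x u] L by (intro mult_mono) (auto simp: z_def)
    also have "\<dots> = (L * L powr (p - 1)) * (norm u)\<^sup>2 * (1 + norm x) powr (p - 1)" by (simp add: mult_ac)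
    also have "\<dots> \<le> (L * L powr (p - 1)) * (norm u)\<^sup>2 * q powr (p - 1)"
      using L p by (intro mult_left_mono powr_mono2) (auto simp: q_def)
    also have "\<dots> \<le> L powr p * (norm u)\<^sup>2 * q powr s"
      unfolding Lp(1) using q by (intro mult_left_mono weight) auto
    finally have "p * \<bar>powr_grad p (v x) \<bullet> (z - Dv x u)\<bar> \<le> p\<^sup>2 * (L powr p * (norm u)\<^sup>2 * q powr s)"
      using pp p by (intro mult_mono) auto
    moreover have "p * (powr_grad p (v x) \<bullet> z) - (p *\<^sub>R Dv x (powr_grad p (v x))) \<bullet> u
        = p * (powr_grad p (v x) \<bullet> (z - Dv x u))"
      using sym[of "powr_grad p (v x)" x u] by (simp add: inner_diff_right algebra_simps)
    ultimately have 2: "\<bar>p * (powr_grad p (v x) \<bullet> z) - (p *\<^sub>R Dv x (powr_grad p (v x))) \<bullet> u\<bar>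
        \<le> p\<^sup>2 * (L powr p * (norm u)\<^sup>2 * q powr s)"
      using p by (simp add: abs_mult)
    have "v (x + u) = v x + z" by (simp add: z_def)
    then show ?thesis using 1 2 unfolding q_def[symmetric] by (simp add: abs_le_iff algebra_simps)
  qed
  ultimately show ?thesis
    unfolding quad_test_def using p L by auto
qed

lemma quad_map_id: "quad_map 1 (\<lambda>x::'v::euclidean_space. x) (\<lambda>x a. a)"
  unfolding quad_map_def by auto

text \<open>Taylor expansion along the segment from \<open>x\<close> to \<open>x + u\<close>. With
  \<open>r\<close> the squared distance in the exponent, the second derivative is
  \<open>f * (l^2 - k)\<close>; Cauchy-Schwarz gives \<open>l^2 \<le> k * r\<close>, and
  \<open>f * r \<le> 2\<close> because \<open>f = exp (- r / 2)\<close>. This yields the constant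
  \<open>3 = 2 + 1\<close>.\<close>

lemma exp_quad_bound:
  fixes x u y :: "'v::euclidean_space" and c :: real
  shows "\<bar>exp (- ((y - c *\<^sub>R (x + u)) \<bullet> (y - c *\<^sub>R (x + u))) / 2) - exp (- ((y - c *\<^sub>R x) \<bullet> (y - c *\<^sub>R x)) / 2)
     - (exp (- ((y - c *\<^sub>R x) \<bullet> (y - c *\<^sub>R x)) / 2) * c) *\<^sub>R (y - c *\<^sub>R x) \<bullet> u\<bar> \<le> 3 * c\<^sup>2 * (norm u)\<^sup>2"
proof -
  define w1 where "w1 = y - c *\<^sub>R x"
  define a where "a = w1 \<bullet> w1"
  define b where "b = c * (w1 \<bullet> u)"
  define k where "k = c\<^sup>2 * (u \<bullet> u)"
  define f where "f t = exp (- (a - 2 * b * t + k * t\<^sup>2) / 2)" for t :: real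
  define l where "l t = b - k * t" for t :: real
  define f2 where "f2 t = f t * (l t)\<^sup>2 - f t * k" for t
  have fd: "(f has_real_derivative f t * l t) (at t)" for t
    unfolding f_def l_def by (auto intro!: derivative_eq_intros simp: power2_eq_square field_simps)
  have fd2: "((\<lambda>t. f t * l t) has_real_derivative f2 t) (at t)" for t
    unfolding f2_def by (auto intro!: derivative_eq_intros fd simp: l_def power2_eq_square algebra_simps)
  have sq: "(w1 - (t * c) *\<^sub>R u) \<bullet> (w1 - (t * c) *\<^sub>R u) = a - 2 * b * t + k * t\<^sup>2" for t
    by (simp add: a_def b_def k_def inner_diff_left inner_diff_right inner_commute power2_eq_square algebra_simps)
  have le: "\<bar>f2 t\<bar> \<le> 3 * k" for t
  proof -
    define r where "r = a - 2 * b * t + k * t\<^sup>2"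
    have r0: "0 \<le> r" unfolding r_def sq[symmetric] by simp
    have k0: "0 \<le> k" by (simp add: k_def)
    have l: "l t = c * ((w1 - (t * c) *\<^sub>R u) \<bullet> u)"
      by (simp add: l_def b_def k_def inner_diff_left power2_eq_square algebra_simps)
    have "((w1 - (t * c) *\<^sub>R u) \<bullet> u)\<^sup>2 \<le> r * (u \<bullet> u)"
      unfolding r_def sq[symmetric] by (rule Cauchy_Schwarz_ineq)
    then have "c\<^sup>2 * ((w1 - (t * c) *\<^sub>R u) \<bullet> u)\<^sup>2 \<le> c\<^sup>2 * (r * (u \<bullet> u))" by (intro mult_left_mono) auto
    then have l2: "(l t)\<^sup>2 \<le> k * r" unfolding l power_mult_distrib by (simp add: k_def mult_ac)
    have f: "f t = exp (- (r / 2))" unfolding f_def r_def[symmetric] by simp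
    have "r \<le> 2 * exp (r / 2)" using exp_ge_add_one_self[of "r / 2"] exp_gt_zero[of "r / 2"] by linarith
    then have fr: "f t * r \<le> 2" by (simp add: f exp_minus field_simps)
    have "f t * (l t)\<^sup>2 \<le> f t * (k * r)" using l2 by (intro mult_left_mono) (auto simp: f)
    also have "\<dots> = k * (f t * r)" by simp
    also have "\<dots> \<le> k * 2" using fr k0 by (intro mult_left_mono) auto
    finally have 1: "f t * (l t)\<^sup>2 \<le> k * 2" .
    have "f t \<le> 1" using r0 by (simp add: f)
    then have 2: "f t * k \<le> 1 * k" using k0 by (intro mult_right_mono) auto
    have "0 \<le> f t * (l t)\<^sup>2" "0 \<le> f t * k" using k0 by (auto simp: f)
    then show ?thesis unfolding f2_def using 1 2 by linarith
  qed
  have "\<exists>t. 0 < t \<and> t < 1 \<and> f 1 = (\<Sum>m<2. (if m = 0 then f else if m = 1 then (\<lambda>t. f t * l t) else f2) 0 / fact m * 1 ^ m)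
      + (if (2::nat) = 0 then f else if (2::nat) = 1 then (\<lambda>t. f t * l t) else f2) t / fact 2 * 1 ^ 2"
    by (rule Maclaurin[where diff = "\<lambda>m. if m = 0 then f else if m = 1 then (\<lambda>t. f t * l t) else f2"])
       (use fd fd2 in \<open>auto simp: less_2_cases_iff\<close>)
  then obtain t where "f 1 = f 0 + f 0 * l 0 + f2 t / 2" by (auto simp: numeral_2_eq_2)
  then have "\<bar>f 1 - f 0 - f 0 * l 0\<bar> \<le> 3 * k" using le[of t] by linarith
  moreover have "k = c\<^sup>2 * (norm u)\<^sup>2" by (simp add: k_def power2_norm_eq_inner)
  moreover have "f 1 = exp (- ((y - c *\<^sub>R (x + u)) \<bullet> (y - c *\<^sub>R (x + u))) / 2)"
  proof -
    have "y - c *\<^sub>R (x + u) = w1 - (1 * c) *\<^sub>R u" by (simp add: w1_def algebra_simps)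
    then show ?thesis by (simp only: sq f_def)
  qed
  moreover have "f 0 = exp (- ((y - c *\<^sub>R x) \<bullet> (y - c *\<^sub>R x)) / 2)" by (simp add: f_def a_def w1_def)
  ultimately show ?thesis by (simp add: l_def b_def w1_def mult_ac)
qed

text \<open>Adding Gaussian noise turns a law into a density whose values are expectations of such
  kernels. Testing with them, with a size that does not depend on \<open>y\<close>, makes weak
  closeness of laws into uniform closeness of densities.\<close>

lemma quad_test_gauss_kernel:
  fixes y :: "'v::euclidean_space"
  assumes "0 \<le> s"
  shows "quad_test s (3 * c\<^sup>2 + \<bar>c\<bar>) (\<lambda>x. exp (- ((y - c *\<^sub>R x) \<bullet> (y - c *\<^sub>R x)) / 2))
     (\<lambda>x. (exp (- ((y - c *\<^sub>R x) \<bullet> (y - c *\<^sub>R x)) / 2) * c) *\<^sub>R (y - c *\<^sub>R x))"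
proof -
  let ?A = "3 * c\<^sup>2 + \<bar>c\<bar>"
  have one: "1 \<le> w1 powr s" if "1 \<le> w1" for w1 :: real
    using that assms by (simp add: ge_one_powr_ge_zero)
  have kernel: "exp (- (w1 \<bullet> w1) / 2) * norm w1 \<le> 1" for w1 :: 'v
  proof -
    have "norm w1 \<le> 1 + (norm w1)\<^sup>2 / 2" using zero_le_power2[of "norm w1 - 1"] by (simp add: power2_eq_square algebra_simps)
    also have "\<dots> \<le> exp ((norm w1)\<^sup>2 / 2)" by (rule exp_ge_add_one_self)
    finally show ?thesis by (simp add: exp_minus power2_norm_eq_inner field_simps)
  qed
  have "norm ((exp (- ((y - c *\<^sub>R x) \<bullet> (y - c *\<^sub>R x)) / 2) * c) *\<^sub>R (y - c *\<^sub>R x)) \<le> ?A * (1 + norm x) powr s" for x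
  proof -
    have "norm ((exp (- ((y - c *\<^sub>R x) \<bullet> (y - c *\<^sub>R x)) / 2) * c) *\<^sub>R (y - c *\<^sub>R x))
       = \<bar>c\<bar> * (exp (- ((y - c *\<^sub>R x) \<bullet> (y - c *\<^sub>R x)) / 2) * norm (y - c *\<^sub>R x))"
      by (simp add: abs_mult mult_ac)
    also have "\<dots> \<le> \<bar>c\<bar> * 1" by (intro mult_left_mono kernel) auto
    also have "\<dots> \<le> ?A * (1 + norm x) powr s" using one[of "1 + norm x"] by (intro mult_mono) auto
    finally show ?thesis .
  qed
  note 1 = this
  have "3 * c\<^sup>2 * (norm u)\<^sup>2 \<le> ?A * (norm u)\<^sup>2 * (1 + norm x + norm u) powr s" for x u :: 'v
  proof -
    have "3 * c\<^sup>2 * (norm u)\<^sup>2 \<le> ?A * (norm u)\<^sup>2 * 1" by (simp add: algebra_simps)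
    also have "\<dots> \<le> ?A * (norm u)\<^sup>2 * (1 + norm x + norm u) powr s"
      using one[of "1 + norm x + norm u"] by (intro mult_left_mono) auto
    finally show ?thesis .
  qed
  note 2 = order_trans[OF exp_quad_bound[of y c] this]
  show ?thesis
    unfolding quad_test_def by (intro conjI allI 1 2) auto
qed

section \<open>Exponentially tilted means of a bounded vector\<close>

lemma (in prob_space) norm_integral_bound:
  fixes f :: "'a \<Rightarrow> 'v::euclidean_space"
  assumes [measurable]: "f \<in> borel_measurable M" and b: "\<And>w. w \<in> space M \<Longrightarrow> norm (f w) \<le> B"
  shows "norm (integral\<^sup>L M f) \<le> B" "integrable M f"
proof -
  show i: "integrable M f" by (rule integrable_const_bound[where B = B]) (auto intro: b)
  have "norm (integral\<^sup>L M f) \<le> (\<integral>w. norm (f w) \<partial>M)" by (rule integral_norm_bound)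
  also have "\<dots> \<le> (\<integral>w. B \<partial>M)" using i b by (intro integral_mono) auto
  finally show "norm (integral\<^sup>L M f) \<le> B" by (simp add: prob_space)
qed

text \<open>The covariance operator of \<open>W\<close> applied to \<open>y\<close>. Centring one
  factor gives the same operator as centring both, because the centred factor has mean 0.\<close>

definition tilt_cov :: "'a measure \<Rightarrow> ('a \<Rightarrow> 'v::euclidean_space) \<Rightarrow> 'v \<Rightarrow> 'v"
  where "tilt_cov M W y = (\<integral>w. (y \<bullet> W w) *\<^sub>R (W w - integral\<^sup>L M W) \<partial>M)"

text \<open>The tilted mean \<open>m\<close> is the gradient of the logarithmic Laplace transform of
  \<open>W\<close>, so its derivative at 0 is the covariance operator. The expansion is done by hand
  for a bounded vector, with constants depending on \<open>R\<close> only.\<close>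

lemma (in prob_space) tilt_expansion:
  fixes W :: "'a \<Rightarrow> 'v::euclidean_space"
  assumes [measurable]: "W \<in> borel_measurable M" and W: "\<And>w. w \<in> space M \<Longrightarrow> norm (W w) \<le> R" and R: "0 \<le> R"
  defines "m0 \<equiv> integral\<^sup>L M W"
    and "m \<equiv> \<lambda>y. (1 / (\<integral>w. exp (y \<bullet> W w) \<partial>M)) *\<^sub>R (\<integral>w. exp (y \<bullet> W w) *\<^sub>R W w \<partial>M)"
    and "C \<equiv> 2 * R + 2 * R\<^sup>2 + 4 * R ^ 3 * exp R ^ 2"
  shows "norm (tilt_cov M W y) \<le> 2 * R\<^sup>2 * norm y"
    and "norm (m y - m0) \<le> (2 * R\<^sup>2 + C) * norm y"
    and "norm (m y - m0 - tilt_cov M W y) \<le> C * (norm y)\<^sup>2"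
    and "0 < (\<integral>w. exp (y \<bullet> W w) \<partial>M)"
    and "norm (m y) \<le> R"
proof -
  have C: "0 \<le> C" "2 * R \<le> C" using R by (simp_all add: C_def)
  have m0: "norm m0 \<le> R" unfolding m0_def by (rule norm_integral_bound[OF _ W]) auto
  have W0: "norm (W w - m0) \<le> 2 * R" if "w \<in> space M" for w
    using W[OF that] m0 norm_triangle_ineq4[of "W w" m0] by linarith
  have yW: "\<bar>y \<bullet> W w\<bar> \<le> norm y * R" if "w \<in> space M" for y w
    using Cauchy_Schwarz_ineq2[of y "W w"] mult_left_mono[OF W[OF that], of "norm y"] by simp
  have expb: "exp (- (norm y * R)) \<le> exp (y \<bullet> W w)" "exp (y \<bullet> W w) \<le> exp (norm y * R)" if "w \<in> space M" for y w
    using yW[OF that, of y] by auto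
  have intE: "integrable M (\<lambda>w. exp (y \<bullet> W w))" for y
    by (rule norm_integral_bound(2)[where B = "exp (norm y * R)"]) (use expb in auto)
  define D where "D y = (\<integral>w. exp (y \<bullet> W w) \<partial>M)" for y
  have Dge: "exp (- (norm y * R)) \<le> D y" for y
  proof -
    have "exp (- (norm y * R)) = (\<integral>w. exp (- (norm y * R)) \<partial>M)" by (simp add: prob_space)
    also have "\<dots> \<le> D y" unfolding D_def using intE expb by (intro integral_mono) auto
    finally show ?thesis .
  qed
  have Dpos: "0 < D y" for y using Dge[of y] exp_gt_zero[of "- (norm y * R)"] by linarith
  show "0 < (\<integral>w. exp (y \<bullet> W w) \<partial>M)" using Dpos by (simp add: D_def)
  have normm: "norm (m y) \<le> R" for y
  proof -
    have "norm (\<integral>w. exp (y \<bullet> W w) *\<^sub>R W w \<partial>M) \<le> (\<integral>w. norm (exp (y \<bullet> W w) *\<^sub>R W w) \<partial>M)"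
      by (rule integral_norm_bound)
    also have "\<dots> \<le> (\<integral>w. R * exp (y \<bullet> W w) \<partial>M)"
    proof (rule integral_mono)
      show "integrable M (\<lambda>w. norm (exp (y \<bullet> W w) *\<^sub>R W w))"
        by (intro integrable_norm norm_integral_bound(2)[where B = "exp (norm y * R) * R"])
           (use expb W in \<open>auto intro!: mult_mono\<close>)
      show "norm (exp (y \<bullet> W w) *\<^sub>R W w) \<le> R * exp (y \<bullet> W w)" if "w \<in> space M" for w
        using W[OF that] by simp
    qed (use intE in auto)
    also have "\<dots> = R * D y" by (simp add: D_def)
    finally show ?thesis using Dpos[of y] by (simp add: m_def D_def[symmetric] field_simps)
  qed
  show "norm (m y) \<le> R" by (rule normm)
  have cov: "norm (tilt_cov M W y) \<le> 2 * R\<^sup>2 * norm y" for y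
    unfolding tilt_cov_def m0_def[symmetric]
  proof (rule norm_integral_bound)
    fix w assume w1: "w \<in> space M"
    have "norm ((y \<bullet> W w) *\<^sub>R (W w - m0)) \<le> (norm y * R) * (2 * R)"
      using yW[OF w1, of y] W0[OF w1] R by (simp, intro mult_mono) auto
    then show "norm ((y \<bullet> W w) *\<^sub>R (W w - m0)) \<le> 2 * R\<^sup>2 * norm y" by (simp add: power2_eq_square mult_ac)
  qed simp
  show "norm (tilt_cov M W y) \<le> 2 * R\<^sup>2 * norm y" by (rule cov)
  \<comment> \<open>For \<open>norm y > 1\<close> nothing is expanded: both means are at most
    \<open>R\<close> and \<open>C\<close> dominates. For \<open>norm y \<le> 1\<close> the
    exponentials and the reciprocal of the normalisation are at most \<open>exp R\<close>.\<close>
  have main: "norm (m y - m0 - tilt_cov M W y) \<le> C * (norm y)\<^sup>2" for y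
  proof (cases "norm y \<le> 1")
    case False
    then have y: "1 \<le> norm y" "norm y \<le> (norm y)\<^sup>2" using mult_left_mono[of 1 "norm y" "norm y"] by (auto simp: power2_eq_square)
    then have "1 \<le> (norm y)\<^sup>2" by linarith
    have "norm (m y - m0 - tilt_cov M W y) \<le> norm (m y) + norm m0 + norm (tilt_cov M W y)"
      by (meson norm_triangle_ineq4 order_trans add_right_mono)
    also have "\<dots> \<le> 2 * R * 1 + 2 * R\<^sup>2 * norm y" using normm[of y] m0 cov[of y] by linarith
    also have "\<dots> \<le> 2 * R * (norm y)\<^sup>2 + 2 * R\<^sup>2 * (norm y)\<^sup>2"
      using R y \<open>1 \<le> (norm y)\<^sup>2\<close> by (intro add_mono mult_left_mono) auto
    also have "\<dots> \<le> C * (norm y)\<^sup>2" using R by (simp add: C_def algebra_simps)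
    finally show ?thesis .
  next
    case True
    then have yR: "norm y * R \<le> R" using R mult_right_mono[of "norm y" 1 R] by simp
    define e where "e = exp R"
    have e: "1 \<le> e" using R by (simp add: e_def)
    have eb: "exp \<bar>y \<bullet> W w\<bar> \<le> e" if "w \<in> space M" for w
      using yW[OF that, of y] yR by (simp add: e_def)
    define V where "V = (\<lambda>w. W w - m0)"
    have V: "norm (V w) \<le> 2 * R" if "w \<in> space M" for w using W0[OF that] by (simp add: V_def)
    have [measurable]: "V \<in> borel_measurable M" by (simp add: V_def)
    have intV: "integrable M V" by (rule norm_integral_bound(2)[OF _ V]) auto
    have intW: "integrable M W" by (rule norm_integral_bound(2)[OF _ W]) auto
    have V0: "integral\<^sup>L M V = 0" unfolding V_def using intW by (simp add: m0_def prob_space)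
    have intEV: "integrable M (\<lambda>w. exp (y \<bullet> W w) *\<^sub>R V w)"
      by (rule norm_integral_bound(2)[where B = "exp (norm y * R) * (2 * R)"])
         (use expb V in \<open>auto intro!: mult_mono\<close>)
    have intEW: "integrable M (\<lambda>w. exp (y \<bullet> W w) *\<^sub>R W w)"
      by (rule norm_integral_bound(2)[where B = "exp (norm y * R) * R"])
         (use expb W in \<open>auto intro!: mult_mono\<close>)
    have intyV: "integrable M (\<lambda>w. (y \<bullet> W w) *\<^sub>R V w)"
      by (rule norm_integral_bound(2)[where B = "(norm y * R) * (2 * R)"])
         (use yW V R in \<open>auto intro!: mult_mono\<close>)
    \<comment> \<open>The second-order remainder of the exponential, integrated against the centred
      vector \<open>V\<close>. The constant term of the exponential integrates to 0 against
      \<open>V\<close>, and the linear term gives \<open>tilt_cov\<close>.\<close>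
    define \<rho> where "\<rho> = (\<integral>w. (exp (y \<bullet> W w) - 1 - y \<bullet> W w) *\<^sub>R V w \<partial>M)"
    have rho: "norm \<rho> \<le> (2 * R ^ 3 * e) * (norm y)\<^sup>2"
      unfolding \<rho>_def
    proof (rule norm_integral_bound)
      fix w assume w1: "w \<in> space M"
      have "(y \<bullet> W w)\<^sup>2 \<le> (norm y * R)\<^sup>2" using yW[OF w1, of y] R by (intro abs_le_square_iff[THEN iffD1]) auto
      then have "(y \<bullet> W w)\<^sup>2 * exp \<bar>y \<bullet> W w\<bar> \<le> (norm y * R)\<^sup>2 * e"
        using eb[OF w1] by (intro mult_mono) auto
      then have "\<bar>exp (y \<bullet> W w) - 1 - y \<bullet> W w\<bar> \<le> (norm y * R)\<^sup>2 * e"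
        using exp_taylor_two_le[of "y \<bullet> W w"] by linarith
      then have "\<bar>exp (y \<bullet> W w) - 1 - y \<bullet> W w\<bar> * norm (V w) \<le> ((norm y * R)\<^sup>2 * e) * (2 * R)"
        using V[OF w1] e by (intro mult_mono) auto
      then show "norm ((exp (y \<bullet> W w) - 1 - y \<bullet> W w) *\<^sub>R V w) \<le> (2 * R ^ 3 * e) * (norm y)\<^sup>2"
        by (simp add: power2_eq_square power3_eq_cube mult_ac)
    qed simp
    have "(\<integral>w. exp (y \<bullet> W w) *\<^sub>R V w \<partial>M) - integral\<^sup>L M V - (\<integral>w. (y \<bullet> W w) *\<^sub>R V w \<partial>M) = \<rho>"
      unfolding \<rho>_def scaleR_diff_left scaleR_one using intEV intV intyV by simp
    then have num: "(\<integral>w. exp (y \<bullet> W w) *\<^sub>R V w \<partial>M) = tilt_cov M W y + \<rho>"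
    proof -
      have "tilt_cov M W y = (\<integral>w. (y \<bullet> W w) *\<^sub>R V w \<partial>M)"
        by (simp add: tilt_cov_def V_def m0_def)
      then show ?thesis using \<open>_ = \<rho>\<close> by (simp add: V0 algebra_simps)
    qed
    have "(\<integral>w. exp (y \<bullet> W w) *\<^sub>R V w \<partial>M) = (\<integral>w. exp (y \<bullet> W w) *\<^sub>R W w \<partial>M) - D y *\<^sub>R m0"
      unfolding V_def scaleR_diff_right using intEW intE by (simp add: D_def)
    then have "(\<integral>w. exp (y \<bullet> W w) *\<^sub>R W w \<partial>M) = D y *\<^sub>R m0 + (tilt_cov M W y + \<rho>)"
      unfolding num by (simp add: algebra_simps)
    then have "m y - m0 = (1 / D y) *\<^sub>R (tilt_cov M W y + \<rho>)"
      using Dpos[of y] by (simp add: m_def D_def[symmetric] scaleR_add_right)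
    \<comment> \<open>Dividing by \<open>D y\<close> instead of 1 contributes \<open>1 - D y\<close>
      times the covariance term, a product of two quantities of first order in
      \<open>y\<close>.\<close>
    then have "m y - m0 - tilt_cov M W y = (1 / D y) *\<^sub>R ((1 - D y) *\<^sub>R tilt_cov M W y + \<rho>)"
      using Dpos[of y] by (simp add: algebra_simps)
    then have "norm (m y - m0 - tilt_cov M W y) = (1 / D y) * norm ((1 - D y) *\<^sub>R tilt_cov M W y + \<rho>)"
      using Dpos[of y] by simp
    also have "\<dots> \<le> e * (2 * R ^ 3 * e * (norm y)\<^sup>2 + (2 * R ^ 3 * e) * (norm y)\<^sup>2)"
    proof (intro mult_mono order.trans[OF norm_triangle_ineq] add_mono rho)
      have "exp (- R) \<le> D y" using Dge[of y] yR by (meson exp_le_cancel_iff neg_le_iff_le order_trans)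
      then show "1 / D y \<le> e" using Dpos[of y] by (simp add: e_def exp_minus field_simps)
      have "D y - 1 = (\<integral>w. exp (y \<bullet> W w) - 1 \<partial>M)" using intE by (simp add: D_def prob_space)
      moreover have "norm (\<integral>w. exp (y \<bullet> W w) - 1 \<partial>M) \<le> norm y * R * e"
      proof (rule norm_integral_bound)
        fix w assume w1: "w \<in> space M"
        have "\<bar>y \<bullet> W w\<bar> * exp \<bar>y \<bullet> W w\<bar> \<le> (norm y * R) * e"
          using yW[OF w1, of y] eb[OF w1] R by (intro mult_mono) auto
        then show "norm (exp (y \<bullet> W w) - 1) \<le> norm y * R * e"
          using exp_minus_one_abs_le[of "y \<bullet> W w"] by simp
      qed simp
      ultimately have "\<bar>1 - D y\<bar> \<le> norm y * R * e" by simp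
      then have "\<bar>1 - D y\<bar> * norm (tilt_cov M W y) \<le> (norm y * R * e) * (2 * R\<^sup>2 * norm y)"
        using cov[of y] R e by (intro mult_mono) auto
      then show "norm ((1 - D y) *\<^sub>R tilt_cov M W y) \<le> 2 * R ^ 3 * e * (norm y)\<^sup>2"
        by (simp add: power2_eq_square power3_eq_cube mult_ac)
    qed (use e in auto)
    also have "\<dots> = 4 * R ^ 3 * exp R ^ 2 * (norm y)\<^sup>2" by (simp add: e_def power2_eq_square)
    also have "\<dots> \<le> C * (norm y)\<^sup>2" using R by (intro mult_right_mono) (auto simp: C_def)
    finally show ?thesis .
  qed
  show "norm (m y - m0 - tilt_cov M W y) \<le> C * (norm y)\<^sup>2" by (rule main)
  show "norm (m y - m0) \<le> (2 * R\<^sup>2 + C) * norm y"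
  proof (cases "norm y \<le> 1")
    case True
    have "norm (m y - m0) \<le> norm (tilt_cov M W y) + norm (m y - m0 - tilt_cov M W y)"
      using norm_triangle_ineq[of "tilt_cov M W y" "m y - m0 - tilt_cov M W y"] by simp
    also have "\<dots> \<le> 2 * R\<^sup>2 * norm y + C * (norm y)\<^sup>2" using cov main by (intro add_mono) auto
    also have "\<dots> \<le> 2 * R\<^sup>2 * norm y + C * norm y"
      using C True by (intro add_left_mono mult_left_mono) (auto simp: power2_eq_square mult_left_le)
    finally show ?thesis by (simp add: algebra_simps)
  next
    case False
    have "norm (m y - m0) \<le> 2 * R" using normm[of y] m0 norm_triangle_ineq4[of "m y" m0] by linarith
    also have "\<dots> \<le> (2 * R\<^sup>2 + C) * 1" using C by (simp add: add_increasing)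
    also have "\<dots> \<le> (2 * R\<^sup>2 + C) * norm y" using False C by (intro mult_left_mono) auto
    finally show ?thesis .
  qed
qed

section \<open>The Gaussian rotation path and its velocity\<close>

text \<open>The bound \<open>R\<close> serves only to make the velocity smooth. It enters the
  constants of the Euler scheme but not the cost in \<open>flow_coupling\<close>, so it may grow
  with the number of summands.\<close>

locale bounded_vector = prob_space M for M :: "'a measure" +
  fixes W :: "'a \<Rightarrow> 'v::euclidean_space" and R :: real
  assumes W_measurable [measurable]: "W \<in> borel_measurable M"
    and W_bound: "\<And>w. w \<in> space M \<Longrightarrow> norm (W w) \<le> R"
    and R_nonneg: "0 \<le> R"
begin

sublocale pair: pair_prob_space M "std_gauss :: 'v measure" ..

abbreviation MG :: "('a \<times> 'v) measure" where "MG \<equiv> M \<Otimes>\<^sub>M std_gauss"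

definition path :: "real \<Rightarrow> 'a \<times> 'v \<Rightarrow> 'v"
  where "path \<theta> x = cos \<theta> *\<^sub>R W (fst x) + sin \<theta> *\<^sub>R snd x"

definition path' :: "real \<Rightarrow> 'a \<times> 'v \<Rightarrow> 'v"
  where "path' \<theta> x = - (sin \<theta> *\<^sub>R W (fst x)) + cos \<theta> *\<^sub>R snd x"

text \<open>\<open>wgt \<theta> x\<close> is the unnormalised density of the law of \<open>W\<close> conditional on \<open>path \<theta> = x\<close>, so \<open>vel \<theta> x\<close>
  is the conditional expectation of \<open>path' \<theta>\<close>, and \<open>dvel \<theta> x\<close> is its derivative.\<close>

definition wgt :: "real \<Rightarrow> 'v \<Rightarrow> 'a \<Rightarrow> real"
  where "wgt \<theta> x w = exp (x \<bullet> ((cos \<theta> / (sin \<theta>)\<^sup>2) *\<^sub>R W w) - (cos \<theta> / sin \<theta>)\<^sup>2 * (W w \<bullet> W w) / 2)"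

definition den :: "real \<Rightarrow> 'v \<Rightarrow> real"
  where "den \<theta> x = (\<integral>w. wgt \<theta> x w \<partial>M)"

definition tmean :: "real \<Rightarrow> 'v \<Rightarrow> 'v"
  where "tmean \<theta> x = (1 / den \<theta> x) *\<^sub>R (\<integral>w. wgt \<theta> x w *\<^sub>R W w \<partial>M)"

definition vel :: "real \<Rightarrow> 'v \<Rightarrow> 'v"
  where "vel \<theta> x = (cos \<theta> / sin \<theta>) *\<^sub>R x - (1 / sin \<theta>) *\<^sub>R tmean \<theta> x"

definition tcov :: "real \<Rightarrow> 'v \<Rightarrow> 'v \<Rightarrow> 'v"
  where "tcov \<theta> x y = (\<integral>w. (wgt \<theta> x w / den \<theta> x) *\<^sub>R ((y \<bullet> W w) *\<^sub>R (W w - tmean \<theta> x)) \<partial>M)"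

definition dvel :: "real \<Rightarrow> 'v \<Rightarrow> 'v \<Rightarrow> 'v"
  where "dvel \<theta> x a = (cos \<theta> / sin \<theta>) *\<^sub>R a - (1 / sin \<theta>) *\<^sub>R tcov \<theta> x ((cos \<theta> / (sin \<theta>)\<^sup>2) *\<^sub>R a)"

lemma path_measurable [measurable]: "path \<theta> \<in> borel_measurable (M \<Otimes>\<^sub>M std_gauss)"
  unfolding path_def by measurable

lemma path'_measurable [measurable]: "path' \<theta> \<in> borel_measurable (M \<Otimes>\<^sub>M std_gauss)"
  unfolding path'_def by measurable

lemma wgt_measurable [measurable]: "(\<lambda>(x, w). wgt \<theta> x w) \<in> borel_measurable (borel \<Otimes>\<^sub>M M)"
  unfolding wgt_def by measurable

lemma wgt_measurable' [measurable]: "wgt \<theta> x \<in> borel_measurable M"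
  unfolding wgt_def by measurable

lemma den_measurable [measurable]: "den \<theta> \<in> borel_measurable borel"
  unfolding den_def wgt_def by measurable

lemma tmean_measurable [measurable]: "tmean \<theta> \<in> borel_measurable borel"
  unfolding tmean_def wgt_def by measurable

lemma vel_measurable [measurable]: "vel \<theta> \<in> borel_measurable borel"
  unfolding vel_def by measurable

lemma dvel_measurable:
  assumes [measurable]: "f \<in> borel_measurable borel"
  shows "(\<lambda>x. dvel \<theta> x (f x)) \<in> borel_measurable borel"
  unfolding dvel_def tcov_def wgt_def by measurable

lemma integrable_exp_bound:
  fixes f :: "'a \<times> 'v \<Rightarrow> 'w::{banach,second_countable_topology}"
  assumes [measurable]: "f \<in> borel_measurable (M \<Otimes>\<^sub>M std_gauss)"
    and b: "\<And>w z. w \<in> space M \<Longrightarrow> norm (f (w, z)) \<le> C * exp (k * norm z)"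
  shows "integrable MG f"
proof (rule Bochner_Integration.integrable_bound)
  show "integrable MG (\<lambda>x. C * exp (k * norm (snd x)))"
    by (rule pair.Fubini_integrable)
       (auto simp: integrable_exp_norm_std_gauss)
  show "AE x in MG. norm (f x) \<le> norm (C * exp (k * norm (snd x)))"
  proof (rule AE_I2)
    fix x assume "x \<in> space MG"
    then have "norm (f (fst x, snd x)) \<le> C * exp (k * norm (snd x))"
      by (intro b) (auto simp: space_pair_measure)
    then show "norm (f x) \<le> norm (C * exp (k * norm (snd x)))" by simp
  qed
qed simp

lemma wgt_pos: "0 < wgt \<theta> x w"
  by (simp add: wgt_def)

lemma wgt_le:
  assumes "w \<in> space M"
  shows "wgt \<theta> x w \<le> exp (\<bar>cos \<theta> / (sin \<theta>)\<^sup>2\<bar> * R * norm x)"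
proof -
  have "x \<bullet> ((cos \<theta> / (sin \<theta>)\<^sup>2) *\<^sub>R W w) \<le> norm x * (\<bar>cos \<theta> / (sin \<theta>)\<^sup>2\<bar> * norm (W w))"
    using norm_cauchy_schwarz[of x "(cos \<theta> / (sin \<theta>)\<^sup>2) *\<^sub>R W w"] by simp
  also have "\<dots> \<le> norm x * (\<bar>cos \<theta> / (sin \<theta>)\<^sup>2\<bar> * R)"
    using W_bound[OF assms] by (intro mult_left_mono) auto
  finally have "x \<bullet> ((cos \<theta> / (sin \<theta>)\<^sup>2) *\<^sub>R W w) \<le> \<bar>cos \<theta> / (sin \<theta>)\<^sup>2\<bar> * R * norm x" by (simp add: mult_ac)
  moreover have "0 \<le> (cos \<theta> / sin \<theta>)\<^sup>2 * (W w \<bullet> W w) / 2" by simp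
  ultimately show ?thesis unfolding wgt_def exp_le_cancel_iff by linarith
qed

lemma wgt_integrable: "integrable M (wgt \<theta> x)"
  by (rule norm_integral_bound(2)[where B = "exp (\<bar>cos \<theta> / (sin \<theta>)\<^sup>2\<bar> * R * norm x)"])
     (use wgt_le wgt_pos in \<open>auto simp: abs_of_pos\<close>)

lemma wgt_W_integrable: "integrable M (\<lambda>w. wgt \<theta> x w *\<^sub>R W w)"
  by (rule norm_integral_bound(2)[where B = "exp (\<bar>cos \<theta> / (sin \<theta>)\<^sup>2\<bar> * R * norm x) * R"])
     (use wgt_le wgt_pos W_bound in \<open>auto simp: abs_of_pos intro!: mult_mono\<close>)

lemma den_pos: "0 < den \<theta> x"
proof -
  have "den \<theta> x \<noteq> 0"
  proof
    assume "den \<theta> x = 0"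
    then have "AE w in M. wgt \<theta> x w = 0"
      unfolding den_def using wgt_integrable wgt_pos
      by (subst (asm) integral_nonneg_eq_0_iff_AE) (auto intro!: AE_I2 less_imp_le)
    then have "AE w in M. False" using wgt_pos by (auto elim!: eventually_mono simp: less_imp_neq[symmetric])
    then show False by simp
  qed
  moreover have "0 \<le> den \<theta> x" unfolding den_def by (intro integral_nonneg_AE AE_I2 less_imp_le wgt_pos)
  ultimately show ?thesis by simp
qed

text \<open>The conditional law given \<open>path \<theta> = x\<close>, realised on the original
  sample space, so that \<open>tilt_expansion\<close> can be applied at every base point
  \<open>x\<close>.\<close>

definition tiltM :: "real \<Rightarrow> 'v \<Rightarrow> 'a measure"
  where "tiltM \<theta> x = density M (\<lambda>w. ennreal (wgt \<theta> x w / den \<theta> x))"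

lemma prob_space_tiltM: "prob_space (tiltM \<theta> x)"
proof
  have "emeasure (tiltM \<theta> x) (space (tiltM \<theta> x)) = (\<integral>\<^sup>+w. ennreal (wgt \<theta> x w / den \<theta> x) \<partial>M)"
    by (simp add: tiltM_def emeasure_density)
  also have "\<dots> = ennreal (\<integral>w. wgt \<theta> x w / den \<theta> x \<partial>M)"
    using wgt_integrable den_pos[of \<theta> x] wgt_pos
    by (intro nn_integral_eq_integral) (auto intro!: AE_I2 divide_nonneg_pos less_imp_le[OF wgt_pos])
  also have "(\<integral>w. wgt \<theta> x w / den \<theta> x \<partial>M) = 1"
    using den_pos[of \<theta> x] by (simp add: den_def)
  finally show "emeasure (tiltM \<theta> x) (space (tiltM \<theta> x)) = 1" by simp
qed

lemma integral_tiltM: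
  fixes f :: "'a \<Rightarrow> 'w::{banach,second_countable_topology}"
  assumes "f \<in> borel_measurable M"
  shows "(\<integral>w. f w \<partial>tiltM \<theta> x) = (1 / den \<theta> x) *\<^sub>R (\<integral>w. wgt \<theta> x w *\<^sub>R f w \<partial>M)"
proof -
  have "(\<integral>w. f w \<partial>tiltM \<theta> x) = (\<integral>w. (wgt \<theta> x w / den \<theta> x) *\<^sub>R f w \<partial>M)"
    unfolding tiltM_def using assms den_pos[of \<theta> x] wgt_pos
    by (subst integral_density) (auto intro!: AE_I2 less_imp_le simp: divide_nonneg_pos)
  also have "\<dots> = (\<integral>w. (1 / den \<theta> x) *\<^sub>R (wgt \<theta> x w *\<^sub>R f w) \<partial>M)" by simp
  finally show ?thesis by (simp only: integral_scaleR_right)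
qed

text \<open>Moving the position from \<open>x\<close> to \<open>x + u\<close> multiplies
  \<open>wgt\<close> by \<open>exp (y \<bullet> W)\<close>: differentiating the conditional mean in
  the position is an exponential tilt of the conditional law.\<close>

lemma tilt_shift:
  fixes \<theta> :: real and x u :: 'v
  defines "y \<equiv> (cos \<theta> / (sin \<theta>)\<^sup>2) *\<^sub>R u"
  shows "tmean \<theta> (x + u) = (1 / (\<integral>w. exp (y \<bullet> W w) \<partial>tiltM \<theta> x)) *\<^sub>R (\<integral>w. exp (y \<bullet> W w) *\<^sub>R W w \<partial>tiltM \<theta> x)"
    and "tmean \<theta> x = integral\<^sup>L (tiltM \<theta> x) W"
    and "tcov \<theta> x y = tilt_cov (tiltM \<theta> x) W y"
proof -
  have w1: "wgt \<theta> (x + u) w = wgt \<theta> x w * exp (y \<bullet> W w)" for w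
    unfolding wgt_def exp_add[symmetric]
    by (simp add: y_def inner_add_left distrib_left add_divide_distrib)
  show "tmean \<theta> (x + u) = (1 / (\<integral>w. exp (y \<bullet> W w) \<partial>tiltM \<theta> x)) *\<^sub>R (\<integral>w. exp (y \<bullet> W w) *\<^sub>R W w \<partial>tiltM \<theta> x)"
    using den_pos[of \<theta> x] by (simp add: integral_tiltM tmean_def den_def[of \<theta> "x + u"] w1)
  show m: "tmean \<theta> x = integral\<^sup>L (tiltM \<theta> x) W"
    by (simp add: integral_tiltM tmean_def)
  have "tilt_cov (tiltM \<theta> x) W y = (1 / den \<theta> x) *\<^sub>R (\<integral>w. wgt \<theta> x w *\<^sub>R ((y \<bullet> W w) *\<^sub>R (W w - tmean \<theta> x)) \<partial>M)"
    unfolding tilt_cov_def m[symmetric] by (rule integral_tiltM) measurable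
  also have "\<dots> = tcov \<theta> x y"
    unfolding tcov_def integral_scaleR_right[symmetric] by simp
  finally show "tcov \<theta> x y = tilt_cov (tiltM \<theta> x) W y" ..
qed

text \<open>Both sides equal the covariance of \<open>a \<bullet> W\<close> and
  \<open>b \<bullet> W\<close> under the tilted law. This is the symmetry that
  \<open>quad_map\<close> demands of the derivative.\<close>

lemma tcov_symmetric: "a \<bullet> tcov \<theta> x b = tcov \<theta> x a \<bullet> b"
proof -
  interpret Q: prob_space "tiltM \<theta> x" by (rule prob_space_tiltM)
  let ?Q = "tiltM \<theta> x"
  have sp: "space ?Q = space M" "W \<in> borel_measurable ?Q" by (simp_all add: tiltM_def)
  note [measurable] = sp(2)
  define m where "m = integral\<^sup>L ?Q W"
  have cov: "tcov \<theta> x y = (\<integral>w. (y \<bullet> W w) *\<^sub>R (W w - m) \<partial>?Q)" for y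
  proof -
    have m: "tmean \<theta> x = m" using tilt_shift(2)[of \<theta> x] by (simp add: m_def)
    show ?thesis
      unfolding tcov_def m by (subst integral_tiltM) (simp_all add: integral_scaleR_right[symmetric] del: integral_scaleR_right)
  qed
  have Wb: "norm (W w) \<le> R" if "w \<in> space ?Q" for w using W_bound that sp by simp
  have inner: "\<bar>y \<bullet> W w\<bar> \<le> norm y * R" if "w \<in> space ?Q" for y w
    using Cauchy_Schwarz_ineq2[of y "W w"] mult_left_mono[OF Wb[OF that], of "norm y"] by simp
  have i1: "integrable ?Q (\<lambda>w. (y \<bullet> W w) *\<^sub>R (W w - m))" for y
  proof (rule Q.norm_integral_bound(2))
    fix w assume w1: "w \<in> space ?Q"
    have "norm (W w - m) \<le> R + norm m" using Wb[OF w1] norm_triangle_ineq4[of "W w" m] by linarith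
    then show "norm ((y \<bullet> W w) *\<^sub>R (W w - m)) \<le> (norm y * R) * (R + norm m)"
      using inner[OF w1, of y] R_nonneg by (simp, intro mult_mono) auto
  qed simp
  have i2: "integrable ?Q (\<lambda>w. (y \<bullet> W w) * (w1 \<bullet> W w))" for y w1
    by (rule Q.norm_integral_bound(2)[where B = "(norm y * R) * (norm w1 * R)"])
       (use inner R_nonneg in \<open>auto simp: abs_mult intro!: mult_mono\<close>)
  have iW: "integrable ?Q W" by (rule Q.norm_integral_bound(2)[OF _ Wb]) auto
  have form: "w1 \<bullet> tcov \<theta> x y = (\<integral>w. (y \<bullet> W w) * (w1 \<bullet> W w) \<partial>?Q) - (y \<bullet> m) * (w1 \<bullet> m)" for y w1
  proof -
    have "w1 \<bullet> tcov \<theta> x y = (\<integral>w. w1 \<bullet> ((y \<bullet> W w) *\<^sub>R (W w - m)) \<partial>?Q)"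
      unfolding cov by (rule integral_inner_right[symmetric]) (rule i1)
    also have "\<dots> = (\<integral>w. (y \<bullet> W w) * (w1 \<bullet> W w) - (w1 \<bullet> m) * (y \<bullet> W w) \<partial>?Q)"
      by (simp add: inner_diff_right algebra_simps)
    also have "\<dots> = (\<integral>w. (y \<bullet> W w) * (w1 \<bullet> W w) \<partial>?Q) - (w1 \<bullet> m) * (y \<bullet> m)"
      using i2 iW by (simp add: m_def)
    finally show ?thesis by simp
  qed
  show ?thesis using form[of a b] form[of b a] by (simp add: mult.commute inner_commute)
qed

text \<open>Uniformity in the angle is the point: \<open>tilt_expansion\<close> is applied to all
  tilted laws with the same \<open>R\<close>, and the trigonometric factors stay bounded away from
  angle 0.\<close>

lemma quad_map_vel:
  assumes th0: "0 < \<theta>0" "\<theta>0 \<le> pi / 2"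
  obtains L where "1 \<le> L" "\<And>\<theta>. \<theta>0 \<le> \<theta> \<Longrightarrow> \<theta> \<le> pi / 2 \<Longrightarrow> quad_map L (vel \<theta>) (dvel \<theta>)"
proof
  \<comment> \<open>\<open>K\<close> dominates \<open>cos \<theta> / sin \<theta>\<close>,
    \<open>1 / sin \<theta>\<close> and \<open>cos \<theta> / (sin \<theta>)^2\<close> for all
    admissible angles. The cube in \<open>L\<close> arises from one factor in front of the
    conditional mean and two from a quadratic remainder.\<close>
  define K where "K = 1 / (sin \<theta>0)\<^sup>2"
  define C where "C = 2 * R + 2 * R\<^sup>2 + 4 * R ^ 3 * exp R ^ 2"
  define L where "L = 1 + K ^ 3 * (1 + R + 2 * R\<^sup>2 + C)"
  have s0: "0 < sin \<theta>0" using th0 pi_gt_zero by (intro sin_gt_zero) auto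
  have K: "1 \<le> K" using s0 by (simp add: K_def field_simps power_le_one)
  then have K0: "0 \<le> K" by simp
  have KK: "K \<le> K ^ 3" "K * K \<le> K ^ 3" "1 \<le> K ^ 3"
    using K power_increasing[of 1 3 K] power_increasing[of 2 3 K] power_increasing[of 0 3 K]
    by (auto simp: power2_eq_square)
  have C: "0 \<le> C" using R_nonneg by (simp add: C_def)
  have Lbig: "K * (1 + R) \<le> L" "K + K * ((2 * R\<^sup>2 + C) * K) \<le> L" "K * (C * K\<^sup>2) \<le> L" "K + K * (2 * R\<^sup>2 * K) \<le> L"
  proof -
    have "K * (1 + R) \<le> K ^ 3 * (1 + R)" using KK R_nonneg by (intro mult_right_mono) auto
    moreover have "0 \<le> K ^ 3 * (2 * R\<^sup>2 + C)" using K0 C by (intro mult_nonneg_nonneg) auto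
    ultimately show "K * (1 + R) \<le> L" by (simp add: L_def algebra_simps)
    have 1: "(K * K) * (2 * R\<^sup>2 + C) \<le> K ^ 3 * (2 * R\<^sup>2 + C)" using KK C by (intro mult_right_mono) auto
    have 2: "0 \<le> K ^ 3 * R" using K0 R_nonneg by (intro mult_nonneg_nonneg) auto
    show "K + K * ((2 * R\<^sup>2 + C) * K) \<le> L" using 1 2 KK by (simp add: L_def algebra_simps)
    have 3: "0 \<le> K ^ 3 * (1 + R + 2 * R\<^sup>2)" using K0 R_nonneg by (intro mult_nonneg_nonneg) auto
    show "K * (C * K\<^sup>2) \<le> L" using 3 by (simp add: L_def algebra_simps power2_eq_square power3_eq_cube)
    have "0 \<le> K * K * C" using K0 C by (intro mult_nonneg_nonneg) auto
    then show "K + K * (2 * R\<^sup>2 * K) \<le> L" using 1 2 KK by (simp add: L_def algebra_simps)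
  qed
  have "0 \<le> K ^ 3 * (1 + R + 2 * R\<^sup>2 + C)"
    using K0 R_nonneg C by (intro mult_nonneg_nonneg add_nonneg_nonneg) auto
  then show "1 \<le> L" by (simp add: L_def)
  show "quad_map L (vel \<theta>) (dvel \<theta>)" if th: "\<theta>0 \<le> \<theta>" "\<theta> \<le> pi / 2" for \<theta>
  proof -
    define c s where "c = cos \<theta>" and "s = sin \<theta>"
    have s: "sin \<theta>0 \<le> s" unfolding s_def using th th0 pi_gt_zero by (intro sin_monotone_2pi_le) auto
    have c: "0 \<le> c" "c \<le> 1" unfolding c_def using th th0 by (auto intro: cos_ge_zero)
    have spos: "0 < s" "s \<le> 1" using s s0 by (auto simp: s_def)
    have sq: "(sin \<theta>0)\<^sup>2 \<le> s\<^sup>2" using s s0 by (intro power_mono) auto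
    have k2: "c / s\<^sup>2 \<le> K" "0 \<le> c / s\<^sup>2"
      unfolding K_def using c sq s0 spos by (auto intro!: frac_le)
    have "s\<^sup>2 \<le> s" using spos by (simp add: power2_eq_square mult_left_le)
    then have "(sin \<theta>0)\<^sup>2 \<le> s" using sq by linarith
    then have k1: "c / s \<le> K" "0 \<le> c / s" "1 / s \<le> K" "0 \<le> 1 / s"
      unfolding K_def using c s0 spos by (auto intro!: frac_le)
    define Q where "Q x = tiltM \<theta> x" for x
    have Q: "prob_space (Q x)" "W \<in> borel_measurable (Q x)" "space (Q x) = space M" for x
      unfolding Q_def using prob_space_tiltM by (auto simp: tiltM_def)
    have WQ: "norm (W w) \<le> R" if "w \<in> space (Q x)" for w x using W_bound that Q by simp
    define y where "y u = (c / s\<^sup>2) *\<^sub>R u" for u :: 'v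
    have ny: "norm (y u) \<le> K * norm u" for u
      unfolding y_def using mult_right_mono[OF k2(1), of "norm u"] c by simp
    define m where "m x y = (1 / (\<integral>w. exp (y \<bullet> W w) \<partial>Q x)) *\<^sub>R (\<integral>w. exp (y \<bullet> W w) *\<^sub>R W w \<partial>Q x)" for x y
    have te: "norm (tilt_cov (Q x) W y) \<le> 2 * R\<^sup>2 * norm y"
      "norm (m x y - integral\<^sup>L (Q x) W) \<le> (2 * R\<^sup>2 + C) * norm y"
      "norm (m x y - integral\<^sup>L (Q x) W - tilt_cov (Q x) W y) \<le> C * (norm y)\<^sup>2"
      "norm (m x y) \<le> R" for x y
      unfolding C_def m_def by (rule prob_space.tilt_expansion[OF Q(1,2) WQ R_nonneg], assumption)+
    have cov: "norm (tcov \<theta> x (y u)) \<le> 2 * R\<^sup>2 * (K * norm u)" for x u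
    proof -
      have "norm (tcov \<theta> x (y u)) \<le> 2 * R\<^sup>2 * norm (y u)"
        using te(1)[of x "y u"] tilt_shift(3)[of \<theta> x u] by (simp add: Q_def y_def c_def s_def)
      also have "\<dots> \<le> 2 * R\<^sup>2 * (K * norm u)" using ny by (intro mult_left_mono) auto
      finally show ?thesis .
    qed
    have lip: "norm (tmean \<theta> (x + u) - tmean \<theta> x) \<le> (2 * R\<^sup>2 + C) * (K * norm u)" for x u
    proof -
      have "norm (tmean \<theta> (x + u) - tmean \<theta> x) \<le> (2 * R\<^sup>2 + C) * norm (y u)"
        using te(2)[of x "y u"] tilt_shift(1)[of \<theta> x u] tilt_shift(2)[of \<theta> x] by (simp add: Q_def m_def y_def c_def s_def)
      also have "\<dots> \<le> (2 * R\<^sup>2 + C) * (K * norm u)" using ny C by (intro mult_left_mono) auto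
      finally show ?thesis .
    qed
    have quad: "norm (tmean \<theta> (x + u) - tmean \<theta> x - tcov \<theta> x (y u)) \<le> C * (K\<^sup>2 * (norm u)\<^sup>2)" for x u
    proof -
      have "norm (tmean \<theta> (x + u) - tmean \<theta> x - tcov \<theta> x (y u)) \<le> C * (norm (y u))\<^sup>2"
        using te(3)[of x "y u"] tilt_shift(1,3)[of \<theta> x u] tilt_shift(2)[of \<theta> x] by (simp add: Q_def m_def y_def c_def s_def)
      also have "\<dots> \<le> C * (K * norm u)\<^sup>2" using ny C by (intro mult_left_mono power_mono) auto
      finally show ?thesis by (simp add: power_mult_distrib)
    qed
    have tb: "norm (tmean \<theta> x) \<le> R" for x
      using te(4)[of x 0] tilt_shift(1)[of \<theta> x 0] by (simp add: Q_def m_def)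
    have V: "vel \<theta> x = (c / s) *\<^sub>R x - (1 / s) *\<^sub>R tmean \<theta> x" for x by (simp add: vel_def c_def s_def)
    have D: "dvel \<theta> x a = (c / s) *\<^sub>R a - (1 / s) *\<^sub>R tcov \<theta> x (y a)" for x a
      by (simp add: dvel_def y_def c_def s_def)
    have nrm: "norm ((c / s) *\<^sub>R a - (1 / s) *\<^sub>R b) \<le> K * norm a + K * norm b" for a b :: 'v
    proof -
      have "norm ((c / s) *\<^sub>R a - (1 / s) *\<^sub>R b) \<le> (c / s) * norm a + (1 / s) * norm b"
        using k1 c by (intro order.trans[OF norm_triangle_ineq4]) simp
      also have "\<dots> \<le> K * norm a + K * norm b" using k1 by (intro add_mono mult_right_mono) auto
      finally show ?thesis .
    qed
    show ?thesis
      unfolding quad_map_def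
    proof (intro conjI allI ballI)
      show "1 \<le> L" by fact
      show "(\<lambda>x. dvel \<theta> x (f x)) \<in> borel_measurable borel" if "f \<in> borel_measurable borel" for f
        by (rule dvel_measurable[OF that])
      show "a \<bullet> dvel \<theta> x b = dvel \<theta> x a \<bullet> b" for x a b
      proof -
        have "a \<bullet> tcov \<theta> x (y b) = tcov \<theta> x (y a) \<bullet> b"
        proof -
          have "a \<bullet> tcov \<theta> x (y b) = (c / s\<^sup>2) * (tcov \<theta> x a \<bullet> b)"
            using tcov_symmetric[of a \<theta> x "y b"] by (simp add: y_def)
          moreover have "tcov \<theta> x (y a) \<bullet> b = (c / s\<^sup>2) * (a \<bullet> tcov \<theta> x b)"
            using tcov_symmetric[of "y a" \<theta> x b] by (simp add: y_def)
          ultimately show ?thesis using tcov_symmetric[of a \<theta> x b] by simp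
        qed
        then show ?thesis by (simp add: D inner_diff_left inner_diff_right)
      qed
      show "norm (dvel \<theta> x a) \<le> L * norm a" for x a
      proof -
        have "norm (dvel \<theta> x a) \<le> K * norm a + K * (2 * R\<^sup>2 * (K * norm a))"
          unfolding D using K cov by (intro order.trans[OF nrm] add_left_mono mult_left_mono) auto
        also have "\<dots> = (K + K * (2 * R\<^sup>2 * K)) * norm a" by (simp add: algebra_simps)
        also have "\<dots> \<le> L * norm a" using Lbig by (intro mult_right_mono) auto
        finally show ?thesis .
      qed
      show "norm (vel \<theta> x) \<le> L * (1 + norm x)" for x
      proof -
        have "norm (vel \<theta> x) \<le> K * norm x + K * R"
          unfolding V using K tb by (intro order.trans[OF nrm] add_left_mono mult_left_mono) auto
        also have "\<dots> \<le> K * (1 + R) * (1 + norm x)" using K R_nonneg by (simp add: algebra_simps)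
        also have "\<dots> \<le> L * (1 + norm x)" using Lbig by (intro mult_right_mono) auto
        finally show ?thesis .
      qed
      show "norm (vel \<theta> (x + u) - vel \<theta> x) \<le> L * norm u" for x u
      proof -
        have "vel \<theta> (x + u) - vel \<theta> x = (c / s) *\<^sub>R u - (1 / s) *\<^sub>R (tmean \<theta> (x + u) - tmean \<theta> x)"
          by (simp add: V algebra_simps)
        then have "norm (vel \<theta> (x + u) - vel \<theta> x) \<le> K * norm u + K * ((2 * R\<^sup>2 + C) * (K * norm u))"
          using K lip by (simp only:) (intro order.trans[OF nrm] add_left_mono mult_left_mono, auto)
        also have "\<dots> = (K + K * ((2 * R\<^sup>2 + C) * K)) * norm u" by (simp add: algebra_simps)
        also have "\<dots> \<le> L * norm u" using Lbig by (intro mult_right_mono) auto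
        finally show ?thesis .
      qed
      show "norm (vel \<theta> (x + u) - vel \<theta> x - dvel \<theta> x u) \<le> L * (norm u)\<^sup>2" for x u
      proof -
        have "vel \<theta> (x + u) - vel \<theta> x - dvel \<theta> x u = (c / s) *\<^sub>R 0 - (1 / s) *\<^sub>R (tmean \<theta> (x + u) - tmean \<theta> x - tcov \<theta> x (y u))"
          by (simp add: V D algebra_simps)
        then have "norm (vel \<theta> (x + u) - vel \<theta> x - dvel \<theta> x u) \<le> K * norm (0::'v) + K * (C * (K\<^sup>2 * (norm u)\<^sup>2))"
          using K quad by (simp only:) (intro order.trans[OF nrm] add_left_mono mult_left_mono, auto)
        also have "\<dots> = K * (C * K\<^sup>2) * (norm u)\<^sup>2" by simp
        also have "\<dots> \<le> L * (norm u)\<^sup>2" using Lbig by (intro mult_right_mono) auto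
        finally show ?thesis .
      qed
    qed simp
  qed
qed

text \<open>For fixed \<open>w\<close> the Cameron-Martin formula with shift
  \<open>cot \<theta>\<close> times \<open>W w\<close> turns the path into
  \<open>sin \<theta> * z\<close>, with \<open>wgt\<close> as density. Exchanging the integrals then
  displays the conditional law given the position as a weighted integral over
  \<open>w\<close>.\<close>

lemma path_transport:
  fixes F :: "'a \<Rightarrow> 'v \<Rightarrow> 'w::{banach,second_countable_topology}"
  assumes F [measurable]: "(\<lambda>(w, x). F w x) \<in> borel_measurable (M \<Otimes>\<^sub>M borel)"
    and b: "\<And>w x. w \<in> space M \<Longrightarrow> norm (F w x) \<le> C * exp (k * norm x)" and k: "0 \<le> k" and C: "0 \<le> C"
    and s: "0 < sin \<theta>"
  shows "integrable MG (\<lambda>p. F (fst p) (path \<theta> p))"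
    and "(\<integral>p. F (fst p) (path \<theta> p) \<partial>MG)
      = (\<integral>z. (\<integral>w. wgt \<theta> (sin \<theta> *\<^sub>R z) w *\<^sub>R F w (sin \<theta> *\<^sub>R z) \<partial>M) \<partial>std_gauss)"
proof -
  let ?s = "sin \<theta>" and ?c = "cos \<theta>"
  have pb: "norm (path \<theta> (w, z)) \<le> R + norm z" if "w \<in> space M" for w z
  proof -
    have "norm (path \<theta> (w, z)) \<le> \<bar>?c\<bar> * norm (W w) + \<bar>?s\<bar> * norm z"
      unfolding path_def by (intro order.trans[OF norm_triangle_ineq]) simp
    also have "\<dots> \<le> 1 * R + 1 * norm z" using W_bound[OF that] by (intro add_mono mult_mono) auto
    finally show ?thesis by simp
  qed
  show i1: "integrable MG (\<lambda>p. F (fst p) (path \<theta> p))"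
  proof (rule integrable_exp_bound[where C = "C * exp (k * R)" and k = k])
    fix w and z :: 'v assume w1: "w \<in> space M"
    have "norm (F w (path \<theta> (w, z))) \<le> C * exp (k * norm (path \<theta> (w, z)))" by (rule b[OF w1])
    also have "\<dots> \<le> C * exp (k * (R + norm z))" using pb[OF w1] k C by (intro mult_left_mono) (auto intro: mult_left_mono)
    finally show "norm (F (fst (w, z)) (path \<theta> (w, z))) \<le> C * exp (k * R) * exp (k * norm z)"
      by (simp add: distrib_left exp_add mult_ac)
  qed measurable
  have i2: "integrable MG (\<lambda>(w, z). wgt \<theta> (?s *\<^sub>R z) w *\<^sub>R F w (?s *\<^sub>R z))"
  proof (rule integrable_exp_bound[where C = C and k = "\<bar>?c / ?s\<^sup>2\<bar> * R + k"])
    fix w and z :: 'v assume w1: "w \<in> space M"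
    have sz: "norm (?s *\<^sub>R z) \<le> norm z" by (simp add: mult_left_le_one_le)
    have "norm (wgt \<theta> (?s *\<^sub>R z) w *\<^sub>R F w (?s *\<^sub>R z)) \<le> exp (\<bar>?c / ?s\<^sup>2\<bar> * R * norm (?s *\<^sub>R z)) * (C * exp (k * norm (?s *\<^sub>R z)))"
      using wgt_le[OF w1, of \<theta> "?s *\<^sub>R z"] wgt_pos[of \<theta> "?s *\<^sub>R z" w] b[OF w1, of "?s *\<^sub>R z"] by (simp add: abs_of_pos mult_mono)
    also have "\<dots> \<le> exp (\<bar>?c / ?s\<^sup>2\<bar> * R * norm z) * (C * exp (k * norm z))"
      using sz C k R_nonneg
      by (intro mult_mono exp_le_cancel_iff[THEN iffD2] mult_left_mono mult_nonneg_nonneg) auto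
    finally show "norm (case (w, z) of (w, z) \<Rightarrow> wgt \<theta> (?s *\<^sub>R z) w *\<^sub>R F w (?s *\<^sub>R z))
        \<le> C * exp ((\<bar>?c / ?s\<^sup>2\<bar> * R + k) * norm z)"
      unfolding distrib_right exp_add by (simp only: prod.case mult_ac)
  qed measurable
  have "(\<integral>p. F (fst p) (path \<theta> p) \<partial>MG) = (\<integral>w. (\<integral>z. F w (path \<theta> (w, z)) \<partial>std_gauss) \<partial>M)"
    using pair.integral_fst'[OF i1] by simp
  also have "\<dots> = (\<integral>w. (\<integral>z. wgt \<theta> (?s *\<^sub>R z) w *\<^sub>R F w (?s *\<^sub>R z) \<partial>std_gauss) \<partial>M)"
  proof (rule Bochner_Integration.integral_cong[OF refl])
    fix w assume w1 [measurable]: "w \<in> space M"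
    define u where "u = (?c / ?s) *\<^sub>R W w"
    have "(\<integral>z. F w (path \<theta> (w, z)) \<partial>std_gauss) = (\<integral>z. F w (?s *\<^sub>R (z + u)) \<partial>std_gauss)"
      using s by (simp add: path_def u_def scaleR_add_right add.commute)
    also have "\<dots> = (\<integral>z. exp (z \<bullet> u - (u \<bullet> u) / 2) *\<^sub>R F w (?s *\<^sub>R z) \<partial>std_gauss)"
      by (rule integral_gauss_shift[of "\<lambda>z. F w (?s *\<^sub>R z)"]) measurable
    also have "(\<lambda>z. exp (z \<bullet> u - (u \<bullet> u) / 2)) = (\<lambda>z. wgt \<theta> (?s *\<^sub>R z) w)"
      using s by (auto simp: wgt_def u_def power2_eq_square fun_eq_iff)
    finally show "(\<integral>z. F w (path \<theta> (w, z)) \<partial>std_gauss) = (\<integral>z. wgt \<theta> (?s *\<^sub>R z) w *\<^sub>R F w (?s *\<^sub>R z) \<partial>std_gauss)" .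
  qed
  also have "\<dots> = (\<integral>z. (\<integral>w. wgt \<theta> (?s *\<^sub>R z) w *\<^sub>R F w (?s *\<^sub>R z) \<partial>M) \<partial>std_gauss)"
    using pair.Fubini_integral[OF i2] by simp
  finally show "(\<integral>p. F (fst p) (path \<theta> p) \<partial>MG)
      = (\<integral>z. (\<integral>w. wgt \<theta> (?s *\<^sub>R z) w *\<^sub>R F w (?s *\<^sub>R z) \<partial>M) \<partial>std_gauss)" .
qed

text \<open>The derivative of the path is a function of the position and of \<open>W\<close>, so
  conditioning on the position only averages \<open>W\<close>; this is where the formula for
  \<open>vel\<close> comes from.\<close>

lemma path'_eq:
  assumes "0 < sin \<theta>"
  shows "path' \<theta> p = (cos \<theta> / sin \<theta>) *\<^sub>R path \<theta> p - (1 / sin \<theta>) *\<^sub>R W (fst p)"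
proof -
  have "(cos \<theta> / sin \<theta>) * cos \<theta> - 1 / sin \<theta> = - sin \<theta>"
    using assms sin_cos_squared_add[of \<theta>] by (simp add: field_simps power2_eq_square)
  then have "((cos \<theta> / sin \<theta>) * cos \<theta>) *\<^sub>R W (fst p) - (1 / sin \<theta>) *\<^sub>R W (fst p) = - sin \<theta> *\<^sub>R W (fst p)"
    by (metis scaleR_left_diff_distrib)
  then show ?thesis using assms
    by (simp add: path_def path'_def scaleR_add_right algebra_simps)
qed

text \<open>The defining property of a conditional expectation. After \<open>path_transport\<close>
  both sides are integrals over the position, and the weighted integrals over \<open>w\<close> agree
  for every single position, by the choice of \<open>tmean\<close>.\<close>

lemma vel_identity:
  fixes g :: "'v \<Rightarrow> 'v"
  assumes [measurable]: "g \<in> borel_measurable borel" and g: "\<And>x. norm (g x) \<le> A * exp (k * norm x)"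
    and k: "0 \<le> k" and A: "0 \<le> A" and th: "0 < \<theta>" "\<theta> \<le> pi / 2"
  shows "(\<integral>p. g (path \<theta> p) \<bullet> path' \<theta> p \<partial>MG) = (\<integral>p. g (path \<theta> p) \<bullet> vel \<theta> (path \<theta> p) \<partial>MG)"
    and "integrable MG (\<lambda>p. g (path \<theta> p) \<bullet> path' \<theta> p)"
    and "integrable MG (\<lambda>p. g (path \<theta> p) \<bullet> vel \<theta> (path \<theta> p))"
proof -
  let ?s = "sin \<theta>" and ?c = "cos \<theta>"
  have s: "0 < ?s" using th pi_gt_zero by (intro sin_gt_zero) auto
  obtain L where L: "1 \<le> L" and qm: "quad_map L (vel \<theta>) (dvel \<theta>)" using quad_map_vel[OF th] th by blast
  have vb: "norm (vel \<theta> x) \<le> L * (1 + norm x)" for x using qm by (auto simp: quad_map_def)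
  have ex: "1 + norm x \<le> exp (norm x)" for x :: 'v by (rule exp_ge_add_one_self)
  define B where "B = ?c / ?s + R / ?s + L"
  have c: "0 \<le> ?c" using th by (intro cos_ge_zero) auto
  have B: "0 \<le> B" using s c R_nonneg L by (simp add: B_def)
  define F1 where "F1 w x = g x \<bullet> ((?c / ?s) *\<^sub>R x - (1 / ?s) *\<^sub>R W w)" for w x
  define F2 where "F2 w x = g x \<bullet> vel \<theta> x" for w :: 'a and x
  have F1: "(\<lambda>(w, x). F1 w x) \<in> borel_measurable (M \<Otimes>\<^sub>M borel)" unfolding F1_def by measurable
  have F2: "(\<lambda>(w, x). F2 w x) \<in> borel_measurable (M \<Otimes>\<^sub>M borel)" unfolding F2_def by measurable
  have bnd: "norm (g x \<bullet> w1) \<le> (A * B) * exp ((k + 1) * norm x)" if "norm w1 \<le> B * exp (norm x)" for w1 x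
  proof -
    have "norm (g x \<bullet> w1) \<le> norm (g x) * norm w1" using Cauchy_Schwarz_ineq2[of "g x" w1] by simp
    also have "\<dots> \<le> (A * exp (k * norm x)) * (B * exp (norm x))"
      using g that A by (intro mult_mono) auto
    also have "\<dots> = (A * B) * exp ((k + 1) * norm x)"
      unfolding distrib_right exp_add by simp
    finally show ?thesis .
  qed
  have b1: "norm (F1 w x) \<le> (A * B) * exp ((k + 1) * norm x)" if "w \<in> space M" for w x
    unfolding F1_def
  proof (rule bnd)
    have "norm ((?c / ?s) *\<^sub>R x - (1 / ?s) *\<^sub>R W w) \<le> ?c / ?s * norm x + 1 / ?s * norm (W w)"
      using s c by (intro order.trans[OF norm_triangle_ineq4]) simp
    also have "\<dots> \<le> ?c / ?s * norm x + 1 / ?s * R" using s W_bound[OF that] by (intro add_left_mono mult_left_mono) auto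
    also have "\<dots> \<le> B * (1 + norm x)"
    proof -
      define c1 r1 where "c1 = ?c / ?s" and "r1 = R / ?s"
      have "0 \<le> r1 * norm x" "0 \<le> c1" "0 \<le> L * (1 + norm x)"
        using s c R_nonneg L by (auto simp: c1_def r1_def)
      then have "c1 * norm x + r1 \<le> (c1 + r1 + L) * (1 + norm x)" by (simp add: algebra_simps)
      then show ?thesis by (simp add: B_def c1_def r1_def)
    qed
    also have "\<dots> \<le> B * exp (norm x)" using B ex by (intro mult_left_mono) auto
    finally show "norm ((?c / ?s) *\<^sub>R x - (1 / ?s) *\<^sub>R W w) \<le> B * exp (norm x)" .
  qed
  have b2: "norm (F2 w x) \<le> (A * B) * exp ((k + 1) * norm x)" for w x
    unfolding F2_def
  proof (rule bnd)
    have "norm (vel \<theta> x) \<le> L * (1 + norm x)" by (rule vb)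
    also have "\<dots> \<le> B * exp (norm x)" using s c R_nonneg L ex by (intro mult_mono) (auto simp: B_def)
    finally show "norm (vel \<theta> x) \<le> B * exp (norm x)" .
  qed
  have AB: "0 \<le> A * B" "0 \<le> k + 1" using A B k by auto
  note t1 = path_transport[OF F1 b1 AB(2,1) s]
  note t2 = path_transport[OF F2 b2 AB(2,1) s]
  have e1: "(\<lambda>p. F1 (fst p) (path \<theta> p)) = (\<lambda>p. g (path \<theta> p) \<bullet> path' \<theta> p)"
    by (simp add: F1_def path'_eq[OF s])
  have e2: "(\<lambda>p. F2 (fst p) (path \<theta> p)) = (\<lambda>p. g (path \<theta> p) \<bullet> vel \<theta> (path \<theta> p))"
    by (simp add: F2_def)
  show "integrable MG (\<lambda>p. g (path \<theta> p) \<bullet> path' \<theta> p)" using t1(1) by (simp add: e1)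
  show "integrable MG (\<lambda>p. g (path \<theta> p) \<bullet> vel \<theta> (path \<theta> p))" using t2(1) by (simp add: e2)
  have "(\<integral>w. wgt \<theta> x w *\<^sub>R F1 w x \<partial>M) = (\<integral>w. wgt \<theta> x w *\<^sub>R F2 w x \<partial>M)" for x
  proof -
    have "(\<integral>w. wgt \<theta> x w *\<^sub>R F1 w x \<partial>M) = (\<integral>w. g x \<bullet> (wgt \<theta> x w *\<^sub>R (?c / ?s) *\<^sub>R x - (1 / ?s) *\<^sub>R (wgt \<theta> x w *\<^sub>R W w)) \<partial>M)"
      by (simp add: F1_def algebra_simps inner_diff_right)
    also have "\<dots> = g x \<bullet> (\<integral>w. wgt \<theta> x w *\<^sub>R (?c / ?s) *\<^sub>R x - (1 / ?s) *\<^sub>R (wgt \<theta> x w *\<^sub>R W w) \<partial>M)"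
      by (intro integral_inner_right Bochner_Integration.integrable_diff integrable_scaleR_left
            integrable_scaleR_right wgt_integrable wgt_W_integrable)
    also have "(\<integral>w. wgt \<theta> x w *\<^sub>R (?c / ?s) *\<^sub>R x - (1 / ?s) *\<^sub>R (wgt \<theta> x w *\<^sub>R W w) \<partial>M)
       = den \<theta> x *\<^sub>R (?c / ?s) *\<^sub>R x - (1 / ?s) *\<^sub>R (\<integral>w. wgt \<theta> x w *\<^sub>R W w \<partial>M)"
      by (subst Bochner_Integration.integral_diff)
         (auto simp only: den_def integral_scaleR_right integral_scaleR_left wgt_integrable wgt_W_integrable
            intro!: integrable_scaleR_left integrable_scaleR_right)
    also have "\<dots> = den \<theta> x *\<^sub>R vel \<theta> x"
      using den_pos[of \<theta> x] by (simp add: vel_def tmean_def scaleR_diff_right)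
    also have "g x \<bullet> \<dots> = (\<integral>w. wgt \<theta> x w *\<^sub>R F2 w x \<partial>M)"
      by (simp add: F2_def den_def)
    finally show ?thesis .
  qed
  then show "(\<integral>p. g (path \<theta> p) \<bullet> path' \<theta> p \<partial>MG) = (\<integral>p. g (path \<theta> p) \<bullet> vel \<theta> (path \<theta> p) \<partial>MG)"
    using t1(2) t2(2) unfolding e1 e2 by presburger
qed

end

section \<open>Weak error of the Euler scheme\<close>

lemma taylor_two_bound:
  fixes f :: "real \<Rightarrow> real"
  assumes "\<And>t. (f has_real_derivative f' t) (at t)" "\<And>t. (f' has_real_derivative f'' t) (at t)"
    and "\<And>t. \<bar>f'' t\<bar> \<le> B" and h: "0 \<le> h"
  shows "\<bar>f (a + h) - f a - h * f' a\<bar> \<le> B * h\<^sup>2"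
proof (cases "h = 0")
  case False
  then have h: "0 < h" using h by simp
  let ?d = "\<lambda>(m::nat) t. if m = 0 then f (a + t) else if m = 1 then f' (a + t) else f'' (a + t)"
  have "\<exists>t. 0 < t \<and> t < h \<and> f (a + h) = (\<Sum>m<2. ?d m 0 / fact m * h ^ m) + ?d 2 t / fact 2 * h ^ 2"
  proof (rule Maclaurin[OF h, where diff = ?d])
    show "\<forall>m t. m < 2 \<and> 0 \<le> t \<and> t \<le> h \<longrightarrow> (?d m has_real_derivative ?d (Suc m) t) (at t)"
    proof (intro allI impI)
      fix m :: nat and t :: real assume "m < 2 \<and> 0 \<le> t \<and> t \<le> h"
      then consider "m = 0" | "m = 1" by linarith
      then show "(?d m has_real_derivative ?d (Suc m) t) (at t)"
        using DERIV_shift[of f "f' (a + t)" t a] DERIV_shift[of f' "f'' (a + t)" t a] assms(1,2)[of "a + t"]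
        by cases (auto simp: add.commute)
    qed
  qed auto
  then obtain t where "f (a + h) = f a + f' a * h + f'' (a + t) / 2 * h\<^sup>2" by (auto simp: numeral_2_eq_2)
  then have "\<bar>f (a + h) - f a - h * f' a\<bar> = \<bar>f'' (a + t)\<bar> / 2 * h\<^sup>2" by (simp add: abs_mult)
  also have "\<dots> \<le> B * h\<^sup>2"
  proof (rule mult_right_mono)
    show "\<bar>f'' (a + t)\<bar> / 2 \<le> B" using assms(3)[of "a + t"] abs_ge_zero[of "f'' (a + t)"] by linarith
  qed simp
  finally show ?thesis .
qed simp

lemma quad_test_growth:
  assumes t: "quad_test s A \<psi> g" and s: "0 \<le> s"
  shows "\<bar>\<psi> x\<bar> \<le> (\<bar>\<psi> 0\<bar> + 2 * A) * (1 + norm x) powr (s + 2)"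
proof -
  have A: "0 \<le> A" and gb: "norm (g 0) \<le> A * (1 + norm (0::'a)) powr s"
    and pq: "\<bar>\<psi> (0 + x) - \<psi> 0 - g 0 \<bullet> x\<bar> \<le> A * (norm x)\<^sup>2 * (1 + norm (0::'a) + norm x) powr s"
    using t unfolding quad_test_def by blast+
  define q where "q = 1 + norm x"
  have q: "1 \<le> q" "norm x \<le> q" by (auto simp: q_def)
  have qs: "1 \<le> q powr s" using q s by (simp add: ge_one_powr_ge_zero)
  have "\<bar>g 0 \<bullet> x\<bar> \<le> norm (g 0) * norm x" by (rule Cauchy_Schwarz_ineq2)
  also have "\<dots> \<le> A * q" using gb q A by (intro mult_mono) auto
  finally have 1: "\<bar>g 0 \<bullet> x\<bar> \<le> A * q" .
  have 2: "A * (norm x)\<^sup>2 * (1 + norm (0::'a) + norm x) powr s \<le> A * q\<^sup>2 * q powr s"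
    using A q by (intro mult_mono mult_left_mono power_mono) (auto simp: q_def)
  have q2: "q \<le> q\<^sup>2" "1 \<le> q\<^sup>2" using q mult_left_mono[of 1 q q] mult_mono[of 1 q 1 q] by (auto simp: power2_eq_square)
  have q3: "q \<le> q\<^sup>2 * q powr s" "1 \<le> q\<^sup>2 * q powr s"
    using q2 qs mult_mono[of q "q\<^sup>2" 1 "q powr s"] mult_mono[of 1 "q\<^sup>2" 1 "q powr s"] q by auto
  have "\<bar>\<psi> x\<bar> \<le> \<bar>\<psi> 0\<bar> + \<bar>g 0 \<bullet> x\<bar> + \<bar>\<psi> (0 + x) - \<psi> 0 - g 0 \<bullet> x\<bar>" by simp
  also have "\<dots> \<le> \<bar>\<psi> 0\<bar> * 1 + A * q + A * q\<^sup>2 * q powr s" using 1 pq 2 by simp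
  also have "\<dots> \<le> \<bar>\<psi> 0\<bar> * (q\<^sup>2 * q powr s) + A * (q\<^sup>2 * q powr s) + A * q\<^sup>2 * q powr s"
    using q3 A by (intro add_mono mult_left_mono) auto
  also have "\<dots> = (\<bar>\<psi> 0\<bar> + 2 * A) * q powr (s + 2)"
    using q by (simp add: powr_add powr_numeral algebra_simps)
  finally show ?thesis by (simp add: q_def)
qed

primrec euler :: "(nat \<Rightarrow> 'v \<Rightarrow> 'v) \<Rightarrow> real \<Rightarrow> nat \<Rightarrow> 'v::real_vector \<Rightarrow> 'v"
  where "euler v h 0 x = x"
  | "euler v h (Suc k) x = euler v h k x + h *\<^sub>R v k (euler v h k x)"

lemma euler_measurable:
  fixes v :: "nat \<Rightarrow> 'v::euclidean_space \<Rightarrow> 'v"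
  assumes "\<And>j. j < k \<Longrightarrow> v j \<in> borel_measurable borel"
  shows "euler v h k \<in> borel_measurable borel"
  using assms
proof (induction k)
  case (Suc k)
  have [measurable]: "euler v h k \<in> borel_measurable borel" "v k \<in> borel_measurable borel"
    using Suc by auto
  show ?case by simp
next
  case 0
  have "euler v h 0 = (\<lambda>x. x)" by (simp add: fun_eq_iff)
  then show ?case by simp
qed

lemma euler_sum: "euler v h k x = x + (\<Sum>j<k. h *\<^sub>R v j (euler v h j x))"
  by (induction k) (auto simp: add.assoc)

lemma euler_growth:
  fixes v :: "nat \<Rightarrow> 'v::euclidean_space \<Rightarrow> 'v"
  assumes "\<And>j x. j < k \<Longrightarrow> norm (v j x) \<le> L * (1 + norm x)" and h: "0 \<le> h" and L: "0 \<le> L"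
  shows "1 + norm (euler v h k x) \<le> (1 + h * L) ^ k * (1 + norm x)"
  using assms(1)
proof (induction k)
  case (Suc k)
  let ?e = "euler v h k x"
  have "1 + norm (euler v h (Suc k) x) \<le> 1 + (norm ?e + h * norm (v k ?e))"
    using h by (simp, intro order.trans[OF norm_triangle_ineq]) simp
  also have "\<dots> \<le> 1 + (norm ?e + h * (L * (1 + norm ?e)))"
    using Suc.prems h by (intro add_left_mono mult_left_mono) auto
  also have "\<dots> = (1 + h * L) * (1 + norm ?e)" by (simp add: algebra_simps)
  also have "\<dots> \<le> (1 + h * L) * ((1 + h * L) ^ k * (1 + norm x))"
    using Suc h L by (intro mult_left_mono) auto
  finally show ?case by (simp add: mult_ac)
qed simp

context bounded_vector
begin

lemma norm_path_le: "w \<in> space M \<Longrightarrow> norm (path \<theta> (w, z)) \<le> R + norm z"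
  and norm_path'_le: "w \<in> space M \<Longrightarrow> norm (path' \<theta> (w, z)) \<le> R + norm z"
proof -
  assume w1: "w \<in> space M"
  have *: "norm (a *\<^sub>R W w + b *\<^sub>R z) \<le> R + norm z" if "\<bar>a\<bar> \<le> 1" "\<bar>b\<bar> \<le> 1" for a b
  proof -
    have "norm (a *\<^sub>R W w + b *\<^sub>R z) \<le> \<bar>a\<bar> * norm (W w) + \<bar>b\<bar> * norm z"
      by (intro order.trans[OF norm_triangle_ineq]) simp
    also have "\<dots> \<le> 1 * R + 1 * norm z" using that W_bound[OF w1] by (intro add_mono mult_mono) auto
    finally show ?thesis by simp
  qed
  show "norm (path \<theta> (w, z)) \<le> R + norm z" using *[of "cos \<theta>" "sin \<theta>"] by (simp add: path_def)
  show "norm (path' \<theta> (w, z)) \<le> R + norm z" using *[of "- sin \<theta>" "cos \<theta>"] by (simp add: path'_def)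
qed

lemma path_taylor:
  fixes h :: real
  assumes w1: "w \<in> space M" and h: "0 \<le> h"
  shows "norm (path (\<theta> + h) (w, z) - path \<theta> (w, z) - h *\<^sub>R path' \<theta> (w, z)) \<le> h\<^sup>2 * (R + norm z)"
proof -
  have c: "\<bar>cos (\<theta> + h) - cos \<theta> - h * - sin \<theta>\<bar> \<le> 1 * h\<^sup>2"
    by (rule taylor_two_bound[where f'' = "\<lambda>t. - cos t"]) (use h in \<open>auto intro!: derivative_eq_intros\<close>)
  have s: "\<bar>sin (\<theta> + h) - sin \<theta> - h * cos \<theta>\<bar> \<le> 1 * h\<^sup>2"
    by (rule taylor_two_bound[where f'' = "\<lambda>t. - sin t"]) (use h in \<open>auto intro!: derivative_eq_intros\<close>)
  have "path (\<theta> + h) (w, z) - path \<theta> (w, z) - h *\<^sub>R path' \<theta> (w, z)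
     = (cos (\<theta> + h) - cos \<theta> - h * - sin \<theta>) *\<^sub>R W w + (sin (\<theta> + h) - sin \<theta> - h * cos \<theta>) *\<^sub>R z"
    by (simp add: path_def path'_def algebra_simps)
  also have "norm \<dots> \<le> \<bar>cos (\<theta> + h) - cos \<theta> - h * - sin \<theta>\<bar> * norm (W w) + \<bar>sin (\<theta> + h) - sin \<theta> - h * cos \<theta>\<bar> * norm z"
    by (intro order.trans[OF norm_triangle_ineq]) simp
  also have "\<dots> \<le> (1 * h\<^sup>2) * R + (1 * h\<^sup>2) * norm z"
    using c s W_bound[OF w1] by (intro add_mono mult_mono) auto
  finally show ?thesis by (simp add: algebra_simps)
qed

lemma integrable_poly_bound:
  fixes f :: "'a \<times> 'v \<Rightarrow> 'w::{banach,second_countable_topology}"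
  assumes "f \<in> borel_measurable (M \<Otimes>\<^sub>M std_gauss)" and r: "0 \<le> r"
    and b: "\<And>w z. w \<in> space M \<Longrightarrow> norm (f (w, z)) \<le> C * (1 + R + norm z) powr r"
  shows "integrable MG f"
proof (rule integrable_exp_bound[OF assms(1), where C = "\<bar>C\<bar> * exp (r * R)" and k = r])
  fix w and z :: 'v assume w1: "w \<in> space M"
  have "norm (f (w, z)) \<le> C * (1 + R + norm z) powr r" by (rule b[OF w1])
  also have "\<dots> \<le> \<bar>C\<bar> * (1 + (R + norm z)) powr r" by (simp add: add.assoc mult_right_mono)
  also have "\<dots> \<le> \<bar>C\<bar> * exp (r * (R + norm z))"
    using R_nonneg r by (intro mult_left_mono one_plus_powr_le_exp) auto
  finally show "norm (f (w, z)) \<le> \<bar>C\<bar> * exp (r * R) * exp (r * norm z)"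
    by (simp add: distrib_left exp_add mult_ac)
qed

lemma integrable_quad_test_comp:
  assumes t: "quad_test s A \<psi> g" and s: "0 \<le> s" and [measurable]: "X \<in> borel_measurable (M \<Otimes>\<^sub>M std_gauss)"
    and X: "\<And>w z. w \<in> space M \<Longrightarrow> 1 + norm (X (w, z)) \<le> D * (1 + R + norm z)" and D: "0 \<le> D"
  shows "integrable MG (\<lambda>p. \<psi> (X p))"
proof (rule integrable_poly_bound)
  have [measurable]: "\<psi> \<in> borel_measurable borel" and A: "0 \<le> A" using t by (auto simp: quad_test_def)
  show "(\<lambda>p. \<psi> (X p)) \<in> borel_measurable (M \<Otimes>\<^sub>M std_gauss)" by simp
  show "0 \<le> s + 2" using s by simp
  fix w and z :: 'v assume w1: "w \<in> space M"
  have "norm (\<psi> (X (w, z))) \<le> (\<bar>\<psi> 0\<bar> + 2 * A) * (1 + norm (X (w, z))) powr (s + 2)"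
    using quad_test_growth[OF t s] by simp
  also have "\<dots> \<le> (\<bar>\<psi> 0\<bar> + 2 * A) * (D * (1 + R + norm z)) powr (s + 2)"
    using A s X[OF w1] by (intro mult_left_mono powr_mono2) auto
  also have "\<dots> = ((\<bar>\<psi> 0\<bar> + 2 * A) * D powr (s + 2)) * (1 + R + norm z) powr (s + 2)"
    using D R_nonneg by (simp add: powr_mult)
  finally show "norm (\<psi> (X (w, z))) \<le> ((\<bar>\<psi> 0\<bar> + 2 * A) * D powr (s + 2)) * (1 + R + norm z) powr (s + 2)" .
qed

lemma one_plus_path_le: "w \<in> space M \<Longrightarrow> 1 + norm (path \<theta> (w, z)) \<le> 1 * (1 + R + norm z)"
  using norm_path_le by (simp add: add.assoc)

text \<open>Both expectations are expanded around the exact position \<open>path \<theta>\<close>.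
  The first-order terms pair \<open>g\<close> with \<open>path'\<close> and with \<open>vel\<close>
  and have the same integral by \<open>vel_identity\<close>, so the difference is quadratic in
  \<open>h\<close>. The constant \<open>B\<close> is independent of the angle and of the test
  function, whose size enters through \<open>A\<close> alone.\<close>

lemma one_step:
  fixes \<theta>0 L s :: real
  assumes qm: "\<And>\<theta>. \<theta>0 \<le> \<theta> \<Longrightarrow> \<theta> \<le> pi / 2 \<Longrightarrow> quad_map L (vel \<theta>) (dvel \<theta>)" and th0: "0 < \<theta>0" and s: "0 \<le> s"
  obtains B where "0 \<le> B"
    "\<And>(\<theta>::real) (h::real) \<psi> g A. \<lbrakk>\<theta>0 \<le> \<theta>; \<theta> \<le> pi / 2; 0 \<le> h; h \<le> 2; quad_test s A \<psi> g\<rbrakk> \<Longrightarrow>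
      \<bar>(\<integral>p. \<psi> (path (\<theta> + h) p) \<partial>MG) - (\<integral>p. \<psi> (path \<theta> p + h *\<^sub>R vel \<theta> (path \<theta> p)) \<partial>MG)\<bar> \<le> A * B * h\<^sup>2"
proof
  \<comment> \<open>Three terms of order \<open>h^2\<close>: the remainder of \<open>\<psi>\<close>
    along the path, whose displacement is at most \<open>3 * h * q\<close> (hence 9 and, with
    \<open>h \<le> 2\<close>, 7); the Taylor remainder of the path itself; and the remainder of
    \<open>\<psi>\<close> along the Euler step.\<close>
  define B0 where "B0 = 9 * 7 powr s + 1 + L\<^sup>2 * (1 + 2 * L) powr s"
  define B where "B = B0 * (\<integral>p. (1 + R + norm (snd p)) powr (s + 2) \<partial>MG)"
  have B0: "0 \<le> B0" by (simp add: B0_def)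
  have intq: "integrable MG (\<lambda>p. (1 + R + norm (snd p)) powr (s + 2))"
    by (rule integrable_poly_bound[where C = 1 and r = "s + 2"]) (use s in auto)
  show "0 \<le> B" using B0 by (simp add: B_def)
  fix \<theta> h A :: real and \<psi> :: "'v \<Rightarrow> real" and g :: "'v \<Rightarrow> 'v" assume th: "\<theta>0 \<le> \<theta>" "\<theta> \<le> pi / 2" and h: "0 \<le> h" "h \<le> 2" and t: "quad_test s A \<psi> g"
  have L: "1 \<le> L" and [measurable]: "vel \<theta> \<in> borel_measurable borel"
    and vb: "\<And>x. norm (vel \<theta> x) \<le> L * (1 + norm x)"
    using qm[OF th] unfolding quad_map_def by auto
  have A: "0 \<le> A" and [measurable]: "\<psi> \<in> borel_measurable borel" "g \<in> borel_measurable borel"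
    and gb: "\<And>x. norm (g x) \<le> A * (1 + norm x) powr s"
    and pq: "\<And>x u. \<bar>\<psi> (x + u) - \<psi> x - g x \<bullet> u\<bar> \<le> A * (norm u)\<^sup>2 * (1 + norm x + norm u) powr s"
    using t unfolding quad_test_def by auto
  define D where "D p = \<psi> (path (\<theta> + h) p) - \<psi> (path \<theta> p + h *\<^sub>R vel \<theta> (path \<theta> p))
     - h * (g (path \<theta> p) \<bullet> path' \<theta> p - g (path \<theta> p) \<bullet> vel \<theta> (path \<theta> p))" for p
  have Dle: "\<bar>D (w, z)\<bar> \<le> A * h\<^sup>2 * B0 * (1 + R + norm z) powr (s + 2)" if w1: "w \<in> space M" for w z
  proof -
    define q where "q = 1 + R + norm z"
    have q: "1 \<le> q" "R + norm z \<le> q" using R_nonneg by (auto simp: q_def)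
    define x where "x = path \<theta> (w, z)"
    define d where "d = path (\<theta> + h) (w, z) - x"
    define v where "v = vel \<theta> x"
    have x: "1 + norm x \<le> q" using one_plus_path_le[OF w1, of \<theta> z] by (simp add: x_def q_def)
    have e: "norm (d - h *\<^sub>R path' \<theta> (w, z)) \<le> h\<^sup>2 * q"
      using path_taylor[OF w1 h(1), of \<theta> z] mult_left_mono[OF q(2), of "h\<^sup>2"] by (simp add: d_def x_def)
    have "norm d \<le> norm (h *\<^sub>R path' \<theta> (w, z)) + norm (d - h *\<^sub>R path' \<theta> (w, z))"
      by (metis norm_triangle_sub)
    also have "\<dots> \<le> h * q + h\<^sup>2 * q"
      using e norm_path'_le[OF w1, of \<theta> z] q h by (intro add_mono) (auto intro!: mult_left_mono)
    also have "\<dots> \<le> h * q + h * 2 * q" using h q by (intro add_left_mono mult_right_mono) (auto simp: power2_eq_square mult_left_mono)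
    finally have d: "norm d \<le> 3 * h * q" by simp
    have v: "norm v \<le> L * q" using order_trans[OF vb[of x] mult_left_mono[OF x, of L]] L by (simp add: v_def)
    have e1: "\<bar>\<psi> (x + d) - \<psi> x - g x \<bullet> d\<bar> \<le> A * h\<^sup>2 * (9 * 7 powr s) * (q\<^sup>2 * q powr s)"
    proof -
      have hq: "h * q \<le> 2 * q" using h q by (intro mult_right_mono) auto
      have d7: "1 + norm x + norm d \<le> 7 * q" using d x hq mult.assoc[of 3 h q] by linarith
      have "\<bar>\<psi> (x + d) - \<psi> x - g x \<bullet> d\<bar> \<le> A * (norm d)\<^sup>2 * (1 + norm x + norm d) powr s" by (rule pq)
      also have "\<dots> \<le> A * (3 * h * q)\<^sup>2 * (7 * q) powr s"
        using A d d7 s q h by (intro mult_mono mult_left_mono power_mono powr_mono2) auto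
      finally show ?thesis using q by (simp add: powr_mult power_mult_distrib mult_ac)
    qed
    have e2: "\<bar>g x \<bullet> (d - h *\<^sub>R path' \<theta> (w, z))\<bar> \<le> A * h\<^sup>2 * 1 * (q\<^sup>2 * q powr s)"
    proof -
      have "\<bar>g x \<bullet> (d - h *\<^sub>R path' \<theta> (w, z))\<bar> \<le> norm (g x) * norm (d - h *\<^sub>R path' \<theta> (w, z))"
        by (rule Cauchy_Schwarz_ineq2)
      also have "\<dots> \<le> (A * q powr s) * (h\<^sup>2 * q)"
        using e gb[of x] x s A by (intro mult_mono order.trans[OF gb] mult_left_mono powr_mono2) auto
      also have "\<dots> \<le> (A * q powr s) * (h\<^sup>2 * q\<^sup>2)"
        using A q mult_left_mono[OF q(1), of q] by (intro mult_left_mono) (auto simp: power2_eq_square)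
      finally show ?thesis by (simp add: mult_ac)
    qed
    have e3: "\<bar>\<psi> (x + h *\<^sub>R v) - \<psi> x - g x \<bullet> (h *\<^sub>R v)\<bar> \<le> A * h\<^sup>2 * (L\<^sup>2 * (1 + 2 * L) powr s) * (q\<^sup>2 * q powr s)"
    proof -
      have hv: "norm (h *\<^sub>R v) \<le> h * (L * q)" using h v by (simp add: mult_left_mono)
      have hv2: "h * (L * q) \<le> 2 * (L * q)" using h L q by (intro mult_right_mono) auto
      have "\<bar>\<psi> (x + h *\<^sub>R v) - \<psi> x - g x \<bullet> (h *\<^sub>R v)\<bar> \<le> A * (norm (h *\<^sub>R v))\<^sup>2 * (1 + norm x + norm (h *\<^sub>R v)) powr s" by (rule pq)
      also have "\<dots> \<le> A * (h * (L * q))\<^sup>2 * ((1 + 2 * L) * q) powr s"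
      proof (intro mult_mono mult_left_mono power_mono powr_mono2)
        have "1 + norm x + norm (h *\<^sub>R v) \<le> q + 2 * (L * q)" using x hv hv2 by linarith
        then show "1 + norm x + norm (h *\<^sub>R v) \<le> (1 + 2 * L) * q" by (simp add: algebra_simps)
      qed (use A hv s L q in auto)
      finally show ?thesis using q L by (simp add: powr_mult power_mult_distrib mult_ac)
    qed
    have "D (w, z) = (\<psi> (x + d) - \<psi> x - g x \<bullet> d) + g x \<bullet> (d - h *\<^sub>R path' \<theta> (w, z)) - (\<psi> (x + h *\<^sub>R v) - \<psi> x - g x \<bullet> (h *\<^sub>R v))"
      by (simp add: D_def d_def v_def x_def[symmetric] inner_diff_right algebra_simps)
    then have "\<bar>D (w, z)\<bar> \<le> A * h\<^sup>2 * (9 * 7 powr s) * (q\<^sup>2 * q powr s) + A * h\<^sup>2 * 1 * (q\<^sup>2 * q powr s)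
        + A * h\<^sup>2 * (L\<^sup>2 * (1 + 2 * L) powr s) * (q\<^sup>2 * q powr s)" using e1 e2 e3 by linarith
    also have "\<dots> = A * h\<^sup>2 * B0 * (q\<^sup>2 * q powr s)" by (simp add: B0_def algebra_simps)
    also have "q\<^sup>2 * q powr s = q powr (s + 2)" using q by (simp add: powr_add powr_numeral)
    finally show ?thesis by (simp add: q_def)
  qed
  have i1: "integrable MG (\<lambda>p. \<psi> (path (\<theta> + h) p))"
    by (rule integrable_quad_test_comp[OF t s _ one_plus_path_le]) auto
  have i2: "integrable MG (\<lambda>p. \<psi> (path \<theta> p + h *\<^sub>R vel \<theta> (path \<theta> p)))"
  proof (rule integrable_quad_test_comp[OF t s])
    fix w and z :: 'v assume w1: "w \<in> space M"
    let ?x = "path \<theta> (w, z)"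
    have "1 + norm (?x + h *\<^sub>R vel \<theta> ?x) \<le> 1 + (norm ?x + h * norm (vel \<theta> ?x))"
      using h by (intro add_left_mono order.trans[OF norm_triangle_ineq]) simp
    also have "\<dots> \<le> 1 + (norm ?x + 2 * (L * (1 + norm ?x)))"
      using h L vb by (intro add_left_mono mult_mono) auto
    also have "\<dots> = (1 + 2 * L) * (1 + norm ?x)" by (simp add: algebra_simps)
    also have "\<dots> \<le> (1 + 2 * L) * (1 + R + norm z)"
      using one_plus_path_le[OF w1, of \<theta> z] L by (intro mult_left_mono) auto
    finally show "1 + norm (?x + h *\<^sub>R vel \<theta> ?x) \<le> (1 + 2 * L) * (1 + R + norm z)" .
  qed (use L in auto)
  have gexp: "norm (g x) \<le> A * exp (s * norm x)" for x
    using gb[of x] mult_left_mono[OF one_plus_powr_le_exp[of "norm x" s], of A] A s by simp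
  have "0 < \<theta>" using th th0 by simp
  note vi = vel_identity[OF _ gexp s A this th(2)]
  have "(\<integral>p. D p \<partial>MG) = (\<integral>p. \<psi> (path (\<theta> + h) p) \<partial>MG) - (\<integral>p. \<psi> (path \<theta> p + h *\<^sub>R vel \<theta> (path \<theta> p)) \<partial>MG)"
    unfolding D_def using i1 i2 vi by simp
  moreover have "\<bar>\<integral>p. D p \<partial>MG\<bar> \<le> A * B * h\<^sup>2"
  proof -
    have "\<bar>\<integral>p. D p \<partial>MG\<bar> \<le> (\<integral>p. \<bar>D p\<bar> \<partial>MG)" by (rule integral_abs_bound)
    also have "\<dots> \<le> (\<integral>p. A * h\<^sup>2 * B0 * (1 + R + norm (snd p)) powr (s + 2) \<partial>MG)"
    proof (rule integral_mono_AE)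
      show "integrable MG (\<lambda>p. \<bar>D p\<bar>)" unfolding D_def using i1 i2 vi by (intro integrable_abs) simp
      show "AE p in MG. \<bar>D p\<bar> \<le> A * h\<^sup>2 * B0 * (1 + R + norm (snd p)) powr (s + 2)"
        by (rule AE_I2) (use Dle in \<open>auto simp: space_pair_measure\<close>)
    qed (use intq in auto)
    also have "\<dots> = A * B * h\<^sup>2" by (simp add: B_def)
    finally show ?thesis .
  qed
  ultimately show "\<bar>(\<integral>p. \<psi> (path (\<theta> + h) p) \<partial>MG) - (\<integral>p. \<psi> (path \<theta> p + h *\<^sub>R vel \<theta> (path \<theta> p)) \<partial>MG)\<bar> \<le> A * B * h\<^sup>2"
    by simp
qed

text \<open>Induction from the end: the last Euler step is absorbed into the test function by
  \<open>quad_test_comp\<close>, at the price of one exponential factor, and \<open>one_step\<close>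
  compares this step with the exact path. For this reason the test function has to be arbitrary in
  the induction.\<close>

lemma euler_weak_error:
  fixes \<theta>0 L s h B :: real and k :: nat
  assumes qm: "\<And>\<theta>. \<theta>0 \<le> \<theta> \<Longrightarrow> \<theta> \<le> pi / 2 \<Longrightarrow> quad_map L (vel \<theta>) (dvel \<theta>)" and th0: "0 < \<theta>0" and s: "0 \<le> s"
    and B: "0 \<le> B"
    and step: "\<And>(\<theta>::real) (h::real) \<psi> g A. \<lbrakk>\<theta>0 \<le> \<theta>; \<theta> \<le> pi / 2; 0 \<le> h; h \<le> 2; quad_test s A \<psi> g\<rbrakk> \<Longrightarrow>
      \<bar>(\<integral>p. \<psi> (path (\<theta> + h) p) \<partial>MG) - (\<integral>p. \<psi> (path \<theta> p + h *\<^sub>R vel \<theta> (path \<theta> p)) \<partial>MG)\<bar> \<le> A * B * h\<^sup>2"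
    and h: "0 \<le> h" "h \<le> 2" and k: "\<theta>0 + k * h \<le> pi / 2" and t: "quad_test s A \<psi> g"
  shows "\<bar>(\<integral>p. \<psi> (euler (\<lambda>j. vel (\<theta>0 + j * h)) h k (path \<theta>0 p)) \<partial>MG) - (\<integral>p. \<psi> (path (\<theta>0 + k * h) p) \<partial>MG)\<bar>
     \<le> A * B * (k * h\<^sup>2) * exp (h * (L * (s + 3)) * k)"
  using k t
proof (induction k arbitrary: A \<psi> g)
  case (Suc k)
  let ?\<theta> = "\<theta>0 + k * h"
  define K where "K = h * (L * (s + 3))"
  have th: "\<theta>0 \<le> ?\<theta>" "?\<theta> \<le> pi / 2" using Suc.prems h by (auto simp: algebra_simps)
  have L: "1 \<le> L" using qm[OF th] by (auto simp: quad_map_def)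
  have A: "0 \<le> A" using Suc.prems by (simp add: quad_test_def)
  have K: "0 \<le> K" using h L s by (simp add: K_def)
  have qt: "quad_test s (A * exp K) (\<lambda>x. \<psi> (x + h *\<^sub>R vel ?\<theta> x))
           (\<lambda>x. g (x + h *\<^sub>R vel ?\<theta> x) + h *\<^sub>R dvel ?\<theta> x (g (x + h *\<^sub>R vel ?\<theta> x)))"
    unfolding K_def by (rule quad_test_comp[OF qm[OF th] Suc.prems(2) h(1) s])
  have "\<bar>(\<integral>p. \<psi> (euler (\<lambda>j. vel (\<theta>0 + j * h)) h (Suc k) (path \<theta>0 p)) \<partial>MG) - (\<integral>p. \<psi> (path ?\<theta> p + h *\<^sub>R vel ?\<theta> (path ?\<theta> p)) \<partial>MG)\<bar>
     \<le> A * exp K * B * (k * h\<^sup>2) * exp (K * k)"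
    using Suc.IH[OF th(2) qt] by (simp add: K_def)
  moreover have "\<bar>(\<integral>p. \<psi> (path (?\<theta> + h) p) \<partial>MG) - (\<integral>p. \<psi> (path ?\<theta> p + h *\<^sub>R vel ?\<theta> (path ?\<theta> p)) \<partial>MG)\<bar> \<le> A * B * h\<^sup>2"
    by (rule step[OF th h Suc.prems(2)])
  moreover have "A * exp K * B * (k * h\<^sup>2) * exp (K * k) + A * B * h\<^sup>2 \<le> A * B * (Suc k * h\<^sup>2) * exp (K * Suc k)"
  proof -
    have "A * B * h\<^sup>2 * 1 \<le> A * B * h\<^sup>2 * exp (K * Suc k)"
      using A B K by (intro mult_left_mono) auto
    then show ?thesis by (simp add: algebra_simps exp_add)
  qed
  moreover have "?\<theta> + h = \<theta>0 + Suc k * h" by (simp add: algebra_simps)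
  ultimately show ?case unfolding K_def[symmetric] by simp
qed simp

end

section \<open>Coupling along the flow\<close>

lemma nn_integral_uniform_split:
  fixes a b :: ennreal and r :: real
  assumes "0 \<le> r" "r \<le> 1"
  shows "(\<integral>\<^sup>+t. (if t \<le> r then a else b) \<partial>uniform_measure lborel {0..1}) = ennreal r * a + ennreal (1 - r) * b"
proof -
  have "(\<integral>\<^sup>+t. (if t \<le> r then a else b) \<partial>uniform_measure lborel {0..1})
      = (\<integral>\<^sup>+t. a * indicator {0..r} t + b * indicator {r<..1} t \<partial>lborel)"
    using assms by (subst nn_integral_uniform_measure)
      (auto intro!: nn_integral_cong simp: divide_ennreal_def indicator_def)
  also have "\<dots> = a * ennreal r + b * ennreal (1 - r)"
    using assms by (subst nn_integral_add) (auto simp: nn_integral_cmult_indicator)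
  finally show ?thesis by (simp add: mult.commute)
qed

text \<open>Maximal coupling by rejection: \<open>V = Y\<close> with probability \<open>min (f Y) (g Y) / f Y\<close>, otherwise \<open>V\<close> is drawn
  from the normalised positive part of \<open>g - f\<close>.\<close>

lemma density_coupling:
  fixes P :: "'a measure" and Y :: "'a \<Rightarrow> 'v::euclidean_space" and f g :: "'v \<Rightarrow> real"
  assumes P: "prob_space P" and Y [measurable]: "Y \<in> borel_measurable P"
    and law: "distr P borel Y = density lborel (\<lambda>x. ennreal (f x))"
    and [measurable]: "f \<in> borel_measurable borel" "g \<in> borel_measurable borel"
    and f0: "\<And>x. 0 \<le> f x" and g0: "\<And>x. 0 \<le> g x"
    and g1: "prob_space (density lborel (\<lambda>x. ennreal (g x)))" and p: "0 \<le> p"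
  obtains Q :: "(real \<times> 'v) measure" and V :: "'a \<times> real \<times> 'v \<Rightarrow> 'v"
  where "prob_space Q" "V \<in> borel_measurable (P \<Otimes>\<^sub>M Q)"
    "distr (P \<Otimes>\<^sub>M Q) borel V = density lborel (\<lambda>x. ennreal (g x))"
    "(\<integral>\<^sup>+x. ennreal (norm (Y (fst x) - V x) powr p) \<partial>(P \<Otimes>\<^sub>M Q))
       \<le> 2 powr p * (\<integral>\<^sup>+x. ennreal (norm x powr p * \<bar>f x - g x\<bar>) \<partial>lborel)"
proof -
  interpret P: prob_space P by (rule P)
  define m where "m = (\<integral>\<^sup>+x. ennreal (max 0 (g x - f x)) \<partial>lborel)"
  have F1: "(\<integral>\<^sup>+x. ennreal (f x) \<partial>lborel) = 1"
  proof -
    have "prob_space (distr P borel Y)" by (rule P.prob_space_distr) simp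
    then show ?thesis unfolding law by (auto dest!: prob_space.emeasure_space_1 simp: emeasure_density)
  qed
  have G1: "(\<integral>\<^sup>+x. ennreal (g x) \<partial>lborel) = 1"
    using prob_space.emeasure_space_1[OF g1] by (simp add: emeasure_density)
  have m1: "m \<le> 1"
    unfolding m_def G1[symmetric] using f0 g0 by (intro nn_integral_mono ennreal_leI) auto
  have mfin: "m \<noteq> \<infinity>" using m1 by (auto simp: top_unique)
  \<comment> \<open>Positive and negative part of \<open>g - f\<close> have equal mass: adding them
    to \<open>f\<close> and to \<open>g\<close> respectively gives the pointwise maximum in both
    cases, and \<open>f\<close> and \<open>g\<close> have mass 1.\<close>
  have m2: "(\<integral>\<^sup>+x. ennreal (max 0 (f x - g x)) \<partial>lborel) = m"
  proof -
    have "1 + m = (\<integral>\<^sup>+x. ennreal (f x) + ennreal (max 0 (g x - f x)) \<partial>lborel)"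
      by (subst nn_integral_add) (auto simp: F1 m_def)
    also have "\<dots> = (\<integral>\<^sup>+x. ennreal (g x) + ennreal (max 0 (f x - g x)) \<partial>lborel)"
      using f0 g0 by (intro nn_integral_cong) (auto simp: ennreal_plus[symmetric] max_def simp del: ennreal_plus)
    also have "\<dots> = 1 + (\<integral>\<^sup>+x. ennreal (max 0 (f x - g x)) \<partial>lborel)"
      by (subst nn_integral_add) (auto simp: G1)
    finally show ?thesis by (simp add: ennreal_add_left_cancel)
  qed
  then have m2': "(\<integral>\<^sup>+x. ennreal (f x - g x) \<partial>lborel) = m" by simp
  \<comment> \<open>The normalised positive part is characterised by an identity multiplied by
    \<open>m\<close>, so that \<open>m = 0\<close> is covered: then the positive part vanishes
    almost everywhere and a point mass satisfies the identity.\<close>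
  obtain \<rho> :: "'v measure" where rho: "prob_space \<rho>" "sets \<rho> = sets borel"
    and rho_int: "\<And>G. G \<in> borel_measurable borel \<Longrightarrow>
      m * (\<integral>\<^sup>+x. G x \<partial>\<rho>) = (\<integral>\<^sup>+x. ennreal (max 0 (g x - f x)) * G x \<partial>lborel)"
  proof (cases "m = 0")
    case True
    show ?thesis
    proof (rule that[of "return borel 0"])
      fix G :: "'v \<Rightarrow> ennreal" assume [measurable]: "G \<in> borel_measurable borel"
      have "AE x in lborel. ennreal (max 0 (g x - f x)) = 0"
        using True unfolding m_def by (subst (asm) nn_integral_0_iff_AE) auto
      then have "(\<integral>\<^sup>+x. ennreal (max 0 (g x - f x)) * G x \<partial>lborel) = (\<integral>\<^sup>+(x::'v). 0 \<partial>lborel)"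
        by (intro nn_integral_cong_AE) (auto elim!: eventually_mono)
      then show "m * (\<integral>\<^sup>+x. G x \<partial>return borel 0) = (\<integral>\<^sup>+x. ennreal (max 0 (g x - f x)) * G x \<partial>lborel)"
        by (simp add: True)
    qed (auto intro: prob_space_return)
  next
    case False
    have mm: "m * (e / m) = e" for e
      using False mfin by (simp add: ennreal_times_divide ennreal_mult_divide_eq mult.commute[of m])
    have int: "m * (\<integral>\<^sup>+x. G x \<partial>density lborel (\<lambda>x. ennreal (max 0 (g x - f x)) / m)) = (\<integral>\<^sup>+x. ennreal (max 0 (g x - f x)) * G x \<partial>lborel)"
      if [measurable]: "G \<in> borel_measurable borel" for G :: "'v \<Rightarrow> ennreal"
    proof -
      have "m * (\<integral>\<^sup>+x. G x \<partial>density lborel (\<lambda>x. ennreal (max 0 (g x - f x)) / m))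
        = (\<integral>\<^sup>+x. m * (ennreal (max 0 (g x - f x)) / m * G x) \<partial>lborel)"
        by (subst nn_integral_density) (auto simp: nn_integral_cmult)
      then show ?thesis by (simp add: mult.assoc[symmetric] mm)
    qed
    show ?thesis
    proof (rule that[OF _ _ int])
      show "prob_space (density lborel (\<lambda>x. ennreal (max 0 (g x - f x)) / m))"
      proof
        have "m * (\<integral>\<^sup>+x. 1 \<partial>density lborel (\<lambda>x. ennreal (max 0 (g x - f x)) / m)) = m"
          by (subst int) (auto simp: m_def)
        then have "m * emeasure (density lborel (\<lambda>x. ennreal (max 0 (g x - f x)) / m)) UNIV = m * 1" by simp
        then show "emeasure (density lborel (\<lambda>x. ennreal (max 0 (g x - f x)) / m)) (space (density lborel (\<lambda>x. ennreal (max 0 (g x - f x)) / m))) = 1"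
          unfolding ennreal_mult_cancel_left using False mfin by simp
      qed
    qed auto
  qed
  note [measurable_cong] = rho(2)
  interpret rho: prob_space \<rho> by (rule rho(1))
  define U where "U = (uniform_measure lborel {0..1} :: real measure)"
  interpret U: prob_space U unfolding U_def by (rule prob_space_uniform_measure) auto
  have [measurable_cong]: "sets U = sets borel" by (simp add: U_def)
  interpret UR: pair_prob_space U \<rho> ..
  define Q where "Q = U \<Otimes>\<^sub>M \<rho>"
  interpret Q: prob_space Q unfolding Q_def by (rule UR.prob_space_axioms)
  interpret PQ: pair_prob_space P Q ..
  \<comment> \<open>Where \<open>f\<close> vanishes, the quotient has the value 0; the identities
    \<open>fr\<close> and \<open>fr'\<close> remain true there because both of their sides are
    0.\<close>
  define r where "r x = min (f x) (g x) / f x" for x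
  have r: "0 \<le> r x" "r x \<le> 1" for x using f0[of x] g0[of x] by (auto simp: r_def divide_le_eq)
  have [measurable]: "r \<in> borel_measurable borel" by (simp add: r_def[abs_def])
  define V where "V = (\<lambda>(w, t, x). if t \<le> r (Y w) then Y w else x)"
  have V [measurable]: "V \<in> borel_measurable (P \<Otimes>\<^sub>M Q)"
    unfolding V_def Q_def by measurable
  have fr: "ennreal (f x) * ennreal (r x) = ennreal (min (f x) (g x))" for x
    using f0[of x] g0[of x] r[of x] by (simp add: ennreal_mult[symmetric] r_def)
  have fr': "ennreal (f x) * ennreal (1 - r x) = ennreal (max 0 (f x - g x))" for x
    using f0[of x] g0[of x] r[of x] by (subst ennreal_mult[symmetric]) (auto simp: r_def field_simps min_def max_def)
  have main: "(\<integral>\<^sup>+x. (case x of (w, t, y) \<Rightarrow> if t \<le> r (Y w) then H1 (Y w) else H2 (Y w) y) \<partial>(P \<Otimes>\<^sub>M Q))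
     = (\<integral>\<^sup>+x. ennreal (min (f x) (g x)) * H1 x + ennreal (max 0 (f x - g x)) * (\<integral>\<^sup>+y. H2 x y \<partial>\<rho>) \<partial>lborel)"
    if [measurable]: "H1 \<in> borel_measurable borel" "case_prod H2 \<in> borel_measurable (borel \<Otimes>\<^sub>M borel)"
    for H1 :: "'v \<Rightarrow> ennreal" and H2 :: "'v \<Rightarrow> 'v \<Rightarrow> ennreal"
  proof -
    have "(\<integral>\<^sup>+x. (case x of (w, t, y) \<Rightarrow> if t \<le> r (Y w) then H1 (Y w) else H2 (Y w) y) \<partial>(P \<Otimes>\<^sub>M Q))
       = (\<integral>\<^sup>+w. (\<integral>\<^sup>+x. (case x of (t, y) \<Rightarrow> if t \<le> r (Y w) then H1 (Y w) else H2 (Y w) y) \<partial>Q) \<partial>P)"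
      unfolding Q_def by (subst Q.nn_integral_fst[symmetric, unfolded Q_def]) auto
    also have "\<dots> = (\<integral>\<^sup>+w. ennreal (r (Y w)) * H1 (Y w) + ennreal (1 - r (Y w)) * (\<integral>\<^sup>+y. H2 (Y w) y \<partial>\<rho>) \<partial>P)"
    proof (rule nn_integral_cong)
      fix w
      have "(\<integral>\<^sup>+x. (case x of (t, y) \<Rightarrow> if t \<le> r (Y w) then H1 (Y w) else H2 (Y w) y) \<partial>Q)
         = (\<integral>\<^sup>+t. (\<integral>\<^sup>+y. (if t \<le> r (Y w) then H1 (Y w) else H2 (Y w) y) \<partial>\<rho>) \<partial>U)"
        unfolding Q_def by (subst rho.nn_integral_fst[symmetric]) auto
      also have "\<dots> = (\<integral>\<^sup>+t. (if t \<le> r (Y w) then H1 (Y w) else (\<integral>\<^sup>+y. H2 (Y w) y \<partial>\<rho>)) \<partial>U)"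
        by (intro nn_integral_cong) (auto simp: rho.emeasure_space_1)
      also have "\<dots> = ennreal (r (Y w)) * H1 (Y w) + ennreal (1 - r (Y w)) * (\<integral>\<^sup>+y. H2 (Y w) y \<partial>\<rho>)"
        unfolding U_def by (rule nn_integral_uniform_split) (use r in auto)
      finally show "(\<integral>\<^sup>+x. (case x of (t, y) \<Rightarrow> if t \<le> r (Y w) then H1 (Y w) else H2 (Y w) y) \<partial>Q)
        = ennreal (r (Y w)) * H1 (Y w) + ennreal (1 - r (Y w)) * (\<integral>\<^sup>+y. H2 (Y w) y \<partial>\<rho>)" .
    qed
    also have "\<dots> = (\<integral>\<^sup>+x. ennreal (r x) * H1 x + ennreal (1 - r x) * (\<integral>\<^sup>+y. H2 x y \<partial>\<rho>) \<partial>distr P borel Y)"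
      by (subst nn_integral_distr) auto
    also have "\<dots> = (\<integral>\<^sup>+x. ennreal (f x) * (ennreal (r x) * H1 x + ennreal (1 - r x) * (\<integral>\<^sup>+y. H2 x y \<partial>\<rho>)) \<partial>lborel)"
      unfolding law by (subst nn_integral_density) auto
    also have "\<dots> = (\<integral>\<^sup>+x. ennreal (min (f x) (g x)) * H1 x + ennreal (max 0 (f x - g x)) * (\<integral>\<^sup>+y. H2 x y \<partial>\<rho>) \<partial>lborel)"
      by (simp add: distrib_left mult.assoc[symmetric] fr fr')
    finally show ?thesis .
  qed
  have lawV: "distr (P \<Otimes>\<^sub>M Q) borel V = density lborel (\<lambda>x. ennreal (g x))"
  proof (rule measure_eqI)
    fix A assume "A \<in> sets (distr (P \<Otimes>\<^sub>M Q) borel V)"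
    then have [measurable]: "A \<in> sets borel" by simp
    have "emeasure (distr (P \<Otimes>\<^sub>M Q) borel V) A = (\<integral>\<^sup>+x. indicator A x \<partial>distr (P \<Otimes>\<^sub>M Q) borel V)" by simp
    also have "\<dots> = (\<integral>\<^sup>+x. indicator A (V x) \<partial>(P \<Otimes>\<^sub>M Q))" by (subst nn_integral_distr) auto
    also have "\<dots> = (\<integral>\<^sup>+x. (case x of (w, t, y) \<Rightarrow> if t \<le> r (Y w) then indicator A (Y w) else indicator A y) \<partial>(P \<Otimes>\<^sub>M Q))"
      by (intro nn_integral_cong) (auto simp: V_def)
    also have "\<dots> = (\<integral>\<^sup>+x. ennreal (min (f x) (g x)) * indicator A x + ennreal (max 0 (f x - g x)) * (\<integral>\<^sup>+y. indicator A y \<partial>\<rho>) \<partial>lborel)"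
      by (rule main) auto
    also have "\<dots> = (\<integral>\<^sup>+x. ennreal (min (f x) (g x)) * indicator A x \<partial>lborel) + m * (\<integral>\<^sup>+y. indicator A y \<partial>\<rho>)"
      by (subst nn_integral_add) (auto simp: nn_integral_multc m2 m2')
    also have "m * (\<integral>\<^sup>+y. indicator A y \<partial>\<rho>) = (\<integral>\<^sup>+x. ennreal (max 0 (g x - f x)) * indicator A x \<partial>lborel)"
      by (rule rho_int) simp
    also have "(\<integral>\<^sup>+x. ennreal (min (f x) (g x)) * indicator A x \<partial>lborel) + (\<integral>\<^sup>+x. ennreal (max 0 (g x - f x)) * indicator A x \<partial>lborel)
       = (\<integral>\<^sup>+x. ennreal (g x) * indicator A x \<partial>lborel)"
      using f0 g0 by (subst nn_integral_add[symmetric])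
        (auto intro!: nn_integral_cong simp: distrib_right[symmetric] ennreal_plus[symmetric] min_def max_def simp del: ennreal_plus)
    finally show "emeasure (distr (P \<Otimes>\<^sub>M Q) borel V) A = emeasure (density lborel (\<lambda>x. ennreal (g x))) A"
      by (simp add: emeasure_density)
  qed simp
  have cost: "(\<integral>\<^sup>+x. ennreal (norm (Y (fst x) - V x) powr p) \<partial>(P \<Otimes>\<^sub>M Q))
       \<le> 2 powr p * (\<integral>\<^sup>+x. ennreal (norm x powr p * \<bar>f x - g x\<bar>) \<partial>lborel)"
  proof -
    let ?n = "\<lambda>x::'v. ennreal (norm x powr p)"
    have "(\<integral>\<^sup>+x. ennreal (norm (Y (fst x) - V x) powr p) \<partial>(P \<Otimes>\<^sub>M Q))
      \<le> (\<integral>\<^sup>+x. (case x of (w, t, y) \<Rightarrow> if t \<le> r (Y w) then 0 else ennreal (2 powr p) * (?n (Y w) + ?n y)) \<partial>(P \<Otimes>\<^sub>M Q))"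
    proof (rule nn_integral_mono, clarify)
      fix w t y
      show "ennreal (norm (Y (fst (w, t, y)) - V (w, t, y)) powr p)
        \<le> (if t \<le> r (Y w) then 0 else ennreal (2 powr p) * (?n (Y w) + ?n y))"
        using norm_add_powr_bound[OF p, of "Y w" "- y"] p
        by (auto simp: V_def ennreal_plus[symmetric] ennreal_mult[symmetric] simp del: ennreal_plus intro!: ennreal_leI)
    qed
    also have "\<dots> = (\<integral>\<^sup>+x. ennreal (min (f x) (g x)) * 0 + ennreal (max 0 (f x - g x)) * (\<integral>\<^sup>+y. ennreal (2 powr p) * (?n x + ?n y) \<partial>\<rho>) \<partial>lborel)"
      by (rule main) auto
    also have "\<dots> = (\<integral>\<^sup>+x. ennreal (2 powr p) * (ennreal (max 0 (f x - g x)) * ?n x + ennreal (max 0 (f x - g x)) * (\<integral>\<^sup>+y. ?n y \<partial>\<rho>)) \<partial>lborel)"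
    proof (rule nn_integral_cong)
      fix x
      have "(\<integral>\<^sup>+y. ennreal (2 powr p) * (?n x + ?n y) \<partial>\<rho>) = ennreal (2 powr p) * (?n x + (\<integral>\<^sup>+y. ?n y \<partial>\<rho>))"
        by (subst nn_integral_cmult, simp, subst nn_integral_add) (auto simp: rho.emeasure_space_1)
      then show "ennreal (min (f x) (g x)) * 0 + ennreal (max 0 (f x - g x)) * (\<integral>\<^sup>+y. ennreal (2 powr p) * (?n x + ?n y) \<partial>\<rho>)
        = ennreal (2 powr p) * (ennreal (max 0 (f x - g x)) * ?n x + ennreal (max 0 (f x - g x)) * (\<integral>\<^sup>+y. ?n y \<partial>\<rho>))"
        by (simp only: mult_zero_left mult_zero_right add_0 distrib_left mult_ac)
    qed
    also have "\<dots> = ennreal (2 powr p) * ((\<integral>\<^sup>+x. ennreal (max 0 (f x - g x)) * ?n x \<partial>lborel) + m * (\<integral>\<^sup>+y. ?n y \<partial>\<rho>))"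
      by (subst nn_integral_cmult, simp, subst nn_integral_add) (auto simp: nn_integral_multc m2 m2')
    also have "m * (\<integral>\<^sup>+y. ?n y \<partial>\<rho>) = (\<integral>\<^sup>+x. ennreal (max 0 (g x - f x)) * ?n x \<partial>lborel)"
      by (rule rho_int) simp
    also have "(\<integral>\<^sup>+x. ennreal (max 0 (f x - g x)) * ?n x \<partial>lborel) + (\<integral>\<^sup>+x. ennreal (max 0 (g x - f x)) * ?n x \<partial>lborel)
       = (\<integral>\<^sup>+x. ennreal (norm x powr p * \<bar>f x - g x\<bar>) \<partial>lborel)"
      by (subst nn_integral_add[symmetric])
         (auto intro!: nn_integral_cong simp: distrib_right[symmetric] ennreal_plus[symmetric] ennreal_mult[symmetric] max_def abs_if mult.commute simp del: ennreal_plus)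
    finally show ?thesis .
  qed
  show ?thesis by (rule that[OF Q.prob_space_axioms V lawV cost])
qed

section \<open>Smoothing by Gaussian noise and the approximate flow\<close>

lemma noise_density:
  fixes P :: "'a measure" and Y :: "'a \<Rightarrow> 'v::euclidean_space"
  assumes P: "prob_space P" and [measurable]: "Y \<in> borel_measurable P" and s: "0 < s"
  shows "distr (P \<Otimes>\<^sub>M std_gauss) borel (\<lambda>x. c *\<^sub>R Y (fst x) + s *\<^sub>R snd x)
    = density lborel (\<lambda>x. ennreal (\<integral>w. gauss_pdf ((1 / s) *\<^sub>R x - (c / s) *\<^sub>R Y w) / s ^ DIM('v) \<partial>P))"
proof (rule measure_eqI)
  interpret P: prob_space P by (rule P)
  interpret PG: pair_prob_space P "std_gauss :: 'v measure" ..
  interpret PL: pair_sigma_finite P "lborel :: 'v measure" ..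
  fix A assume "A \<in> sets (distr (P \<Otimes>\<^sub>M std_gauss) borel (\<lambda>x. c *\<^sub>R Y (fst x) + s *\<^sub>R snd x))"
  then have [measurable]: "A \<in> sets borel" by simp
  let ?k = "\<lambda>w x. gauss_pdf ((1 / s) *\<^sub>R x - (c / s) *\<^sub>R Y w) / s ^ DIM('v)"
  have pdf_le: "gauss_pdf (w1::'v) \<le> 1 / sqrt (2 * pi) ^ DIM('v)" for w1
    by (simp add: gauss_pdf_def divide_right_mono)
  have "emeasure (distr (P \<Otimes>\<^sub>M std_gauss) borel (\<lambda>x. c *\<^sub>R Y (fst x) + s *\<^sub>R snd x)) A
     = (\<integral>\<^sup>+x. indicator A x \<partial>distr (P \<Otimes>\<^sub>M std_gauss) borel (\<lambda>x. c *\<^sub>R Y (fst x) + s *\<^sub>R snd x))" by simp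
  also have "\<dots> = (\<integral>\<^sup>+x. indicator A (c *\<^sub>R Y (fst x) + s *\<^sub>R snd x) \<partial>(P \<Otimes>\<^sub>M std_gauss))"
    by (subst nn_integral_distr) auto
  also have "\<dots> = (\<integral>\<^sup>+w. (\<integral>\<^sup>+z. indicator A (c *\<^sub>R Y w + s *\<^sub>R z) \<partial>std_gauss) \<partial>P)"
    by (subst std_gauss.nn_integral_fst[symmetric]) auto
  also have "\<dots> = (\<integral>\<^sup>+w. (\<integral>\<^sup>+x. ennreal (?k w x) * indicator A x \<partial>lborel) \<partial>P)"
  proof (rule nn_integral_cong)
    fix w
    define K where "K x = ennreal (?k w x) * indicator A x" for x
    have [measurable]: "K \<in> borel_measurable borel" unfolding K_def by measurable
    have "(\<integral>\<^sup>+x. K x \<partial>lborel) = (\<integral>\<^sup>+x. K (c *\<^sub>R Y w + x) \<partial>lborel)"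
      by (rule nn_integral_lborel_translate[symmetric]) simp
    also have "\<dots> = ennreal (s ^ DIM('v)) * (\<integral>\<^sup>+x. K (c *\<^sub>R Y w + s *\<^sub>R x) \<partial>lborel)"
      by (rule nn_integral_lborel_scale) (use s in auto)
    also have "\<dots> = (\<integral>\<^sup>+x. ennreal (s ^ DIM('v)) * K (c *\<^sub>R Y w + s *\<^sub>R x) \<partial>lborel)"
      by (subst nn_integral_cmult) auto
    also have "\<dots> = (\<integral>\<^sup>+z. ennreal (gauss_pdf z) * indicator A (c *\<^sub>R Y w + s *\<^sub>R z) \<partial>lborel)"
      using s by (intro nn_integral_cong)
        (simp add: K_def scaleR_add_right mult.assoc[symmetric] ennreal_mult[symmetric])
    finally show "(\<integral>\<^sup>+z. indicator A (c *\<^sub>R Y w + s *\<^sub>R z) \<partial>std_gauss) = (\<integral>\<^sup>+x. ennreal (?k w x) * indicator A x \<partial>lborel)"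
      by (simp add: nn_integral_std_gauss K_def)
  qed
  also have "\<dots> = (\<integral>\<^sup>+x. (\<integral>\<^sup>+w. ennreal (?k w x) * indicator A x \<partial>P) \<partial>lborel)"
    by (rule PL.Fubini'[symmetric]) measurable
  also have "\<dots> = (\<integral>\<^sup>+x. ennreal (\<integral>w. ?k w x \<partial>P) * indicator A x \<partial>lborel)"
  proof (rule nn_integral_cong)
    fix x
    have "integrable P (\<lambda>w. ?k w x)"
    proof (rule P.integrable_const_bound[where B = "(1 / sqrt (2 * pi) ^ DIM('v)) / s ^ DIM('v)"])
      show "AE w in P. norm (?k w x) \<le> (1 / sqrt (2 * pi) ^ DIM('v)) / s ^ DIM('v)"
      proof (rule AE_I2)
        fix w
        have "?k w x \<le> (1 / sqrt (2 * pi) ^ DIM('v)) / s ^ DIM('v)"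
          using s by (intro divide_right_mono pdf_le) auto
        then show "norm (?k w x) \<le> (1 / sqrt (2 * pi) ^ DIM('v)) / s ^ DIM('v)" using s by simp
      qed
    qed simp
    then show "(\<integral>\<^sup>+w. ennreal (?k w x) * indicator A x \<partial>P) = ennreal (\<integral>w. ?k w x \<partial>P) * indicator A x"
      using s by (subst nn_integral_multc) (auto simp: nn_integral_eq_integral)
  qed
  finally show "emeasure (distr (P \<Otimes>\<^sub>M std_gauss) borel (\<lambda>x. c *\<^sub>R Y (fst x) + s *\<^sub>R snd x)) A
    = emeasure (density lborel (\<lambda>x. ennreal (\<integral>w. ?k w x \<partial>P))) A"
    by (simp add: emeasure_density)
qed simp

lemma distr_gauss_rotate:
  assumes s: "0 < s" and cs: "c\<^sup>2 + s\<^sup>2 = 1"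
  shows "distr (std_gauss \<Otimes>\<^sub>M std_gauss) borel (\<lambda>x::'v \<times> 'v::euclidean_space. c *\<^sub>R fst x + s *\<^sub>R snd x) = std_gauss"
proof (rule measure_eqI)
  fix A assume "A \<in> sets (distr (std_gauss \<Otimes>\<^sub>M std_gauss) borel (\<lambda>x::'v \<times> 'v. c *\<^sub>R fst x + s *\<^sub>R snd x))"
  then have [measurable]: "A \<in> sets borel" by simp
  have "emeasure (distr (std_gauss \<Otimes>\<^sub>M std_gauss) borel (\<lambda>x::'v \<times> 'v. c *\<^sub>R fst x + s *\<^sub>R snd x)) A
     = (\<integral>\<^sup>+x. indicator A x \<partial>distr (std_gauss \<Otimes>\<^sub>M std_gauss) borel (\<lambda>x::'v \<times> 'v. c *\<^sub>R fst x + s *\<^sub>R snd x))" by simp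
  also have "\<dots> = (\<integral>\<^sup>+x. indicator A (c *\<^sub>R fst x + s *\<^sub>R snd x) \<partial>(std_gauss \<Otimes>\<^sub>M std_gauss))"
    by (subst nn_integral_distr) auto
  also have "\<dots> = (\<integral>\<^sup>+z. (\<integral>\<^sup>+y. indicator A (c *\<^sub>R z + s *\<^sub>R y) \<partial>std_gauss) \<partial>std_gauss)"
    by (subst std_gauss.nn_integral_fst[symmetric]) auto
  also have "\<dots> = (\<integral>\<^sup>+x. indicator A x \<partial>std_gauss)"
    by (rule nn_integral_gauss_rotate) (use s cs in auto)
  finally show "emeasure (distr (std_gauss \<Otimes>\<^sub>M std_gauss) borel (\<lambda>x::'v \<times> 'v. c *\<^sub>R fst x + s *\<^sub>R snd x)) A = emeasure std_gauss A"
    by simp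
qed simp

context bounded_vector
begin

text \<open>The velocities met by the scheme, a moment of its endpoint and the smoothed density of
  its endpoint are all expectations of test functions, so one weak error bound yields the three
  estimates. Convexity over the steps bounds the displacement by the total angle to the power
  \<open>p\<close> times a bound on the velocity moments. The moment of order \<open>p + 1\<close>
  will control tails under the weight \<open>norm x powr p\<close>.\<close>

lemma euler_approx:
  fixes \<theta>0 p G \<epsilon> c :: real
  assumes th0: "0 < \<theta>0" "\<theta>0 \<le> pi / 2" and p: "2 \<le> p" and G: "0 \<le> G" and eps: "0 < \<epsilon>"
    and vG: "\<And>\<theta>. \<theta>0 \<le> \<theta> \<Longrightarrow> \<theta> \<le> pi / 2 \<Longrightarrow> (\<integral>x. norm (vel \<theta> (path \<theta> x)) powr p \<partial>MG) \<le> G"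
  obtains T D where "T \<in> borel_measurable borel" "0 \<le> D" "\<And>x. 1 + norm (T x) \<le> D * (1 + norm x)"
    "(\<integral>x. norm (T (path \<theta>0 x) - path \<theta>0 x) powr p \<partial>MG) \<le> (pi / 2 - \<theta>0) powr p * (G + \<epsilon>)"
    "(\<integral>x. norm (T (path \<theta>0 x)) powr (p + 1) \<partial>MG) \<le> (\<integral>x. norm (path (pi / 2) x) powr (p + 1) \<partial>MG) + \<epsilon>"
    "\<And>y. \<bar>(\<integral>x. exp (- ((y - c *\<^sub>R T (path \<theta>0 x)) \<bullet> (y - c *\<^sub>R T (path \<theta>0 x))) / 2) \<partial>MG)
        - (\<integral>x. exp (- ((y - c *\<^sub>R path (pi / 2) x) \<bullet> (y - c *\<^sub>R path (pi / 2) x)) / 2) \<partial>MG)\<bar> \<le> \<epsilon>"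
proof -
  obtain L where L: "1 \<le> L" and qm: "\<And>\<theta>. \<theta>0 \<le> \<theta> \<Longrightarrow> \<theta> \<le> pi / 2 \<Longrightarrow> quad_map L (vel \<theta>) (dvel \<theta>)"
    using quad_map_vel[OF th0] by blast
  define s where "s = p + 1"
  have s: "0 \<le> s" using p by (simp add: s_def)
  obtain B where B: "0 \<le> B" and step: "\<And>(\<theta>::real) (h::real) \<psi> g A. \<lbrakk>\<theta>0 \<le> \<theta>; \<theta> \<le> pi / 2; 0 \<le> h; h \<le> 2; quad_test s A \<psi> g\<rbrakk> \<Longrightarrow>
      \<bar>(\<integral>p. \<psi> (path (\<theta> + h) p) \<partial>MG) - (\<integral>p. \<psi> (path \<theta> p + h *\<^sub>R vel \<theta> (path \<theta> p)) \<partial>MG)\<bar> \<le> A * B * h\<^sup>2"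
    using one_step[OF qm th0(1) s] by blast
  define \<tau> where "\<tau> = pi / 2 - \<theta>0"
  have tau: "0 \<le> \<tau>" "\<tau> \<le> 2" using th0 pi_less_4 by (auto simp: \<tau>_def)
  \<comment> \<open>The sum of the sizes of the three kinds of test functions: velocity, moment (the
    identity map with \<open>L = 1\<close>) and Gaussian kernel.\<close>
  define A where "A = 2 * p\<^sup>2 * L powr p + 2 * (p + 1)\<^sup>2 + (3 * c\<^sup>2 + \<bar>c\<bar>)"
  have A: "0 \<le> A" by (simp add: A_def)
  \<comment> \<open>With \<open>n\<close> steps of length \<open>\<tau> / n\<close>, the number of
    steps times the squared step is \<open>\<tau>^2 / n\<close>, so the accumulated weak error is at
    most \<open>E / n\<close>.\<close>
  define E where "E = A * B * \<tau>\<^sup>2 * exp (\<tau> * (L * (s + 3)))"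
  obtain N :: nat where "E / \<epsilon> < real N" using reals_Archimedean2 by blast
  define n where "n = Suc N"
  have n: "0 < real n" "E / n \<le> \<epsilon>"
  proof -
    have "E < \<epsilon> * real N" using \<open>E / \<epsilon> < real N\<close> eps by (simp add: field_simps)
    also have "\<dots> \<le> \<epsilon> * real n" using eps by (intro mult_left_mono) (auto simp: n_def)
    finally show "E / n \<le> \<epsilon>" by (simp add: n_def field_simps)
  qed (simp add: n_def)
  define h where "h = \<tau> / n"
  have hn: "h * n = \<tau>" using n by (simp add: h_def)
  have "h \<le> \<tau>" unfolding h_def using tau n by (simp add: n_def divide_le_eq mult_left_le_one_le) (metis mult_left_mono of_nat_0_le_iff add_increasing2 mult.right_neutral distrib_left le_add_same_cancel1 mult_nonneg_nonneg)
  then have h: "0 \<le> h" "h \<le> 2" using tau n by (auto simp: h_def)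
  define v where "v j = vel (\<theta>0 + real j * h)" for j
  define e where "e j = euler v h j" for j
  have in_range: "\<theta>0 \<le> \<theta>0 + real j * h" "\<theta>0 + real j * h \<le> pi / 2" if "j \<le> n" for j
  proof -
    have "real j * h \<le> real n * h" using that h by (intro mult_right_mono) auto
    then show "\<theta>0 + real j * h \<le> pi / 2" using hn by (simp add: \<tau>_def mult.commute)
  qed (use h in simp)
  have weak: "\<bar>(\<integral>p. \<psi> (e j (path \<theta>0 p)) \<partial>MG) - (\<integral>p. \<psi> (path (\<theta>0 + j * h) p) \<partial>MG)\<bar> \<le> \<epsilon>"
    if j: "j \<le> n" and t: "quad_test s A' \<psi> g" and A': "A' \<le> A" for j A' \<psi> g
  proof -
    have A'0: "0 \<le> A'" using t by (simp add: quad_test_def)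
    have jh: "real j * h \<le> \<tau>" using in_range(2)[OF j] by (simp add: \<tau>_def)
    have "\<bar>(\<integral>p. \<psi> (e j (path \<theta>0 p)) \<partial>MG) - (\<integral>p. \<psi> (path (\<theta>0 + j * h) p) \<partial>MG)\<bar>
      \<le> A' * B * (j * h\<^sup>2) * exp (h * (L * (s + 3)) * j)"
      unfolding e_def v_def
      by (rule euler_weak_error[OF qm th0(1) s B step h in_range(2)[OF j] t])
    also have "\<dots> \<le> A * B * (\<tau>\<^sup>2 / n) * exp (\<tau> * (L * (s + 3)))"
    proof (intro mult_mono)
      have "real j * h\<^sup>2 = (real j * h) * h" by (simp add: power2_eq_square)
      also have "\<dots> \<le> \<tau> * h" using jh h by (intro mult_right_mono) auto
      also have "\<dots> = \<tau>\<^sup>2 / n" by (simp add: h_def power2_eq_square)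
      finally show "real j * h\<^sup>2 \<le> \<tau>\<^sup>2 / n" .
      have "(real j * h) * (L * (s + 3)) \<le> \<tau> * (L * (s + 3))" using jh L s by (intro mult_right_mono) auto
      then show "exp (h * (L * (s + 3)) * j) \<le> exp (\<tau> * (L * (s + 3)))" by (simp add: mult_ac)
    qed (use A A' A'0 B h tau in auto)
    also have "\<dots> = E / n" by (simp add: E_def)
    also have "\<dots> \<le> \<epsilon>" by (rule n(2))
    finally show ?thesis .
  qed
  have vm [measurable]: "v j \<in> borel_measurable borel" for j by (simp add: v_def)
  have em [measurable]: "e j \<in> borel_measurable borel" for j
    unfolding e_def by (rule euler_measurable) simp
  have vb: "norm (v j x) \<le> L * (1 + norm x)" if "j \<le> n" for j x
    unfolding v_def using qm[OF in_range[OF that]] by (simp add: quad_map_def)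
  define D where "D = (1 + h * L) ^ n"
  have D: "1 \<le> D" unfolding D_def using h L by (intro one_le_power) simp
  have eb: "1 + norm (e j x) \<le> D * (1 + norm x)" if "j \<le> n" for j x
  proof -
    have "1 + norm (e j x) \<le> (1 + h * L) ^ j * (1 + norm x)"
      unfolding e_def by (rule euler_growth) (use vb that h L in auto)
    also have "\<dots> \<le> D * (1 + norm x)"
      unfolding D_def using that h L by (intro mult_right_mono power_increasing) auto
    finally show ?thesis .
  qed
  have ep: "1 + norm (e j (path \<theta>0 (w, z))) \<le> D * (1 + R + norm z)" if "w \<in> space M" "j \<le> n" for j w z
  proof (rule order_trans[OF eb[OF that(2)] mult_left_mono])
    show "1 + norm (path \<theta>0 (w, z)) \<le> 1 + R + norm z" using one_plus_path_le[OF that(1)] by simp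
  qed (use D in simp)
  have endp: "\<theta>0 + real n * h = pi / 2" using hn by (simp add: \<tau>_def mult.commute)
  have qv: "quad_test s (2 * p\<^sup>2 * L powr p) (\<lambda>x. norm (v j x) powr p) (\<lambda>x. p *\<^sub>R dvel (\<theta>0 + real j * h) x (powr_grad p (v j x)))"
    if "j \<le> n" for j
    unfolding v_def by (rule quad_map_norm_powr[OF qm[OF in_range[OF that]] p]) (simp add: s_def)
  have disp: "(\<integral>x. norm (v j (e j (path \<theta>0 x))) powr p \<partial>MG) \<le> G + \<epsilon>" if "j \<le> n" for j
  proof -
    have "(\<integral>x. norm (v j (path (\<theta>0 + real j * h) x)) powr p \<partial>MG) \<le> G"
      unfolding v_def by (rule vG[OF in_range[OF that]])
    moreover have "\<bar>(\<integral>x. norm (v j (e j (path \<theta>0 x))) powr p \<partial>MG) - (\<integral>x. norm (v j (path (\<theta>0 + real j * h) x)) powr p \<partial>MG)\<bar> \<le> \<epsilon>"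
      by (rule weak[OF that qv[OF that]]) (simp add: A_def)
    ultimately show ?thesis by linarith
  qed
  have disp_int: "integrable MG (\<lambda>x. norm (v j (e j (path \<theta>0 x))) powr p)" if "j \<le> n" for j
    by (rule integrable_quad_test_comp[OF qv[OF that] s _ ep]) (use that D in auto)
  show ?thesis
  proof (rule that[of "e n" D])
    show "0 \<le> D" using D by simp
    show "1 + norm (e n x) \<le> D * (1 + norm x)" for x by (rule eb) simp
    have pw: "norm (e n x - x) powr p \<le> real n powr (p - 1) * (\<Sum>j<n. h powr p * norm (v j (e j x)) powr p)" for x
    proof -
      have "e n x - x = (\<Sum>j<n. h *\<^sub>R v j (e j x))" unfolding e_def by (subst euler_sum) simp
      moreover have "norm (\<Sum>j<n. h *\<^sub>R v j (e j x)) powr p \<le> real (card {..<n}) powr (p - 1) * (\<Sum>j<n. norm (h *\<^sub>R v j (e j x)) powr p)"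
        by (rule sum_norm_powr_le) (use p in auto)
      ultimately show ?thesis using h by (simp add: powr_mult)
    qed
    have "(\<integral>x. norm (e n (path \<theta>0 x) - path \<theta>0 x) powr p \<partial>MG)
      \<le> (\<integral>x. real n powr (p - 1) * (\<Sum>j<n. h powr p * norm (v j (e j (path \<theta>0 x))) powr p) \<partial>MG)"
    proof (rule Bochner_Integration.integral_mono')
      show "integrable MG (\<lambda>x. real n powr (p - 1) * (\<Sum>j<n. h powr p * norm (v j (e j (path \<theta>0 x))) powr p))"
        by (intro integrable_mult_right Bochner_Integration.integrable_sum disp_int) auto
    qed (use pw in \<open>auto intro!: mult_nonneg_nonneg sum_nonneg\<close>)
    also have "\<dots> = real n powr (p - 1) * (\<Sum>j<n. h powr p * (\<integral>x. norm (v j (e j (path \<theta>0 x))) powr p \<partial>MG))"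
      using disp_int by (subst integral_mult_right_zero, subst Bochner_Integration.integral_sum) auto
    also have "\<dots> \<le> real n powr (p - 1) * (\<Sum>j<n. h powr p * (G + \<epsilon>))"
      using disp by (intro mult_left_mono sum_mono) auto
    also have "\<dots> = (real n powr (p - 1) * real n) * h powr p * (G + \<epsilon>)" by simp
    also have "real n powr (p - 1) * real n = real n powr p" using n by (simp add: powr_diff)
    also have "real n powr p * h powr p = \<tau> powr p"
      using n h hn by (simp add: powr_mult[symmetric] mult.commute)
    finally show "(\<integral>x. norm (e n (path \<theta>0 x) - path \<theta>0 x) powr p \<partial>MG) \<le> (pi / 2 - \<theta>0) powr p * (G + \<epsilon>)"
      by (simp add: \<tau>_def)
    have "quad_test s (2 * (p + 1)\<^sup>2 * 1 powr (p + 1)) (\<lambda>x::'v. norm x powr (p + 1)) (\<lambda>x. (p + 1) *\<^sub>R powr_grad (p + 1) x)"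
      by (rule quad_map_norm_powr[OF quad_map_id]) (use p in \<open>auto simp: s_def\<close>)
    from weak[OF order_refl this, unfolded endp]
    show "(\<integral>x. norm (e n (path \<theta>0 x)) powr (p + 1) \<partial>MG) \<le> (\<integral>x. norm (path (pi / 2) x) powr (p + 1) \<partial>MG) + \<epsilon>"
      by (simp add: A_def)
    show "\<bar>(\<integral>x. exp (- ((y - c *\<^sub>R e n (path \<theta>0 x)) \<bullet> (y - c *\<^sub>R e n (path \<theta>0 x))) / 2) \<partial>MG)
        - (\<integral>x. exp (- ((y - c *\<^sub>R path (pi / 2) x) \<bullet> (y - c *\<^sub>R path (pi / 2) x)) / 2) \<partial>MG)\<bar> \<le> \<epsilon>" for y
      using weak[OF order_refl quad_test_gauss_kernel[OF s, of c y], unfolded endp] by (simp add: A_def)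
  qed simp
qed

end

lemma nn_integral_pair_fst:
  assumes "prob_space M" "prob_space N" and [measurable]: "f \<in> borel_measurable M"
  shows "(\<integral>\<^sup>+x. f (fst x) \<partial>(M \<Otimes>\<^sub>M N)) = (\<integral>\<^sup>+x. f x \<partial>M)"
proof -
  interpret N: prob_space N by fact
  show ?thesis by (subst N.nn_integral_fst[symmetric]) (auto simp: N.emeasure_space_1)
qed

lemma nn_integral_pair_snd:
  assumes "prob_space M" "prob_space N" and [measurable]: "f \<in> borel_measurable N"
  shows "(\<integral>\<^sup>+x. f (snd x) \<partial>(M \<Otimes>\<^sub>M N)) = (\<integral>\<^sup>+x. f x \<partial>N)"
proof -
  interpret M: prob_space M by fact
  interpret N: prob_space N by fact
  show ?thesis by (subst N.nn_integral_fst[symmetric]) (auto simp: M.emeasure_space_1)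
qed

context bounded_vector
begin

abbreviation MGG :: "(('a \<times> 'v) \<times> 'v) measure" where "MGG \<equiv> MG \<Otimes>\<^sub>M std_gauss"

lemma nn_integral_MGG_fst:
  "H \<in> borel_measurable (M \<Otimes>\<^sub>M std_gauss) \<Longrightarrow> (\<integral>\<^sup>+x. H (fst x) \<partial>MGG) = (\<integral>\<^sup>+x. H x \<partial>MG)"
  by (rule nn_integral_pair_fst[OF pair.prob_space_axioms std_gauss.prob_space_axioms])

lemma nn_integral_MGG_snd:
  "H \<in> borel_measurable borel \<Longrightarrow> (\<integral>\<^sup>+x. H (snd x) \<partial>MGG) = (\<integral>\<^sup>+x. H x \<partial>std_gauss)"
  by (rule nn_integral_pair_snd[OF pair.prob_space_axioms std_gauss.prob_space_axioms]) simp

lemma path_end: "path (pi / 2) x = snd x"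
  by (simp add: path_def)

text \<open>Three legs: from the path to the Euler endpoint \<open>X\<close>, from \<open>X\<close>
  to a noisy version \<open>Y\<close>, and from \<open>Y\<close> to \<open>V\<close> by
  \<open>density_coupling\<close>. Mixing the noise with weights \<open>c\<close> and
  \<open>s\<close> on the unit circle keeps the Gaussian endpoint of the exact path Gaussian, so the
  density of \<open>Y\<close> is compared with that of the target itself. The noise level, the
  radius \<open>R0\<close> and the accuracy of the scheme are chosen in this order, each depending
  on the previous ones.\<close>

lemma flow_coupling:
  fixes \<theta>0 p G \<epsilon> :: real
  assumes th0: "0 < \<theta>0" "\<theta>0 \<le> pi / 2" and p: "2 \<le> p" and G: "0 \<le> G" and eps: "0 < \<epsilon>"
    and vG: "\<And>\<theta>. \<theta>0 \<le> \<theta> \<Longrightarrow> \<theta> \<le> pi / 2 \<Longrightarrow> (\<integral>x. norm (vel \<theta> (path \<theta> x)) powr p \<partial>MG) \<le> G"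
  obtains Q :: "(real \<times> 'v) measure" and V :: "(('a \<times> 'v) \<times> 'v) \<times> real \<times> 'v \<Rightarrow> 'v"
  where "prob_space Q" "V \<in> borel_measurable (MGG \<Otimes>\<^sub>M Q)"
    "distr (MGG \<Otimes>\<^sub>M Q) borel V = std_gauss"
    "(\<integral>\<^sup>+x. ennreal (norm (path \<theta>0 (fst (fst x)) - V x) powr p) \<partial>(MGG \<Otimes>\<^sub>M Q))
      \<le> ennreal (3 powr (p - 1) * ((pi / 2 - \<theta>0) powr p * G) + \<epsilon>)"
proof -
  define \<Gamma> where "\<Gamma> = (std_gauss :: 'v measure)"
  have [measurable_cong]: "sets \<Gamma> = sets borel" by (simp add: \<Gamma>_def)
  interpret pair2: pair_prob_space MG "std_gauss :: 'v measure" ..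
  define \<tau> where "\<tau> = pi / 2 - \<theta>0"
  \<comment> \<open>Three errors of size \<open>\<eta>\<close>, each multiplied by the convexity
    factor \<open>3 powr (p - 1)\<close>, stay below \<open>\<epsilon>\<close>.\<close>
  define \<eta> where "\<eta> = \<epsilon> / (4 * 3 powr (p - 1))"
  have eta: "0 < \<eta>" using eps by (simp add: \<eta>_def)
  define Np where "Np = (\<integral>z. norm z powr (p + 1) \<partial>\<Gamma>)"
  have Np0: "0 \<le> Np" by (simp add: Np_def)
  have int_std: "integrable \<Gamma> (\<lambda>z. norm z powr r)" if "0 \<le> r" for r
    unfolding \<Gamma>_def by (rule integrable_norm_powr_std_gauss[OF that])
  have nn_std: "(\<integral>\<^sup>+z. ennreal (norm z powr (p + 1)) \<partial>\<Gamma>) = ennreal Np"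
    unfolding Np_def by (rule nn_integral_eq_integral) (use p int_std in auto)
  have end_int: "(\<integral>x. norm (path (pi / 2) x) powr (p + 1) \<partial>MG) = Np"
  proof -
    have "integrable MG (\<lambda>x. norm (path (pi / 2) x) powr (p + 1))"
      by (rule integrable_poly_bound[where C = 1 and r = "p + 1"])
         (use p R_nonneg in \<open>auto simp: path_end intro!: powr_mono2\<close>)
    then have "ennreal (\<integral>x. norm (path (pi / 2) x) powr (p + 1) \<partial>MG) = (\<integral>\<^sup>+x. ennreal (norm (snd x) powr (p + 1)) \<partial>MG)"
      by (subst nn_integral_eq_integral[symmetric]) (auto simp: path_end)
    also have "\<dots> = ennreal Np"
      using nn_integral_pair_snd[OF prob_space_axioms std_gauss.prob_space_axioms, of "\<lambda>z::'v. ennreal (norm z powr (p + 1))"] nn_std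
      by (simp add: \<Gamma>_def)
    finally show ?thesis using Np0 by simp
  qed
  \<comment> \<open>\<open>K2 * s\<close> bounds the cost of the noise. It uses
    \<open>1 - c \<le> s\<close>, \<open>s powr p \<le> s\<close> and
    \<open>norm x powr p \<le> 1 + norm x powr (p + 1)\<close>; the moments of order
    \<open>p + 1\<close> of \<open>X\<close> and of the noise are at most \<open>Np + 1\<close> and
    \<open>Np\<close>.\<close>
  define K2 where "K2 = 2 powr p * (2 * Np + 3)"
  have K2: "0 < K2" using Np0 by (simp add: K2_def)
  define s where "s = min (1 / 2) (\<eta> / K2)"
  have s: "0 < s" "s \<le> 1 / 2" "K2 * s \<le> \<eta>"
  proof -
    show "s \<le> 1 / 2" unfolding s_def by (rule min.cobounded1)
    have "K2 * s \<le> K2 * (\<eta> / K2)" using K2 by (intro mult_left_mono) (auto simp: s_def)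
    then show "K2 * s \<le> \<eta>" using K2 by simp
  qed (use eta K2 in \<open>auto simp: s_def\<close>)
  define c where "c = sqrt (1 - s\<^sup>2)"
  have s2: "s\<^sup>2 \<le> s" "s\<^sup>2 \<le> 1" using s by (auto simp: power2_eq_square mult_left_le intro: mult_le_one)
  have c: "c\<^sup>2 + s\<^sup>2 = 1" "0 \<le> c" "c \<le> 1" "1 - c \<le> s"
  proof -
    have "(1 - s)\<^sup>2 \<le> 1 - s\<^sup>2" using s2 by (simp add: power2_eq_square algebra_simps)
    then show "1 - c \<le> s" using real_le_rsqrt[of "1 - s" "1 - s\<^sup>2"] by (simp add: c_def)
  qed (use s2 in \<open>auto simp: c_def\<close>)
  \<comment> \<open>A bound for the sum of the moments of order \<open>p + 1\<close> of
    \<open>Y\<close> and of the Gaussian, so that \<open>K3 / R0\<close> bounds the weighted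
    difference of densities outside the ball of radius \<open>R0\<close>.\<close>
  define K3 where "K3 = 2 powr (p + 1) * (2 * Np + 1) + Np"
  have K3: "0 \<le> K3" using Np0 by (simp add: K3_def)
  define R0 where "R0 = 2 * 2 powr p * K3 / \<eta> + 1"
  have R0: "0 < R0" "2 powr p * (K3 / R0) \<le> \<eta> / 2"
  proof -
    show R0: "0 < R0" using K3 eta by (simp add: R0_def add_nonneg_pos)
    have "2 * 2 powr p * K3 / \<eta> \<le> R0" by (simp add: R0_def)
    then show "2 powr p * (K3 / R0) \<le> \<eta> / 2" using R0 eta by (simp add: field_simps)
  qed
  define Cs where "Cs = 1 / sqrt (2 * pi) ^ DIM('v) / s ^ DIM('v)"
  have Cs: "0 < Cs" using s by (simp add: Cs_def)
  define vol where "vol = measure lborel (cball (0::'v) R0)"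
  define K4 where "K4 = 2 powr p * (R0 powr p * (Cs * vol))"
  have K4: "0 \<le> K4" using Cs by (simp add: K4_def vol_def)
  define \<epsilon>1 where "\<epsilon>1 = min 1 (min (\<eta> / (\<tau> powr p + 1)) (\<eta> / 2 / (K4 + 1)))"
  have eps1: "0 < \<epsilon>1" "\<epsilon>1 \<le> 1" "\<tau> powr p * \<epsilon>1 \<le> \<eta>" "K4 * \<epsilon>1 \<le> \<eta> / 2"
  proof -
    show e: "0 < \<epsilon>1" using eta K4 by (simp add: \<epsilon>1_def add_nonneg_pos)
    have a: "e * b \<le> x" if "0 \<le> e" "0 < x" "b \<le> x / (e + 1)" "0 < b" for e b x :: real
    proof -
      have "e * b \<le> (e + 1) * b" using that by simp
      also have "\<dots> \<le> (e + 1) * (x / (e + 1))" using that by (intro mult_left_mono) auto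
      finally show ?thesis using that by simp
    qed
    show "\<tau> powr p * \<epsilon>1 \<le> \<eta>" by (rule a) (use eta e in \<open>auto simp: \<epsilon>1_def\<close>)
    show "K4 * \<epsilon>1 \<le> \<eta> / 2" by (rule a) (use eta e K4 in \<open>auto simp: \<epsilon>1_def\<close>)
  qed (simp add: \<epsilon>1_def)
  obtain T D where T [measurable]: "T \<in> borel_measurable borel" and D: "0 \<le> D" "\<And>x. 1 + norm (T x) \<le> D * (1 + norm x)"
    and T1: "(\<integral>x. norm (T (path \<theta>0 x) - path \<theta>0 x) powr p \<partial>MG) \<le> (pi / 2 - \<theta>0) powr p * (G + \<epsilon>1)"
    and T2: "(\<integral>x. norm (T (path \<theta>0 x)) powr (p + 1) \<partial>MG) \<le> (\<integral>x. norm (path (pi / 2) x) powr (p + 1) \<partial>MG) + \<epsilon>1"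
    and T3: "\<And>y. \<bar>(\<integral>x. exp (- ((y - (c / s) *\<^sub>R T (path \<theta>0 x)) \<bullet> (y - (c / s) *\<^sub>R T (path \<theta>0 x))) / 2) \<partial>MG)
        - (\<integral>x. exp (- ((y - (c / s) *\<^sub>R path (pi / 2) x) \<bullet> (y - (c / s) *\<^sub>R path (pi / 2) x)) / 2) \<partial>MG)\<bar> \<le> \<epsilon>1"
    by (rule euler_approx[OF th0 p G eps1(1) vG, of "c / s"]) blast+
  define X where "X = (\<lambda>x. T (path \<theta>0 x))"
  have [measurable]: "X \<in> borel_measurable (M \<Otimes>\<^sub>M std_gauss)" by (simp add: X_def)
  have Xb: "1 + norm (X (w, z)) \<le> D * (1 + R + norm z)" if "w \<in> space M" for w z
    unfolding X_def
    by (rule order_trans[OF D(2) mult_left_mono]) (use one_plus_path_le[OF that] D in auto)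
  have pathb: "1 + norm (path \<theta>0 (w, z)) \<le> 1 * (1 + R + norm z)" if "w \<in> space M" for w z
    by (rule one_plus_path_le[OF that])
  have intX: "integrable MG (\<lambda>x. norm (X x) powr (p + 1))"
  proof (rule integrable_poly_bound[where C = "D powr (p + 1)" and r = "p + 1"])
    fix w and z :: 'v assume w1: "w \<in> space M"
    have "norm (X (w, z)) powr (p + 1) \<le> (D * (1 + R + norm z)) powr (p + 1)"
      using Xb[OF w1, of z] p by (intro powr_mono2) auto
    then show "norm (norm (X (w, z)) powr (p + 1)) \<le> D powr (p + 1) * (1 + R + norm z) powr (p + 1)"
      using D R_nonneg by (simp add: powr_mult)
  qed (use p in auto)
  have intXp: "integrable MG (\<lambda>x. norm (X x - path \<theta>0 x) powr p)"
  proof (rule integrable_poly_bound[where C = "(D + 1) powr p" and r = p])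
    fix w and z :: 'v assume w1: "w \<in> space M"
    have "norm (X (w, z) - path \<theta>0 (w, z)) \<le> (D + 1) * (1 + R + norm z)"
      using norm_triangle_ineq4[of "X (w, z)" "path \<theta>0 (w, z)"] Xb[OF w1, of z] pathb[OF w1, of z]
      by (simp add: algebra_simps)
    then have "norm (X (w, z) - path \<theta>0 (w, z)) powr p \<le> ((D + 1) * (1 + R + norm z)) powr p"
      using p by (intro powr_mono2) auto
    then show "norm (norm (X (w, z) - path \<theta>0 (w, z)) powr p) \<le> (D + 1) powr p * (1 + R + norm z) powr p"
      using D R_nonneg by (simp add: powr_mult)
  qed (use p in auto)
  have nnX: "(\<integral>\<^sup>+x. ennreal (norm (X x) powr (p + 1)) \<partial>MG) \<le> ennreal (Np + 1)"
    using T2 eps1(2) unfolding X_def[symmetric] end_int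
    by (subst nn_integral_eq_integral[OF intX]) (auto simp: X_def intro!: ennreal_leI)
  have nnXp: "(\<integral>\<^sup>+x. ennreal (norm (path \<theta>0 x - X x) powr p) \<partial>MG) \<le> ennreal (\<tau> powr p * G + \<eta>)"
  proof -
    have "(\<integral>\<^sup>+x. ennreal (norm (path \<theta>0 x - X x) powr p) \<partial>MG) = ennreal (\<integral>x. norm (X x - path \<theta>0 x) powr p \<partial>MG)"
      by (subst nn_integral_eq_integral[OF intXp, symmetric]) (auto simp: norm_minus_commute)
    also have "\<dots> \<le> ennreal (\<tau> powr p * G + \<eta>)"
      using T1 eps1(3) by (intro ennreal_leI) (simp add: X_def \<tau>_def distrib_left)
    finally show ?thesis .
  qed
  define Y where "Y = (\<lambda>x. c *\<^sub>R X (fst x) + s *\<^sub>R (snd x :: 'v))"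
  have [measurable]: "Y \<in> borel_measurable ((M \<Otimes>\<^sub>M std_gauss) \<Otimes>\<^sub>M std_gauss)" by (simp add: Y_def)
  define f where "f x = (\<integral>w. gauss_pdf ((1 / s) *\<^sub>R x - (c / s) *\<^sub>R X w) / s ^ DIM('v) \<partial>MG)" for x
  define g where "g x = (\<integral>w. gauss_pdf ((1 / s) *\<^sub>R x - (c / s) *\<^sub>R path (pi / 2) w) / s ^ DIM('v) \<partial>MG)" for x
  have [measurable]: "f \<in> borel_measurable borel" "g \<in> borel_measurable borel"
    unfolding f_def g_def by measurable
  have f0: "0 \<le> f x" and g0: "0 \<le> g x" for x
    unfolding f_def g_def using s by (auto intro!: integral_nonneg)
  have lawY: "distr MGG borel Y = density lborel (\<lambda>x. ennreal (f x))"
    unfolding Y_def f_def by (rule noise_density[OF pair.prob_space_axioms _ s(1)]) simp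
  have lawg: "density lborel (\<lambda>x. ennreal (g x)) = std_gauss"
  proof -
    have "density lborel (\<lambda>x. ennreal (g x)) = distr MGG borel (\<lambda>x. c *\<^sub>R path (pi / 2) (fst x) + s *\<^sub>R snd x)"
      unfolding g_def by (rule noise_density[OF pair.prob_space_axioms _ s(1), symmetric]) simp
    also have "\<dots> = distr (std_gauss \<Otimes>\<^sub>M std_gauss) borel (\<lambda>x::'v \<times> 'v. c *\<^sub>R fst x + s *\<^sub>R snd x)"
    proof (rule measure_eqI)
      fix A assume "A \<in> sets (distr MGG borel (\<lambda>x. c *\<^sub>R path (pi / 2) (fst x) + s *\<^sub>R snd x))"
      then have A [measurable]: "A \<in> sets borel" by simp
      have "emeasure (distr MGG borel (\<lambda>x. c *\<^sub>R path (pi / 2) (fst x) + s *\<^sub>R snd x)) A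
        = (\<integral>\<^sup>+x. indicator A x \<partial>distr MGG borel (\<lambda>x. c *\<^sub>R path (pi / 2) (fst x) + s *\<^sub>R snd x))" by simp
      also have "\<dots> = (\<integral>\<^sup>+x. (indicator A (c *\<^sub>R snd (fst x) + s *\<^sub>R snd x) :: ennreal) \<partial>MGG)"
        by (subst nn_integral_distr) (auto simp: path_end)
      also have "\<dots> = (\<integral>\<^sup>+x. (\<integral>\<^sup>+y. indicator A (c *\<^sub>R snd x + s *\<^sub>R y) \<partial>std_gauss) \<partial>MG)"
        by (subst std_gauss.nn_integral_fst[symmetric]) auto
      also have "\<dots> = (\<integral>\<^sup>+z. (\<integral>\<^sup>+y. indicator A (c *\<^sub>R z + s *\<^sub>R y) \<partial>std_gauss) \<partial>std_gauss)"
        by (rule nn_integral_pair_snd[OF prob_space_axioms std_gauss.prob_space_axioms]) measurable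
      also have "\<dots> = (\<integral>\<^sup>+x. (indicator A (c *\<^sub>R fst x + s *\<^sub>R snd x) :: ennreal) \<partial>(std_gauss \<Otimes>\<^sub>M (std_gauss :: 'v measure)))"
        by (subst std_gauss.nn_integral_fst[symmetric]) auto
      also have "\<dots> = (\<integral>\<^sup>+x. indicator A x \<partial>distr (std_gauss \<Otimes>\<^sub>M std_gauss) borel (\<lambda>x::'v \<times> 'v. c *\<^sub>R fst x + s *\<^sub>R snd x))"
        by (subst nn_integral_distr) auto
      finally show "emeasure (distr MGG borel (\<lambda>x. c *\<^sub>R path (pi / 2) (fst x) + s *\<^sub>R snd x)) A
        = emeasure (distr (std_gauss \<Otimes>\<^sub>M std_gauss) borel (\<lambda>x::'v \<times> 'v. c *\<^sub>R fst x + s *\<^sub>R snd x)) A" by simp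
    qed simp
    also have "\<dots> = std_gauss" by (rule distr_gauss_rotate[OF s(1) c(1)])
    finally show ?thesis .
  qed
  have fg: "\<bar>f x - g x\<bar> \<le> Cs * \<epsilon>1" for x
  proof -
    define y where "y = (1 / s) *\<^sub>R x"
    have fe: "(\<integral>w. gauss_pdf (y - (c / s) *\<^sub>R H w) / s ^ DIM('v) \<partial>MG)
       = Cs * (\<integral>w. exp (- ((y - (c / s) *\<^sub>R H w) \<bullet> (y - (c / s) *\<^sub>R H w)) / 2) \<partial>MG)" for H :: "'a \<times> 'v \<Rightarrow> 'v"
      by (simp add: gauss_pdf_def Cs_def)
    have "f x - g x = Cs * ((\<integral>w. exp (- ((y - (c / s) *\<^sub>R X w) \<bullet> (y - (c / s) *\<^sub>R X w)) / 2) \<partial>MG)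
       - (\<integral>w. exp (- ((y - (c / s) *\<^sub>R path (pi / 2) w) \<bullet> (y - (c / s) *\<^sub>R path (pi / 2) w)) / 2) \<partial>MG))"
      unfolding f_def g_def y_def[symmetric] fe by (simp only: right_diff_distrib)
    then show ?thesis using T3[of y] Cs by (simp add: abs_mult X_def)
  qed
  have g1: "prob_space (density lborel (\<lambda>x. ennreal (g x)))" unfolding lawg by (rule std_gauss.prob_space_axioms)
  have p0: "0 \<le> p" using p by simp
  obtain Q :: "(real \<times> 'v) measure" and V :: "(('a \<times> 'v) \<times> 'v) \<times> real \<times> 'v \<Rightarrow> 'v"
    where Q: "prob_space Q" and V [measurable]: "V \<in> borel_measurable (MGG \<Otimes>\<^sub>M Q)"
      and lawV: "distr (MGG \<Otimes>\<^sub>M Q) borel V = density lborel (\<lambda>x. ennreal (g x))"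
      and costV: "(\<integral>\<^sup>+x. ennreal (norm (Y (fst x) - V x) powr p) \<partial>(MGG \<Otimes>\<^sub>M Q))
       \<le> 2 powr p * (\<integral>\<^sup>+x. ennreal (norm x powr p * \<bar>f x - g x\<bar>) \<partial>lborel)"
    by (rule density_coupling[OF pair2.prob_space_axioms _ lawY _ _ f0 g0 g1 p0]) auto
  have nnY: "(\<integral>\<^sup>+x. ennreal (norm (Y x) powr (p + 1)) \<partial>MGG) \<le> ennreal (2 powr (p + 1) * (2 * Np + 1))"
  proof -
    have "(\<integral>\<^sup>+x. ennreal (norm (Y x) powr (p + 1)) \<partial>MGG)
      \<le> (\<integral>\<^sup>+x. ennreal (2 powr (p + 1)) * (ennreal (norm (X (fst x)) powr (p + 1)) + ennreal (norm (snd x) powr (p + 1))) \<partial>MGG)"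
    proof (rule nn_integral_mono)
      fix x :: "('a \<times> 'v) \<times> 'v"
      have "norm (Y x) powr (p + 1) \<le> 2 powr (p + 1) * (norm (c *\<^sub>R X (fst x)) powr (p + 1) + norm (s *\<^sub>R snd x) powr (p + 1))"
        unfolding Y_def using p by (intro norm_add_powr_bound) auto
      also have "\<dots> \<le> 2 powr (p + 1) * (norm (X (fst x)) powr (p + 1) + norm (snd x) powr (p + 1))"
        using c s p by (intro mult_left_mono add_mono powr_mono2) (auto intro!: mult_left_le_one_le)
      finally show "ennreal (norm (Y x) powr (p + 1)) \<le> ennreal (2 powr (p + 1)) * (ennreal (norm (X (fst x)) powr (p + 1)) + ennreal (norm (snd x) powr (p + 1)))"
        by (simp add: ennreal_plus[symmetric] ennreal_mult[symmetric] ennreal_leI del: ennreal_plus)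
    qed
    also have "\<dots> = ennreal (2 powr (p + 1)) * ((\<integral>\<^sup>+x. ennreal (norm (X x) powr (p + 1)) \<partial>MG) + (\<integral>\<^sup>+z. ennreal (norm z powr (p + 1)) \<partial>\<Gamma>))"
      unfolding \<Gamma>_def
      using nn_integral_MGG_fst[of "\<lambda>x. ennreal (norm (X x) powr (p + 1))"]
        nn_integral_MGG_snd[of "\<lambda>z::'v. ennreal (norm z powr (p + 1))"]
      by (subst nn_integral_cmult, simp, subst nn_integral_add) auto
    also have "\<dots> \<le> ennreal (2 powr (p + 1)) * (ennreal (Np + 1) + ennreal Np)"
      using nnX nn_std by (intro mult_left_mono add_mono) auto
    also have "\<dots> = ennreal (2 powr (p + 1) * (2 * Np + 1))"
      using Np0 by (simp add: ennreal_plus[symmetric] ennreal_mult[symmetric] del: ennreal_plus)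
    finally show ?thesis .
  qed
  \<comment> \<open>Uniform closeness of the densities is used only on the ball, where it is
    multiplied by the volume. Outside, one power of the norm is traded for
    \<open>1 / R0\<close>.\<close>
  have tail: "(\<integral>\<^sup>+x. ennreal (norm x powr p * \<bar>f x - g x\<bar>) \<partial>lborel) \<le> ennreal (R0 powr p * (Cs * \<epsilon>1 * vol) + K3 / R0)"
  proof -
    have "(\<integral>\<^sup>+x. ennreal (norm x powr p * \<bar>f x - g x\<bar>) \<partial>lborel)
      \<le> (\<integral>\<^sup>+x. ennreal (R0 powr p * (Cs * \<epsilon>1)) * indicator (cball 0 R0) x
            + ennreal (1 / R0) * (ennreal (f x) * ennreal (norm x powr (p + 1)) + ennreal (g x) * ennreal (norm x powr (p + 1))) \<partial>lborel)"
    proof (rule nn_integral_mono)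
      fix x :: 'v
      show "ennreal (norm x powr p * \<bar>f x - g x\<bar>) \<le> ennreal (R0 powr p * (Cs * \<epsilon>1)) * indicator (cball 0 R0) x
            + ennreal (1 / R0) * (ennreal (f x) * ennreal (norm x powr (p + 1)) + ennreal (g x) * ennreal (norm x powr (p + 1)))"
      proof (cases "norm x \<le> R0")
        case True
        have "norm x powr p * \<bar>f x - g x\<bar> \<le> R0 powr p * (Cs * \<epsilon>1)"
          using True fg[of x] p by (intro mult_mono powr_mono2) auto
        then have "ennreal (norm x powr p * \<bar>f x - g x\<bar>) \<le> ennreal (R0 powr p * (Cs * \<epsilon>1)) * indicator (cball 0 R0) x"
          using True by (simp add: ennreal_leI)
        then show ?thesis by (rule add_increasing2[rotated]) simp
      next
        case False
        have "norm x powr p * R0 \<le> norm x powr p * norm x" using False by (intro mult_left_mono) auto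
        then have "norm x powr p \<le> 1 / R0 * norm x powr (p + 1)"
          using R0(1) False by (simp add: powr_add field_simps)
        moreover have "\<bar>f x - g x\<bar> \<le> f x + g x" using f0[of x] g0[of x] by linarith
        ultimately have "norm x powr p * \<bar>f x - g x\<bar> \<le> (1 / R0 * norm x powr (p + 1)) * (f x + g x)"
          using R0(1) by (intro mult_mono) auto
        also have "\<dots> = 1 / R0 * (f x * norm x powr (p + 1) + g x * norm x powr (p + 1))"
          by (simp only: distrib_left distrib_right mult_ac)
        finally have "ennreal (norm x powr p * \<bar>f x - g x\<bar>)
           \<le> ennreal (1 / R0 * (f x * norm x powr (p + 1) + g x * norm x powr (p + 1)))" by (rule ennreal_leI)
        also have "\<dots> = ennreal (1 / R0) * (ennreal (f x) * ennreal (norm x powr (p + 1)) + ennreal (g x) * ennreal (norm x powr (p + 1)))"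
          using R0(1) f0[of x] g0[of x] by (subst ennreal_mult) (auto simp: ennreal_mult)
        finally show ?thesis by (rule add_increasing[rotated]) simp
      qed
    qed
    also have "\<dots> = ennreal (R0 powr p * (Cs * \<epsilon>1)) * emeasure lborel (cball (0::'v) R0)
        + ennreal (1 / R0) * ((\<integral>\<^sup>+x. ennreal (f x) * ennreal (norm x powr (p + 1)) \<partial>lborel) + (\<integral>\<^sup>+x. ennreal (g x) * ennreal (norm x powr (p + 1)) \<partial>lborel))"
    proof -
      have affine: "(\<integral>\<^sup>+x. a * indicator S x + b * (F x + H x) \<partial>lborel)
          = a * emeasure lborel S + b * ((\<integral>\<^sup>+x. F x \<partial>lborel) + (\<integral>\<^sup>+x. H x \<partial>lborel))"
        if [measurable]: "S \<in> sets borel" "F \<in> borel_measurable borel" "H \<in> borel_measurable borel"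
        for a b :: ennreal and S :: "'v set" and F H
      proof -
        have "(\<integral>\<^sup>+x. a * indicator S x + b * (F x + H x) \<partial>lborel)
          = (\<integral>\<^sup>+x. a * indicator S x \<partial>lborel) + (\<integral>\<^sup>+x. b * (F x + H x) \<partial>lborel)"
          by (rule nn_integral_add) measurable
        also have "(\<integral>\<^sup>+x. a * indicator S x \<partial>lborel) = a * emeasure lborel S"
          by (rule nn_integral_cmult_indicator) measurable
        also have "(\<integral>\<^sup>+x. b * (F x + H x) \<partial>lborel) = b * (\<integral>\<^sup>+x. F x + H x \<partial>lborel)"
          by (rule nn_integral_cmult) measurable
        also have "(\<integral>\<^sup>+x. F x + H x \<partial>lborel) = (\<integral>\<^sup>+x. F x \<partial>lborel) + (\<integral>\<^sup>+x. H x \<partial>lborel)"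
          by (rule nn_integral_add) measurable
        finally show ?thesis .
      qed
      show ?thesis by (rule affine) measurable
    qed
    also have "(\<integral>\<^sup>+x. ennreal (f x) * ennreal (norm x powr (p + 1)) \<partial>lborel) = (\<integral>\<^sup>+x. ennreal (norm (Y x) powr (p + 1)) \<partial>MGG)"
    proof -
      have "(\<integral>\<^sup>+x. ennreal (f x) * ennreal (norm x powr (p + 1)) \<partial>lborel) = (\<integral>\<^sup>+x. ennreal (norm x powr (p + 1)) \<partial>distr MGG borel Y)"
        unfolding lawY by (subst nn_integral_density) auto
      then show ?thesis by (subst (asm) nn_integral_distr) auto
    qed
    also have "(\<integral>\<^sup>+x. ennreal (g x) * ennreal (norm x powr (p + 1)) \<partial>lborel) = ennreal Np"
    proof -
      have "(\<integral>\<^sup>+x. ennreal (g x) * ennreal (norm x powr (p + 1)) \<partial>lborel) = (\<integral>\<^sup>+x. ennreal (norm x powr (p + 1)) \<partial>\<Gamma>)"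
        unfolding \<Gamma>_def lawg[symmetric] by (subst nn_integral_density) auto
      then show ?thesis by (simp add: nn_std)
    qed
    also have "emeasure lborel (cball (0::'v) R0) = ennreal vol"
      unfolding vol_def using emeasure_lborel_cball_finite[of "0::'v" R0] by (intro emeasure_eq_ennreal_measure) auto
    also have "ennreal (R0 powr p * (Cs * \<epsilon>1)) * ennreal vol + ennreal (1 / R0) * ((\<integral>\<^sup>+x. ennreal (norm (Y x) powr (p + 1)) \<partial>MGG) + ennreal Np)
       \<le> ennreal (R0 powr p * (Cs * \<epsilon>1)) * ennreal vol + ennreal (1 / R0) * (ennreal (2 powr (p + 1) * (2 * Np + 1)) + ennreal Np)"
      using nnY by (intro add_left_mono mult_left_mono add_right_mono) auto
    also have "\<dots> = ennreal (R0 powr p * (Cs * \<epsilon>1) * vol + 1 / R0 * (2 powr (p + 1) * (2 * Np + 1) + Np))"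
      using R0(1) Cs eps1(1) Np0
      by (simp add: ennreal_plus[symmetric] ennreal_mult[symmetric] vol_def del: ennreal_plus)
    also have "\<dots> = ennreal (R0 powr p * (Cs * \<epsilon>1 * vol) + K3 / R0)"
      by (simp add: K3_def mult_ac)
    finally show ?thesis .
  qed
  have cost3: "(\<integral>\<^sup>+x. ennreal (norm (Y (fst x) - V x) powr p) \<partial>(MGG \<Otimes>\<^sub>M Q)) \<le> ennreal \<eta>"
  proof -
    have "ennreal (2 powr p) * (\<integral>\<^sup>+x. ennreal (norm x powr p * \<bar>f x - g x\<bar>) \<partial>lborel)
      \<le> ennreal (2 powr p) * ennreal (R0 powr p * (Cs * \<epsilon>1 * vol) + K3 / R0)"
      using tail by (intro mult_left_mono) auto
    also have "\<dots> = ennreal (K4 * \<epsilon>1 + 2 powr p * (K3 / R0))"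
      using R0(1) Cs eps1(1) K3 by (subst ennreal_mult[symmetric]) (auto simp: K4_def vol_def algebra_simps)
    also have "\<dots> \<le> ennreal \<eta>" using R0(2) eps1(4) by (intro ennreal_leI) linarith
    finally show ?thesis using costV by (rule order_trans[rotated])
  qed
  have cost2: "(\<integral>\<^sup>+x. ennreal (norm (X (fst x) - Y x) powr p) \<partial>MGG) \<le> ennreal \<eta>"
  proof -
    have pp: "norm w1 powr p \<le> 1 + norm w1 powr (p + 1)" for w1 :: 'v
    proof (cases "norm w1 \<le> 1")
      case True
      then have "norm w1 powr p \<le> 1" using p by (intro powr_le1) auto
      then show ?thesis by (simp add: add_increasing2)
    next
      case False
      then have "norm w1 powr p \<le> norm w1 powr (p + 1)" by (intro powr_mono) auto
      then show ?thesis by simp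
    qed
    have sp: "s powr p \<le> s" using s p powr_mono'[of 1 p s] by simp
    have "(\<integral>\<^sup>+x. ennreal (norm (X (fst x) - Y x) powr p) \<partial>MGG)
      \<le> (\<integral>\<^sup>+x. ennreal (2 powr p * s) * (2 + ennreal (norm (X (fst x)) powr (p + 1)) + ennreal (norm (snd x) powr (p + 1))) \<partial>MGG)"
    proof (rule nn_integral_mono)
      fix x :: "('a \<times> 'v) \<times> 'v"
      have "X (fst x) - Y x = (1 - c) *\<^sub>R X (fst x) + (- s) *\<^sub>R snd x" by (simp add: Y_def algebra_simps)
      then have "norm (X (fst x) - Y x) powr p \<le> 2 powr p * (norm ((1 - c) *\<^sub>R X (fst x)) powr p + norm ((- s) *\<^sub>R snd x) powr p)"
        using norm_add_powr_bound[OF p0, of "(1 - c) *\<^sub>R X (fst x)" "(- s) *\<^sub>R snd x"] by simp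
      also have "\<dots> = 2 powr p * ((1 - c) powr p * norm (X (fst x)) powr p + s powr p * norm (snd x) powr p)"
        using c s by (simp add: powr_mult)
      also have "\<dots> \<le> 2 powr p * (s powr p * norm (X (fst x)) powr p + s powr p * norm (snd x) powr p)"
        using c p by (intro mult_left_mono add_mono mult_right_mono powr_mono2) auto
      also have "\<dots> = 2 powr p * (s powr p * (norm (X (fst x)) powr p + norm (snd x) powr p))" by (simp add: distrib_left)
      also have "\<dots> \<le> 2 powr p * (s * (norm (X (fst x)) powr p + norm (snd x) powr p))"
        using sp by (intro mult_left_mono mult_right_mono) auto
      also have "\<dots> \<le> 2 powr p * (s * (2 + norm (X (fst x)) powr (p + 1) + norm (snd x) powr (p + 1)))"
        using s pp[of "X (fst x)"] pp[of "snd x"] by (intro mult_left_mono) auto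
      finally have "ennreal (norm (X (fst x) - Y x) powr p)
        \<le> ennreal ((2 powr p * s) * (2 + norm (X (fst x)) powr (p + 1) + norm (snd x) powr (p + 1)))"
        by (intro ennreal_leI) (simp add: mult.assoc)
      also have "\<dots> = ennreal (2 powr p * s) * (2 + ennreal (norm (X (fst x)) powr (p + 1)) + ennreal (norm (snd x) powr (p + 1)))"
        using s by (subst ennreal_mult) auto
      finally show "ennreal (norm (X (fst x) - Y x) powr p) \<le> ennreal (2 powr p * s) * (2 + ennreal (norm (X (fst x)) powr (p + 1)) + ennreal (norm (snd x) powr (p + 1)))" .
    qed
    also have "\<dots> = ennreal (2 powr p * s) * (2 + (\<integral>\<^sup>+x. ennreal (norm (X x) powr (p + 1)) \<partial>MG) + (\<integral>\<^sup>+z. ennreal (norm z powr (p + 1)) \<partial>\<Gamma>))"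
      unfolding \<Gamma>_def
      using nn_integral_MGG_fst[of "\<lambda>x. ennreal (norm (X x) powr (p + 1))"]
        nn_integral_MGG_snd[of "\<lambda>z::'v. ennreal (norm z powr (p + 1))"]
        pair2.emeasure_space_1
      by (subst nn_integral_cmult, simp, subst nn_integral_add, simp, simp, subst nn_integral_add) auto
    also have "\<dots> \<le> ennreal (2 powr p * s) * (2 + ennreal (Np + 1) + ennreal Np)"
      using nnX nn_std by (intro mult_left_mono add_mono) auto
    also have "\<dots> = ennreal ((2 powr p * s) * (2 * Np + 3))"
    proof -
      have "2 + ennreal (Np + 1) + ennreal Np = ennreal (2 * Np + 3)"
        using Np0 ennreal_plus[of 2 "Np + 1"] ennreal_plus[of "2 + (Np + 1)" Np] by (simp add: algebra_simps)
      moreover have "ennreal ((2 powr p * s) * (2 * Np + 3)) = ennreal (2 powr p * s) * ennreal (2 * Np + 3)"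
        using s Np0 by (intro ennreal_mult) auto
      ultimately show ?thesis by (simp only:)
    qed
    also have "\<dots> \<le> ennreal \<eta>" using s(3) by (intro ennreal_leI) (simp add: K2_def mult_ac)
    finally show ?thesis .
  qed
  let ?\<Omega> = "MGG \<Otimes>\<^sub>M Q"
  have "(\<integral>\<^sup>+x. ennreal (norm (path \<theta>0 (fst (fst x)) - V x) powr p) \<partial>?\<Omega>)
    \<le> (\<integral>\<^sup>+x. ennreal (3 powr (p - 1)) * (ennreal (norm (path \<theta>0 (fst (fst x)) - X (fst (fst x))) powr p)
        + ennreal (norm (X (fst (fst x)) - Y (fst x)) powr p) + ennreal (norm (Y (fst x) - V x) powr p)) \<partial>?\<Omega>)"
  proof (rule nn_integral_mono)
    fix x :: "(('a \<times> 'v) \<times> 'v) \<times> real \<times> 'v"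
    define w1 where "w1 i = (if i = (0::nat) then path \<theta>0 (fst (fst x)) - X (fst (fst x)) else
       if i = 1 then X (fst (fst x)) - Y (fst x) else Y (fst x) - V x)" for i
    have "norm (\<Sum>i<3. w1 i) powr p \<le> real (card {..<3::nat}) powr (p - 1) * (\<Sum>i<3. norm (w1 i) powr p)"
      by (rule sum_norm_powr_le) (use p in auto)
    then have "norm (path \<theta>0 (fst (fst x)) - V x) powr p \<le> 3 powr (p - 1) * (norm (path \<theta>0 (fst (fst x)) - X (fst (fst x))) powr p
        + norm (X (fst (fst x)) - Y (fst x)) powr p + norm (Y (fst x) - V x) powr p)"
      by (simp add: w1_def numeral_3_eq_3)
    then show "ennreal (norm (path \<theta>0 (fst (fst x)) - V x) powr p)
      \<le> ennreal (3 powr (p - 1)) * (ennreal (norm (path \<theta>0 (fst (fst x)) - X (fst (fst x))) powr p)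
        + ennreal (norm (X (fst (fst x)) - Y (fst x)) powr p) + ennreal (norm (Y (fst x) - V x) powr p))"
      by (simp add: ennreal_plus[symmetric] ennreal_mult[symmetric] ennreal_leI del: ennreal_plus)
  qed
  also have "\<dots> = ennreal (3 powr (p - 1)) * ((\<integral>\<^sup>+x. ennreal (norm (path \<theta>0 x - X x) powr p) \<partial>MG)
        + (\<integral>\<^sup>+x. ennreal (norm (X (fst x) - Y x) powr p) \<partial>MGG) + (\<integral>\<^sup>+x. ennreal (norm (Y (fst x) - V x) powr p) \<partial>?\<Omega>))"
    using nn_integral_MGG_fst[of "\<lambda>x. ennreal (norm (path \<theta>0 x - X x) powr p)"]
      nn_integral_pair_fst[OF pair2.prob_space_axioms Q, of "\<lambda>x. ennreal (norm (path \<theta>0 (fst x) - X (fst x)) powr p)"]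
      nn_integral_pair_fst[OF pair2.prob_space_axioms Q, of "\<lambda>x. ennreal (norm (X (fst x) - Y x) powr p)"]
    by (subst nn_integral_cmult, simp, subst nn_integral_add, simp, simp, subst nn_integral_add) auto
  also have "\<dots> \<le> ennreal (3 powr (p - 1)) * (ennreal (\<tau> powr p * G + \<eta>) + ennreal \<eta> + ennreal \<eta>)"
    using nnXp cost2 cost3 by (intro mult_left_mono add_mono) auto
  also have "\<dots> = ennreal (3 powr (p - 1) * (\<tau> powr p * G) + 3 * (3 powr (p - 1) * \<eta>))"
  proof -
    have "ennreal (\<tau> powr p * G + \<eta>) + ennreal \<eta> + ennreal \<eta> = ennreal (\<tau> powr p * G + 3 * \<eta>)"
      using eta G by (subst ennreal_plus[symmetric], simp, simp, subst ennreal_plus[symmetric]) (auto simp: algebra_simps)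
    moreover have "ennreal (3 powr (p - 1) * (\<tau> powr p * G + 3 * \<eta>)) = ennreal (3 powr (p - 1)) * ennreal (\<tau> powr p * G + 3 * \<eta>)"
      using eta G by (intro ennreal_mult) auto
    moreover have "3 powr (p - 1) * (\<tau> powr p * G + 3 * \<eta>) = 3 powr (p - 1) * (\<tau> powr p * G) + 3 * (3 powr (p - 1) * \<eta>)"
      by (simp add: algebra_simps)
    ultimately show ?thesis by (simp only:)
  qed
  also have "\<dots> \<le> ennreal (3 powr (p - 1) * ((pi / 2 - \<theta>0) powr p * G) + \<epsilon>)"
    using eps by (intro ennreal_leI) (simp add: \<eta>_def \<tau>_def)
  finally have "(\<integral>\<^sup>+x. ennreal (norm (path \<theta>0 (fst (fst x)) - V x) powr p) \<partial>?\<Omega>)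
     \<le> ennreal (3 powr (p - 1) * ((pi / 2 - \<theta>0) powr p * G) + \<epsilon>)" .
  then show ?thesis by (rule that[OF Q V lawV[unfolded lawg]])
qed

end

section \<open>Locally dependent sums and the Stein representation of the velocity\<close>

lemma m_dependentD:
  assumes "m_dependent P n M X" and "prob_space P"
    and "I \<subseteq> {..<n}" "J \<subseteq> {..<n}" "\<And>i j. i \<in> I \<Longrightarrow> j \<in> J \<Longrightarrow> int M < \<bar>int i - int j\<bar>"
    and F: "F \<in> Pi\<^sub>M I (\<lambda>_. borel) \<rightarrow>\<^sub>M N1" and G: "G \<in> Pi\<^sub>M J (\<lambda>_. borel) \<rightarrow>\<^sub>M N2"
  shows "prob_space.indep_var P N1 (\<lambda>w. F (\<lambda>i\<in>I. X i w)) N2 (\<lambda>w. G (\<lambda>j\<in>J. X j w))"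
proof -
  have "prob_space.indep_var P (Pi\<^sub>M I (\<lambda>_. borel)) (\<lambda>w. \<lambda>i\<in>I. X i w) (Pi\<^sub>M J (\<lambda>_. borel)) (\<lambda>w. \<lambda>j\<in>J. X j w)"
    using assms(1,3-5) unfolding m_dependent_def by blast
  from prob_space.indep_var_compose[OF assms(2) this F G] show ?thesis by (simp add: comp_def)
qed

lemma m_dependent_compose:
  fixes X :: "nat \<Rightarrow> 'a \<Rightarrow> real ^ 'd" and h :: "nat \<Rightarrow> real ^ 'd \<Rightarrow> real ^ 'e"
  assumes "m_dependent P n M X" and "prob_space P" and h [measurable]: "\<And>i. h i \<in> borel_measurable borel"
  shows "m_dependent P n M (\<lambda>i w. h i (X i w))"
  unfolding m_dependent_def
proof (intro allI impI)
  have rm: "(\<lambda>x. \<lambda>i\<in>S. h i (x i)) \<in> Pi\<^sub>M S (\<lambda>_. borel) \<rightarrow>\<^sub>M Pi\<^sub>M S (\<lambda>_. borel)" for S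
    by (intro measurable_restrict measurable_compose[OF _ h] measurable_component_singleton)
  fix I J assume IJ: "I \<subseteq> {..<n} \<and> J \<subseteq> {..<n} \<and> (\<forall>i\<in>I. \<forall>j\<in>J. int M < \<bar>int i - int j\<bar>)"
  have "prob_space.indep_var P (Pi\<^sub>M I (\<lambda>_. borel)) (\<lambda>w. (\<lambda>x. \<lambda>i\<in>I. h i (x i)) (\<lambda>i\<in>I. X i w))
      (Pi\<^sub>M J (\<lambda>_. borel)) (\<lambda>w. (\<lambda>x. \<lambda>i\<in>J. h i (x i)) (\<lambda>i\<in>J. X i w))"
    by (rule m_dependentD[OF assms(1,2) _ _ _ rm rm]) (use IJ in auto)
  then show "prob_space.indep_var P (Pi\<^sub>M I (\<lambda>_. borel)) (\<lambda>w. \<lambda>i\<in>I. h i (X i w)) (Pi\<^sub>M J (\<lambda>_. borel)) (\<lambda>w. \<lambda>j\<in>J. h j (X j w))"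
    by (simp cong: restrict_cong)
qed

text \<open>Jensen's inequality, from integrating Young's inequality for \<open>norm (Y w)\<close>
  and \<open>a powr (r - 1)\<close> with \<open>a\<close> the expectation of the norm.\<close>

lemma (in prob_space) norm_integral_powr_le:
  fixes Y :: "'a \<Rightarrow> 'v::euclidean_space"
  assumes [measurable]: "Y \<in> borel_measurable M" and int: "integrable M (\<lambda>w. norm (Y w) powr r)" and r: "1 \<le> r"
  shows "norm (expectation Y) powr r \<le> expectation (\<lambda>w. norm (Y w) powr r)"
proof -
  have iY: "integrable M Y" by (rule integrable_norm_powr_imp[OF _ int r]) simp
  have "norm (expectation Y) powr r \<le> expectation (\<lambda>w. norm (Y w)) powr r"
    using r by (intro powr_mono2 integral_norm_bound) auto
  also have "expectation (\<lambda>w. norm (Y w)) powr r \<le> expectation (\<lambda>w. norm (Y w) powr r)"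
  proof (cases "r = 1")
    case False
    define a where "a = expectation (\<lambda>w. norm (Y w))"
    have a: "0 \<le> a" by (simp add: a_def)
    have young: "norm (Y w) * a powr (r - 1) \<le> norm (Y w) powr r / r + a powr r / (r / (r - 1))" for w
    proof -
      have "(r - 1) * (r / (r - 1)) = r" "1 / r + 1 / (r / (r - 1)) = 1" "1 < r / (r - 1)"
        using r False by (auto simp: field_simps)
      then show ?thesis
        using Youngs_inequality[of r "r / (r - 1)" "norm (Y w)" "a powr (r - 1)"] r False
        by (simp only: powr_powr) simp
    qed
    have "a powr r = a * a powr (r - 1)" using a by (cases "a = 0") (auto simp: powr_diff)
    also have "\<dots> = expectation (\<lambda>w. norm (Y w) * a powr (r - 1))" by (simp add: a_def)
    also have "\<dots> \<le> expectation (\<lambda>w. norm (Y w) powr r / r + a powr r / (r / (r - 1)))"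
      using iY int young by (intro integral_mono) auto
    also have "\<dots> = expectation (\<lambda>w. norm (Y w) powr r) / r + a powr r / (r / (r - 1))"
      using int by (simp add: prob_space)
    finally show ?thesis using r False by (simp add: a_def[symmetric] field_simps)
  qed simp
  finally show ?thesis .
qed

lemma (in prob_space) centered_powr_le:
  fixes Y :: "'a \<Rightarrow> 'v::euclidean_space"
  assumes [measurable]: "Y \<in> borel_measurable M" and int: "integrable M (\<lambda>w. norm (Y w) powr r)" and r: "1 \<le> r"
  shows "expectation (\<lambda>w. norm (Y w - expectation Y) powr r) \<le> 2 powr (r + 1) * expectation (\<lambda>w. norm (Y w) powr r)"
    and "integrable M (\<lambda>w. norm (Y w - expectation Y) powr r)"
proof -
  have "integrable M (\<lambda>w. norm (Y w + (- expectation Y)) powr r)"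
    by (rule integrable_norm_powr_add) (use int r in auto)
  then show i: "integrable M (\<lambda>w. norm (Y w - expectation Y) powr r)" by simp
  have "expectation (\<lambda>w. norm (Y w - expectation Y) powr r)
    \<le> expectation (\<lambda>w. 2 powr r * (norm (Y w) powr r + norm (expectation Y) powr r))"
    using norm_add_powr_bound[of r _ "- expectation Y"] r int i by (intro integral_mono) auto
  also have "\<dots> = 2 powr r * (expectation (\<lambda>w. norm (Y w) powr r) + norm (expectation Y) powr r)"
    using int by (simp add: prob_space)
  also have "\<dots> \<le> 2 powr r * (expectation (\<lambda>w. norm (Y w) powr r) + expectation (\<lambda>w. norm (Y w) powr r))"
    using norm_integral_powr_le[OF assms] by (intro mult_left_mono add_left_mono) auto
  finally show "expectation (\<lambda>w. norm (Y w - expectation Y) powr r) \<le> 2 powr (r + 1) * expectation (\<lambda>w. norm (Y w) powr r)"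
    by (simp add: powr_add)
qed

context bounded_vector
begin

text \<open>Young's inequality replaces the conditional Jensen inequality: the velocity is a conditional
  expectation of any \<open>V\<close> that has the same pairing with functions of the path.\<close>

lemma vel_powr_le:
  fixes V :: "'a \<times> 'v \<Rightarrow> 'v"
  assumes th: "0 < \<theta>" "\<theta> \<le> pi / 2" and p: "2 \<le> p" and [measurable]: "V \<in> borel_measurable (M \<Otimes>\<^sub>M std_gauss)"
    and Vb: "\<And>w z. w \<in> space M \<Longrightarrow> norm (V (w, z)) \<le> C * exp (k * norm z)" and k: "0 \<le> k" and C: "0 \<le> C"
    and pairing: "\<And>g A r. g \<in> borel_measurable borel \<Longrightarrow> 0 \<le> r \<Longrightarrow> 0 \<le> A \<Longrightarrow> (\<And>x. norm (g x) \<le> A * exp (r * norm x)) \<Longrightarrow>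
      (\<integral>x. g (path \<theta> x) \<bullet> V x \<partial>MG) = (\<integral>x. g (path \<theta> x) \<bullet> path' \<theta> x \<partial>MG)"
  shows "(\<integral>x. norm (vel \<theta> (path \<theta> x)) powr p \<partial>MG) \<le> (\<integral>x. norm (V x) powr p \<partial>MG)"
proof -
  obtain L where L: "1 \<le> L" and qm: "quad_map L (vel \<theta>) (dvel \<theta>)" using quad_map_vel[OF th] th by blast
  have vb: "norm (vel \<theta> x) \<le> L * exp (norm x)" for x
  proof -
    have "norm (vel \<theta> x) \<le> L * (1 + norm x)" using qm by (auto simp: quad_map_def)
    also have "\<dots> \<le> L * exp (norm x)" using L by (intro mult_left_mono) auto
    finally show ?thesis .
  qed
  \<comment> \<open>The gradient of the p-th power at the velocity. Pairing it with the velocity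
    gives the p-th moment, and pairing it with \<open>V\<close> has the same integral.\<close>
  define g where "g x = powr_grad p (vel \<theta> x)" for x
  have pb: "norm (vel \<theta> x) powr r \<le> L powr r * exp (r * norm x)" if "0 \<le> r" for r x
  proof -
    have "norm (vel \<theta> x) powr r \<le> (L * exp (norm x)) powr r" using vb that by (intro powr_mono2) auto
    then show ?thesis using L by (simp add: powr_mult exp_powr_real mult.commute)
  qed
  have gm: "g \<in> borel_measurable borel" unfolding g_def powr_grad_def by measurable
  note [measurable] = gm
  have gb: "norm (g x) \<le> L powr (p - 1) * exp ((p - 1) * norm x)" for x
    unfolding g_def norm_powr_grad using p by (intro pb) auto
  have expR: "L powr r * exp (r * norm (path \<theta> (w, z))) \<le> (L powr r * exp (r * R)) * exp (r * norm z)"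
    if "w \<in> space M" "0 \<le> r" for w z r
  proof -
    have "r * norm (path \<theta> (w, z)) \<le> r * (R + norm z)" using norm_path_le[OF that(1)] that(2) by (intro mult_left_mono) auto
    then have "exp (r * norm (path \<theta> (w, z))) \<le> exp (r * R) * exp (r * norm z)" by (simp add: exp_add[symmetric] distrib_left)
    then show ?thesis by (simp add: mult.assoc mult_left_mono)
  qed
  have int_v: "integrable MG (\<lambda>x. norm (vel \<theta> (path \<theta> x)) powr p)"
  proof (rule integrable_exp_bound[where k = p])
    fix w and z :: 'v assume w1: "w \<in> space M"
    show "norm (norm (vel \<theta> (path \<theta> (w, z))) powr p) \<le> (L powr p * exp (p * R)) * exp (p * norm z)"
      using pb[of p "path \<theta> (w, z)"] expR[OF w1, of p z] p by simp
  qed measurable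
  have int_V: "integrable MG (\<lambda>x. norm (V x) powr p)"
  proof (rule integrable_exp_bound[where C = "C powr p" and k = "p * k"])
    fix w and z :: 'v assume w1: "w \<in> space M"
    have "norm (V (w, z)) powr p \<le> (C * exp (k * norm z)) powr p" using Vb[OF w1] p by (intro powr_mono2) auto
    then show "norm (norm (V (w, z)) powr p) \<le> C powr p * exp (p * k * norm z)"
      using C by (simp add: powr_mult exp_powr_real mult_ac)
  qed measurable
  have int_gV: "integrable MG (\<lambda>x. g (path \<theta> x) \<bullet> V x)"
  proof (rule integrable_exp_bound[where C = "(L powr (p - 1) * exp ((p - 1) * R)) * C" and k = "(p - 1) + k"])
    fix w and z :: 'v assume w1: "w \<in> space M"
    have "norm (g (path \<theta> (w, z)) \<bullet> V (w, z)) \<le> norm (g (path \<theta> (w, z))) * norm (V (w, z))"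
      using Cauchy_Schwarz_ineq2 by simp
    also have "\<dots> \<le> ((L powr (p - 1) * exp ((p - 1) * R)) * exp ((p - 1) * norm z)) * (C * exp (k * norm z))"
      using order_trans[OF gb expR[OF w1, of "p - 1" z]] Vb[OF w1] p by (intro mult_mono) auto
    also have "\<dots> = (L powr (p - 1) * exp ((p - 1) * R)) * C * exp (((p - 1) + k) * norm z)"
      unfolding distrib_right exp_add by (simp only: mult_ac)
    finally show "norm (g (path \<theta> (w, z)) \<bullet> V (w, z)) \<le> (L powr (p - 1) * exp ((p - 1) * R)) * C * exp (((p - 1) + k) * norm z)" .
  qed measurable
  have "(\<integral>x. norm (vel \<theta> (path \<theta> x)) powr p \<partial>MG) = (\<integral>x. g (path \<theta> x) \<bullet> vel \<theta> (path \<theta> x) \<partial>MG)"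
    by (simp add: g_def powr_grad_inner_self)
  also have "\<dots> = (\<integral>x. g (path \<theta> x) \<bullet> path' \<theta> x \<partial>MG)"
    by (rule vel_identity(1)[OF gm gb _ _ th, symmetric]) (use p in auto)
  also have "\<dots> = (\<integral>x. g (path \<theta> x) \<bullet> V x \<partial>MG)"
    by (rule pairing[OF gm _ _ gb, symmetric]) (use p in auto)
  finally have eq: "p * (\<integral>x. norm (vel \<theta> (path \<theta> x)) powr p \<partial>MG) = (\<integral>x. p * (g (path \<theta> x) \<bullet> V x) \<partial>MG)"
    by simp
  \<comment> \<open>The moment of the velocity appears on both sides. It is finite by
    \<open>int_v\<close>, so \<open>p - 1\<close> copies of it may be subtracted.\<close>
  also have "\<dots> \<le> (\<integral>x. (p - 1) * norm (vel \<theta> (path \<theta> x)) powr p + norm (V x) powr p \<partial>MG)"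
    using int_gV int_v int_V powr_grad_young[OF p] by (intro integral_mono) (auto simp: g_def)
  also have "\<dots> = (p - 1) * (\<integral>x. norm (vel \<theta> (path \<theta> x)) powr p \<partial>MG) + (\<integral>x. norm (V x) powr p \<partial>MG)"
    using int_v int_V by simp
  finally show ?thesis by (simp add: algebra_simps)
qed

end

section \<open>Bounded m-dependent families and their windows\<close>

locale mdep_family = prob_space P for P :: "'a measure" +
  fixes X :: "nat \<Rightarrow> 'a \<Rightarrow> real ^ 'd" and n m :: nat and \<tau> :: real
  assumes X_measurable [measurable]: "\<And>i. X i \<in> borel_measurable P"
    and X_mdep: "m_dependent P n m X"
    and X_mean: "\<And>i. i < n \<Longrightarrow> expectation (X i) = 0"
    and X_bound: "\<And>i w. w \<in> space P \<Longrightarrow> norm (X i w) \<le> \<tau>"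
    and tau_nonneg: "0 \<le> \<tau>" and n_pos: "0 < n"
begin

definition W :: "'a \<Rightarrow> real ^ 'd" where "W w = (\<Sum>i<n. X i w)"

definition nbr :: "nat \<Rightarrow> nat set" where "nbr i = {j. j < n \<and> \<bar>int i - int j\<bar> \<le> int m}"

definition eta :: "nat \<Rightarrow> 'a \<Rightarrow> real ^ 'd" where "eta i w = (\<Sum>j\<in>nbr i. X j w)"

lemma nbr_subset: "nbr i \<subseteq> {..<n}" and finite_nbr: "finite (nbr i)"
  by (auto simp: nbr_def intro: finite_subset[of _ "{..<n}"])

lemma card_nbr: "card (nbr i) \<le> 2 * m + 1"
proof -
  have "nbr i \<subseteq> {i - m..i + m}" by (auto simp: nbr_def)
  then have "card (nbr i) \<le> card {i - m..i + m}" by (intro card_mono) auto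
  also have "\<dots> \<le> 2 * m + 1" by simp
  finally show ?thesis .
qed

lemma W_measurable' [measurable]: "W \<in> borel_measurable P"
  unfolding W_def by measurable

lemma eta_measurable [measurable]: "eta i \<in> borel_measurable P"
  unfolding eta_def by measurable

lemma norm_W: "w \<in> space P \<Longrightarrow> norm (W w) \<le> n * \<tau>"
  unfolding W_def using X_bound by (intro order.trans[OF norm_sum] sum_bounded_above[THEN order.trans]) auto

lemma norm_eta: "w \<in> space P \<Longrightarrow> norm (eta i w) \<le> (2 * m + 1) * \<tau>"
proof -
  assume w1: "w \<in> space P"
  have "norm (eta i w) \<le> (\<Sum>j\<in>nbr i. norm (X j w))" unfolding eta_def by (rule norm_sum)
  also have "\<dots> \<le> card (nbr i) * \<tau>" using X_bound[OF w1] by (intro sum_bounded_above) auto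
  also have "\<dots> \<le> (2 * m + 1) * \<tau>" using card_nbr[of i] tau_nonneg by (intro mult_right_mono) auto
  finally show ?thesis .
qed

sublocale bounded_vector P W "real n * \<tau>"
  by unfold_locales (use norm_W tau_nonneg in auto)

lemma indep_far: "i < n \<Longrightarrow> indep_var borel (X i) borel (\<lambda>w. W w - eta i w)"
proof -
  assume i: "i < n"
  have eq: "W w - eta i w = (\<Sum>j\<in>{..<n} - nbr i. X j w)" for w
    unfolding W_def eta_def using nbr_subset[of i] by (simp add: sum_diff)
  have "indep_var borel (\<lambda>w. (\<lambda>x. x i) (\<lambda>i\<in>{i}. X i w)) borel (\<lambda>w. (\<lambda>x. \<Sum>j\<in>{..<n} - nbr i. x j) (\<lambda>j\<in>{..<n} - nbr i. X j w))"
    by (rule m_dependentD[OF X_mdep prob_space_axioms])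
       (use i in \<open>auto simp: nbr_def intro!: borel_measurable_sum measurable_component_singleton\<close>)
  moreover have "(\<Sum>j\<in>{..<n} - nbr i. (\<lambda>j\<in>{..<n} - nbr i. X j w) j) = W w - eta i w" for w
    unfolding eq by (intro sum.cong) auto
  ultimately show ?thesis by simp
qed

text \<open>A window reaches \<open>m\<close> indices to either side, and independence needs a gap
  of more than \<open>m\<close>; the spacing \<open>3 * m + 1\<close> leaves exactly
  \<open>m + 1\<close>. The function may depend on the index, so that centring constants can be
  absorbed into it.\<close>

lemma indep_windows:
  fixes F :: "nat \<Rightarrow> real ^ 'd \<Rightarrow> real ^ 'd \<Rightarrow> real ^ 'd"
  assumes F [measurable]: "\<And>i. (\<lambda>(x, y). F i x y) \<in> borel_measurable (borel \<Otimes>\<^sub>M borel)"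
    and b: "b = min (3 * m + 1) n" and c: "c < b" "j * b + c < n"
  shows "indep_var borel (\<lambda>w. \<Sum>k<j. F (k * b + c) (X (k * b + c) w) (eta (k * b + c) w))
    borel (\<lambda>w. F (j * b + c) (X (j * b + c) w) (eta (j * b + c) w))"
proof -
  define I where "I = (\<Union>k<j. nbr (k * b + c))"
  define J where "J = nbr (j * b + c)"
  have own: "i \<in> nbr i" if "i < n" for i using that by (simp add: nbr_def)
  have lt: "k * b + c < n" if "k < j" for k
    using mult_le_mono1[of k j b] that c(2) by linarith
  have sep: "int m < \<bar>int x - int y\<bar>" if x: "x \<in> I" and y: "y \<in> J" for x y
  proof -
    obtain k where k: "k < j" "x \<in> nbr (k * b + c)" using x by (auto simp: I_def)
    \<comment> \<open>If \<open>b = n\<close>, every class consists of one index and there is no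
      earlier window; the element \<open>x\<close> of \<open>I\<close> excludes this.\<close>
    have "b \<noteq> n"
    proof
      assume "b = n"
      then have "n \<le> j * b" using k(1) by (cases j) auto
      then show False using c(2) by simp
    qed
    then have b3: "b = 3 * m + 1" using b unfolding min_def by (auto split: if_splits)
    have "k * b + b \<le> j * b" using mult_le_mono1[of "Suc k" j b] k(1) by simp
    then have "int (k * b + c) + 3 * int m + 1 \<le> int (j * b + c)" using b3 by linarith
    then show ?thesis using k(2) y by (auto simp: nbr_def J_def)
  qed
  define F1 where "F1 x = (\<Sum>k<j. F (k * b + c) (x (k * b + c)) (\<Sum>l\<in>nbr (k * b + c). x l))" for x :: "nat \<Rightarrow> real ^ 'd"
  define F2 where "F2 x = F (j * b + c) (x (j * b + c)) (\<Sum>l\<in>nbr (j * b + c). x l)" for x :: "nat \<Rightarrow> real ^ 'd"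
  have comp: "(\<lambda>x. x i) \<in> borel_measurable (Pi\<^sub>M S (\<lambda>_. borel :: (real ^ 'd) measure))" if "i \<in> S" for i S
    using that by (rule measurable_component_singleton)
  have m1: "F1 \<in> Pi\<^sub>M I (\<lambda>_. borel) \<rightarrow>\<^sub>M borel"
    unfolding F1_def
  proof (rule borel_measurable_sum)
    fix k assume k: "k \<in> {..<j}"
    have "(\<lambda>x. x (k * b + c)) \<in> borel_measurable (Pi\<^sub>M I (\<lambda>_. borel :: (real ^ 'd) measure))"
      using k own[OF lt] by (intro comp) (auto simp: I_def)
    moreover have "(\<lambda>x. \<Sum>l\<in>nbr (k * b + c). x l) \<in> borel_measurable (Pi\<^sub>M I (\<lambda>_. borel :: (real ^ 'd) measure))"
      using k by (intro borel_measurable_sum comp) (auto simp: I_def)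
    ultimately show "(\<lambda>x. F (k * b + c) (x (k * b + c)) (\<Sum>l\<in>nbr (k * b + c). x l)) \<in> borel_measurable (Pi\<^sub>M I (\<lambda>_. borel))"
      using measurable_compose[OF measurable_Pair F[of "k * b + c"]] by simp
  qed
  have m2: "F2 \<in> Pi\<^sub>M J (\<lambda>_. borel) \<rightarrow>\<^sub>M borel"
  proof -
    have "(\<lambda>x. x (j * b + c)) \<in> borel_measurable (Pi\<^sub>M J (\<lambda>_. borel :: (real ^ 'd) measure))"
      using own[OF c(2)] by (intro comp) (auto simp: J_def)
    moreover have "(\<lambda>x. \<Sum>l\<in>nbr (j * b + c). x l) \<in> borel_measurable (Pi\<^sub>M J (\<lambda>_. borel :: (real ^ 'd) measure))"
      by (intro borel_measurable_sum comp) (auto simp: J_def)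
    ultimately show ?thesis
      unfolding F2_def using measurable_compose[OF measurable_Pair F[of "j * b + c"]] by simp
  qed
  have "indep_var borel (\<lambda>w. F1 (\<lambda>i\<in>I. X i w)) borel (\<lambda>w. F2 (\<lambda>i\<in>J. X i w))"
    by (rule m_dependentD[OF X_mdep prob_space_axioms _ _ sep m1 m2])
       (use nbr_subset in \<open>auto simp: I_def J_def\<close>)
  moreover have "F1 (\<lambda>i\<in>I. X i w) = (\<Sum>k<j. F (k * b + c) (X (k * b + c) w) (eta (k * b + c) w))" for w
    unfolding F1_def eta_def using own[OF lt] by (intro sum.cong refl arg_cong2[where f = "F _"]) (auto simp: I_def)
  moreover have "F2 (\<lambda>i\<in>J. X i w) = F (j * b + c) (X (j * b + c) w) (eta (j * b + c) w)" for w
    unfolding F2_def eta_def using own[OF c(2)] by (intro arg_cong2[where f = "F _"] sum.cong refl) (auto simp: J_def)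
  ultimately show ?thesis by simp
qed

text \<open>The windows of indices in the same class modulo \<open>3 m + 1\<close> are more than \<open>m\<close> apart, hence independent.\<close>

lemma rosenthal_windows:
  fixes p y2 yp :: real and F :: "nat \<Rightarrow> real ^ 'd \<Rightarrow> real ^ 'd \<Rightarrow> real ^ 'd"
  assumes F [measurable]: "\<And>i. (\<lambda>(x, y). F i x y) \<in> borel_measurable (borel \<Otimes>\<^sub>M borel)" and p: "2 \<le> p"
    and int: "\<And>i. i < n \<Longrightarrow> integrable P (\<lambda>w. norm (F i (X i w) (eta i w)) powr p)"
    and y2: "\<And>i. i < n \<Longrightarrow> expectation (\<lambda>w. (norm (F i (X i w) (eta i w)))\<^sup>2) \<le> y2" "0 \<le> y2"
    and yp: "\<And>i. i < n \<Longrightarrow> expectation (\<lambda>w. norm (F i (X i w) (eta i w)) powr p) \<le> yp" "0 \<le> yp"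
  defines "Y \<equiv> \<lambda>i w. F i (X i w) (eta i w) - expectation (\<lambda>w. F i (X i w) (eta i w))"
  shows "expectation (\<lambda>w. norm (\<Sum>i<n. Y i w) powr p)
     \<le> exp (ros_const p) * ros_const p * 2 powr p *
       ((real (3 * m + 1) * real n * (8 * y2)) powr (p / 2) + real (3 * m + 1) powr (p - 1) * n * (2 powr (p + 1) * yp))"
proof -
  define b where "b = min (3 * m + 1) n"
  have b: "0 < b" "b \<le> n" "b \<le> 3 * m + 1" using n_pos by (auto simp: b_def)
  let ?f = "\<lambda>i w. F i (X i w) (eta i w)"
  have mf: "?f i \<in> borel_measurable P" for i by measurable
  have fi: "integrable P (?f i)" if "i < n" for i
    by (rule integrable_norm_powr_imp[OF mf int[OF that]]) (use p in auto)
  have cp: "expectation (\<lambda>w. norm (Y i w) powr p) \<le> 2 powr (p + 1) * yp" "integrable P (\<lambda>w. norm (Y i w) powr p)" if "i < n" for i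
  proof -
    have "expectation (\<lambda>w. norm (Y i w) powr p) \<le> 2 powr (p + 1) * expectation (\<lambda>w. norm (?f i w) powr p)"
      unfolding Y_def by (rule centered_powr_le(1)[OF mf int[OF that]]) (use p in auto)
    also have "\<dots> \<le> 2 powr (p + 1) * yp" using yp(1)[OF that] by (intro mult_left_mono) auto
    finally show "expectation (\<lambda>w. norm (Y i w) powr p) \<le> 2 powr (p + 1) * yp" .
    show "integrable P (\<lambda>w. norm (Y i w) powr p)"
      unfolding Y_def by (rule centered_powr_le(2)[OF mf int[OF that]]) (use p in auto)
  qed
  have c2: "expectation (\<lambda>w. (norm (Y i w))\<^sup>2) \<le> 8 * y2" if "i < n" for i
  proof -
    have i2: "integrable P (\<lambda>w. norm (?f i w) powr 2)"
      by (rule integrable_norm_powr_mono[OF mf int[OF that]]) (use p in auto)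
    have "expectation (\<lambda>w. norm (Y i w) powr 2) \<le> 2 powr (2 + 1) * expectation (\<lambda>w. norm (?f i w) powr 2)"
      unfolding Y_def by (rule centered_powr_le(1)[OF mf i2]) auto
    then show ?thesis using y2(1)[OF that] by simp
  qed
  have Fm: "(\<lambda>(x, y). F i x y - expectation (?f i)) \<in> borel_measurable (borel \<Otimes>\<^sub>M borel)" for i
    by measurable
  have "expectation (\<lambda>w. norm (\<Sum>i<n. Y i w) powr p)
     \<le> exp (ros_const p) * ros_const p * 2 powr p * ((real b * real n * (8 * y2)) powr (p / 2) + real b powr (p - 1) * n * (2 powr (p + 1) * yp))"
  proof (rule rosenthal_classes[OF p b(1,2)])
    fix c j assume cj: "c < b" "j * b + c < n"
    show "indep_var borel (\<lambda>w. \<Sum>k<j. Y (k * b + c) w) borel (Y (j * b + c))"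
      using indep_windows[of "\<lambda>i x y. F i x y - expectation (?f i)", OF Fm b_def cj] by (simp add: Y_def)
  next
    fix j assume "j < n"
    then show "expectation (Y j) = 0" using fi[of j] by (simp add: Y_def prob_space)
    show "Y j \<in> borel_measurable P" by (simp add: Y_def)
  qed (use cp c2 y2(2) yp(2) in auto)
  also have "\<dots> \<le> exp (ros_const p) * ros_const p * 2 powr p * ((real (3 * m + 1) * real n * (8 * y2)) powr (p / 2)
      + real (3 * m + 1) powr (p - 1) * n * (2 powr (p + 1) * yp))"
  proof (intro mult_left_mono add_mono powr_mono2 mult_right_mono)
    show "real b \<le> real (3 * m + 1)" using b(3) by (simp only: of_nat_le_iff)
    show "real b \<le> real (3 * m + 1)" using b(3) by (simp only: of_nat_le_iff)
  qed (use b p y2(2) yp(2) in \<open>auto simp: ros_const_def\<close>)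
  finally show ?thesis .
qed

end

text \<open>A common majorant, depending on the Gaussian variable alone, for the first- and
  second-order remainders of the Cameron-Martin weight under shifts of norm at most 1. All its
  powers are integrable.\<close>

definition stein_H :: "real ^ 'd \<Rightarrow> real"
  where "stein_H z = 2 * exp (1 + 3 * norm z)"

lemma stein_H_pos: "0 < stein_H z"
  by (simp add: stein_H_def)

lemma stein_H_ge_norm: "norm z \<le> stein_H z"
proof -
  have "norm z \<le> exp (norm z)" using exp_ge_add_one_self[of "norm z"] by linarith
  also have "\<dots> \<le> exp (1 + 3 * norm z)" by simp
  also have "\<dots> \<le> stein_H z" by (simp add: stein_H_def)
  finally show ?thesis .
qed

text \<open>The exponent satisfies \<open>\<bar>y\<bar> \<le> norm u * (norm z + 1)\<close> since
  \<open>norm u \<le> 1\<close>. The second bound removes the linear term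
  \<open>z \<bullet> u\<close> only; the term \<open>(u \<bullet> u) / 2\<close> of the exponent is
  already quadratic and accounts for the factor 2 in \<open>stein_H\<close>.\<close>

lemma stein_weight_bounds:
  fixes u z :: "real ^ 'd"
  assumes u: "norm u \<le> 1"
  defines "e \<equiv> exp (- (z \<bullet> u) - (u \<bullet> u) / 2)"
  shows "\<bar>1 - e\<bar> \<le> norm u * stein_H z"
    and "\<bar>1 - e - z \<bullet> u\<bar> \<le> (norm u)\<^sup>2 * stein_H z"
proof -
  define y where "y = z \<bullet> u + (u \<bullet> u) / 2"
  define E where "E = exp (norm z + 1)"
  have E: "1 \<le> E" by (simp add: E_def)
  have e: "e = exp (- y)" by (simp add: e_def y_def)
  have uu: "u \<bullet> u = (norm u)\<^sup>2" by (simp add: power2_norm_eq_inner)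
  have "(norm u)\<^sup>2 \<le> norm u" using u by (simp add: power2_eq_square mult_left_le)
  moreover have "\<bar>z \<bullet> u\<bar> \<le> norm z * norm u" by (rule Cauchy_Schwarz_ineq2)
  moreover have "\<bar>y\<bar> \<le> \<bar>z \<bullet> u\<bar> + (norm u)\<^sup>2 / 2" unfolding y_def uu
    using abs_triangle_ineq[of "z \<bullet> u" "(norm u)\<^sup>2 / 2"] by simp
  moreover have "0 \<le> norm u" by simp
  ultimately have y: "\<bar>y\<bar> \<le> norm u * (norm z + 1)" unfolding distrib_left mult.commute[of "norm u" "norm z"] by linarith
  also have "\<dots> \<le> 1 * (norm z + 1)" using u by (intro mult_right_mono) auto
  finally have ey: "exp \<bar>y\<bar> \<le> E" by (simp add: E_def)
  have z1: "norm z + 1 \<le> exp (norm z)" using exp_ge_add_one_self[of "norm z"] by linarith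
  have HE1: "exp (norm z) * E \<le> stein_H z" "exp (norm z) * exp (norm z) * E \<le> exp (1 + 3 * norm z)"
    by (simp_all add: stein_H_def E_def exp_add[symmetric]) (rule order_trans[of _ "exp (1 + 3 * norm z)"], simp_all)
  have "\<bar>1 - e\<bar> \<le> \<bar>y\<bar> * exp \<bar>y\<bar>" using exp_minus_one_abs_le[of "- y"] by (simp add: e abs_minus_commute)
  also have "\<dots> \<le> (norm u * (norm z + 1)) * E" using y ey by (intro mult_mono) auto
  also have "\<dots> \<le> (norm u * exp (norm z)) * E" using z1 E by (intro mult_right_mono mult_left_mono) auto
  also have "\<dots> \<le> norm u * stein_H z" using HE1(1) by (simp add: mult.assoc mult_left_mono)
  finally show "\<bar>1 - e\<bar> \<le> norm u * stein_H z" .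
  have "\<bar>1 - e - z \<bullet> u\<bar> \<le> \<bar>exp (- y) - 1 - (- y)\<bar> + (norm u)\<^sup>2 / 2"
  proof -
    have "1 - e - z \<bullet> u = - (exp (- y) - 1 - (- y)) + (norm u)\<^sup>2 / 2" unfolding e by (simp add: y_def uu)
    then show ?thesis using abs_triangle_ineq[of "- (exp (- y) - 1 - (- y))" "(norm u)\<^sup>2 / 2"] by (simp only: abs_minus_cancel) simp
  qed
  also have "\<bar>exp (- y) - 1 - (- y)\<bar> \<le> y\<^sup>2 * exp \<bar>y\<bar>" using exp_taylor_two_le[of "- y"] by simp
  also have "y\<^sup>2 * exp \<bar>y\<bar> \<le> (norm u * exp (norm z))\<^sup>2 * E"
  proof (intro mult_mono ey)
    have "\<bar>y\<bar> \<le> norm u * exp (norm z)" using y z1 by (meson mult_left_mono norm_ge_zero order_trans)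
    then show "y\<^sup>2 \<le> (norm u * exp (norm z))\<^sup>2" by (metis abs_ge_zero power2_abs power_mono)
  qed auto
  also have "\<dots> = (norm u)\<^sup>2 * (exp (norm z) * exp (norm z) * E)" by (simp add: power2_eq_square)
  also have "\<dots> \<le> (norm u)\<^sup>2 * exp (1 + 3 * norm z)" using HE1(2) by (intro mult_left_mono) auto
  also have "(norm u)\<^sup>2 / 2 \<le> (norm u)\<^sup>2 * exp (1 + 3 * norm z)"
  proof -
    have "1 \<le> exp (1 + 3 * norm z)" by simp
    then have "(norm u)\<^sup>2 * 1 \<le> (norm u)\<^sup>2 * exp (1 + 3 * norm z)" by (intro mult_left_mono) auto
    then show ?thesis using zero_le_power2[of "norm u"] by linarith
  qed
  finally show "\<bar>1 - e - z \<bullet> u\<bar> \<le> (norm u)\<^sup>2 * stein_H z" by (simp add: stein_H_def algebra_simps)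
qed

lemma integral_std_gauss_bound:
  fixes f :: "'v::euclidean_space \<Rightarrow> 'w::{banach,second_countable_topology}"
  assumes "f \<in> borel_measurable borel" "\<And>z. norm (f z) \<le> C * exp (k * norm z)"
  shows "integrable std_gauss f"
  by (rule Bochner_Integration.integrable_bound[where f = "\<lambda>z. C * exp (k * norm z)"])
     (use assms integrable_exp_norm_std_gauss in \<open>auto intro!: AE_I2 order_trans[OF assms(2)]\<close>)

context mdep_family
begin

text \<open>The Cameron-Martin density that turns \<open>path \<theta>\<close> into \<open>cos \<theta> (W - \<eta>\<^sub>i) + sin \<theta> Z\<close>, which is independent of
  \<open>X i\<close>.\<close>

definition wexp :: "real \<Rightarrow> nat \<Rightarrow> 'a \<times> (real ^ 'd) \<Rightarrow> real"
  where "wexp \<theta> i x = exp (- (snd x \<bullet> ((cos \<theta> / sin \<theta>) *\<^sub>R eta i (fst x)))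
      - (((cos \<theta> / sin \<theta>) *\<^sub>R eta i (fst x)) \<bullet> ((cos \<theta> / sin \<theta>) *\<^sub>R eta i (fst x))) / 2)"

lemma wexp_measurable [measurable]: "wexp \<theta> i \<in> borel_measurable (P \<Otimes>\<^sub>M std_gauss)"
  unfolding wexp_def by measurable

lemma norm_kap_eta:
  assumes "w \<in> space P"
  shows "norm ((cos \<theta> / sin \<theta>) *\<^sub>R eta i w) \<le> \<bar>cos \<theta> / sin \<theta>\<bar> * ((2 * m + 1) * \<tau>)"
  using norm_eta[OF assms, of i] by (simp only: norm_scaleR) (rule mult_left_mono, auto)

lemma wexp_le:
  assumes "w \<in> space P"
  shows "wexp \<theta> i (w, z) \<le> exp (\<bar>cos \<theta> / sin \<theta>\<bar> * ((2 * m + 1) * \<tau>) * norm z)"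
proof -
  let ?u = "(cos \<theta> / sin \<theta>) *\<^sub>R eta i w"
  have "- (z \<bullet> ?u) \<le> norm z * norm ?u" using Cauchy_Schwarz_ineq2[of z ?u] by linarith
  also have "\<dots> \<le> norm z * (\<bar>cos \<theta> / sin \<theta>\<bar> * ((2 * m + 1) * \<tau>))"
    by (rule mult_left_mono[OF norm_kap_eta[OF assms]]) simp
  finally have "- (z \<bullet> ?u) - (?u \<bullet> ?u) / 2 \<le> norm z * (\<bar>cos \<theta> / sin \<theta>\<bar> * ((2 * m + 1) * \<tau>))"
    using inner_ge_zero[of ?u] by linarith
  then show ?thesis unfolding wexp_def fst_conv snd_conv exp_le_cancel_iff by (simp only: mult_ac)
qed

lemma wexp_pos: "0 < wexp \<theta> i x"
  by (simp add: wexp_def)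

text \<open>Integrating over \<open>z\<close> first, the Cameron-Martin formula turns the weighted
  integral of \<open>g\<close> into \<open>\<Phi> (W - eta i)\<close>. This is independent of the
  centred variable \<open>X i\<close>, so the expectation of the product vanishes.\<close>

lemma stein_zero:
  fixes g :: "real ^ 'd \<Rightarrow> real ^ 'd"
  assumes i: "i < n" and s: "0 < sin \<theta>" and [measurable]: "g \<in> borel_measurable borel"
    and g: "\<And>x. norm (g x) \<le> A * exp (r * norm x)" and r: "0 \<le> r" and A: "0 \<le> A"
  shows "(\<integral>x. g (path \<theta> x) \<bullet> (wexp \<theta> i x *\<^sub>R X i (fst x)) \<partial>MG) = 0"
    and "integrable MG (\<lambda>x. g (path \<theta> x) \<bullet> (wexp \<theta> i x *\<^sub>R X i (fst x)))"
proof -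
  let ?R = "real n * \<tau>"
  define U where "U = \<bar>cos \<theta> / sin \<theta>\<bar> * ((2 * m + 1) * \<tau>)"
  show i1: "integrable MG (\<lambda>x. g (path \<theta> x) \<bullet> (wexp \<theta> i x *\<^sub>R X i (fst x)))"
  proof (rule integrable_exp_bound[where C = "A * exp (r * ?R) * \<tau>" and k = "r + U"])
    fix w and z :: "real ^ 'd" assume w1: "w \<in> space P"
    have "norm (g (path \<theta> (w, z)) \<bullet> (wexp \<theta> i (w, z) *\<^sub>R X i w))
      \<le> norm (g (path \<theta> (w, z))) * norm (wexp \<theta> i (w, z) *\<^sub>R X i w)"
      unfolding real_norm_def by (rule Cauchy_Schwarz_ineq2)
    also have "\<dots> \<le> (A * exp (r * (?R + norm z))) * (exp (U * norm z) * \<tau>)"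
    proof (rule mult_mono)
      show "norm (g (path \<theta> (w, z))) \<le> A * exp (r * (?R + norm z))"
        using norm_path_le[OF w1, of \<theta> z] r A
        by (intro order_trans[OF g] mult_left_mono) (auto intro: mult_left_mono)
      show "norm (wexp \<theta> i (w, z) *\<^sub>R X i w) \<le> exp (U * norm z) * \<tau>"
        unfolding norm_scaleR U_def using wexp_le[OF w1, of \<theta> i z] wexp_pos[of \<theta> i "(w, z)"] X_bound[OF w1, of i]
        by (intro mult_mono) auto
    qed (use A in auto)
    also have "\<dots> = A * exp (r * ?R) * \<tau> * exp ((r + U) * norm z)"
      unfolding distrib_left distrib_right exp_add by (simp only: mult_ac)
    finally show "norm (g (path \<theta> (w, z)) \<bullet> (wexp \<theta> i (w, z) *\<^sub>R X i (fst (w, z)))) \<le> A * exp (r * ?R) * \<tau> * exp ((r + U) * norm z)"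
      by simp
  qed measurable
  define \<Phi> where "\<Phi> w1 = (\<integral>z. g (cos \<theta> *\<^sub>R w1 + sin \<theta> *\<^sub>R z) \<partial>std_gauss)" for w1
  have [measurable]: "\<Phi> \<in> borel_measurable borel" unfolding \<Phi>_def by measurable
  define E where "E = (\<integral>z. exp (r * norm z) \<partial>(std_gauss :: (real ^ 'd) measure))"
  have gb: "norm (g (cos \<theta> *\<^sub>R w1 + sin \<theta> *\<^sub>R z)) \<le> A * exp (r * norm w1) * exp (r * norm z)" for w1 z
  proof -
    have "norm (cos \<theta> *\<^sub>R w1 + sin \<theta> *\<^sub>R z) \<le> 1 * norm w1 + 1 * norm z"
      by (intro order_trans[OF norm_triangle_ineq] add_mono) (simp_all add: mult_left_le_one_le)
    then have "A * exp (r * norm (cos \<theta> *\<^sub>R w1 + sin \<theta> *\<^sub>R z)) \<le> A * exp (r * (norm w1 + norm z))"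
      using A r by (intro mult_left_mono) (auto intro: mult_left_mono)
    then show ?thesis using order_trans[OF g] by (simp add: distrib_left exp_add mult_ac)
  qed
  have int_g: "integrable std_gauss (\<lambda>z. g (cos \<theta> *\<^sub>R w1 + sin \<theta> *\<^sub>R z))" for w1
    by (rule integral_std_gauss_bound[OF _ gb]) measurable
  have Phib: "norm (\<Phi> w1) \<le> A * exp (r * norm w1) * E" for w1
  proof -
    have "norm (\<Phi> w1) \<le> (\<integral>z. norm (g (cos \<theta> *\<^sub>R w1 + sin \<theta> *\<^sub>R z)) \<partial>std_gauss)"
      unfolding \<Phi>_def by (rule integral_norm_bound)
    also have "\<dots> \<le> (\<integral>z. A * exp (r * norm w1) * exp (r * norm z) \<partial>(std_gauss :: (real ^ 'd) measure))"
      by (intro integral_mono integrable_norm int_g integrable_mult_right integrable_exp_norm_std_gauss gb)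
    finally show ?thesis by (simp add: E_def)
  qed
  have E0: "0 \<le> E" by (simp add: E_def)
  have ind: "indep_var borel (X i) borel (\<lambda>w. \<Phi> (W w - eta i w))"
    by (rule indep_var_compose[OF indep_far[OF i], of "\<lambda>x. x" borel \<Phi> borel, unfolded comp_def]) auto
  have intX: "integrable P (X i)" by (rule norm_integral_bound(2)[OF _ X_bound]) auto
  have intPhi: "integrable P (\<lambda>w. \<Phi> (W w - eta i w))"
  proof (rule norm_integral_bound(2)[where B = "A * exp (r * (?R + (2 * m + 1) * \<tau>)) * E"])
    fix w assume w1: "w \<in> space P"
    have "norm (W w - eta i w) \<le> ?R + (2 * m + 1) * \<tau>"
      using norm_triangle_ineq4[of "W w" "eta i w"] norm_W[OF w1] norm_eta[OF w1, of i] by linarith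
    then have "A * exp (r * norm (W w - eta i w)) * E \<le> A * exp (r * (?R + (2 * m + 1) * \<tau>)) * E"
      using A r E0 by (intro mult_right_mono mult_left_mono) (auto intro: mult_left_mono)
    then show "norm (\<Phi> (W w - eta i w)) \<le> A * exp (r * (?R + (2 * m + 1) * \<tau>)) * E"
      using Phib order_trans by blast
  qed measurable
  have "(\<integral>x. g (path \<theta> x) \<bullet> (wexp \<theta> i x *\<^sub>R X i (fst x)) \<partial>MG)
     = (\<integral>w. (\<integral>z. g (path \<theta> (w, z)) \<bullet> (wexp \<theta> i (w, z) *\<^sub>R X i w) \<partial>std_gauss) \<partial>P)"
    using pair.integral_fst'[OF i1] by simp
  also have "\<dots> = (\<integral>w. X i w \<bullet> \<Phi> (W w - eta i w) \<partial>P)"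
  proof (rule Bochner_Integration.integral_cong[OF refl])
    fix w
    define u where "u = (cos \<theta> / sin \<theta>) *\<^sub>R eta i w"
    have "(\<integral>z. g (path \<theta> (w, z)) \<bullet> (wexp \<theta> i (w, z) *\<^sub>R X i w) \<partial>std_gauss)
      = (\<integral>z. exp (z \<bullet> (- u) - ((- u) \<bullet> (- u)) / 2) *\<^sub>R (X i w \<bullet> g (cos \<theta> *\<^sub>R W w + sin \<theta> *\<^sub>R z)) \<partial>std_gauss)"
      by (simp add: wexp_def u_def path_def inner_commute)
    also have "\<dots> = (\<integral>z. X i w \<bullet> g (cos \<theta> *\<^sub>R W w + sin \<theta> *\<^sub>R (z + (- u))) \<partial>std_gauss)"
      by (rule integral_gauss_shift[symmetric]) measurable
    also have "(\<lambda>z. cos \<theta> *\<^sub>R W w + sin \<theta> *\<^sub>R (z + (- u))) = (\<lambda>z. cos \<theta> *\<^sub>R (W w - eta i w) + sin \<theta> *\<^sub>R z)"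
      using s by (simp add: u_def algebra_simps)
    also have "(\<integral>z. X i w \<bullet> g (cos \<theta> *\<^sub>R (W w - eta i w) + sin \<theta> *\<^sub>R z) \<partial>std_gauss) = X i w \<bullet> \<Phi> (W w - eta i w)"
      unfolding \<Phi>_def using int_g by (intro integral_inner_right) auto
    finally show "(\<integral>z. g (path \<theta> (w, z)) \<bullet> (wexp \<theta> i (w, z) *\<^sub>R X i w) \<partial>std_gauss) = X i w \<bullet> \<Phi> (W w - eta i w)" .
  qed
  also have "\<dots> = 0" using indep_var_inner(2)[OF ind intX intPhi] X_mean[OF i] by simp
  finally show "(\<integral>x. g (path \<theta> x) \<bullet> (wexp \<theta> i x *\<^sub>R X i (fst x)) \<partial>MG) = 0" .
qed

text \<open>The added sum is orthogonal to all functions of the path by lemma \<open>stein_zero\<close>.\<close>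

definition Vst :: "real \<Rightarrow> 'a \<times> (real ^ 'd) \<Rightarrow> real ^ 'd"
  where "Vst \<theta> x = path' \<theta> x + sin \<theta> *\<^sub>R (\<Sum>i<n. wexp \<theta> i x *\<^sub>R X i (fst x))"

lemma Vst_measurable [measurable]: "Vst \<theta> \<in> borel_measurable (P \<Otimes>\<^sub>M std_gauss)"
  unfolding Vst_def by measurable

lemma Vst_pairing:
  fixes g :: "real ^ 'd \<Rightarrow> real ^ 'd"
  assumes th: "0 < \<theta>" "\<theta> \<le> pi / 2" and gm: "g \<in> borel_measurable borel"
    and g: "\<And>x. norm (g x) \<le> A * exp (r * norm x)" and r: "0 \<le> r" and A: "0 \<le> A"
  shows "(\<integral>x. g (path \<theta> x) \<bullet> Vst \<theta> x \<partial>MG) = (\<integral>x. g (path \<theta> x) \<bullet> path' \<theta> x \<partial>MG)"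
proof -
  have s: "0 < sin \<theta>" using th pi_gt_zero by (intro sin_gt_zero) auto
  note z = stein_zero[OF _ s gm g r A]
  have "(\<integral>x. g (path \<theta> x) \<bullet> Vst \<theta> x \<partial>MG)
     = (\<integral>x. g (path \<theta> x) \<bullet> path' \<theta> x + sin \<theta> * (\<Sum>i<n. g (path \<theta> x) \<bullet> (wexp \<theta> i x *\<^sub>R X i (fst x))) \<partial>MG)"
    by (simp add: Vst_def inner_add_right inner_sum_right)
  also have "\<dots> = (\<integral>x. g (path \<theta> x) \<bullet> path' \<theta> x \<partial>MG) + sin \<theta> * (\<Sum>i<n. \<integral>x. g (path \<theta> x) \<bullet> (wexp \<theta> i x *\<^sub>R X i (fst x)) \<partial>MG)"
  proof -
    have a: "integrable MG (\<lambda>x. \<Sum>i<n. g (path \<theta> x) \<bullet> (wexp \<theta> i x *\<^sub>R X i (fst x)))"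
      by (rule Bochner_Integration.integrable_sum) (use z(2) in auto)
    have "(\<integral>x. (\<Sum>i<n. g (path \<theta> x) \<bullet> (wexp \<theta> i x *\<^sub>R X i (fst x))) \<partial>MG) = (\<Sum>i<n. \<integral>x. g (path \<theta> x) \<bullet> (wexp \<theta> i x *\<^sub>R X i (fst x)) \<partial>MG)"
      by (rule Bochner_Integration.integral_sum) (use z(2) in auto)
    then show ?thesis
      using vel_identity(2)[OF gm g r A th] a by (subst Bochner_Integration.integral_add) auto
  qed
  also have "(\<Sum>i<n. \<integral>x. g (path \<theta> x) \<bullet> (wexp \<theta> i x *\<^sub>R X i (fst x)) \<partial>MG) = 0"
    by (rule sum.neutral) (use z(1) in auto)
  finally show ?thesis by simp
qed

lemma Vst_bound:
  assumes w1: "w \<in> space P"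
  shows "norm (Vst \<theta> (w, z)) \<le> (2 * (n * \<tau>) + 1) * exp ((\<bar>cos \<theta> / sin \<theta>\<bar> * ((2 * m + 1) * \<tau>) + 1) * norm z)"
proof -
  define U where "U = \<bar>cos \<theta> / sin \<theta>\<bar> * ((2 * m + 1) * \<tau>)"
  have U: "0 \<le> U" using tau_nonneg by (simp add: U_def)
  have "norm (\<Sum>i<n. wexp \<theta> i (w, z) *\<^sub>R X i w) \<le> (\<Sum>i<n. exp (U * norm z) * \<tau>)"
  proof (intro order_trans[OF norm_sum] sum_mono)
    fix i
    show "norm (wexp \<theta> i (w, z) *\<^sub>R X i w) \<le> exp (U * norm z) * \<tau>"
      unfolding norm_scaleR U_def using wexp_le[OF w1, of \<theta> i z] wexp_pos[of \<theta> i "(w, z)"] X_bound[OF w1, of i]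
      by (intro mult_mono) auto
  qed
  then have S: "norm (sin \<theta> *\<^sub>R (\<Sum>i<n. wexp \<theta> i (w, z) *\<^sub>R X i w)) \<le> 1 * (n * \<tau> * exp (U * norm z))"
    unfolding norm_scaleR by (intro mult_mono) (auto simp: mult_ac)
  have a: "1 \<le> exp ((U + 1) * norm z)" "exp (U * norm z) \<le> exp ((U + 1) * norm z)"
    using U by (auto simp: distrib_right)
  have b: "norm z \<le> exp ((U + 1) * norm z)"
  proof -
    have "norm z \<le> exp (norm z)" using exp_ge_add_one_self[of "norm z"] by linarith
    also have "\<dots> \<le> exp ((U + 1) * norm z)" using U by (simp add: algebra_simps)
    finally show ?thesis .
  qed
  have "norm (Vst \<theta> (w, z)) \<le> (n * \<tau> + norm z) + n * \<tau> * exp (U * norm z)"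
    unfolding Vst_def using norm_path'_le[OF w1, of \<theta> z] S
    by (intro order_trans[OF norm_triangle_ineq]) simp
  also have "\<dots> \<le> (n * \<tau> * exp ((U + 1) * norm z) + 1 * exp ((U + 1) * norm z)) + n * \<tau> * exp ((U + 1) * norm z)"
  proof (intro add_mono mult_left_mono a(2))
    show "n * \<tau> \<le> n * \<tau> * exp ((U + 1) * norm z)" using mult_left_mono[OF a(1), of "n * \<tau>"] tau_nonneg by simp
    show "norm z \<le> 1 * exp ((U + 1) * norm z)" using b by simp
  qed (use tau_nonneg in auto)
  also have "\<dots> = (2 * (n * \<tau>) + 1) * exp ((U + 1) * norm z)" by (simp add: algebra_simps)
  finally show ?thesis by (simp add: U_def)
qed

lemma vel_le_Vst:
  assumes "0 < \<theta>" "\<theta> \<le> pi / 2" "2 \<le> p"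
  shows "(\<integral>x. norm (vel \<theta> (path \<theta> x)) powr p \<partial>MG) \<le> (\<integral>x. norm (Vst \<theta> x) powr p \<partial>MG)"
  by (rule vel_powr_le[OF assms Vst_measurable Vst_bound]) (use tau_nonneg Vst_pairing[OF assms(1,2)] in auto)

text \<open>Replacing \<open>eta i\<close> by \<open>W\<close> changes nothing, because
  \<open>X i\<close> is centred and independent of the difference. Thus the local covariances add up
  to the covariance of the whole sum.\<close>

lemma expectation_W_inner:
  "(\<Sum>i<n. expectation (\<lambda>w. (z \<bullet> eta i w) *\<^sub>R X i w)) = expectation (\<lambda>w. (z \<bullet> W w) *\<^sub>R W w)"
proof -
  have bnd: "integrable P (\<lambda>w. (z \<bullet> Y w) *\<^sub>R X i w)" if [measurable]: "Y \<in> borel_measurable P"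
    and Y: "\<And>w. w \<in> space P \<Longrightarrow> norm (Y w) \<le> D" for Y i D
  proof (rule norm_integral_bound(2)[where B = "(norm z * D) * \<tau>"])
    fix w assume w1: "w \<in> space P"
    have "\<bar>z \<bullet> Y w\<bar> \<le> norm z * D" using Cauchy_Schwarz_ineq2[of z "Y w"] mult_left_mono[OF Y[OF w1], of "norm z"] by simp
    then show "norm ((z \<bullet> Y w) *\<^sub>R X i w) \<le> (norm z * D) * \<tau>"
      unfolding norm_scaleR using X_bound[OF w1, of i] abs_ge_zero[of "z \<bullet> Y w"] by (intro mult_mono) auto
  qed measurable
  have bW: "integrable P (\<lambda>w. (z \<bullet> W w) *\<^sub>R X i w)" and bE: "integrable P (\<lambda>w. (z \<bullet> eta j w) *\<^sub>R X i w)" for i j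
    by (rule bnd[OF _ norm_W], simp, assumption) (rule bnd[OF _ norm_eta], simp, assumption)
  have "expectation (\<lambda>w. (z \<bullet> eta i w) *\<^sub>R X i w) = expectation (\<lambda>w. (z \<bullet> W w) *\<^sub>R X i w)" if i: "i < n" for i
  proof -
    have intX: "integrable P (X i)" by (rule norm_integral_bound(2)[OF _ X_bound]) auto
    have d: "integrable P (\<lambda>w. (z \<bullet> (W w - eta i w)) *\<^sub>R X i w)"
      using Bochner_Integration.integrable_diff[OF bW[of i] bE[of i i]] by (simp add: inner_diff_right scaleR_diff_left)
    have "expectation (\<lambda>w. (z \<bullet> (W w - eta i w)) *\<^sub>R X i w) = 0"
    proof (rule euclidean_eqI)
      fix b :: "real ^ 'd"
      have ind: "indep_var borel (\<lambda>w. X i w \<bullet> b) borel (\<lambda>w. z \<bullet> (W w - eta i w))"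
        by (rule indep_var_compose[OF indep_far[OF i], of "\<lambda>x. x \<bullet> b" borel "\<lambda>x. z \<bullet> x" borel, unfolded comp_def]) auto
      have iW: "integrable P W" and iE: "integrable P (eta i)"
        by (rule norm_integral_bound(2)[OF _ norm_W], auto) (rule norm_integral_bound(2)[OF _ norm_eta], auto)
      have "expectation (\<lambda>w. (z \<bullet> (W w - eta i w)) *\<^sub>R X i w) \<bullet> b = expectation (\<lambda>w. (X i w \<bullet> b) * (z \<bullet> (W w - eta i w)))"
        using d by (subst integral_inner_left[symmetric]) (auto simp: mult.commute)
      also have "\<dots> = expectation (\<lambda>w. X i w \<bullet> b) * expectation (\<lambda>w. z \<bullet> (W w - eta i w))"
        by (rule indep_var_lebesgue_integral[OF ind]) (use iW iE intX in auto)
      also have "expectation (\<lambda>w. X i w \<bullet> b) = 0" using intX X_mean[OF i] by simp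
      finally show "expectation (\<lambda>w. (z \<bullet> (W w - eta i w)) *\<^sub>R X i w) \<bullet> b = 0 \<bullet> b" by simp
    qed
    then show ?thesis using bW[of i] bE[of i i] by (simp add: inner_diff_right scaleR_diff_left)
  qed
  then have "(\<Sum>i<n. expectation (\<lambda>w. (z \<bullet> eta i w) *\<^sub>R X i w)) = (\<Sum>i<n. expectation (\<lambda>w. (z \<bullet> W w) *\<^sub>R X i w))"
    by (intro sum.cong) auto
  also have "\<dots> = expectation (\<lambda>w. \<Sum>i<n. (z \<bullet> W w) *\<^sub>R X i w)"
    by (rule Bochner_Integration.integral_sum[symmetric]) (rule bW)
  also have "\<dots> = expectation (\<lambda>w. (z \<bullet> W w) *\<^sub>R W w)" by (simp add: W_def scaleR_sum_right)
  finally show ?thesis .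
qed

end

context mdep_family
begin

text \<open>The right-hand side of \<open>rosenthal_windows\<close> for local functions with second
  moment at most \<open>a2\<close> and p-th moment at most \<open>ap\<close>; the factors 8 and
  \<open>2 powr (p + 1)\<close> are the price of centring them.\<close>

definition ros_bound :: "real \<Rightarrow> real \<Rightarrow> real \<Rightarrow> real"
  where "ros_bound p a2 ap = exp (ros_const p) * ros_const p * 2 powr p *
    ((real (3 * m + 1) * real n * (8 * a2)) powr (p / 2) + real (3 * m + 1) powr (p - 1) * n * (2 powr (p + 1) * ap))"

text \<open>The local functions are \<open>f i = sin \<theta> * (1 - weight) * X i\<close>. By
  \<open>stein_weight_bounds\<close> they are of first order in \<open>cot \<theta>\<close> times
  \<open>eta i\<close>, and \<open>sin \<theta> * cot \<theta> = cos \<theta>\<close>, so every term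
  carries the factor \<open>cos \<theta> * stein_H z\<close> and the remaining moments do not
  involve the angle, except for one cotangent in the mean.\<close>

lemma Vst_fiber_bound:
  fixes \<theta> p a2 ap a3 \<Delta> :: real and z :: "real ^ 'd"
  assumes th: "0 < \<theta>" "\<theta> \<le> pi / 2" and p: "2 \<le> p"
    and kap: "cos \<theta> / sin \<theta> * ((2 * m + 1) * \<tau>) \<le> 1"
    and a2: "\<And>i. i < n \<Longrightarrow> expectation (\<lambda>w. (norm (X i w))\<^sup>2 * (norm (eta i w))\<^sup>2) \<le> a2" "0 \<le> a2"
    and ap: "\<And>i. i < n \<Longrightarrow> expectation (\<lambda>w. norm (X i w) powr p * norm (eta i w) powr p) \<le> ap" "0 \<le> ap"
    and a3: "\<And>i. i < n \<Longrightarrow> expectation (\<lambda>w. norm (X i w) * (norm (eta i w))\<^sup>2) \<le> a3" "0 \<le> a3"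
    and cov: "\<And>z. norm (expectation (\<lambda>w. (z \<bullet> W w) *\<^sub>R W w) - z) \<le> \<Delta> * norm z" and Delta: "0 \<le> \<Delta>"
  shows "expectation (\<lambda>w. norm (Vst \<theta> (w, z)) powr p)
    \<le> (cos \<theta> * stein_H z) powr p * (2 powr p * (ros_bound p a2 ap + (\<Delta> + cos \<theta> / sin \<theta> * (n * a3)) powr p))"
proof -
  define c s k where "c = cos \<theta>" and "s = sin \<theta>" and "k = c / s"
  have s: "0 < s" unfolding s_def using th pi_gt_zero by (intro sin_gt_zero) auto
  have c: "0 \<le> c" unfolding c_def using th by (intro cos_ge_zero) auto
  have k: "0 \<le> k" "s * k = c" using s c by (auto simp: k_def)
  define H where "H = stein_H z"
  have H: "0 < H" "norm z \<le> H" using stein_H_pos stein_H_ge_norm by (auto simp: H_def)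
  define F where "F i x y = (s * (1 - exp (- (z \<bullet> (k *\<^sub>R y)) - ((k *\<^sub>R y) \<bullet> (k *\<^sub>R y)) / 2))) *\<^sub>R x" for i :: nat and x y :: "real ^ 'd"
  have Fm [measurable]: "(\<lambda>(x, y). F i x y) \<in> borel_measurable (borel \<Otimes>\<^sub>M borel)" for i
    unfolding F_def by measurable
  have ke: "norm (k *\<^sub>R eta i w) \<le> 1" if "w \<in> space P" for i w
  proof -
    have "norm (k *\<^sub>R eta i w) \<le> k * ((2 * m + 1) * \<tau>)"
      using norm_eta[OF that, of i] k by (simp only: norm_scaleR abs_of_nonneg) (rule mult_left_mono, auto)
    then show ?thesis using kap by (simp add: k_def c_def s_def)
  qed
  define f where "f i w = F i (X i w) (eta i w)" for i w
  have fm [measurable]: "f i \<in> borel_measurable P" for i unfolding f_def by measurable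
  have f1: "norm (f i w) \<le> c * H * (norm (X i w) * norm (eta i w))" if "w \<in> space P" for i w
  proof -
    let ?e = "exp (- (z \<bullet> (k *\<^sub>R eta i w)) - ((k *\<^sub>R eta i w) \<bullet> (k *\<^sub>R eta i w)) / 2)"
    have "norm (f i w) = s * \<bar>1 - ?e\<bar> * norm (X i w)" using s by (simp add: f_def F_def abs_mult)
    also have "\<dots> \<le> s * (norm (k *\<^sub>R eta i w) * H) * norm (X i w)"
      unfolding H_def using s by (intro mult_right_mono mult_left_mono stein_weight_bounds(1)[OF ke[OF that]]) auto
    also have "\<dots> = (s * k) * H * (norm (X i w) * norm (eta i w))" using k by simp
    finally show ?thesis by (simp add: k)
  qed
  have f2: "norm (f i w - (c * (z \<bullet> eta i w)) *\<^sub>R X i w) \<le> c * k * H * (norm (X i w) * (norm (eta i w))\<^sup>2)" if "w \<in> space P" for i w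
  proof -
    let ?e = "exp (- (z \<bullet> (k *\<^sub>R eta i w)) - ((k *\<^sub>R eta i w) \<bullet> (k *\<^sub>R eta i w)) / 2)"
    have "f i w - (c * (z \<bullet> eta i w)) *\<^sub>R X i w = (s * (1 - ?e - z \<bullet> (k *\<^sub>R eta i w))) *\<^sub>R X i w"
      by (simp add: f_def F_def k(2)[symmetric] algebra_simps)
    then have "norm (f i w - (c * (z \<bullet> eta i w)) *\<^sub>R X i w) = s * \<bar>1 - ?e - z \<bullet> (k *\<^sub>R eta i w)\<bar> * norm (X i w)"
      using s by (simp only: norm_scaleR abs_mult abs_of_pos)
    also have "\<dots> \<le> s * ((norm (k *\<^sub>R eta i w))\<^sup>2 * H) * norm (X i w)"
      unfolding H_def using s by (intro mult_right_mono mult_left_mono stein_weight_bounds(2)[OF ke[OF that]]) auto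
    also have "\<dots> = (s * k) * k * H * (norm (X i w) * (norm (eta i w))\<^sup>2)"
      using k by (simp add: power2_eq_square)
    finally show ?thesis by (simp add: k)
  qed
  define B where "B = real (2 * m + 1) * \<tau>"
  have B: "0 \<le> B" using tau_nonneg by (simp add: B_def)
  have eb: "norm (eta i w) \<le> B" if "w \<in> space P" for i w using norm_eta[OF that, of i] by (simp add: B_def)
  have ints: "integrable P (\<lambda>w. norm (X i w) powr r * norm (eta i w) powr q)" if "0 \<le> r" "0 \<le> q" for i r q
    by (rule norm_integral_bound(2)[where B = "\<tau> powr r * B powr q"])
       (use that X_bound eb in \<open>auto intro!: mult_mono powr_mono2\<close>)
  have int22: "integrable P (\<lambda>w. (norm (X i w))\<^sup>2 * (norm (eta i w))\<^sup>2)" for i using ints[of 2 2] by simp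
  have int12: "integrable P (\<lambda>w. norm (X i w) * (norm (eta i w))\<^sup>2)" for i using ints[of 1 2] by simp
  have fb: "norm (f i w) \<le> c * H * (\<tau> * B)" if "w \<in> space P" for i w
    using order_trans[OF f1[OF that] mult_left_mono[OF mult_mono[OF X_bound[OF that] eb[OF that]]]] c H tau_nonneg by auto
  have fi: "integrable P (f i)" for i by (rule norm_integral_bound(2)[OF fm fb])
  have intfp: "integrable P (\<lambda>w. norm (f i w) powr r)" if "0 \<le> r" for i r
    by (rule norm_integral_bound(2)[where B = "(c * H * (\<tau> * B)) powr r"]) (use that fb in \<open>auto intro!: powr_mono2\<close>)
  define S where "S w = (\<Sum>i<n. f i w - expectation (f i))" for w
  have ros: "expectation (\<lambda>w. norm (S w) powr p) \<le> (c * H) powr p * ros_bound p a2 ap"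
  proof -
    have y2: "expectation (\<lambda>w. (norm (f i w))\<^sup>2) \<le> (c * H)\<^sup>2 * a2" if i: "i < n" for i
    proof -
      have "expectation (\<lambda>w. (norm (f i w))\<^sup>2) \<le> expectation (\<lambda>w. (c * H)\<^sup>2 * ((norm (X i w))\<^sup>2 * (norm (eta i w))\<^sup>2))"
      proof (rule integral_mono)
        show "(norm (f i w))\<^sup>2 \<le> (c * H)\<^sup>2 * ((norm (X i w))\<^sup>2 * (norm (eta i w))\<^sup>2)" if "w \<in> space P" for w
          using power_mono[OF f1[OF that, of i], of 2] by (simp add: power_mult_distrib)
      qed (use intfp[of 2] int22 in auto)
      also have "\<dots> \<le> (c * H)\<^sup>2 * a2" using a2(1)[OF i] by (simp add: mult_left_mono)
      finally show ?thesis .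
    qed
    have yp: "expectation (\<lambda>w. norm (f i w) powr p) \<le> (c * H) powr p * ap" if i: "i < n" for i
    proof -
      have "expectation (\<lambda>w. norm (f i w) powr p) \<le> expectation (\<lambda>w. (c * H) powr p * (norm (X i w) powr p * norm (eta i w) powr p))"
      proof (rule integral_mono)
        show "norm (f i w) powr p \<le> (c * H) powr p * (norm (X i w) powr p * norm (eta i w) powr p)" if "w \<in> space P" for w
        proof -
          have "norm (f i w) powr p \<le> (c * H * (norm (X i w) * norm (eta i w))) powr p"
            using f1[OF that] p by (intro powr_mono2) auto
          then show ?thesis using c H by (simp add: powr_mult mult_ac)
        qed
      qed (use intfp[of p] ints[of p p] p in auto)
      also have "\<dots> \<le> (c * H) powr p * ap" using ap(1)[OF i] by (simp add: mult_left_mono)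
      finally show ?thesis .
    qed
    have "expectation (\<lambda>w. norm (S w) powr p) \<le> exp (ros_const p) * ros_const p * 2 powr p *
       ((real (3 * m + 1) * real n * (8 * ((c * H)\<^sup>2 * a2))) powr (p / 2) + real (3 * m + 1) powr (p - 1) * n * (2 powr (p + 1) * ((c * H) powr p * ap)))"
      unfolding S_def f_def
      by (rule rosenthal_windows[OF Fm p]) (use y2 yp a2(2) ap(2) intfp[of p] p in \<open>auto simp: f_def\<close>)
    also have "(real (3 * m + 1) * real n * (8 * ((c * H)\<^sup>2 * a2))) powr (p / 2)
      = (c * H) powr p * (real (3 * m + 1) * real n * (8 * a2)) powr (p / 2)"
    proof -
      have "real (3 * m + 1) * real n * (8 * ((c * H)\<^sup>2 * a2)) = (c * H)\<^sup>2 * (real (3 * m + 1) * real n * (8 * a2))" by simp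
      moreover have "((c * H)\<^sup>2) powr (p / 2) = (c * H) powr p"
        using c H by (cases "c = 0") (auto simp: powr_powr simp flip: powr_numeral)
      ultimately show ?thesis using a2(2) by (simp only:) (subst powr_mult, auto)
    qed
    finally show ?thesis by (simp add: ros_bound_def algebra_simps)
  qed
  \<comment> \<open>The linear parts of the expectations of \<open>f i\<close> add up to
    \<open>c\<close> times the covariance operator at \<open>z\<close>, by
    \<open>expectation_W_inner\<close>, and cancel \<open>c *\<^sub>R z\<close> up to
    \<open>\<Delta>\<close>. The quadratic parts cost the mixed third moments
    \<open>a3\<close>.\<close>
  define \<mu> where "\<mu> = c *\<^sub>R z - (\<Sum>i<n. expectation (f i))"
  have mu: "norm \<mu> \<le> c * H * (\<Delta> + k * (n * a3))"
  proof -
    have g_int: "integrable P (\<lambda>w. (c * (z \<bullet> eta i w)) *\<^sub>R X i w)" for i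
    proof (rule norm_integral_bound(2)[where B = "(c * (norm z * B)) * \<tau>"])
      fix w assume w1: "w \<in> space P"
      have "\<bar>z \<bullet> eta i w\<bar> \<le> norm z * B"
        using Cauchy_Schwarz_ineq2[of z "eta i w"] mult_left_mono[OF eb[OF w1, of i], of "norm z"] by simp
      then show "norm ((c * (z \<bullet> eta i w)) *\<^sub>R X i w) \<le> (c * (norm z * B)) * \<tau>"
        unfolding norm_scaleR abs_mult using c X_bound[OF w1, of i] B by (intro mult_mono) auto
    qed measurable
    have *: "(\<Sum>i<n. expectation (\<lambda>w. (c * (z \<bullet> eta i w)) *\<^sub>R X i w)) = c *\<^sub>R expectation (\<lambda>w. (z \<bullet> W w) *\<^sub>R W w)"
    proof -
      have "expectation (\<lambda>w. (c * (z \<bullet> eta i w)) *\<^sub>R X i w) = c *\<^sub>R expectation (\<lambda>w. (z \<bullet> eta i w) *\<^sub>R X i w)" for i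
        by (subst integral_scaleR_right[symmetric]) (simp_all only: scaleR_scaleR)
      then show ?thesis unfolding expectation_W_inner[symmetric] by (simp only: scaleR_sum_right)
    qed
    have "\<mu> = - (c *\<^sub>R (expectation (\<lambda>w. (z \<bullet> W w) *\<^sub>R W w) - z)) - (\<Sum>i<n. expectation (\<lambda>w. f i w - (c * (z \<bullet> eta i w)) *\<^sub>R X i w))"
    proof -
      have "(\<Sum>i<n. expectation (\<lambda>w. f i w - (c * (z \<bullet> eta i w)) *\<^sub>R X i w)) = (\<Sum>i<n. expectation (f i)) - (\<Sum>i<n. expectation (\<lambda>w. (c * (z \<bullet> eta i w)) *\<^sub>R X i w))"
        unfolding Bochner_Integration.integral_diff[OF fi g_int] by (rule sum_subtractf)
      then show ?thesis unfolding \<mu>_def using * by (simp only: scaleR_diff_right) simp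
    qed
    then have "norm \<mu> \<le> norm (c *\<^sub>R (expectation (\<lambda>w. (z \<bullet> W w) *\<^sub>R W w) - z)) + norm (\<Sum>i<n. expectation (\<lambda>w. f i w - (c * (z \<bullet> eta i w)) *\<^sub>R X i w))"
      by (simp only:) (rule order_trans[OF norm_triangle_ineq4], simp only: norm_minus_cancel)
    also have "norm (c *\<^sub>R (expectation (\<lambda>w. (z \<bullet> W w) *\<^sub>R W w) - z)) \<le> c * (\<Delta> * H)"
    proof -
      have "norm (expectation (\<lambda>w. (z \<bullet> W w) *\<^sub>R W w) - z) \<le> \<Delta> * H"
        using cov[of z] mult_left_mono[OF H(2) Delta] by linarith
      then show ?thesis using c by (simp add: mult_left_mono)
    qed
    also have "norm (\<Sum>i<n. expectation (\<lambda>w. f i w - (c * (z \<bullet> eta i w)) *\<^sub>R X i w)) \<le> (\<Sum>i<n. c * k * H * a3)"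
    proof (intro order_trans[OF norm_sum] sum_mono)
      fix i assume "i \<in> {..<n}"
      then have i: "i < n" by simp
      have "norm (expectation (\<lambda>w. f i w - (c * (z \<bullet> eta i w)) *\<^sub>R X i w))
        \<le> expectation (\<lambda>w. norm (f i w - (c * (z \<bullet> eta i w)) *\<^sub>R X i w))" by (rule integral_norm_bound)
      also have "\<dots> \<le> expectation (\<lambda>w. c * k * H * (norm (X i w) * (norm (eta i w))\<^sup>2))"
        using fi g_int int12 f2 by (intro integral_mono) auto
      also have "\<dots> \<le> c * k * H * a3" using a3(1)[OF i] c k H by (simp add: mult_left_mono)
      finally show "norm (expectation (\<lambda>w. f i w - (c * (z \<bullet> eta i w)) *\<^sub>R X i w)) \<le> c * k * H * a3" .
    qed
    finally show ?thesis by (simp add: algebra_simps)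
  qed
  have V: "Vst \<theta> (w, z) = \<mu> + - S w" for w
  proof -
    have fw: "f i w = s *\<^sub>R (X i w - wexp \<theta> i (w, z) *\<^sub>R X i w)" for i
      by (simp add: f_def F_def wexp_def k_def c_def s_def algebra_simps)
    have fs: "(\<Sum>i<n. f i w) = s *\<^sub>R W w - s *\<^sub>R (\<Sum>i<n. wexp \<theta> i (w, z) *\<^sub>R X i w)"
      unfolding fw scaleR_sum_right[symmetric] sum_subtractf W_def by (rule scaleR_diff_right)
    show ?thesis
      unfolding Vst_def path'_def \<mu>_def S_def sum_subtractf fs fst_conv snd_conv c_def s_def by simp
  qed
  have Sm [measurable]: "S \<in> borel_measurable P" unfolding S_def by measurable
  have intS: "integrable P (\<lambda>w. norm (S w) powr p)"
    unfolding S_def using p intfp[of p]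
    by (intro integrable_norm_powr_sum centered_powr_le(2)) auto
  have "expectation (\<lambda>w. norm (Vst \<theta> (w, z)) powr p) \<le> expectation (\<lambda>w. 2 powr p * (norm \<mu> powr p + norm (S w) powr p))"
  proof (rule Bochner_Integration.integral_mono')
    show "norm (Vst \<theta> (w, z)) powr p \<le> 2 powr p * (norm \<mu> powr p + norm (S w) powr p)" for w
      unfolding V using norm_add_powr_bound[of p \<mu> "- S w"] p by simp
  qed (use intS in auto)
  also have "\<dots> = 2 powr p * (norm \<mu> powr p + expectation (\<lambda>w. norm (S w) powr p))"
    using intS by (simp add: prob_space)
  also have "\<dots> \<le> 2 powr p * ((c * H * (\<Delta> + k * (n * a3))) powr p + (c * H) powr p * ros_bound p a2 ap)"
    using mu ros p by (intro mult_left_mono add_mono powr_mono2) auto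
  also have "(c * H * (\<Delta> + k * (n * a3))) powr p = (c * H) powr p * (\<Delta> + k * (n * a3)) powr p"
    by (rule powr_mult)
  also have "2 powr p * ((c * H) powr p * (\<Delta> + k * (n * a3)) powr p + (c * H) powr p * ros_bound p a2 ap)
    = (c * H) powr p * (2 powr p * (ros_bound p a2 ap + (\<Delta> + k * (n * a3)) powr p))" by (simp add: algebra_simps)
  finally show ?thesis by (simp add: c_def s_def k_def H_def)
qed

lemma ros_bound_nonneg: "0 \<le> ap \<Longrightarrow> 0 \<le> ros_bound p a2 ap"
  by (simp add: ros_bound_def ros_const_def)

definition gauss_H :: "real \<Rightarrow> real"
  where "gauss_H p = (\<integral>z. stein_H (z :: real ^ 'd) powr p \<partial>std_gauss)"

lemma stein_H_powr_integrable: "integrable std_gauss (\<lambda>z :: real ^ 'd. stein_H z powr p)"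
  by (rule integral_std_gauss_bound[where C = "2 powr p * exp p" and k = "3 * p"])
     (auto simp: stein_H_def powr_mult exp_powr_real exp_add[symmetric] algebra_simps)

lemma Vst_Lp_bound:
  fixes \<theta> p a2 ap a3 \<Delta> :: real
  assumes th: "0 < \<theta>" "\<theta> \<le> pi / 2" and p: "2 \<le> p"
    and kap: "cos \<theta> / sin \<theta> * ((2 * m + 1) * \<tau>) \<le> 1"
    and a2: "\<And>i. i < n \<Longrightarrow> expectation (\<lambda>w. (norm (X i w))\<^sup>2 * (norm (eta i w))\<^sup>2) \<le> a2" "0 \<le> a2"
    and ap: "\<And>i. i < n \<Longrightarrow> expectation (\<lambda>w. norm (X i w) powr p * norm (eta i w) powr p) \<le> ap" "0 \<le> ap"
    and a3: "\<And>i. i < n \<Longrightarrow> expectation (\<lambda>w. norm (X i w) * (norm (eta i w))\<^sup>2) \<le> a3" "0 \<le> a3"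
    and cov: "\<And>z. norm (expectation (\<lambda>w. (z \<bullet> W w) *\<^sub>R W w) - z) \<le> \<Delta> * norm z" and Delta: "0 \<le> \<Delta>"
  shows "(\<integral>x. norm (Vst \<theta> x) powr p \<partial>MG)
    \<le> cos \<theta> powr p * (gauss_H p * (2 powr p * (ros_bound p a2 ap + (\<Delta> + cos \<theta> / sin \<theta> * (n * a3)) powr p)))"
proof -
  define D where "D = 2 powr p * (ros_bound p a2 ap + (\<Delta> + cos \<theta> / sin \<theta> * (n * a3)) powr p)"
  have c: "0 \<le> cos \<theta>" using th by (intro cos_ge_zero) auto
  define K where "K = 2 * (real n * \<tau>) + 1"
  define k where "k = \<bar>cos \<theta> / sin \<theta>\<bar> * ((2 * m + 1) * \<tau>) + 1"
  have intV: "integrable MG (\<lambda>x. norm (Vst \<theta> x) powr p)"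
  proof (rule integrable_exp_bound[where C = "K powr p" and k = "p * k"])
    fix w and z :: "real ^ 'd" assume w1: "w \<in> space P"
    have "norm (Vst \<theta> (w, z)) powr p \<le> (K * exp (k * norm z)) powr p"
      unfolding K_def k_def using Vst_bound[OF w1] p by (intro powr_mono2) auto
    then show "norm (norm (Vst \<theta> (w, z)) powr p) \<le> K powr p * exp (p * k * norm z)"
      using tau_nonneg by (simp add: K_def powr_mult exp_powr_real mult_ac)
  qed measurable
  then have i2: "integrable MG (\<lambda>(w, z :: real ^ 'd). norm (Vst \<theta> (w, z)) powr p)" by (simp add: case_prod_beta')
  have "(\<integral>x. norm (Vst \<theta> x) powr p \<partial>MG) = (\<integral>z. expectation (\<lambda>w. norm (Vst \<theta> (w, z)) powr p) \<partial>std_gauss)"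
    using pair.integral_snd[OF i2] by (simp add: case_prod_beta')
  also have "\<dots> \<le> (\<integral>z. (cos \<theta> powr p * D) * stein_H (z :: real ^ 'd) powr p \<partial>std_gauss)"
  proof (rule integral_mono)
    show "expectation (\<lambda>w. norm (Vst \<theta> (w, z)) powr p) \<le> (cos \<theta> powr p * D) * stein_H z powr p" for z
      using Vst_fiber_bound[OF th p kap a2 ap a3 cov Delta, of z] c stein_H_pos[of z]
      by (simp add: D_def powr_mult mult_ac)
  qed (use pair.integrable_snd[OF i2] stein_H_powr_integrable in auto)
  also have "\<dots> = cos \<theta> powr p * (gauss_H p * D)" by (simp add: gauss_H_def)
  finally show ?thesis by (simp add: D_def)
qed

text \<open>With \<open>tan \<theta>0 = \<beta>\<close>, the vector \<open>W\<close> is compared with \<open>W + \<beta> Z = path \<theta>0 / cos \<theta>0\<close>, then with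
  \<open>V / cos \<theta>0\<close> and finally with \<open>V\<close>.\<close>

lemma stein_coupling:
  fixes p a2 ap a3 \<Delta> \<beta> :: real
  assumes p: "2 \<le> p" and beta: "\<beta> = real (2 * m + 1) * \<tau>" "0 < \<beta>"
    and a2: "\<And>i. i < n \<Longrightarrow> expectation (\<lambda>w. (norm (X i w))\<^sup>2 * (norm (eta i w))\<^sup>2) \<le> a2" "0 \<le> a2"
    and ap: "\<And>i. i < n \<Longrightarrow> expectation (\<lambda>w. norm (X i w) powr p * norm (eta i w) powr p) \<le> ap" "0 \<le> ap"
    and a3: "\<And>i. i < n \<Longrightarrow> expectation (\<lambda>w. norm (X i w) * (norm (eta i w))\<^sup>2) \<le> a3" "0 \<le> a3"
    and cov: "\<And>z. norm (expectation (\<lambda>w. (z \<bullet> W w) *\<^sub>R W w) - z) \<le> \<Delta> * norm z" and Delta: "0 \<le> \<Delta>"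
  obtains Q :: "(real \<times> (real ^ 'd)) measure" and V :: "(('a \<times> (real ^ 'd)) \<times> (real ^ 'd)) \<times> real \<times> (real ^ 'd) \<Rightarrow> real ^ 'd"
  where "prob_space Q" "V \<in> borel_measurable (MGG \<Otimes>\<^sub>M Q)" "distr (MGG \<Otimes>\<^sub>M Q) borel V = std_gauss"
    "(\<integral>\<^sup>+x. ennreal (norm (W (fst (fst (fst x))) - V x) powr p) \<partial>(MGG \<Otimes>\<^sub>M Q))
      \<le> ennreal (3 powr (p - 1) * (2 * (\<beta> powr p * (\<integral>z. norm (z :: real ^ 'd) powr p \<partial>std_gauss)) + \<beta> powr p
          + 3 powr (p - 1) * (arctan (1 / \<beta>) powr p * (gauss_H p * (2 powr p * (ros_bound p a2 ap + (\<Delta> + n * a3 / \<beta>) powr p))))))"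
proof -
  define \<theta>0 where "\<theta>0 = arctan \<beta>"
  define c0 where "c0 = cos \<theta>0"
  define Zp where "Zp = (\<integral>z. norm (z :: real ^ 'd) powr p \<partial>std_gauss)"
  define D where "D = gauss_H p * (2 powr p * (ros_bound p a2 ap + (\<Delta> + n * a3 / \<beta>) powr p))"
  have th0: "0 < \<theta>0" "\<theta>0 < pi / 2" using beta(2) arctan_ubound[of \<beta>] by (auto simp: \<theta>0_def)
  have c0: "0 < c0" "c0 \<le> 1" unfolding c0_def using th0 by (auto intro: cos_gt_zero_pi)
  have s0: "sin \<theta>0 = \<beta> * c0" using c0 tan_arctan[of \<beta>] by (simp add: c0_def \<theta>0_def tan_def field_simps)
  have pi2: "pi / 2 - \<theta>0 = arctan (1 / \<beta>)" using arctan_inverse[of \<beta>] beta(2) by (simp add: \<theta>0_def inverse_eq_divide)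
  have gH: "0 \<le> gauss_H p" by (simp add: gauss_H_def)
  have D0: "0 \<le> D" unfolding D_def using gH ros_bound_nonneg[OF ap(2)] by simp
  have Zp0: "0 \<le> Zp" by (simp add: Zp_def)
  \<comment> \<open>From \<open>\<theta>0\<close> on the cotangent is at most
    \<open>1 / \<beta>\<close>, which makes all Cameron-Martin shifts have norm at most 1. The
    factor \<open>c0 powr p\<close> is kept because dividing the path by \<open>c0\<close> later
    costs \<open>(1 / c0) powr p\<close>; the two cancel, however close \<open>\<theta>0\<close> is
    to \<open>pi / 2\<close>.\<close>
  have vG: "(\<integral>x. norm (vel \<theta> (path \<theta> x)) powr p \<partial>MG) \<le> c0 powr p * D" if th: "\<theta>0 \<le> \<theta>" "\<theta> \<le> pi / 2" for \<theta>
  proof -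
    have th': "0 < \<theta>" using th th0 by simp
    have c: "0 \<le> cos \<theta>" "cos \<theta> \<le> c0" unfolding c0_def using th th0 by (auto intro!: cos_ge_zero cos_monotone_0_pi_le)
    have s: "\<beta> * c0 \<le> sin \<theta>" unfolding s0[symmetric] using th th0 by (intro sin_monotone_2pi_le) auto
    have sp: "0 < \<beta> * c0" using beta(2) c0 by simp
    have k: "cos \<theta> / sin \<theta> \<le> 1 / \<beta>" "0 \<le> cos \<theta> / sin \<theta>"
    proof -
      have "cos \<theta> / sin \<theta> \<le> c0 / (\<beta> * c0)" using c s sp c0 by (intro frac_le) auto
      then show "cos \<theta> / sin \<theta> \<le> 1 / \<beta>" using c0 by simp
    qed (use c s sp in auto)
    have kap: "cos \<theta> / sin \<theta> * ((2 * m + 1) * \<tau>) \<le> 1"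
    proof -
      have "cos \<theta> / sin \<theta> * \<beta> \<le> 1" using mult_right_mono[OF k(1), of \<beta>] beta(2) by simp
      then show ?thesis by (simp only: beta(1))
    qed
    have "(\<integral>x. norm (vel \<theta> (path \<theta> x)) powr p \<partial>MG) \<le> (\<integral>x. norm (Vst \<theta> x) powr p \<partial>MG)"
      by (rule vel_le_Vst[OF th' th(2) p])
    also have "\<dots> \<le> cos \<theta> powr p * (gauss_H p * (2 powr p * (ros_bound p a2 ap + (\<Delta> + cos \<theta> / sin \<theta> * (n * a3)) powr p)))"
      by (rule Vst_Lp_bound[OF th' th(2) p kap a2 ap a3 cov Delta])
    also have "\<dots> \<le> c0 powr p * D"
      unfolding D_def
    proof (rule mult_mono)
      show "cos \<theta> powr p \<le> c0 powr p" using c p by (intro powr_mono2) auto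
      have "cos \<theta> / sin \<theta> * (n * a3) \<le> 1 / \<beta> * (n * a3)" using k a3(2) by (intro mult_right_mono) auto
      moreover have "0 \<le> \<Delta> + cos \<theta> / sin \<theta> * (n * a3)" using Delta k a3(2) by (intro add_nonneg_nonneg mult_nonneg_nonneg) auto
      ultimately have "(\<Delta> + cos \<theta> / sin \<theta> * (n * a3)) powr p \<le> (\<Delta> + n * a3 / \<beta>) powr p"
        using p by (intro powr_mono2) auto
      then show "gauss_H p * (2 powr p * (ros_bound p a2 ap + (\<Delta> + cos \<theta> / sin \<theta> * (n * a3)) powr p))
        \<le> gauss_H p * (2 powr p * (ros_bound p a2 ap + (\<Delta> + n * a3 / \<beta>) powr p))"
        using gH by (intro mult_left_mono add_left_mono) auto
      show "0 \<le> gauss_H p * (2 powr p * (ros_bound p a2 ap + (\<Delta> + cos \<theta> / sin \<theta> * (n * a3)) powr p))"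
        using gH ros_bound_nonneg[OF ap(2)] by simp
    qed simp
    finally show ?thesis .
  qed
  have G0: "0 \<le> c0 powr p * D" using D0 by simp
  \<comment> \<open>The free error of \<open>flow_coupling\<close> is set to
    \<open>(c0 * \<beta>) powr p\<close>, which becomes \<open>\<beta> powr p\<close> after the
    division by \<open>c0\<close>.\<close>
  have e0: "0 < (c0 * \<beta>) powr p" using c0 beta(2) by simp
  obtain Q :: "(real \<times> (real ^ 'd)) measure" and V where Q: "prob_space Q" and V [measurable]: "V \<in> borel_measurable (MGG \<Otimes>\<^sub>M Q)"
    and lawV: "distr (MGG \<Otimes>\<^sub>M Q) borel V = std_gauss"
    and cost: "(\<integral>\<^sup>+x. ennreal (norm (path \<theta>0 (fst (fst x)) - V x) powr p) \<partial>(MGG \<Otimes>\<^sub>M Q))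
      \<le> ennreal (3 powr (p - 1) * ((pi / 2 - \<theta>0) powr p * (c0 powr p * D)) + (c0 * \<beta>) powr p)"
    by (rule flow_coupling[OF th0(1) less_imp_le[OF th0(2)] p G0 e0 vG])
  interpret pair2: pair_prob_space MG "std_gauss :: (real ^ 'd) measure" ..
  let ?\<Omega> = "MGG \<Otimes>\<^sub>M Q"
  have c0b: "1 / c0 - 1 \<le> \<beta>" "0 \<le> 1 / c0 - 1"
  proof -
    have "1 / c0 = sqrt (1 + \<beta>\<^sup>2)" using c0 by (simp add: c0_def \<theta>0_def cos_arctan)
    also have "\<dots> \<le> sqrt ((1 + \<beta>)\<^sup>2)" using beta(2) by (intro real_sqrt_le_mono) (simp add: power2_eq_square algebra_simps)
    finally show "1 / c0 - 1 \<le> \<beta>" using beta(2) by simp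
  qed (use c0 in simp)
  have nnZ: "(\<integral>\<^sup>+z. ennreal (norm (z :: real ^ 'd) powr p) \<partial>std_gauss) = ennreal Zp"
    unfolding Zp_def by (rule nn_integral_eq_integral[OF integrable_norm_powr_std_gauss]) (use p in auto)
  have nV: "(\<integral>\<^sup>+x. ennreal (norm (V x) powr p) \<partial>?\<Omega>) = ennreal Zp"
  proof -
    have "(\<integral>\<^sup>+x. ennreal (norm (V x) powr p) \<partial>?\<Omega>) = (\<integral>\<^sup>+z. ennreal (norm z powr p) \<partial>distr ?\<Omega> borel V)"
      by (subst nn_integral_distr) auto
    then show ?thesis by (simp add: lawV nnZ)
  qed
  have n1: "(\<integral>\<^sup>+x. ennreal (norm (snd (fst (fst x))) powr p) \<partial>?\<Omega>) = ennreal Zp"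
  proof -
    have "(\<integral>\<^sup>+x. ennreal (norm (snd (fst (fst x))) powr p) \<partial>?\<Omega>) = (\<integral>\<^sup>+x. ennreal (norm (snd (fst x)) powr p) \<partial>MGG)"
      by (rule nn_integral_pair_fst[OF pair2.prob_space_axioms Q]) measurable
    also have "\<dots> = (\<integral>\<^sup>+x. ennreal (norm (snd x) powr p) \<partial>MG)"
      by (rule nn_integral_MGG_fst) measurable
    also have "\<dots> = (\<integral>\<^sup>+z. ennreal (norm (z :: real ^ 'd) powr p) \<partial>std_gauss)"
      by (rule nn_integral_pair_snd[OF prob_space_axioms std_gauss.prob_space_axioms]) measurable
    finally show ?thesis by (simp add: nnZ)
  qed
  have split: "norm (W w - v) powr p \<le> 3 powr (p - 1) * (\<beta> powr p * norm z powr p + (1 / c0) powr p * norm (path \<theta>0 (w, z) - v) powr p + \<beta> powr p * norm v powr p)" for w z v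
  proof -
    define w1 where "w1 i = (if i = (0::nat) then - (\<beta> *\<^sub>R z) else if i = 1 then (1 / c0) *\<^sub>R (path \<theta>0 (w, z) - v) else (1 / c0 - 1) *\<^sub>R v)" for i
    have "(1 / c0) *\<^sub>R path \<theta>0 (w, z) = W w + \<beta> *\<^sub>R z"
      using c0 s0 by (simp add: path_def c0_def[symmetric] scaleR_add_right)
    then have sum: "(\<Sum>i<3. w1 i) = W w - v" by (simp add: w1_def numeral_3_eq_3 algebra_simps)
    have "norm (\<Sum>i<3. w1 i) powr p \<le> real (card {..<3::nat}) powr (p - 1) * (\<Sum>i<3. norm (w1 i) powr p)"
      by (rule sum_norm_powr_le) (use p in auto)
    also have "\<dots> = 3 powr (p - 1) * (norm (- (\<beta> *\<^sub>R z)) powr p + norm ((1 / c0) *\<^sub>R (path \<theta>0 (w, z) - v)) powr p + norm ((1 / c0 - 1) *\<^sub>R v) powr p)"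
      by (simp add: w1_def numeral_3_eq_3)
    also have "\<dots> \<le> 3 powr (p - 1) * (\<beta> powr p * norm z powr p + (1 / c0) powr p * norm (path \<theta>0 (w, z) - v) powr p + \<beta> powr p * norm v powr p)"
    proof (intro mult_left_mono add_mono)
      show "norm (- (\<beta> *\<^sub>R z)) powr p \<le> \<beta> powr p * norm z powr p" using beta(2) by (simp add: powr_mult)
      show "norm ((1 / c0) *\<^sub>R (path \<theta>0 (w, z) - v)) powr p \<le> (1 / c0) powr p * norm (path \<theta>0 (w, z) - v) powr p"
        unfolding norm_scaleR using c0 by (simp add: powr_mult[symmetric])
      have "norm ((1 / c0 - 1) *\<^sub>R v) \<le> \<beta> * norm v" unfolding norm_scaleR using c0b by (intro mult_right_mono) auto
      then have "norm ((1 / c0 - 1) *\<^sub>R v) powr p \<le> (\<beta> * norm v) powr p" using p by (intro powr_mono2) auto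
      then show "norm ((1 / c0 - 1) *\<^sub>R v) powr p \<le> \<beta> powr p * norm v powr p" using beta(2) by (simp add: powr_mult)
    qed simp
    finally show ?thesis unfolding sum .
  qed
  have "(\<integral>\<^sup>+x. ennreal (norm (W (fst (fst (fst x))) - V x) powr p) \<partial>?\<Omega>)
     \<le> (\<integral>\<^sup>+x. ennreal (3 powr (p - 1)) * ((ennreal (\<beta> powr p) * ennreal (norm (snd (fst (fst x))) powr p)
         + ennreal ((1 / c0) powr p) * ennreal (norm (path \<theta>0 (fst (fst x)) - V x) powr p)) + ennreal (\<beta> powr p) * ennreal (norm (V x) powr p)) \<partial>?\<Omega>)"
  proof (rule nn_integral_mono)
    fix x :: "(('a \<times> (real ^ 'd)) \<times> (real ^ 'd)) \<times> real \<times> (real ^ 'd)"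
    have "norm (W (fst (fst (fst x))) - V x) powr p \<le> 3 powr (p - 1) * (\<beta> powr p * norm (snd (fst (fst x))) powr p
        + (1 / c0) powr p * norm (path \<theta>0 (fst (fst x)) - V x) powr p + \<beta> powr p * norm (V x) powr p)"
      using split[of "fst (fst (fst x))" "V x" "snd (fst (fst x))"] by simp
    then show "ennreal (norm (W (fst (fst (fst x))) - V x) powr p) \<le> ennreal (3 powr (p - 1)) * ((ennreal (\<beta> powr p) * ennreal (norm (snd (fst (fst x))) powr p)
         + ennreal ((1 / c0) powr p) * ennreal (norm (path \<theta>0 (fst (fst x)) - V x) powr p)) + ennreal (\<beta> powr p) * ennreal (norm (V x) powr p))"
      by (simp add: ennreal_plus[symmetric] ennreal_mult[symmetric] ennreal_leI del: ennreal_plus)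
  qed
  also have "\<dots> = ennreal (3 powr (p - 1)) * ((ennreal (\<beta> powr p) * (\<integral>\<^sup>+x. ennreal (norm (snd (fst (fst x))) powr p) \<partial>?\<Omega>)
     + ennreal ((1 / c0) powr p) * (\<integral>\<^sup>+x. ennreal (norm (path \<theta>0 (fst (fst x)) - V x) powr p) \<partial>?\<Omega>)) + ennreal (\<beta> powr p) * (\<integral>\<^sup>+x. ennreal (norm (V x) powr p) \<partial>?\<Omega>))"
  proof -
    have lin: "(\<integral>\<^sup>+x. a * ((b * f x + c * g x) + d * h x) \<partial>?\<Omega>) = a * ((b * (\<integral>\<^sup>+x. f x \<partial>?\<Omega>) + c * (\<integral>\<^sup>+x. g x \<partial>?\<Omega>)) + d * (\<integral>\<^sup>+x. h x \<partial>?\<Omega>))"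
      if "f \<in> borel_measurable ?\<Omega>" "g \<in> borel_measurable ?\<Omega>" "h \<in> borel_measurable ?\<Omega>" for a b c d :: ennreal and f g h
      using that by (simp add: nn_integral_cmult nn_integral_add)
    show ?thesis by (rule lin) measurable
  qed
  also have "\<dots> \<le> ennreal (3 powr (p - 1)) * ((ennreal (\<beta> powr p) * ennreal Zp
     + ennreal ((1 / c0) powr p) * ennreal (3 powr (p - 1) * ((pi / 2 - \<theta>0) powr p * (c0 powr p * D)) + (c0 * \<beta>) powr p)) + ennreal (\<beta> powr p) * ennreal Zp)"
    unfolding n1 nV using cost by (intro mult_left_mono add_mono) auto
  also have "\<dots> = ennreal (3 powr (p - 1) * ((\<beta> powr p * Zp + (1 / c0) powr p * (3 powr (p - 1) * ((pi / 2 - \<theta>0) powr p * (c0 powr p * D)) + (c0 * \<beta>) powr p)) + \<beta> powr p * Zp))"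
    using Zp0 D0 by (simp add: ennreal_plus[symmetric] ennreal_mult[symmetric] del: ennreal_plus)
  also have "(\<beta> powr p * Zp + (1 / c0) powr p * (3 powr (p - 1) * ((pi / 2 - \<theta>0) powr p * (c0 powr p * D)) + (c0 * \<beta>) powr p)) + \<beta> powr p * Zp
    = 2 * (\<beta> powr p * Zp) + \<beta> powr p + 3 powr (p - 1) * (arctan (1 / \<beta>) powr p * D)"
  proof -
    have "(1 / c0) powr p * c0 powr p = 1" using c0 by (simp add: powr_mult[symmetric])
    moreover have "(c0 * \<beta>) powr p = c0 powr p * \<beta> powr p" using c0 beta(2) by (simp add: powr_mult)
    moreover have "b * z + i * (t * (q * (c * d)) + c * b) + b * z = 2 * (b * z) + b + t * (q * d)" if "i * c = 1" for b z i t q c d :: real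
    proof -
      have "b * z + i * (t * (q * (c * d)) + c * b) + b * z = 2 * (b * z) + (i * c) * b + (i * c) * (t * (q * d))" by (simp add: algebra_simps)
      then show ?thesis by (simp add: that)
    qed
    ultimately show ?thesis unfolding pi2 by metis
  qed
  finally show ?thesis unfolding D_def Zp_def by (rule that[OF Q V lawV])
qed

end

section \<open>Linear images of Gaussian measures and whitening\<close>

lemma lborel_eq_PiM: "(lborel :: 'v::euclidean_space measure) = distr (\<Pi>\<^sub>M b\<in>Basis. lborel) borel (\<lambda>f. \<Sum>b\<in>Basis. f b *\<^sub>R b)"
  by (simp add: lborel_def[where 'a = 'v] lborel_eq_real)

text \<open>By Fubini with the coordinate of \<open>b\<close> integrated innermost: since
  \<open>b\<close> and \<open>b'\<close> differ, the shear acts on this coordinate as a translation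
  by an amount that is fixed by the others.\<close>

lemma nn_integral_lborel_shear:
  fixes h :: "'v::euclidean_space \<Rightarrow> ennreal"
  assumes [measurable]: "h \<in> borel_measurable borel" and b: "b \<in> Basis" "b' \<in> Basis" "b \<noteq> b'"
  shows "(\<integral>\<^sup>+x. h (x + (c * (x \<bullet> b')) *\<^sub>R b) \<partial>lborel) = (\<integral>\<^sup>+x. h x \<partial>lborel)"
proof -
  interpret product_sigma_finite "\<lambda>_::'v. lborel :: real measure" ..
  let ?I = "Basis - {b} :: 'v set"
  have I: "insert b ?I = Basis" "finite ?I" "b \<notin> ?I" using b by auto
  have fub: "(\<integral>\<^sup>+x. g x \<partial>lborel) = (\<integral>\<^sup>+f. (\<integral>\<^sup>+y. g (y *\<^sub>R b + (\<Sum>j\<in>?I. f j *\<^sub>R j)) \<partial>lborel) \<partial>(\<Pi>\<^sub>M j\<in>?I. lborel))"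
    if [measurable]: "g \<in> borel_measurable borel" for g :: "'v \<Rightarrow> ennreal"
  proof -
    have "(\<integral>\<^sup>+x. g x \<partial>lborel) = (\<integral>\<^sup>+f. g (\<Sum>j\<in>Basis. f j *\<^sub>R j) \<partial>(\<Pi>\<^sub>M j\<in>insert b ?I. lborel))"
      unfolding I(1) by (subst lborel_eq_PiM[where 'v = 'v]) (rule nn_integral_distr, measurable)
    also have "\<dots> = (\<integral>\<^sup>+f. (\<integral>\<^sup>+y. g (\<Sum>j\<in>Basis. (f(b := y)) j *\<^sub>R j) \<partial>lborel) \<partial>(\<Pi>\<^sub>M j\<in>?I. lborel))"
      by (rule product_nn_integral_insert[OF I(2,3)]) (simp add: I(1))
    also have "(\<lambda>f y. g (\<Sum>j\<in>Basis. (f(b := y)) j *\<^sub>R j)) = (\<lambda>f y. g (y *\<^sub>R b + (\<Sum>j\<in>?I. f j *\<^sub>R j)))"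
    proof (intro ext arg_cong[where f = g])
      fix f y
      have "(\<Sum>j\<in>Basis. (f(b := y)) j *\<^sub>R j) = (f(b := y)) b *\<^sub>R b + (\<Sum>j\<in>?I. (f(b := y)) j *\<^sub>R j)"
        by (rule sum.remove[OF finite_Basis b(1)])
      also have "(\<Sum>j\<in>?I. (f(b := y)) j *\<^sub>R j) = (\<Sum>j\<in>?I. f j *\<^sub>R j)" by (intro sum.cong) auto
      finally show "(\<Sum>j\<in>Basis. (f(b := y)) j *\<^sub>R j) = y *\<^sub>R b + (\<Sum>j\<in>?I. f j *\<^sub>R j)" by simp
    qed
    finally show ?thesis .
  qed
  have sb: "(\<Sum>j\<in>?I. f j *\<^sub>R j) \<bullet> b' = f b'" for f
    using b by (simp add: inner_sum_left inner_Basis sum.delta if_distrib cong: if_cong)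
  have "(\<integral>\<^sup>+x. h (x + (c * (x \<bullet> b')) *\<^sub>R b) \<partial>lborel)
    = (\<integral>\<^sup>+f. (\<integral>\<^sup>+y. h (y *\<^sub>R b + (\<Sum>j\<in>?I. f j *\<^sub>R j) + (c * ((y *\<^sub>R b + (\<Sum>j\<in>?I. f j *\<^sub>R j)) \<bullet> b')) *\<^sub>R b) \<partial>lborel) \<partial>(\<Pi>\<^sub>M j\<in>?I. lborel))"
    by (rule fub) measurable
  also have "\<dots> = (\<integral>\<^sup>+f. (\<integral>\<^sup>+y. h ((c * f b' + 1 * y) *\<^sub>R b + (\<Sum>j\<in>?I. f j *\<^sub>R j)) \<partial>lborel) \<partial>(\<Pi>\<^sub>M j\<in>?I. lborel))"
  proof (intro nn_integral_cong arg_cong[where f = h])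
    fix f y
    have "(y *\<^sub>R b + (\<Sum>j\<in>?I. f j *\<^sub>R j)) \<bullet> b' = f b'" using b by (simp add: inner_add_left sb inner_Basis)
    then show "y *\<^sub>R b + (\<Sum>j\<in>?I. f j *\<^sub>R j) + (c * ((y *\<^sub>R b + (\<Sum>j\<in>?I. f j *\<^sub>R j)) \<bullet> b')) *\<^sub>R b
        = (c * f b' + 1 * y) *\<^sub>R b + (\<Sum>j\<in>?I. f j *\<^sub>R j)"
      by (simp add: algebra_simps)
  qed
  also have "\<dots> = (\<integral>\<^sup>+f. (\<integral>\<^sup>+y. h (y *\<^sub>R b + (\<Sum>j\<in>?I. f j *\<^sub>R j)) \<partial>lborel) \<partial>(\<Pi>\<^sub>M j\<in>?I. lborel))"
  proof (rule nn_integral_cong)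
    fix f :: "'v \<Rightarrow> real"
    show "(\<integral>\<^sup>+y. h ((c * f b' + 1 * y) *\<^sub>R b + (\<Sum>j\<in>?I. f j *\<^sub>R j)) \<partial>lborel) = (\<integral>\<^sup>+y. h (y *\<^sub>R b + (\<Sum>j\<in>?I. f j *\<^sub>R j)) \<partial>lborel)"
      using nn_integral_real_affine[of "\<lambda>y. h (y *\<^sub>R b + (\<Sum>j\<in>?I. f j *\<^sub>R j))" 1 "c * f b'"] by simp
  qed
  also have "\<dots> = (\<integral>\<^sup>+x. h x \<partial>lborel)" by (rule fub[symmetric]) measurable
  finally show ?thesis .
qed

lemma measurable_matrix_mult [measurable]: "(*v) A \<in> borel_measurable borel" for A :: "real ^ 'n ^ 'm"
  by (intro borel_measurable_continuous_onI matrix_vector_mult_linear_continuous_on)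

text \<open>The library proves the change of variables only for well-ordered index types.\<close>

lemma nn_integral_lborel_matrix:
  fixes A :: "real ^ 'n ^ 'n" and h :: "real ^ 'n \<Rightarrow> ennreal"
  assumes "det A \<noteq> 0" and "h \<in> borel_measurable borel"
  shows "(\<integral>\<^sup>+x. h x \<partial>lborel) = ennreal \<bar>det A\<bar> * (\<integral>\<^sup>+x. h (A *v x) \<partial>lborel)"
proof -
  \<comment> \<open>Invertibility is a premise inside the induction predicate, so that products can
    be decomposed into their invertible factors and the case of a zero row is vacuous.\<close>
  define Q where "Q A \<longleftrightarrow> (det A \<noteq> 0 \<longrightarrow> (\<forall>h\<in>borel_measurable borel. (\<integral>\<^sup>+x. h x \<partial>lborel) = ennreal \<bar>det A\<bar> * (\<integral>\<^sup>+x. h (A *v x) \<partial>lborel)))"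
    for A :: "real ^ 'n ^ 'n"
  have QD: "(\<integral>\<^sup>+x. h x \<partial>lborel) = ennreal \<bar>det A\<bar> * (\<integral>\<^sup>+x. h (A *v x) \<partial>lborel)"
    if "Q A" "det A \<noteq> 0" "h \<in> borel_measurable borel" for A :: "real ^ 'n ^ 'n" and h
    using that unfolding Q_def by blast
  have "Q A"
  proof (induction A rule: induct_matrix_elementary)
    case (1 A B)
    show ?case unfolding Q_def
    proof (intro impI ballI)
      fix h :: "real ^ 'n \<Rightarrow> ennreal" assume d: "det (A ** B) \<noteq> 0" and [measurable]: "h \<in> borel_measurable borel"
      have AB: "det A \<noteq> 0" "det B \<noteq> 0" using d by (auto simp: det_mul)
      have "(\<integral>\<^sup>+x. h x \<partial>lborel) = ennreal \<bar>det A\<bar> * (\<integral>\<^sup>+x. h (A *v x) \<partial>lborel)" by (rule QD[OF 1(1) AB(1)]) measurable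
      also have "(\<integral>\<^sup>+x. h (A *v x) \<partial>lborel) = ennreal \<bar>det B\<bar> * (\<integral>\<^sup>+x. h (A *v (B *v x)) \<partial>lborel)"
        by (rule QD[OF 1(2) AB(2)]) measurable
      finally show "(\<integral>\<^sup>+x. h x \<partial>lborel) = ennreal \<bar>det (A ** B)\<bar> * (\<integral>\<^sup>+x. h (A ** B *v x) \<partial>lborel)"
        by (simp add: det_mul abs_mult ennreal_mult mult_ac matrix_vector_mul_assoc)
    qed
  next
    case (2 A i)
    then show ?case by (simp add: Q_def det_zero_row)
  next
    case (3 A)
    have det: "det A = (\<Prod>i\<in>UNIV. A $ i $ i)" by (rule det_diagonal) (use 3 in auto)
    show ?case unfolding Q_def
    proof (intro impI ballI)
      fix h :: "real ^ 'n \<Rightarrow> ennreal" assume d: "det A \<noteq> 0" and [measurable]: "h \<in> borel_measurable borel"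
      \<comment> \<open>On coordinate vectors \<open>c\<close> is the diagonal entry;
        \<open>lborel_affine_euclidean\<close> takes its scaling factors as a function on
        \<open>Basis\<close>.\<close>
      define c where "c x = x \<bullet> (A *v x)" for x
      have Bas: "(Basis :: (real ^ 'n) set) = (\<lambda>i. axis i 1) ` UNIV" by (auto simp: Basis_vec_def)
      have inj: "inj (\<lambda>i. axis i (1::real) :: real ^ 'n)" by (auto simp: inj_on_def axis_eq_axis)
      have ca: "c (axis i 1) = A $ i $ i" for i
        by (simp add: c_def matrix_vector_mult_basis inner_axis' column_def)
      have T: "0 + (\<Sum>j\<in>Basis. (c j * (x \<bullet> j)) *\<^sub>R j) = A *v x" for x
      proof (subst vec_eq_iff, intro allI)
        fix i
        have "(A *v x) $ i = (\<Sum>j\<in>UNIV. if j = i then A $ i $ i * x $ i else 0)"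
          unfolding matrix_vector_mult_def vec_lambda_beta by (intro sum.cong) (use 3 in auto)
        moreover have "(0 + (\<Sum>j\<in>Basis. (c j * (x \<bullet> j)) *\<^sub>R j)) $ i = (\<Sum>j\<in>UNIV. if j = i then A $ i $ i * x $ i else 0)"
          unfolding Bas sum.reindex[OF inj] o_def ca inner_axis by (simp add: axis_def if_distrib[of "\<lambda>a. _ * a"] cong: if_cong)
        ultimately show "(0 + (\<Sum>j\<in>Basis. (c j * (x \<bullet> j)) *\<^sub>R j)) $ i = (A *v x) $ i" by simp
      qed
      have "(\<Prod>j\<in>Basis. \<bar>c j\<bar>) = \<bar>det A\<bar>" unfolding Bas by (simp add: prod.reindex[OF inj] ca det abs_prod)
      moreover have "c j \<noteq> 0" if "j \<in> Basis" for j using that d unfolding Bas by (auto simp: ca det)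
      ultimately have "lborel = density (distr lborel borel ((*v) A)) (\<lambda>_. ennreal \<bar>det A\<bar>)"
        using lborel_affine_euclidean[of c 0] unfolding T by simp
      then have "(\<integral>\<^sup>+x. h x \<partial>lborel) = (\<integral>\<^sup>+x. h x \<partial>density (distr lborel borel ((*v) A)) (\<lambda>_. ennreal \<bar>det A\<bar>))" by simp
      also have "\<dots> = ennreal \<bar>det A\<bar> * (\<integral>\<^sup>+x. h (A *v x) \<partial>lborel)"
        by (simp add: nn_integral_density nn_integral_distr nn_integral_cmult)
      finally show "(\<integral>\<^sup>+x. h x \<partial>lborel) = ennreal \<bar>det A\<bar> * (\<integral>\<^sup>+x. h (A *v x) \<partial>lborel)" .
    qed
  next
    case (4 m n)
    let ?A = "\<chi> i j. mat 1 $ i $ Transposition.transpose m n j :: real ^ 'n ^ 'n"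
    let ?t = "Transposition.transpose m n"
    have mv: "?A *v x = (\<chi> i. x $ ?t i)" for x
    proof (subst vec_eq_iff, intro allI)
      fix i
      have "(?A *v x) $ i = (\<Sum>j\<in>UNIV. if j = ?t i then x $ j else 0)"
        unfolding matrix_vector_mult_def vec_lambda_beta mat_def by (intro sum.cong) (auto simp: transpose_eq_iff)
      then show "(?A *v x) $ i = (\<chi> i. x $ ?t i) $ i" by simp
    qed
    have "?A ** ?A = mat 1"
    proof (rule matrix_eq[THEN iffD2], rule allI)
      show "(?A ** ?A) *v x = mat 1 *v x" for x unfolding matrix_vector_mul_assoc[symmetric] mv by (simp add: vec_eq_iff)
    qed
    then have "det ?A * det ?A = 1" by (metis det_I det_mul)
    then have det: "\<bar>det ?A\<bar> = 1" by (auto simp: square_eq_1_iff)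
    \<comment> \<open>A permutation of the coordinates maps boxes to boxes with permuted side
      lengths, and the values on boxes determine Lebesgue measure.\<close>
    have "(lborel :: (real ^ 'n) measure) = distr lborel borel ((*v) ?A)"
    proof (rule lborel_eqI)
      fix l u :: "real ^ 'n" assume le: "\<And>b. b \<in> Basis \<Longrightarrow> l \<bullet> b \<le> u \<bullet> b"
      let ?s = "\<lambda>x :: real ^ 'n. (\<chi> i. x $ ?t i) :: real ^ 'n"
      have le': "l $ i \<le> u $ i" for i using le[of "axis i 1"] by (simp add: inner_axis)
      have pre: "(*v) ?A -` box l u = box (?s l) (?s u)"
      proof (intro set_eqI iffI)
        fix x assume "x \<in> (*v) ?A -` box l u"
        then have "l $ i < x $ ?t i \<and> x $ ?t i < u $ i" for i unfolding mv by (simp add: mem_box_cart mv)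
        from this[of "?t _"] show "x \<in> box (?s l) (?s u)" by (simp add: mem_box_cart)
      next
        fix x assume "x \<in> box (?s l) (?s u)"
        then have "l $ ?t i < x $ i \<and> x $ i < u $ ?t i" for i by (simp add: mem_box_cart)
        from this[of "?t _"] show "x \<in> (*v) ?A -` box l u" by (simp add: mem_box_cart mv)
      qed
      have Bas: "(Basis :: (real ^ 'n) set) = (\<lambda>i. axis i 1) ` UNIV" by (auto simp: Basis_vec_def)
      have inj: "inj (\<lambda>i. axis i (1::real) :: real ^ 'n)" by (auto simp: inj_on_def axis_eq_axis)
      have "emeasure (distr lborel borel ((*v) ?A)) (box l u) = emeasure lborel (box (?s l) (?s u))"
        by (subst emeasure_distr) (simp_all add: pre)
      also have "\<dots> = (\<Prod>b\<in>Basis. (?s u - ?s l) \<bullet> b)"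
        by (rule emeasure_lborel_box) (auto simp: Bas inner_axis le')
      also have "(\<Prod>b\<in>Basis. (?s u - ?s l) \<bullet> b) = (\<Prod>i\<in>UNIV. (u - l) $ ?t i)"
        unfolding Bas by (simp add: prod.reindex[OF inj] inner_axis)
      also have "\<dots> = (\<Prod>i\<in>UNIV. (u - l) $ i)"
        by (rule prod.reindex_bij_betw) simp
      also have "\<dots> = (\<Prod>b\<in>Basis. (u - l) \<bullet> b)" unfolding Bas by (simp add: prod.reindex[OF inj] inner_axis)
      finally show "emeasure (distr lborel borel ((*v) ?A)) (box l u) = (\<Prod>b\<in>Basis. (u - l) \<bullet> b)" .
    qed simp
    then have lb: "distr lborel borel ((*v) ?A) = (lborel :: (real ^ 'n) measure)" by simp
    show ?case unfolding Q_def det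
    proof (intro impI ballI)
      fix h :: "real ^ 'n \<Rightarrow> ennreal" assume [measurable]: "h \<in> borel_measurable borel"
      have "(\<integral>\<^sup>+x. h x \<partial>distr lborel borel ((*v) ?A)) = (\<integral>\<^sup>+x. h (?A *v x) \<partial>lborel)"
        by (rule nn_integral_distr) measurable
      then show "(\<integral>\<^sup>+x. h x \<partial>lborel) = ennreal 1 * (\<integral>\<^sup>+x. h (?A *v x) \<partial>lborel)" unfolding lb by simp
    qed
  next
    case (5 m n c)
    let ?A = "\<chi> i j. if i = m \<and> j = n then c else of_bool (i = j) :: real ^ 'n ^ 'n"
    have "?A = (\<chi> k. if k = m then row m (mat 1) + c *s row n (mat 1) else row k (mat 1))"
      using 5 by (auto simp: vec_eq_iff row_def mat_def)
    then have det: "det ?A = 1" by (simp only: det_row_operation[OF 5] det_I)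
    have mv: "?A *v x = x + (c * (x \<bullet> axis n 1)) *\<^sub>R axis m 1" for x
    proof (subst vec_eq_iff, intro allI)
      fix i
      have "(?A *v x) $ i = (\<Sum>j\<in>UNIV. (if j = i then x $ i else 0) + (if j = n then if i = m then c * x $ n else 0 else 0))"
        unfolding matrix_vector_mult_def vec_lambda_beta using 5 by (intro sum.cong) auto
      then show "(?A *v x) $ i = (x + (c * (x \<bullet> axis n 1)) *\<^sub>R axis m 1) $ i"
        by (simp only: sum.distrib inner_axis vector_add_component vector_scaleR_component) (simp add: axis_def)
    qed
    have b: "(axis m 1 :: real ^ 'n) \<in> Basis" "(axis n 1 :: real ^ 'n) \<in> Basis" "(axis m 1 :: real ^ 'n) \<noteq> axis n 1"
      using 5 by (auto simp: Basis_vec_def axis_eq_axis)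
    show ?case unfolding Q_def det mv by (simp add: nn_integral_lborel_shear[OF _ b])
  qed
  then show ?thesis using assms unfolding Q_def by blast
qed

section \<open>Eigenvalue bounds and whitening matrices\<close>

lemma inner_matrix_transpose: "(A *v x) \<bullet> y = x \<bullet> (transpose A *v y)" for A :: "real ^ 'n ^ 'm"
  by (metis dot_lmul_matrix inner_commute transpose_matrix_vector)

declare transpose_matrix_vector [simp del]

text \<open>Perturb \<open>v\<close> in the direction \<open>B *v v\<close>: the quadratic form
  becomes \<open>t * (t * b - 2 * a)\<close>, which is negative for small positive \<open>t\<close>
  unless \<open>a = 0\<close>. The choice \<open>t = a / (b + 1)\<close> also covers
  \<open>b = 0\<close>.\<close>

lemma psd_kernel:
  fixes B :: "real ^ 'n ^ 'n"
  assumes sym: "transpose B = B" and psd: "\<And>x. 0 \<le> x \<bullet> (B *v x)" and v: "v \<bullet> (B *v v) = 0"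
  shows "B *v v = 0"
proof (rule ccontr)
  assume nz: "B *v v \<noteq> 0"
  define w1 where "w1 = B *v v"
  define a where "a = w1 \<bullet> w1"
  define b where "b = w1 \<bullet> (B *v w1)"
  have a: "0 < a" using nz by (simp add: a_def w1_def)
  have b: "0 \<le> b" unfolding b_def by (rule psd)
  have vw: "v \<bullet> (B *v w1) = a" using inner_matrix_transpose[of B v w1] sym by (simp add: a_def w1_def)
  have "0 \<le> (v - t *\<^sub>R w1) \<bullet> (B *v (v - t *\<^sub>R w1))" for t by (rule psd)
  moreover have "(v - t *\<^sub>R w1) \<bullet> (B *v (v - t *\<^sub>R w1)) = t * (t * b - 2 * a)" for t
    using v vw by (simp add: matrix_vector_mult_diff_distrib matrix_vector_mult_scaleR w1_def[symmetric] a_def[symmetric] b_def[symmetric]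
        inner_diff_left inner_diff_right algebra_simps)
  ultimately have "0 \<le> t * (t * b - 2 * a)" for t by metis
  from this[of "a / (b + 1)"] have "2 * a \<le> a / (b + 1) * b" using a b by (simp add: zero_le_mult_iff divide_simps)
  also have "\<dots> \<le> a" using a b by (simp add: field_simps)
  finally show False using a by simp
qed

text \<open>Let \<open>v\<close> maximise the form on the unit sphere with value \<open>l\<close>.
  Then \<open>l\<close> times the identity minus \<open>A\<close> is positive semidefinite and its
  form vanishes at \<open>v\<close>, so \<open>psd_kernel\<close> makes \<open>v\<close> an
  eigenvector; no Lagrange multipliers are involved.\<close>

lemma quadratic_form_max:
  fixes A :: "real ^ 'n ^ 'n"
  assumes sym: "transpose A = A"
  obtains l where "l \<in> real_eigenvalues A" "\<And>x. x \<bullet> (A *v x) \<le> l * (x \<bullet> x)"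
proof -
  have "continuous_on (sphere 0 1) (\<lambda>x. x \<bullet> (A *v x))" by (intro continuous_intros)
  moreover have "axis undefined 1 \<in> (sphere 0 1 :: (real ^ 'n) set)" by simp
  ultimately obtain v where v: "norm v = 1" and max: "\<And>x. norm x = 1 \<Longrightarrow> x \<bullet> (A *v x) \<le> v \<bullet> (A *v v)"
    using continuous_attains_sup[of "sphere 0 1 :: (real ^ 'n) set" "\<lambda>x. x \<bullet> (A *v x)"] by auto
  define l where "l = v \<bullet> (A *v v)"
  have le: "x \<bullet> (A *v x) \<le> l * (x \<bullet> x)" for x
  proof (cases "x = 0")
    case False
    have "((1 / norm x) *\<^sub>R x) \<bullet> (A *v ((1 / norm x) *\<^sub>R x)) \<le> l"
      unfolding l_def by (rule max) (use False in simp)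
    then have "(x \<bullet> (A *v x)) / (norm x)\<^sup>2 \<le> l" by (simp add: matrix_vector_mult_scaleR power2_eq_square)
    then show ?thesis using False by (simp add: divide_simps power2_norm_eq_inner)
  qed simp
  have "(l *\<^sub>R mat 1 - A) *v v = 0"
  proof (rule psd_kernel)
    show "transpose (l *\<^sub>R mat 1 - A) = l *\<^sub>R mat 1 - A"
      using sym by (simp add: vec_eq_iff transpose_def mat_def)
    show "0 \<le> x \<bullet> ((l *\<^sub>R mat 1 - A) *v x)" for x
      using le[of x] by (simp add: matrix_vector_mult_diff_rdistrib scaleR_matrix_vector_assoc[symmetric] inner_diff_right)
    show "v \<bullet> ((l *\<^sub>R mat 1 - A) *v v) = 0"
      using v by (simp add: matrix_vector_mult_diff_rdistrib scaleR_matrix_vector_assoc[symmetric] inner_diff_right l_def norm_eq_1)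
  qed
  then have "A *v v = l *\<^sub>R v" by (simp add: matrix_vector_mult_diff_rdistrib scaleR_matrix_vector_assoc[symmetric])
  moreover have "v \<noteq> 0" using v by auto
  ultimately have "l \<in> real_eigenvalues A" unfolding real_eigenvalues_def by blast
  then show thesis using le by (rule that)
qed

text \<open>Eigenvectors for distinct eigenvalues are orthogonal, hence linearly independent.
  Finiteness is what gives \<open>Min\<close> and \<open>Max\<close> in \<open>lambda_min\<close>
  and \<open>lambda_max\<close> their meaning.\<close>

lemma finite_real_eigenvalues:
  fixes A :: "real ^ 'n ^ 'n"
  assumes sym: "transpose A = A"
  shows "finite (real_eigenvalues A)"
proof -
  define e where "e l = (SOME v. v \<noteq> 0 \<and> A *v v = l *\<^sub>R v)" for l
  have e: "e l \<noteq> 0" "A *v e l = l *\<^sub>R e l" if "l \<in> real_eigenvalues A" for l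
  proof -
    have "\<exists>v. v \<noteq> 0 \<and> A *v v = l *\<^sub>R v" using that by (simp add: real_eigenvalues_def)
    then have "e l \<noteq> 0 \<and> A *v e l = l *\<^sub>R e l" unfolding e_def by (rule someI_ex)
    then show "e l \<noteq> 0" "A *v e l = l *\<^sub>R e l" by blast+
  qed
  have orth: "e l \<bullet> e k = 0" if "l \<in> real_eigenvalues A" "k \<in> real_eigenvalues A" "l \<noteq> k" for l k
  proof -
    have "l * (e l \<bullet> e k) = k * (e l \<bullet> e k)"
      using inner_matrix_transpose[of A "e l" "e k"] unfolding sym e(2)[OF that(1)] e(2)[OF that(2)] by simp
    then show ?thesis using that(3) by simp
  qed
  have "independent (e ` real_eigenvalues A)"
  proof (rule pairwise_orthogonal_independent)
    show "pairwise orthogonal (e ` real_eigenvalues A)"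
      unfolding pairwise_def orthogonal_def
    proof (intro ballI impI)
      fix x y assume "x \<in> e ` real_eigenvalues A" "y \<in> e ` real_eigenvalues A" "x \<noteq> y"
      then obtain l k where "x = e l" "y = e k" "l \<in> real_eigenvalues A" "k \<in> real_eigenvalues A" "l \<noteq> k" by blast
      then show "x \<bullet> y = 0" by (simp add: orth)
    qed
    show "0 \<notin> e ` real_eigenvalues A" using e(1) by force
  qed
  then have "finite (e ` real_eigenvalues A)" by (rule independent_imp_finite)
  moreover have "inj_on e (real_eigenvalues A)"
  proof (rule inj_onI, rule ccontr)
    fix l k assume *: "l \<in> real_eigenvalues A" "k \<in> real_eigenvalues A" "e l = e k" "l \<noteq> k"
    have "e l \<bullet> e l = 0" using orth[OF *(1,2,4)] *(3) by simp
    then show False using e(1)[OF *(1)] by simp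
  qed
  ultimately show ?thesis by (rule finite_imageD)
qed

text \<open>The upper bound is \<open>quadratic_form_max\<close>; the lower bound is the same
  statement for \<open>- A\<close>.\<close>

lemma lambda_bounds:
  fixes A :: "real ^ 'n ^ 'n"
  assumes sym: "transpose A = A"
  shows "lambda_min A * (x \<bullet> x) \<le> x \<bullet> (A *v x)" and "x \<bullet> (A *v x) \<le> lambda_max A * (x \<bullet> x)"
proof -
  note fin = finite_real_eigenvalues[OF sym]
  obtain l where l: "l \<in> real_eigenvalues A" "x \<bullet> (A *v x) \<le> l * (x \<bullet> x)"
    using quadratic_form_max[OF sym] by blast
  have "l * (x \<bullet> x) \<le> lambda_max A * (x \<bullet> x)"
    unfolding lambda_max_def by (intro mult_right_mono Max_ge[OF fin l(1)]) simp
  then show "x \<bullet> (A *v x) \<le> lambda_max A * (x \<bullet> x)" using l(2) by simp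
  have mv: "(- A) *v y = - (A *v y)" for y by (simp add: vec_eq_iff matrix_vector_mult_def sum_negf)
  have "transpose (- A) = - A" using sym by (simp add: vec_eq_iff transpose_def)
  then obtain k where k: "k \<in> real_eigenvalues (- A)" "x \<bullet> ((- A) *v x) \<le> k * (x \<bullet> x)"
    using quadratic_form_max by blast
  obtain v where "v \<noteq> 0" "- (A *v v) = k *\<^sub>R v" using k(1) unfolding real_eigenvalues_def mv by blast
  then have "A *v v = (- k) *\<^sub>R v" by (metis minus_minus scaleR_minus_left)
  with \<open>v \<noteq> 0\<close> have "- k \<in> real_eigenvalues A" unfolding real_eigenvalues_def by blast
  then have "lambda_min A * (x \<bullet> x) \<le> - k * (x \<bullet> x)"
    unfolding lambda_min_def by (intro mult_right_mono Min_le[OF fin]) simp_all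
  then show "lambda_min A * (x \<bullet> x) \<le> x \<bullet> (A *v x)" using k(2) by (simp add: mv)
qed

text \<open>Gram-Schmidt for the inner product \<open>x \<bullet> (A *v y)\<close>.\<close>

lemma conjugate_orthonormal_exists:
  fixes A :: "real ^ 'n ^ 'n" and S :: "'n set"
  assumes sym: "transpose A = A" and pd: "\<And>x. x \<noteq> 0 \<Longrightarrow> 0 < x \<bullet> (A *v x)"
  shows "\<exists>f. \<forall>i\<in>S. \<forall>j\<in>S. f i \<bullet> (A *v f j) = (if i = j then 1 else 0)"
proof (induction S rule: finite_induct[OF finite])
  case (2 k S)
  then obtain f where f: "\<And>i j. i \<in> S \<Longrightarrow> j \<in> S \<Longrightarrow> f i \<bullet> (A *v f j) = (if i = j then 1 else 0)" by blast
  \<comment> \<open>Fewer than \<open>CARD('n)\<close> vectors \<open>A *v f i\<close> leave a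
    nonzero \<open>x\<close> orthogonal to all of them, that is, conjugate to every
    \<open>f i\<close>. Normalising \<open>x\<close> in the form of \<open>A\<close> gives the next
    vector.\<close>
  have "dim ((\<lambda>i. A *v f i) ` S) \<le> card ((\<lambda>i. A *v f i) ` S)" by (rule dim_le_card') (use 2 in simp)
  also have "\<dots> \<le> card S" by (rule card_image_le) (use 2 in simp)
  also have "\<dots> < CARD('n)" using 2 by (intro psubset_card_mono) auto
  finally have "dim ((\<lambda>i. A *v f i) ` S) < DIM(real ^ 'n)" by simp
  then obtain x where x: "x \<noteq> 0" "\<And>y. y \<in> span ((\<lambda>i. A *v f i) ` S) \<Longrightarrow> orthogonal x y"
    by (rule orthogonal_to_subspace_exists) blast
  define s where "s = sqrt (x \<bullet> (A *v x))"
  define g where "g = f(k := (1 / s) *\<^sub>R x)"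
  have s: "0 < s" "s * s = x \<bullet> (A *v x)" using pd[OF x(1)] by (simp_all add: s_def)
  have xf: "x \<bullet> (A *v f i) = 0" if "i \<in> S" for i
    using x(2)[of "A *v f i"] that by (simp add: orthogonal_def span_base)
  have fx: "f i \<bullet> (A *v x) = 0" if "i \<in> S" for i
    using xf[OF that] inner_matrix_transpose[of A "f i" x] by (simp add: sym inner_commute)
  have "g i \<bullet> (A *v g j) = (if i = j then 1 else 0)" if ij: "i \<in> insert k S" "j \<in> insert k S" for i j
  proof -
    have gS: "g l = f l" "l \<noteq> k" if "l \<in> S" for l using that 2(2) by (auto simp: g_def)
    have gk: "A *v g k = (1 / s) *\<^sub>R (A *v x)" "g k = (1 / s) *\<^sub>R x" by (simp_all add: g_def matrix_vector_mult_scaleR)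
    consider "i \<in> S" "j \<in> S" | "i \<in> S" "j = k" | "i = k" "j \<in> S" | "i = k" "j = k" using ij by blast
    then show ?thesis
    proof cases
      case 1 then show ?thesis by (simp add: gS f)
    next
      case 2
      then show ?thesis using gS(2)[of i] by (simp add: gS(1) gk(2) matrix_vector_mult_scaleR fx)
    next
      case 3
      then show ?thesis using gS(2)[of j] by (simp add: gS(1) gk(2) xf)
    next
      case 4
      show ?thesis unfolding 4 gk(2) matrix_vector_mult_scaleR inner_scaleR_left inner_scaleR_right s(2)[symmetric] using s(1) by simp
    qed
  qed
  then show ?case by blast
qed simp

text \<open>A matrix and its transpose have the same operator norm: apply Cauchy-Schwarz to
  \<open>norm (A *v y) ^ 2 = y \<bullet> (transpose A *v (A *v y))\<close>.\<close>

lemma transpose_norm_bound: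
  fixes A :: "real ^ 'n ^ 'm"
  assumes "\<And>x. norm (transpose A *v x) \<le> c * norm x" "0 \<le> c"
  shows "norm (A *v y) \<le> c * norm y"
proof (cases "A *v y = 0")
  case False
  have "norm (A *v y) * norm (A *v y) = y \<bullet> (transpose A *v (A *v y))"
    unfolding inner_matrix_transpose[symmetric] by (simp only: power2_norm_eq_inner[symmetric] power2_eq_square)
  also have "\<dots> \<le> norm y * norm (transpose A *v (A *v y))" by (rule norm_cauchy_schwarz)
  also have "\<dots> \<le> norm y * (c * norm (A *v y))" by (intro mult_left_mono assms) simp
  finally show ?thesis using False by (simp add: mult_ac)
qed (use assms(2) in simp)

text \<open>\<open>B\<close> is a root in the sense \<open>B ** transpose B = A\<close>, in general
  not the symmetric one. The rows of \<open>F\<close> are orthonormal for the form of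
  \<open>A\<close>, so \<open>F ** A ** transpose F = mat 1\<close> and
  \<open>B = A ** transpose F\<close> is inverse to \<open>F\<close>. Both norm bounds follow from
  \<open>norm (transpose B *v x) = sqrt (x \<bullet> (A *v x))\<close> and
  \<open>lambda_bounds\<close>.\<close>

lemma covariance_square_root:
  fixes A :: "real ^ 'n ^ 'n"
  assumes sym: "transpose A = A" and pos: "0 < lambda_min A"
  obtains B F :: "real ^ 'n ^ 'n" where "B ** F = mat 1" "F ** B = mat 1" "B ** transpose B = A"
    "\<And>x. norm (B *v x) \<le> sqrt (lambda_max A) * norm x" "\<And>x. norm (F *v x) \<le> 1 / sqrt (lambda_min A) * norm x"
    "\<And>x y. (transpose F *v x) \<bullet> (A *v (transpose F *v y)) = x \<bullet> y"
proof -
  have pd: "0 < x \<bullet> (A *v x)" if "x \<noteq> 0" for x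
  proof -
    have "0 < lambda_min A * (x \<bullet> x)" using pos that by simp
    also have "\<dots> \<le> x \<bullet> (A *v x)" by (rule lambda_bounds(1)[OF sym])
    finally show ?thesis .
  qed
  obtain f :: "'n \<Rightarrow> real ^ 'n" where f': "\<forall>i\<in>UNIV. \<forall>j\<in>UNIV. f i \<bullet> (A *v f j) = (if i = j then 1 else 0)"
  proof -
    have "\<exists>f. \<forall>i\<in>(UNIV :: 'n set). \<forall>j\<in>UNIV. f i \<bullet> (A *v f j) = (if i = j then 1 else 0)"
      by (rule conjugate_orthonormal_exists[OF sym]) (rule pd)
    then show thesis using that by (elim exE)
  qed
  have f: "f i \<bullet> (A *v f j) = (if i = j then 1 else 0)" for i j by (rule f'[rule_format]) simp_all
  define F where "F = (\<chi> i. f i)"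
  have Fv: "(F *v x) $ i = f i \<bullet> x" for x i by (simp add: F_def matrix_vector_mult_def inner_vec_def)
  have Ft: "transpose F *v axis j 1 = f j" for j
    by (simp add: matrix_vector_mult_basis column_transpose row_def F_def)
  have FAF: "F ** A ** transpose F = mat 1"
  proof (subst vec_eq_iff, intro allI, subst vec_eq_iff, intro allI)
    fix i j
    have "(F ** A ** transpose F) $ i $ j = ((F ** A ** transpose F) *v axis j 1) $ i" by (simp add: matrix_vector_mult_basis column_def)
    also have "\<dots> = f i \<bullet> (A *v f j)" by (simp add: matrix_vector_mul_assoc[symmetric] Fv Ft)
    finally show "(F ** A ** transpose F) $ i $ j = mat 1 $ i $ j" by (simp add: f mat_def)
  qed
  define B where "B = A ** transpose F"
  have FB: "F ** B = mat 1" using FAF by (simp add: B_def matrix_mul_assoc)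
  then have BF: "B ** F = mat 1" by (rule matrix_left_right_inverse1)
  have BFt: "transpose F ** transpose B = mat 1" "transpose B ** transpose F = mat 1"
    using BF FB by (simp_all add: matrix_transpose_mul[symmetric])
  have BB: "B ** transpose B = A" by (subst (1) B_def) (simp only: matrix_mul_assoc[symmetric] BFt matrix_mul_rid)
  have nB: "norm (transpose B *v x) = sqrt (x \<bullet> (A *v x))" for x
  proof -
    have "(transpose B *v x) \<bullet> (transpose B *v x) = x \<bullet> (A *v x)"
      by (simp add: inner_matrix_transpose matrix_vector_mul_assoc BB)
    then show ?thesis by (simp add: norm_eq_sqrt_inner)
  qed
  have lmax: "0 \<le> lambda_max A"
  proof -
    have "0 \<le> axis undefined 1 \<bullet> (A *v (axis undefined 1))" by (rule less_imp_le, rule pd) (simp add: axis_eq_0_iff)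
    also have "\<dots> \<le> lambda_max A" using lambda_bounds(2)[OF sym, of "axis undefined 1"] by simp
    finally show ?thesis .
  qed
  show thesis
  proof (rule that[OF BF FB BB])
    show "norm (B *v x) \<le> sqrt (lambda_max A) * norm x" for x
    proof (rule transpose_norm_bound)
      show "norm (transpose B *v x) \<le> sqrt (lambda_max A) * norm x" for x
        unfolding nB norm_eq_sqrt_inner[of x] real_sqrt_mult[symmetric] by (intro real_sqrt_le_mono lambda_bounds sym)
    qed (use lmax in simp)
    show "norm (F *v x) \<le> 1 / sqrt (lambda_min A) * norm x" for x
    proof (rule transpose_norm_bound)
      fix x
      have "sqrt (lambda_min A) * norm (transpose F *v x) \<le> norm (transpose B *v (transpose F *v x))"
        unfolding nB norm_eq_sqrt_inner[of "transpose F *v x"] real_sqrt_mult[symmetric] by (intro real_sqrt_le_mono lambda_bounds sym)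
      also have "\<dots> = norm x" by (simp add: matrix_vector_mul_assoc BFt)
      finally show "norm (transpose F *v x) \<le> 1 / sqrt (lambda_min A) * norm x" using pos by (simp add: field_simps)
    qed (use pos in simp)
    show "(transpose F *v x) \<bullet> (A *v (transpose F *v y)) = x \<bullet> y" for x y
      by (simp add: inner_matrix_transpose matrix_vector_mul_assoc FAF matrix_mul_assoc)
  qed
qed

lemma distr_std_gauss_matrix:
  fixes B F :: "real ^ 'n ^ 'n"
  assumes BF: "B ** F = mat 1"
  shows "distr std_gauss borel ((*v) B) = centered_gaussian (B ** transpose B)"
proof -
  let ?A = "B ** transpose B"
  have FB: "F ** B = mat 1" by (rule matrix_left_right_inverse1[OF BF])
  have BFt: "transpose F ** transpose B = mat 1" "transpose B ** transpose F = mat 1"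
    using BF FB by (simp_all add: matrix_transpose_mul[symmetric])
  have dB: "det B \<noteq> 0" using det_mul[of B F] BF by auto
  have inv: "?A ** (transpose F ** F) = mat 1"
  proof -
    have "?A ** (transpose F ** F) = B ** (transpose B ** transpose F) ** F" by (simp add: matrix_mul_assoc)
    then show ?thesis by (simp add: BFt BF)
  qed
  \<comment> \<open>\<open>matrix_inv\<close> is a choice operator: it is known to be an inverse
    only once \<open>transpose F ** F\<close> has been exhibited as one, and uniqueness then
    identifies the two.\<close>
  then have "?A ** matrix_inv ?A = mat 1 \<and> matrix_inv ?A ** ?A = mat 1"
    unfolding matrix_inv_def
    by (rule someI_ex[of "\<lambda>X. ?A ** X = mat 1 \<and> X ** ?A = mat 1", OF exI[of _ "transpose F ** F"], OF conjI, OF _ matrix_left_right_inverse1[OF inv]])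
  then have "matrix_inv ?A ** (?A ** (transpose F ** F)) = transpose F ** F"
    unfolding matrix_mul_assoc[of "matrix_inv ?A"] by simp
  then have minv: "matrix_inv ?A = transpose F ** F" unfolding inv by simp
  have quad: "(B *v x) \<bullet> (matrix_inv ?A *v (B *v x)) = x \<bullet> x" for x
  proof -
    have "matrix_inv ?A *v (B *v x) = transpose F *v x"
      unfolding minv by (simp add: matrix_vector_mul_assoc matrix_mul_assoc[symmetric] FB)
    then have "(B *v x) \<bullet> (matrix_inv ?A *v (B *v x)) = (F *v (B *v x)) \<bullet> x" by (simp add: inner_matrix_transpose)
    then show ?thesis by (simp add: matrix_vector_mul_assoc FB)
  qed
  have det: "sqrt ((2 * pi) ^ CARD('n) * det ?A) = \<bar>det B\<bar> * sqrt (2 * pi) ^ CARD('n)"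
    unfolding det_mul det_transpose real_sqrt_mult[of "(2 * pi) ^ _"] real_sqrt_power by simp
  define g where "g x = exp (- (x \<bullet> (matrix_inv ?A *v x)) / 2) / sqrt ((2 * pi) ^ CARD('n) * det ?A)" for x
  have [measurable]: "g \<in> borel_measurable borel" unfolding g_def by measurable
  have gB: "ennreal \<bar>det B\<bar> * ennreal (g (B *v x)) = ennreal (gauss_pdf x)" for x
    unfolding g_def quad det gauss_pdf_def using dB by (simp add: ennreal_mult'[symmetric])
  show ?thesis
  proof (rule measure_eqI)
    fix S assume "S \<in> sets (distr std_gauss borel ((*v) B))"
    then have S [measurable]: "S \<in> sets borel" by simp
    have "emeasure (centered_gaussian ?A) S = (\<integral>\<^sup>+x. ennreal (g x) * indicator S x \<partial>lborel)"
      unfolding centered_gaussian_def g_def[symmetric] by (rule emeasure_density) measurable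
    also have "\<dots> = ennreal \<bar>det B\<bar> * (\<integral>\<^sup>+x. ennreal (g (B *v x)) * indicator S (B *v x) \<partial>lborel)"
      by (rule nn_integral_lborel_matrix[OF dB]) measurable
    also have "\<dots> = (\<integral>\<^sup>+x. ennreal (gauss_pdf x) * indicator S (B *v x) \<partial>lborel)"
      by (subst nn_integral_cmult[symmetric]) (simp_all add: mult.assoc[symmetric] gB)
    also have "\<dots> = (\<integral>\<^sup>+x. indicator S (B *v x) \<partial>std_gauss)" by (rule nn_integral_std_gauss[symmetric]) measurable
    also have "\<dots> = emeasure (distr std_gauss borel ((*v) B)) S"
      by (subst nn_integral_indicator[symmetric], simp) (subst nn_integral_distr, simp_all)
    finally show "emeasure (distr std_gauss borel ((*v) B)) S = emeasure (centered_gaussian ?A) S" by simp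
  qed (simp add: centered_gaussian_def)
qed

section \<open>Truncation of whitened sums\<close>

text \<open>Jensen's inequality with exponent \<open>r / s\<close> for the s-th power of the norm,
  followed by taking roots.\<close>

lemma (in prob_space) lyapunov_moment:
  fixes Y :: "'a \<Rightarrow> 'v::euclidean_space"
  assumes [measurable]: "Y \<in> borel_measurable M" and int: "integrable M (\<lambda>w. norm (Y w) powr r)"
    and le: "expectation (\<lambda>w. norm (Y w) powr r) \<le> \<sigma> powr r" and \<sigma>: "0 \<le> \<sigma>" and s: "0 < s" "s \<le> r"
  shows "expectation (\<lambda>w. norm (Y w) powr s) \<le> \<sigma> powr s"
proof -
  let ?Z = "\<lambda>w. norm (Y w) powr s"
  have pw: "(x powr s) powr (r / s) = x powr r" for x :: real using s by (simp add: powr_powr)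
  have "norm (expectation ?Z) powr (r / s) \<le> expectation (\<lambda>w. norm (?Z w) powr (r / s))"
    by (rule norm_integral_powr_le) (use int s in \<open>auto simp: pw\<close>)
  also have "\<dots> \<le> (\<sigma> powr s) powr (r / s)" using le by (simp add: pw)
  finally have "(norm (expectation ?Z) powr (r / s)) powr (s / r) \<le> ((\<sigma> powr s) powr (r / s)) powr (s / r)"
    by (rule powr_mono2[rotated 2]) (use s in auto)
  moreover have "(x powr (r / s)) powr (s / r) = x" if "0 \<le> x" for x :: real using s that by (simp add: powr_powr)
  ultimately have "norm (expectation ?Z) \<le> \<sigma> powr s" by (simp only: norm_ge_zero powr_ge_zero)
  then show ?thesis by simp
qed

text \<open>What remains of \<open>ros_bound\<close> when the scale
  \<open>((m + 1) * t) powr p\<close> is divided out: \<open>3 * m + 1 \<le> 3 * (m + 1)\<close>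
  gives \<open>24 = 3 * 8\<close> and \<open>3 powr (p - 1)\<close>, and \<open>A\<close> bounds the
  normalised moments.\<close>

definition ros_factor :: "real \<Rightarrow> real \<Rightarrow> real"
  where "ros_factor p A = exp (ros_const p) * ros_const p * 2 powr p * ((24 * A) powr (p / 2) + 3 powr (p - 1) * (2 powr (p + 1) * A))"

lemma ros_factor_nonneg: "0 \<le> A \<Longrightarrow> 0 \<le> ros_factor p A"
  by (simp add: ros_factor_def ros_const_def)

context mdep_family
begin

text \<open>The variance term is of order \<open>sqrt (m + 1) * t\<close> and the other of order
  \<open>(m + 1) powr (1 - 1 / p) * t\<close>; both are rounded up to \<open>(m + 1) * t\<close>, so
  that a single scale remains.\<close>

lemma ros_bound_le:
  fixes p t A y2 yp :: real
  assumes p: "2 \<le> p" and t: "0 \<le> t" and A: "0 \<le> A"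
    and y2: "0 \<le> y2" "n * y2 \<le> A * t\<^sup>2" and yp: "0 \<le> yp" "n * yp \<le> A * t powr p"
  shows "ros_bound p y2 yp \<le> ros_factor p A * (real (m + 1) * t) powr p"
proof -
  define b where "b = real (m + 1)"
  have b: "1 \<le> b" "real (3 * m + 1) \<le> 3 * b" by (auto simp: b_def)
  have "real (3 * m + 1) * real n * (8 * y2) \<le> (24 * A) * (b * t)\<^sup>2"
  proof -
    have "real (3 * m + 1) * real n * (8 * y2) = real (3 * m + 1) * (8 * (n * y2))" by simp
    also have "\<dots> \<le> (3 * b) * (8 * (A * t\<^sup>2))" using b y2 by (intro mult_mono[OF b(2)] mult_left_mono) auto
    also have "\<dots> \<le> 24 * A * t\<^sup>2 * (b * b)" using b A mult_left_mono[of 1 b "A * t\<^sup>2"] by simp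
    finally show ?thesis by (simp add: power2_eq_square mult_ac)
  qed
  then have "(real (3 * m + 1) * real n * (8 * y2)) powr (p / 2) \<le> ((24 * A) * (b * t)\<^sup>2) powr (p / 2)"
    using p y2 by (intro powr_mono2) auto
  also have "\<dots> = (24 * A) powr (p / 2) * (b * t) powr p"
  proof -
    have "((b * t)\<^sup>2) powr (p / 2) = (b * t) powr p"
      using b t p by (cases "t = 0") (simp_all add: powr_powr flip: powr_numeral)
    then show ?thesis by (simp only: powr_mult[of "24 * A"])
  qed
  finally have 1: "(real (3 * m + 1) * real n * (8 * y2)) powr (p / 2) \<le> (24 * A) powr (p / 2) * (b * t) powr p" .
  have "real (3 * m + 1) powr (p - 1) * n * (2 powr (p + 1) * yp) = real (3 * m + 1) powr (p - 1) * (2 powr (p + 1) * (n * yp))"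
    by simp
  also have "\<dots> \<le> (3 * b) powr (p - 1) * (2 powr (p + 1) * (A * t powr p))"
    using b p yp by (intro mult_mono powr_mono2 mult_left_mono[OF yp(2)]) auto
  also have "\<dots> = 3 powr (p - 1) * (2 powr (p + 1) * A) * (b powr (p - 1) * t powr p)" by (simp add: powr_mult)
  also have "\<dots> \<le> 3 powr (p - 1) * (2 powr (p + 1) * A) * (b powr p * t powr p)"
    using b p A by (intro mult_left_mono mult_right_mono powr_mono) auto
  also have "b powr p * t powr p = (b * t) powr p" by (simp add: powr_mult)
  finally have 2: "real (3 * m + 1) powr (p - 1) * n * (2 powr (p + 1) * yp) \<le> 3 powr (p - 1) * (2 powr (p + 1) * A) * (b * t) powr p" .
  have "0 \<le> exp (ros_const p) * ros_const p * 2 powr p" by (simp add: ros_const_def)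
  from mult_left_mono[OF add_mono[OF 1 2] this] show ?thesis
    unfolding ros_bound_def ros_factor_def b_def distrib_right[symmetric] by (simp only: mult.assoc)
qed

text \<open>Convexity moves the power inside the window sum, and a product of powers of two numbers
  is at most the sum of their powers of total order \<open>u + v\<close>. At most
  \<open>2 * (m + 1)\<close> indices contribute, each with \<open>2 * \<mu>\<close>.\<close>

lemma window_moment:
  assumes u: "0 \<le> u" and v: "1 \<le> v" and i: "i < n"
    and \<mu>: "\<And>j. j < n \<Longrightarrow> expectation (\<lambda>w. norm (X j w) powr (u + v)) \<le> \<mu>"
  shows "expectation (\<lambda>w. norm (X i w) powr u * norm (eta i w) powr v) \<le> 2 * (2 * real (m + 1)) powr v * \<mu>"
proof -
  define k where "k = real (card (nbr i))"
  have k: "0 \<le> k" "k \<le> 2 * real (m + 1)" using card_nbr[of i] by (simp_all add: k_def)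
  have X0: "integrable P (\<lambda>w. norm (X j w) powr (u + v))" for j
    by (rule norm_integral_bound(2)[where B = "\<tau> powr (u + v)"]) (use X_bound u v in \<open>auto intro!: powr_mono2\<close>)
  have \<mu>0: "0 \<le> \<mu>" using \<mu>[OF i] by (rule order_trans[rotated]) simp
  have ab: "a powr u * b powr v \<le> a powr (u + v) + b powr (u + v)" if "0 \<le> a" "0 \<le> b" for a b :: real
  proof -
    have "a powr u * b powr v \<le> max a b powr u * max a b powr v" using that u v by (intro mult_mono powr_mono2) auto
    also have "\<dots> = max a b powr (u + v)" by (simp add: powr_add)
    also have "\<dots> \<le> a powr (u + v) + b powr (u + v)" by (cases "a \<le> b") (auto simp: max_def)
    finally show ?thesis .
  qed
  have pt: "norm (X i w) powr u * norm (eta i w) powr v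
      \<le> k powr (v - 1) * (\<Sum>j\<in>nbr i. norm (X i w) powr (u + v) + norm (X j w) powr (u + v))" for w
  proof -
    have "norm (eta i w) powr v \<le> k powr (v - 1) * (\<Sum>j\<in>nbr i. norm (X j w) powr v)"
      unfolding eta_def k_def by (rule sum_norm_powr_le[OF finite_nbr v])
    then have "norm (X i w) powr u * norm (eta i w) powr v \<le> norm (X i w) powr u * (k powr (v - 1) * (\<Sum>j\<in>nbr i. norm (X j w) powr v))"
      by (rule mult_left_mono) simp
    also have "\<dots> = k powr (v - 1) * (\<Sum>j\<in>nbr i. norm (X i w) powr u * norm (X j w) powr v)"
      by (simp add: sum_distrib_left mult_ac)
    also have "\<dots> \<le> k powr (v - 1) * (\<Sum>j\<in>nbr i. norm (X i w) powr (u + v) + norm (X j w) powr (u + v))"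
      by (intro mult_left_mono sum_mono ab) auto
    finally show ?thesis .
  qed
  have "expectation (\<lambda>w. norm (X i w) powr u * norm (eta i w) powr v)
    \<le> expectation (\<lambda>w. k powr (v - 1) * (\<Sum>j\<in>nbr i. norm (X i w) powr (u + v) + norm (X j w) powr (u + v)))"
    by (rule Bochner_Integration.integral_mono') (use pt X0 in \<open>auto intro!: mult_nonneg_nonneg sum_nonneg add_nonneg_nonneg\<close>)
  also have "\<dots> = k powr (v - 1) * (\<Sum>j\<in>nbr i. expectation (\<lambda>w. norm (X i w) powr (u + v)) + expectation (\<lambda>w. norm (X j w) powr (u + v)))"
    using X0 by simp
  also have "\<dots> \<le> k powr (v - 1) * (\<Sum>j\<in>nbr i. 2 * \<mu>)"
  proof (intro mult_left_mono sum_mono)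
    fix j assume "j \<in> nbr i"
    then show "expectation (\<lambda>w. norm (X i w) powr (u + v)) + expectation (\<lambda>w. norm (X j w) powr (u + v)) \<le> 2 * \<mu>"
      using \<mu>[OF i] \<mu>[of j] nbr_subset[of i] by force
  qed simp
  also have "\<dots> = 2 * (k powr (v - 1) * k powr 1) * \<mu>" using k by (simp add: k_def)
  also have "k powr (v - 1) * k powr 1 = k powr v" by (simp only: powr_add[symmetric]) simp
  also have "2 * k powr v * \<mu> \<le> 2 * (2 * real (m + 1)) powr v * \<mu>"
    using k v \<mu>0 by (intro mult_right_mono mult_left_mono powr_mono2) auto
  finally show ?thesis .
qed

end

text \<open>\<open>\<kappa> * real n powr (- 1 / 2)\<close> is the \<open>L^(p+q)\<close> size of
  one normalised summand. That the sum has identity covariance is recorded in \<open>xi_cov\<close>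
  as a vector identity, the form in which the covariance appears in
  \<open>stein_coupling\<close>.\<close>

locale whitened_sum = prob_space P for P :: "'a measure" +
  fixes \<xi> :: "nat \<Rightarrow> 'a \<Rightarrow> real ^ 'd" and n m :: nat and p q \<kappa> :: real
  assumes xi_measurable [measurable]: "\<And>i. \<xi> i \<in> borel_measurable P"
    and xi_mdep: "m_dependent P n m \<xi>"
    and xi_mean: "\<And>i. i < n \<Longrightarrow> expectation (\<xi> i) = 0"
    and xi_int: "\<And>i. i < n \<Longrightarrow> integrable P (\<lambda>w. norm (\<xi> i w) powr (p + q))"
    and xi_moment: "\<And>i. i < n \<Longrightarrow> expectation (\<lambda>w. norm (\<xi> i w) powr (p + q)) \<le> (\<kappa> * real n powr (- 1 / 2)) powr (p + q)"
    and p: "2 \<le> p" and q: "0 < q" "q \<le> 2" and kappa: "0 < \<kappa>" and n_pos: "0 < n"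
    and xi_cov: "\<And>z. expectation (\<lambda>w. (z \<bullet> (\<Sum>i<n. \<xi> i w)) *\<^sub>R (\<Sum>i<n. \<xi> i w)) = z"
begin

definition rate :: real where "rate = (p + q - 2) / (2 * (2 * p + q - 2))"

definition tau :: real where "tau = \<kappa> * real n powr (- rate)"

definition S :: "'a \<Rightarrow> real ^ 'd" where "S w = (\<Sum>i<n. \<xi> i w)"

definition trunc :: "real ^ 'd \<Rightarrow> real ^ 'd" where "trunc x = (if norm x \<le> tau then x else 0)"

definition zeta :: "nat \<Rightarrow> 'a \<Rightarrow> real ^ 'd"
  where "zeta i w = trunc (\<xi> i w) - expectation (\<lambda>w. trunc (\<xi> i w))"

lemma tau_pos: "0 < tau" using kappa n_pos by (simp add: tau_def)

text \<open>The first bound is where \<open>q \<le> 2\<close> enters, as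
  \<open>2 * (p + q - 2) \<le> 2 * p + q - 2\<close>; it controls fourth moments when
  \<open>p + q > 4\<close>. The second uses \<open>p \<ge> 2\<close> in the form
  \<open>p + q \<le> 2 * p + q - 2\<close> and makes the truncated tails small.\<close>

lemma rate_le: "rate \<le> 1 / 4" "rate * (p + q) \<le> (p + q - 2) / 2" "0 \<le> rate"
proof -
  define x y where "x = p + q - 2" and "y = 2 * p + q - 2"
  have y: "0 < y" "0 \<le> x" "p + q \<le> y" "2 * x \<le> y" using p q by (simp_all add: x_def y_def)
  have r: "rate = x / (2 * y)" by (simp add: rate_def x_def y_def)
  show "rate \<le> 1 / 4" "0 \<le> rate" unfolding r using y by (simp_all add: divide_simps)
  have "rate * (p + q) \<le> rate * y" unfolding r using y by (intro mult_left_mono) auto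
  then show "rate * (p + q) \<le> (p + q - 2) / 2" unfolding r x_def[symmetric] using y by simp
qed

text \<open>The exponent \<open>rate\<close> is chosen such that this bound on the tails of the normalised variables holds.\<close>

lemma n_sigma_le: "real n * (\<kappa> * real n powr (- 1 / 2)) powr (p + q) \<le> tau powr (p + q)"
proof -
  have "real n * (\<kappa> * real n powr (- 1 / 2)) powr (p + q) = \<kappa> powr (p + q) * (real n powr 1 * real n powr (- 1 / 2 * (p + q)))"
    using n_pos by (simp add: powr_mult powr_powr)
  also have "\<dots> = \<kappa> powr (p + q) * real n powr (1 + - 1 / 2 * (p + q))" by (simp only: powr_add)
  also have "\<dots> \<le> \<kappa> powr (p + q) * real n powr (- rate * (p + q))"
    using n_pos rate_le(2) by (intro mult_left_mono powr_mono) (auto simp: field_simps)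
  also have "\<dots> = tau powr (p + q)" by (simp add: tau_def powr_mult powr_powr)
  finally show ?thesis .
qed

lemma trunc_measurable [measurable]: "trunc \<in> borel_measurable borel"
  unfolding trunc_def by measurable

lemma norm_trunc: "norm (trunc x) \<le> tau" "norm (trunc x) \<le> norm x"
  using tau_pos by (auto simp: trunc_def)

lemma xi_int_le: "i < n \<Longrightarrow> 0 \<le> s \<Longrightarrow> s \<le> p + q \<Longrightarrow> integrable P (\<lambda>w. norm (\<xi> i w) powr s)"
  by (rule integrable_norm_powr_mono[OF _ xi_int]) auto

lemma trunc_int: "0 \<le> s \<Longrightarrow> integrable P (\<lambda>w. norm (trunc (\<xi> i w)) powr s)"
  by (rule norm_integral_bound(2)[where B = "tau powr s"]) (use norm_trunc in \<open>auto intro!: powr_mono2\<close>)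

text \<open>Above the level \<open>tau\<close>, the power of order \<open>s\<close> is at most
  \<open>tau powr (s - (p + q))\<close> times the power of order \<open>p + q\<close>;
  \<open>n_sigma_le\<close> does the rest.\<close>

lemma tail_moment:
  assumes i: "i < n" and s: "0 \<le> s" "s \<le> p + q"
  shows "n * expectation (\<lambda>w. norm (\<xi> i w - trunc (\<xi> i w)) powr s) \<le> tau powr s"
proof -
  have "expectation (\<lambda>w. norm (\<xi> i w - trunc (\<xi> i w)) powr s) \<le> expectation (\<lambda>w. tau powr (s - (p + q)) * norm (\<xi> i w) powr (p + q))"
  proof (rule Bochner_Integration.integral_mono')
    fix w
    show "norm (\<xi> i w - trunc (\<xi> i w)) powr s \<le> tau powr (s - (p + q)) * norm (\<xi> i w) powr (p + q)"
    proof (cases "norm (\<xi> i w) \<le> tau")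
      case False
      then have "norm (\<xi> i w) powr (s - (p + q)) \<le> tau powr (s - (p + q))" using tau_pos s by (intro powr_mono2') auto
      then have "norm (\<xi> i w) powr (s - (p + q)) * norm (\<xi> i w) powr (p + q) \<le> tau powr (s - (p + q)) * norm (\<xi> i w) powr (p + q)"
        by (rule mult_right_mono) simp
      then show ?thesis using False by (simp add: trunc_def powr_add[symmetric])
    qed (simp add: trunc_def)
  qed (use xi_int[OF i] in auto)
  also have "\<dots> \<le> tau powr (s - (p + q)) * (\<kappa> * real n powr (- 1 / 2)) powr (p + q)"
    using xi_moment[OF i] by (simp add: mult_left_mono)
  finally have "n * expectation (\<lambda>w. norm (\<xi> i w - trunc (\<xi> i w)) powr s) \<le> tau powr (s - (p + q)) * (real n * (\<kappa> * real n powr (- 1 / 2)) powr (p + q))"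
    by (simp add: mult_left_mono mult.left_commute)
  also have "\<dots> \<le> tau powr (s - (p + q)) * tau powr (p + q)" by (intro mult_left_mono n_sigma_le) simp
  finally show ?thesis using tau_pos by (simp add: powr_add[symmetric])
qed

lemma trunc_moment_high:
  assumes i: "i < n" and s: "p + q \<le> s"
  shows "n * expectation (\<lambda>w. norm (trunc (\<xi> i w)) powr s) \<le> tau powr s"
proof -
  have "expectation (\<lambda>w. norm (trunc (\<xi> i w)) powr s) \<le> expectation (\<lambda>w. tau powr (s - (p + q)) * norm (\<xi> i w) powr (p + q))"
  proof (rule Bochner_Integration.integral_mono')
    fix w
    have "norm (trunc (\<xi> i w)) powr (s - (p + q)) * norm (trunc (\<xi> i w)) powr (p + q) \<le> tau powr (s - (p + q)) * norm (\<xi> i w) powr (p + q)"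
      using s p q norm_trunc by (intro mult_mono powr_mono2) auto
    then show "norm (trunc (\<xi> i w)) powr s \<le> tau powr (s - (p + q)) * norm (\<xi> i w) powr (p + q)" by (simp add: powr_add[symmetric])
  qed (use xi_int[OF i] in auto)
  also have "\<dots> \<le> tau powr (s - (p + q)) * (\<kappa> * real n powr (- 1 / 2)) powr (p + q)"
    using xi_moment[OF i] by (simp add: mult_left_mono)
  finally have "n * expectation (\<lambda>w. norm (trunc (\<xi> i w)) powr s) \<le> tau powr (s - (p + q)) * (real n * (\<kappa> * real n powr (- 1 / 2)) powr (p + q))"
    by (simp add: mult_left_mono mult.left_commute)
  also have "\<dots> \<le> tau powr (s - (p + q)) * tau powr (p + q)" by (intro mult_left_mono n_sigma_le) simp
  finally show ?thesis using tau_pos by (simp add: powr_add[symmetric])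
qed

lemma trunc_moment_low:
  assumes i: "i < n" and s: "0 < s" "s \<le> p + q"
  shows "expectation (\<lambda>w. norm (trunc (\<xi> i w)) powr s) \<le> (\<kappa> * real n powr (- 1 / 2)) powr s"
proof -
  have "expectation (\<lambda>w. norm (trunc (\<xi> i w)) powr s) \<le> expectation (\<lambda>w. norm (\<xi> i w) powr s)"
    by (rule Bochner_Integration.integral_mono') (use xi_int_le[OF i] s norm_trunc in \<open>auto intro!: powr_mono2\<close>)
  also have "\<dots> \<le> (\<kappa> * real n powr (- 1 / 2)) powr s"
    by (rule lyapunov_moment[OF _ xi_int[OF i] xi_moment[OF i]]) (use s kappa in auto)
  finally show ?thesis .
qed

lemma trunc_moment_2:
  assumes i: "i < n"
  shows "n * expectation (\<lambda>w. norm (trunc (\<xi> i w)) powr 2) \<le> \<kappa>\<^sup>2"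
proof -
  have "n * expectation (\<lambda>w. norm (trunc (\<xi> i w)) powr 2) \<le> n * (\<kappa> * real n powr (- 1 / 2)) powr 2"
    by (intro mult_left_mono trunc_moment_low[OF i]) (use p q in auto)
  also have "(\<kappa> * real n powr (- 1 / 2)) powr 2 = \<kappa>\<^sup>2 * real n powr (- 1)"
    using kappa by (simp add: powr_mult powr_powr)
  also have "n * (\<kappa>\<^sup>2 * real n powr (- 1)) = \<kappa>\<^sup>2" using n_pos by (simp add: powr_minus_divide)
  finally show ?thesis .
qed

text \<open>If \<open>p + q \<le> 4\<close>, truncation bounds the excess powers. Otherwise the
  fourth moment is controlled by the assumed one and \<open>n\<close> times it is at most
  \<open>\<kappa>^4 / n\<close>, which \<open>rate \<le> 1 / 4\<close> compares with
  \<open>tau^4\<close>.\<close>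

lemma trunc_moment_4:
  assumes i: "i < n"
  shows "n * expectation (\<lambda>w. norm (trunc (\<xi> i w)) powr 4) \<le> tau powr 4"
proof (cases "p + q \<le> 4")
  case True
  then show ?thesis by (rule trunc_moment_high[OF i])
next
  case False
  have "n * expectation (\<lambda>w. norm (trunc (\<xi> i w)) powr 4) \<le> n * (\<kappa> * real n powr (- 1 / 2)) powr 4"
    by (intro mult_left_mono trunc_moment_low[OF i]) (use False in auto)
  also have "\<dots> = \<kappa> powr 4 * (real n powr 1 * real n powr (- 2))"
    using n_pos by (simp add: powr_mult powr_powr)
  also have "\<dots> = \<kappa> powr 4 * real n powr (- 1)" by (simp only: powr_add[symmetric]) simp
  also have "\<dots> \<le> \<kappa> powr 4 * real n powr (- rate * 4)"
    using n_pos rate_le(1) by (intro mult_left_mono powr_mono) auto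
  also have "\<dots> = tau powr 4" by (simp only: tau_def powr_mult powr_powr)
  finally show ?thesis .
qed

lemma trunc_moment_3:
  assumes i: "i < n"
  shows "n * expectation (\<lambda>w. norm (trunc (\<xi> i w)) powr 3) \<le> \<kappa> * tau\<^sup>2"
proof -
  \<comment> \<open>The third moment is interpolated between the second and the fourth by the
    arithmetic-geometric mean inequality. This weight makes both halves equal to
    \<open>\<kappa> * tau^2 / 2\<close>.\<close>
  define l where "l = tau\<^sup>2 / \<kappa>"
  have l: "0 < l" using tau_pos kappa by (simp add: l_def)
  have "expectation (\<lambda>w. norm (trunc (\<xi> i w)) powr 3)
    \<le> expectation (\<lambda>w. l / 2 * norm (trunc (\<xi> i w)) powr 2 + 1 / (2 * l) * norm (trunc (\<xi> i w)) powr 4)"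
  proof (rule integral_mono)
    fix w
    let ?x = "norm (trunc (\<xi> i w))"
    have "0 \<le> (l - ?x)\<^sup>2 * ?x\<^sup>2" by simp
    then have "2 * l * ?x ^ 3 \<le> l\<^sup>2 * ?x ^ 2 + ?x ^ 4" by (simp add: power2_eq_square power3_eq_cube power4_eq_xxxx algebra_simps)
    then have "?x ^ 3 \<le> l / 2 * ?x ^ 2 + 1 / (2 * l) * ?x ^ 4" using l by (simp add: field_simps power2_eq_square)
    then show "?x powr 3 \<le> l / 2 * ?x powr 2 + 1 / (2 * l) * ?x powr 4" by simp
  qed (use trunc_int[of 3] trunc_int[of 2] trunc_int[of 4] in auto)
  also have "\<dots> = l / 2 * expectation (\<lambda>w. norm (trunc (\<xi> i w)) powr 2) + 1 / (2 * l) * expectation (\<lambda>w. norm (trunc (\<xi> i w)) powr 4)"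
    using trunc_int[of 2] trunc_int[of 4] by (subst Bochner_Integration.integral_add) auto
  finally have "n * expectation (\<lambda>w. norm (trunc (\<xi> i w)) powr 3)
    \<le> n * (l / 2 * expectation (\<lambda>w. norm (trunc (\<xi> i w)) powr 2) + 1 / (2 * l) * expectation (\<lambda>w. norm (trunc (\<xi> i w)) powr 4))"
    by (rule mult_left_mono) simp
  also have "\<dots> = l / 2 * (n * expectation (\<lambda>w. norm (trunc (\<xi> i w)) powr 2)) + 1 / (2 * l) * (n * expectation (\<lambda>w. norm (trunc (\<xi> i w)) powr 4))"
    by (simp add: algebra_simps)
  also have "\<dots> \<le> l / 2 * \<kappa>\<^sup>2 + 1 / (2 * l) * tau powr 4"
    using l by (intro add_mono mult_left_mono trunc_moment_2[OF i] trunc_moment_4[OF i]) auto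
  also have "\<dots> = \<kappa> * tau\<^sup>2"
    using kappa tau_pos by (simp add: l_def field_simps power2_eq_square power4_eq_xxxx)
  finally show ?thesis .
qed

lemma zeta_moment:
  assumes i: "i < n" and s: "1 \<le> s" and le: "n * expectation (\<lambda>w. norm (trunc (\<xi> i w)) powr s) \<le> B"
  shows "expectation (\<lambda>w. norm (zeta i w) powr s) \<le> 2 powr (s + 1) * B / n"
proof -
  have "expectation (\<lambda>w. norm (zeta i w) powr s) \<le> 2 powr (s + 1) * expectation (\<lambda>w. norm (trunc (\<xi> i w)) powr s)"
    unfolding zeta_def by (rule centered_powr_le(1)) (use s trunc_int in auto)
  also have "\<dots> \<le> 2 powr (s + 1) * (B / n)" using le n_pos by (intro mult_left_mono) (auto simp: field_simps)
  finally show ?thesis by simp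
qed

lemma mdep_zeta: "mdep_family P zeta n m (2 * tau)"
proof
  show "zeta i \<in> borel_measurable P" for i unfolding zeta_def by measurable
  show "m_dependent P n m zeta"
    unfolding zeta_def by (rule m_dependent_compose[OF xi_mdep prob_space_axioms]) measurable
  have int: "integrable P (\<lambda>w. trunc (\<xi> i w))" for i
    by (rule norm_integral_bound(2)[where B = tau]) (use norm_trunc in auto)
  show "expectation (zeta i) = 0" if "i < n" for i
    unfolding zeta_def using int by (simp add: prob_space)
  show "norm (zeta i w) \<le> 2 * tau" for i w
  proof -
    have "norm (expectation (\<lambda>w. trunc (\<xi> i w))) \<le> tau"
      by (rule norm_integral_bound(1)) (use norm_trunc in auto)
    moreover have "norm (zeta i w) \<le> norm (trunc (\<xi> i w)) + norm (expectation (\<lambda>w. trunc (\<xi> i w)))"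
      unfolding zeta_def by (rule norm_triangle_ineq4)
    ultimately show ?thesis using norm_trunc(1)[of "\<xi> i w"] by linarith
  qed
qed (use tau_pos n_pos in auto)

end

lemma arctan_le_self:
  fixes x :: real
  assumes "0 \<le> x"
  shows "arctan x \<le> x"
proof (cases "x = 0")
  case False
  with assms have "0 < x" by simp
  then obtain z where "0 < z" "arctan x - arctan 0 = (x - 0) * inverse (1 + z\<^sup>2)"
    using MVT2[of 0 x arctan "\<lambda>z. inverse (1 + z\<^sup>2)"] DERIV_arctan by auto
  moreover have "inverse (1 + z\<^sup>2) \<le> 1" by (simp add: inverse_le_1_iff)
  ultimately show ?thesis using mult_left_mono[of "inverse (1 + z\<^sup>2)" 1 x] \<open>0 < x\<close> by simp
qed simp

lemma integrable_inner_scaleR: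
  fixes Y :: "'a \<Rightarrow> 'v::euclidean_space"
  assumes "Y \<in> borel_measurable M" and "integrable M (\<lambda>w. (norm (Y w))\<^sup>2)"
  shows "integrable M (\<lambda>w. (z \<bullet> Y w) *\<^sub>R Y w)"
proof (rule Bochner_Integration.integrable_bound[where f = "\<lambda>w. norm z * (norm (Y w))\<^sup>2"])
  show "AE w in M. norm ((z \<bullet> Y w) *\<^sub>R Y w) \<le> norm (norm z * (norm (Y w))\<^sup>2)"
    by (intro AE_I2) (simp add: power2_eq_square mult.assoc[symmetric] mult_right_mono Cauchy_Schwarz_ineq2)
qed (use assms in auto)

lemma distr_pair3_fst:
  assumes "prob_space A" "prob_space B" "prob_space C" "prob_space D" and f [measurable]: "f \<in> borel_measurable A"
  shows "distr (((A \<Otimes>\<^sub>M B) \<Otimes>\<^sub>M C) \<Otimes>\<^sub>M D) borel (\<lambda>x. f (fst (fst (fst x)))) = distr A borel f"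
proof -
  interpret A: prob_space A by fact
  interpret B: prob_space B by fact
  interpret C: prob_space C by fact
  interpret D: prob_space D by fact
  interpret AB: pair_prob_space A B ..
  interpret ABC: pair_prob_space "A \<Otimes>\<^sub>M B" C ..
  show ?thesis
  proof (rule measure_eqI)
    fix S assume "S \<in> sets (distr (((A \<Otimes>\<^sub>M B) \<Otimes>\<^sub>M C) \<Otimes>\<^sub>M D) borel (\<lambda>x. f (fst (fst (fst x)))))"
    then have S [measurable]: "S \<in> sets borel" by simp
    have "emeasure (distr (((A \<Otimes>\<^sub>M B) \<Otimes>\<^sub>M C) \<Otimes>\<^sub>M D) borel (\<lambda>x. f (fst (fst (fst x))))) S
      = (\<integral>\<^sup>+x. indicator S (f (fst (fst (fst x)))) \<partial>(((A \<Otimes>\<^sub>M B) \<Otimes>\<^sub>M C) \<Otimes>\<^sub>M D))"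
      by (subst nn_integral_indicator[symmetric], simp) (subst nn_integral_distr, simp_all)
    also have "\<dots> = (\<integral>\<^sup>+x. indicator S (f (fst (fst x))) \<partial>((A \<Otimes>\<^sub>M B) \<Otimes>\<^sub>M C))"
      by (rule nn_integral_pair_fst[OF ABC.prob_space_axioms D.prob_space_axioms]) measurable
    also have "\<dots> = (\<integral>\<^sup>+x. indicator S (f (fst x)) \<partial>(A \<Otimes>\<^sub>M B))"
      by (rule nn_integral_pair_fst[OF AB.prob_space_axioms C.prob_space_axioms]) measurable
    also have "\<dots> = (\<integral>\<^sup>+x. indicator S (f x) \<partial>A)"
      by (rule nn_integral_pair_fst[OF A.prob_space_axioms B.prob_space_axioms]) measurable
    also have "\<dots> = emeasure (distr A borel f) S"
      by (subst nn_integral_indicator[symmetric], simp) (subst nn_integral_distr, simp_all)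
    finally show "emeasure (distr (((A \<Otimes>\<^sub>M B) \<Otimes>\<^sub>M C) \<Otimes>\<^sub>M D) borel (\<lambda>x. f (fst (fst (fst x))))) S = emeasure (distr A borel f) S" .
  qed simp
qed

context whitened_sum
begin

lemma S_measurable [measurable]: "S \<in> borel_measurable P"
  unfolding S_def by measurable

lemma zeta_measurable [measurable]: "zeta i \<in> borel_measurable P"
  unfolding zeta_def by measurable

text \<open>The Rosenthal bound was stated for bounded families; the unbounded tails are functions of the
  bounded variables \<open>\<xi> / (1 + norm \<xi>)\<close>.\<close>

lemma tail_sum:
  assumes s: "2 \<le> s" "s \<le> p"
  shows "integrable P (\<lambda>w. norm (S w - (\<Sum>i<n. zeta i w)) powr s)"
    and "expectation (\<lambda>w. norm (S w - (\<Sum>i<n. zeta i w)) powr s) \<le> ros_factor s 1 * (real (m + 1) * tau) powr s"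
proof -
  \<comment> \<open>\<open>\<phi>\<close> maps the whole space injectively into the unit ball with
    measurable inverse \<open>\<psi>\<close>, so each unbounded variable is a function of a bounded
    one. Centring by \<open>e i\<close> is undone inside \<open>F\<close>.\<close>
  define \<phi> where "\<phi> x = (1 / (1 + norm x)) *\<^sub>R x" for x :: "real ^ 'd"
  define \<psi> where "\<psi> u = (1 / (1 - norm u)) *\<^sub>R u" for u :: "real ^ 'd"
  have nphi: "norm (\<phi> x) = norm x / (1 + norm x)" for x
    by (simp add: \<phi>_def add_nonneg_nonneg)
  have phi1: "norm (\<phi> x) \<le> 1" for x unfolding nphi by (simp add: divide_simps add_pos_nonneg)
  have psi: "\<psi> (\<phi> x) = x" for x
  proof -
    have pos: "0 < 1 + norm x" by (simp add: add_pos_nonneg)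
    have "1 - norm (\<phi> x) = 1 / (1 + norm x)" unfolding nphi using pos by (simp add: field_simps)
    then have "\<psi> (\<phi> x) = (1 + norm x) *\<^sub>R ((1 / (1 + norm x)) *\<^sub>R x)" by (simp add: \<psi>_def \<phi>_def)
    then show ?thesis using pos by simp
  qed
  have [measurable]: "\<phi> \<in> borel_measurable borel" "\<psi> \<in> borel_measurable borel"
    unfolding \<phi>_def \<psi>_def by measurable
  define e where "e i = expectation (\<lambda>w. \<phi> (\<xi> i w))" for i
  define Y where "Y i w = \<phi> (\<xi> i w) - e i" for i w
  have e1: "norm (e i) \<le> 1" and iphi: "integrable P (\<lambda>w. \<phi> (\<xi> i w))" for i
    unfolding e_def by (rule norm_integral_bound[OF _ phi1]; measurable)+
  interpret Y: mdep_family P Y n m 2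
  proof
    show "Y i \<in> borel_measurable P" for i unfolding Y_def by measurable
    show "m_dependent P n m Y"
      unfolding Y_def by (rule m_dependent_compose[OF xi_mdep prob_space_axioms]) measurable
    show "expectation (Y i) = 0" if "i < n" for i
      unfolding Y_def using iphi[of i] by (simp add: prob_space e_def)
    show "norm (Y i w) \<le> 2" for i w
      unfolding Y_def using phi1[of "\<xi> i w"] e1[of i] norm_triangle_ineq4[of "\<phi> (\<xi> i w)" "e i"] by linarith
  qed (use n_pos in auto)
  define F where "F i x y = \<psi> (x + e i) - trunc (\<psi> (x + e i))" for i :: nat and x y :: "real ^ 'd"
  have FT: "F i (Y i w) y = \<xi> i w - trunc (\<xi> i w)" for i w y by (simp add: F_def Y_def psi)
  have intT: "integrable P (\<lambda>w. norm (\<xi> i w - trunc (\<xi> i w)) powr s)" if "i < n" for i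
    using integrable_norm_powr_add[of "\<xi> i" P "\<lambda>w. - trunc (\<xi> i w)" s] xi_int_le[OF that, of s] trunc_int[of s i] s q by simp
  have int: "integrable P (\<lambda>w. trunc (\<xi> i w))" for i
    by (rule norm_integral_bound(2)[where B = tau]) (use norm_trunc in auto)
  have int': "integrable P (\<xi> i)" if "i < n" for i
    by (rule integrable_norm_powr_imp[OF _ xi_int[OF that]]) (use p q in auto)
  have "S w - (\<Sum>i<n. zeta i w) = (\<Sum>i<n. F i (Y i w) (Y.eta i w) - expectation (\<lambda>w. F i (Y i w) (Y.eta i w)))" for w
    unfolding S_def sum_subtractf[symmetric] FT
    by (intro sum.cong refl) (simp add: zeta_def int int' xi_mean)
  then have eq: "(\<lambda>w. norm (S w - (\<Sum>i<n. zeta i w)) powr s) = (\<lambda>w. norm (\<Sum>i<n. F i (Y i w) (Y.eta i w) - expectation (\<lambda>w. F i (Y i w) (Y.eta i w))) powr s)"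
    by simp
  have mo: "expectation (\<lambda>w. norm (\<xi> i w - trunc (\<xi> i w)) powr t) \<le> tau powr t / n" if "i < n" "0 \<le> t" "t \<le> p" for i t
    using tail_moment[of i t] that q n_pos by (simp add: field_simps)
  show "integrable P (\<lambda>w. norm (S w - (\<Sum>i<n. zeta i w)) powr s)"
    unfolding eq FT by (rule integrable_norm_powr_sum, measurable, rule centered_powr_le(2)) (use intT s in auto)
  have "expectation (\<lambda>w. norm (S w - (\<Sum>i<n. zeta i w)) powr s) \<le> Y.ros_bound s (tau\<^sup>2 / n) (tau powr s / n)"
    unfolding eq Y.ros_bound_def
  proof (rule Y.rosenthal_windows)
    show "(\<lambda>(x, y). F i x y) \<in> borel_measurable (borel \<Otimes>\<^sub>M borel)" for i unfolding F_def by measurable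
    show "expectation (\<lambda>w. (norm (F i (Y i w) (Y.eta i w)))\<^sup>2) \<le> tau\<^sup>2 / n" if "i < n" for i
      unfolding FT using mo[OF that, of 2] p tau_pos by simp
  qed (use intT mo s in \<open>auto simp: FT\<close>)
  also have "\<dots> \<le> ros_factor s 1 * (real (m + 1) * tau) powr s"
    by (rule Y.ros_bound_le) (use s tau_pos n_pos in auto)
  finally show "expectation (\<lambda>w. norm (S w - (\<Sum>i<n. zeta i w)) powr s) \<le> ros_factor s 1 * (real (m + 1) * tau) powr s" .
qed

lemma S_integrable: "integrable P (\<lambda>w. (norm (S w))\<^sup>2)"
proof -
  have "integrable P (\<lambda>w. norm (S w) powr 2)"
    unfolding S_def by (rule integrable_norm_powr_sum, measurable, rule xi_int_le) (use p q in auto)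
  then show ?thesis by simp
qed

text \<open>The trace of the identity covariance, summed over the standard basis.\<close>

lemma S_second_moment: "expectation (\<lambda>w. (norm (S w))\<^sup>2) = CARD('d)"
proof -
  have int: "integrable P (\<lambda>w. (z \<bullet> S w) *\<^sub>R S w)" for z
      by (rule integrable_inner_scaleR[OF S_measurable S_integrable])
  have "(norm (S w))\<^sup>2 = (\<Sum>b\<in>Basis. b \<bullet> ((b \<bullet> S w) *\<^sub>R S w))" for w
    by (subst power2_norm_eq_inner, subst euclidean_inner) (simp add: inner_commute)
  then have "expectation (\<lambda>w. (norm (S w))\<^sup>2) = expectation (\<lambda>w. \<Sum>b\<in>Basis. b \<bullet> ((b \<bullet> S w) *\<^sub>R S w))" by simp
  also have "\<dots> = (\<Sum>b\<in>Basis. expectation (\<lambda>w. b \<bullet> ((b \<bullet> S w) *\<^sub>R S w)))"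
    by (rule Bochner_Integration.integral_sum) (rule integrable_inner_right, rule int)
  also have "\<dots> = (\<Sum>b\<in>(Basis :: (real ^ 'd) set). b \<bullet> b)"
    using xi_cov int by (intro sum.cong refl) (simp only: integral_inner_right S_def)
  also have "\<dots> = CARD('d)" by (simp add: inner_same_Basis)
  finally show ?thesis .
qed

definition cov_err :: real
  where "cov_err = ros_factor 2 1 * (real (m + 1) * tau)\<^sup>2 + (ros_factor 2 1 + CARD('d)) * (real (m + 1) * tau)"

text \<open>With \<open>D\<close> the discarded part, the covariance changes by a term quadratic in
  \<open>D\<close> and by cross terms of \<open>D\<close> and \<open>S\<close>. The cross terms are
  split by the arithmetic-geometric mean inequality with weight \<open>\<beta>\<close>, which
  balances the second moments of \<open>D\<close>, of order \<open>\<beta>^2\<close>, and of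
  \<open>S\<close>, equal to the dimension.\<close>

lemma cov_zeta:
  "norm (expectation (\<lambda>w. (z \<bullet> (\<Sum>i<n. zeta i w)) *\<^sub>R (\<Sum>i<n. zeta i w)) - z) \<le> cov_err * norm z"
proof -
  define \<beta> where "\<beta> = real (m + 1) * tau"
  have b: "0 < \<beta>" using tau_pos by (simp add: \<beta>_def)
  define W where "W w = (\<Sum>i<n. zeta i w)" for w
  define D where "D w = S w - W w" for w
  define g where "g w = (norm (D w))\<^sup>2 + (1 / \<beta> * (norm (D w))\<^sup>2 + \<beta> * (norm (S w))\<^sup>2)" for w
  have [measurable]: "W \<in> borel_measurable P" "D \<in> borel_measurable P" unfolding W_def D_def by measurable
  have D2: "integrable P (\<lambda>w. (norm (D w))\<^sup>2)" "expectation (\<lambda>w. (norm (D w))\<^sup>2) \<le> ros_factor 2 1 * \<beta>\<^sup>2"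
    using tail_sum[of 2] p b unfolding D_def W_def \<beta>_def by simp_all
  have ig: "integrable P g" unfolding g_def using D2 S_integrable by simp
  have intS: "integrable P (\<lambda>w. (z \<bullet> S w) *\<^sub>R S w)"
      by (rule integrable_inner_scaleR[OF S_measurable S_integrable])
  have pt: "norm ((z \<bullet> W w) *\<^sub>R W w - (z \<bullet> S w) *\<^sub>R S w) \<le> norm z * g w" for w
  proof -
    have tri: "norm ((z \<bullet> x) *\<^sub>R y) \<le> norm z * (norm x * norm y)" for x y :: "real ^ 'd"
      using mult_right_mono[OF Cauchy_Schwarz_ineq2[of z x], of "norm y"] by (simp add: mult.assoc)
    have "0 \<le> (norm (D w) - \<beta> * norm (S w))\<^sup>2" by simp
    then have "2 * (norm (D w) * norm (S w)) * \<beta> \<le> (norm (D w))\<^sup>2 + \<beta>\<^sup>2 * (norm (S w))\<^sup>2"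
      by (simp add: power2_eq_square algebra_simps)
    then have am: "2 * (norm (D w) * norm (S w)) \<le> 1 / \<beta> * (norm (D w))\<^sup>2 + \<beta> * (norm (S w))\<^sup>2"
      using b by (simp add: field_simps power2_eq_square)
    have W: "W w = S w - D w" by (simp add: D_def)
    have "(z \<bullet> W w) *\<^sub>R W w - (z \<bullet> S w) *\<^sub>R S w = (z \<bullet> D w) *\<^sub>R D w - ((z \<bullet> D w) *\<^sub>R S w + (z \<bullet> S w) *\<^sub>R D w)"
      unfolding W by (simp add: algebra_simps)
    also have "norm \<dots> \<le> norm ((z \<bullet> D w) *\<^sub>R D w) + norm ((z \<bullet> D w) *\<^sub>R S w + (z \<bullet> S w) *\<^sub>R D w)" by (rule norm_triangle_ineq4)
    also have "\<dots> \<le> norm z * (norm (D w) * norm (D w)) + (norm z * (norm (D w) * norm (S w)) + norm z * (norm (S w) * norm (D w)))"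
      by (intro add_mono tri norm_triangle_mono)
    also have "\<dots> = norm z * ((norm (D w))\<^sup>2 + 2 * (norm (D w) * norm (S w)))" by (simp add: power2_eq_square algebra_simps)
    also have "\<dots> \<le> norm z * g w" unfolding g_def using am by (intro mult_left_mono add_left_mono) auto
    finally show ?thesis .
  qed
  have intd: "integrable P (\<lambda>w. (z \<bullet> W w) *\<^sub>R W w - (z \<bullet> S w) *\<^sub>R S w)"
    by (rule Bochner_Integration.integrable_bound[where f = "\<lambda>w. norm z * g w"])
       (use ig pt in \<open>auto intro!: order_trans[OF pt]\<close>)
  then have intW: "integrable P (\<lambda>w. (z \<bullet> W w) *\<^sub>R W w)" using Bochner_Integration.integrable_add[OF intd intS] by simp
  have "expectation (\<lambda>w. (z \<bullet> W w) *\<^sub>R W w) - z = expectation (\<lambda>w. (z \<bullet> W w) *\<^sub>R W w) - expectation (\<lambda>w. (z \<bullet> S w) *\<^sub>R S w)"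
    using xi_cov[of z] by (simp add: S_def)
  also have "\<dots> = expectation (\<lambda>w. (z \<bullet> W w) *\<^sub>R W w - (z \<bullet> S w) *\<^sub>R S w)"
    using Bochner_Integration.integral_diff[OF intW intS] by simp
  also have "norm \<dots> \<le> expectation (\<lambda>w. norm ((z \<bullet> W w) *\<^sub>R W w - (z \<bullet> S w) *\<^sub>R S w))" by (rule integral_norm_bound)
  also have "\<dots> \<le> expectation (\<lambda>w. norm z * g w)" using intd ig pt by (intro integral_mono) auto
  also have "\<dots> = norm z * expectation g" by simp
  also have "expectation g = expectation (\<lambda>w. (norm (D w))\<^sup>2) + (1 / \<beta> * expectation (\<lambda>w. (norm (D w))\<^sup>2) + \<beta> * CARD('d))"
    unfolding g_def using D2(1) S_integrable by (simp add: S_second_moment)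
  also have "norm z * \<dots> \<le> norm z * (ros_factor 2 1 * \<beta>\<^sup>2 + (1 / \<beta> * (ros_factor 2 1 * \<beta>\<^sup>2) + \<beta> * CARD('d)))"
    using D2(2) b by (intro mult_left_mono add_mono) auto
  also have "\<dots> = cov_err * norm z"
    unfolding cov_err_def \<beta>_def[symmetric] using b by (simp add: power2_eq_square algebra_simps)
  finally show ?thesis unfolding W_def .
qed

end

text \<open>Collects the losses of \<open>whitened_coupling\<close>: 4 from the starting slope being
  at most \<open>4 * \<beta>\<close>, 256 and \<open>2 powr (3 * p + 2)\<close> from the second and
  p-th window moments, and the last bracket from the mean of the velocity. The argument
  \<open>k\<close> is any upper bound for \<open>\<kappa>\<close>.\<close>

definition coupling_const :: "'d::finite itself \<Rightarrow> real \<Rightarrow> real \<Rightarrow> real"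
  where "coupling_const _ p k = 2 powr p * (ros_factor p 1 + 3 powr (p - 1) *
    (2 * (4 powr p * (\<integral>z. norm (z :: real ^ 'd) powr p \<partial>std_gauss)) + 4 powr p + 3 powr (p - 1) *
      ((\<integral>z. stein_H (z :: real ^ 'd) powr p \<partial>std_gauss) * (2 powr p *
        (ros_factor p (max 256 (2 powr (3 * p + 2))) + (3 * ros_factor 2 1 + 2 * CARD('d) + 128 * k) powr p)))))"

lemma coupling_const_nonneg: "0 \<le> coupling_const TYPE('d::finite) p k"
  unfolding coupling_const_def by (intro mult_nonneg_nonneg add_nonneg_nonneg ros_factor_nonneg) auto

context whitened_sum
begin

text \<open>The window moments have scale \<open>t = (m + 1) * tau^2\<close>, and Rosenthal
  contributes another factor \<open>m + 1\<close>; since \<open>(m + 1) * t = \<beta>^2\<close>, the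
  fluctuation of the velocity is of order \<open>\<beta>^2\<close>. The mean is of order
  \<open>\<beta> + \<beta>^2\<close>, and the angle reduces everything to
  \<open>\<beta>\<close>.\<close>

lemma whitened_coupling:
  assumes k: "\<kappa> \<le> k"
  obtains \<Omega> :: "((('a \<times> (real ^ 'd)) \<times> (real ^ 'd)) \<times> real \<times> (real ^ 'd)) measure" and U V
  where "prob_space \<Omega>" "U \<in> borel_measurable \<Omega>" "V \<in> borel_measurable \<Omega>"
    "distr \<Omega> borel U = distr P borel S" "distr \<Omega> borel V = std_gauss"
    "(\<integral>\<^sup>+x. ennreal (norm (U x - V x) powr p) \<partial>\<Omega>) \<le> ennreal (coupling_const TYPE('d) p k * (real (m + 1) * tau) powr p)"
proof -
  interpret T: mdep_family P zeta n m "2 * tau" by (rule mdep_zeta)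
  define \<beta> where "\<beta> = real (m + 1) * tau"
  define t where "t = real (m + 1) * tau\<^sup>2"
  define s where "s = real (2 * m + 1) * (2 * tau)"
  define A where "A = max 256 (2 powr (3 * p + 2))"
  define a2 where "a2 = 256 * t\<^sup>2 / n"
  define ap where "ap = 2 powr (3 * p + 2) * t powr p / n"
  define a3 where "a3 = 128 * \<kappa> * \<beta>\<^sup>2 / n"
  define H where "H = (\<integral>z. stein_H (z :: real ^ 'd) powr p \<partial>std_gauss)"
  define Z where "Z = (\<integral>z. norm (z :: real ^ 'd) powr p \<partial>std_gauss)"
  define R where "R = ros_factor 2 1"
  define L where "L = 3 * R + 2 * CARD('d) + 128 * k"
  have b: "0 < \<beta>" "\<beta>\<^sup>2 = real (m + 1) * t" using tau_pos by (simp_all add: \<beta>_def t_def power2_eq_square)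
  have t: "0 < t" using tau_pos by (simp add: t_def)
  have s: "0 < s" "2 * \<beta> \<le> s" "s \<le> 4 * \<beta>"
  proof -
    show "0 < s" using tau_pos by (simp add: s_def add_pos_nonneg)
    show "2 * \<beta> \<le> s" "s \<le> 4 * \<beta>"
      using tau_pos mult_nonneg_nonneg[of "real m" tau] by (auto simp: s_def \<beta>_def algebra_simps)
  qed
  have HZ: "0 \<le> H" "0 \<le> Z" by (simp_all add: H_def Z_def)
  have R: "0 \<le> R" unfolding R_def by (rule ros_factor_nonneg) simp
  have A0: "0 \<le> A" by (simp add: A_def)
  have m4: "expectation (\<lambda>w. norm (zeta j w) powr (2 + 2)) \<le> 32 * tau ^ 4 / n" if "j < n" for j
    using zeta_moment[OF that _ trunc_moment_4[OF that]] tau_pos by simp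
  have m3: "expectation (\<lambda>w. norm (zeta j w) powr (1 + 2)) \<le> 16 * (\<kappa> * tau\<^sup>2) / n" if "j < n" for j
    using zeta_moment[OF that _ trunc_moment_3[OF that]] by simp
  have mp: "expectation (\<lambda>w. norm (zeta j w) powr (p + p)) \<le> 2 powr (2 * p + 1) * tau powr (2 * p) / n" if "j < n" for j
  proof -
    have "expectation (\<lambda>w. norm (zeta j w) powr (p + p)) \<le> 2 powr ((p + p) + 1) * tau powr (p + p) / n"
      by (rule zeta_moment[OF that _ trunc_moment_high[OF that]]) (use p q in auto)
    then show ?thesis by (simp only: mult_2)
  qed
  have H2: "expectation (\<lambda>w. (norm (zeta i w))\<^sup>2 * (norm (T.eta i w))\<^sup>2) \<le> a2" if "i < n" for i
  proof -
    have "expectation (\<lambda>w. norm (zeta i w) powr 2 * norm (T.eta i w) powr 2) \<le> 2 * (2 * real (m + 1)) powr 2 * (32 * tau ^ 4 / n)"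
      by (rule T.window_moment[OF _ _ that m4]) auto
    moreover have *: "2 * (2 * r) powr 2 * (32 * tau ^ 4 / n) = 256 * (r * tau\<^sup>2)\<^sup>2 / n" if "0 \<le> r" for r
      using that by (simp add: power_mult_distrib power2_eq_square power4_eq_xxxx)
    ultimately show ?thesis unfolding a2_def t_def *[OF of_nat_0_le_iff] by simp
  qed
  have H3: "expectation (\<lambda>w. norm (zeta i w) * (norm (T.eta i w))\<^sup>2) \<le> a3" if "i < n" for i
  proof -
    have "expectation (\<lambda>w. norm (zeta i w) powr 1 * norm (T.eta i w) powr 2) \<le> 2 * (2 * real (m + 1)) powr 2 * (16 * (\<kappa> * tau\<^sup>2) / n)"
      by (rule T.window_moment[OF _ _ that m3]) auto
    moreover have *: "2 * (2 * r) powr 2 * (16 * (\<kappa> * tau\<^sup>2) / n) = 128 * \<kappa> * (r * tau)\<^sup>2 / n" if "0 \<le> r" for r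
      using that by (simp add: power_mult_distrib power2_eq_square)
    ultimately show ?thesis unfolding a3_def \<beta>_def *[OF of_nat_0_le_iff] by simp
  qed
  have Hp: "expectation (\<lambda>w. norm (zeta i w) powr p * norm (T.eta i w) powr p) \<le> ap" if "i < n" for i
  proof -
    have "expectation (\<lambda>w. norm (zeta i w) powr p * norm (T.eta i w) powr p)
      \<le> 2 * (2 * real (m + 1)) powr p * (2 powr (2 * p + 1) * tau powr (2 * p) / n)"
      by (rule T.window_moment[OF _ _ that mp]) (use p in auto)
    also have "\<dots> = (2 powr 1 * 2 powr p * 2 powr (2 * p + 1)) * (real (m + 1) powr p * tau powr (2 * p)) / n"
      unfolding powr_mult[of 2] by simp
    also have "2 powr 1 * 2 powr p * 2 powr (2 * p + 1) = 2 powr (3 * p + 2)"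
      by (simp only: powr_add[symmetric]) (simp add: algebra_simps)
    also have "real (m + 1) powr p * tau powr (2 * p) = t powr p"
      using tau_pos by (simp add: t_def powr_mult powr_powr flip: powr_numeral)
    finally show ?thesis by (simp add: ap_def)
  qed
  have npos: "0 \<le> a2" "0 \<le> ap" "0 \<le> a3" using kappa by (simp_all add: a2_def ap_def a3_def)
  have ce0: "0 \<le> cov_err" unfolding cov_err_def \<beta>_def[symmetric] R_def[symmetric] using b(1) R by (intro add_nonneg_nonneg mult_nonneg_nonneg) auto
  have cov: "norm (expectation (\<lambda>w. (z \<bullet> T.W w) *\<^sub>R T.W w) - z) \<le> cov_err * norm z" for z
    unfolding T.W_def by (rule cov_zeta)
  obtain Q :: "(real \<times> (real ^ 'd)) measure" and V where Q: "prob_space Q" and V [measurable]: "V \<in> borel_measurable (T.MGG \<Otimes>\<^sub>M Q)"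
    and lawV: "distr (T.MGG \<Otimes>\<^sub>M Q) borel V = std_gauss"
    and cost: "(\<integral>\<^sup>+x. ennreal (norm (T.W (fst (fst (fst x))) - V x) powr p) \<partial>(T.MGG \<Otimes>\<^sub>M Q))
      \<le> ennreal (3 powr (p - 1) * (2 * (s powr p * Z) + s powr p
          + 3 powr (p - 1) * (arctan (1 / s) powr p * (H * (2 powr p * (T.ros_bound p a2 ap + (cov_err + n * a3 / s) powr p))))))"
    unfolding H_def Z_def T.gauss_H_def[symmetric]
    by (rule T.stein_coupling[OF p s_def s(1) H2 npos(1) Hp npos(2) H3 npos(3) cov ce0])
  define a where "a = arctan (1 / s)"
  have a: "0 \<le> a" "a \<le> 2" "a * \<beta> \<le> 1"
  proof -
    show "0 \<le> a" using s(1) by (simp add: a_def)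
    show "a \<le> 2" using arctan_ubound[of "1 / s"] pi_less_4 by (simp add: a_def)
    have "a * \<beta> \<le> 1 / s * s" using s b(1) arctan_le_self[of "1 / s"] by (intro mult_mono) (auto simp: a_def)
    then show "a * \<beta> \<le> 1" using s(1) by simp
  qed
  have ab2: "a * \<beta>\<^sup>2 \<le> \<beta>" using mult_right_mono[OF a(3), of \<beta>] b(1) by (simp add: power2_eq_square mult.assoc)
  have na3: "n * a3 / s \<le> 64 * \<kappa> * \<beta>"
  proof -
    have "n * a3 / s = 128 * \<kappa> * \<beta>\<^sup>2 / s" using n_pos by (simp add: a3_def)
    also have "\<dots> \<le> 128 * \<kappa> * \<beta>\<^sup>2 / (2 * \<beta>)" using s b(1) kappa by (intro divide_left_mono) auto
    finally show ?thesis using b(1) by (simp add: power2_eq_square mult_ac)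
  qed
  \<comment> \<open>The quadratic part of \<open>cov_err\<close> contributes one \<open>R\<close>;
    the linear part and the third moments are multiplied by the bound 2 for the angle, whence
    \<open>3 * R\<close>, twice the dimension and \<open>128 * k\<close>.\<close>
  have L: "a * (cov_err + n * a3 / s) \<le> L * \<beta>"
  proof -
    have "a * (cov_err + n * a3 / s) \<le> a * (R * \<beta>\<^sup>2 + (R + CARD('d)) * \<beta> + 64 * \<kappa> * \<beta>)"
      using na3 a unfolding cov_err_def \<beta>_def[symmetric] R_def[symmetric] by (intro mult_left_mono) auto
    also have "\<dots> = R * (a * \<beta>\<^sup>2) + a * ((R + CARD('d) + 64 * \<kappa>) * \<beta>)" by (simp add: algebra_simps)
    also have "\<dots> \<le> R * \<beta> + 2 * ((R + CARD('d) + 64 * k) * \<beta>)"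
      using R ab2 a b(1) k kappa by (intro add_mono mult_left_mono mult_mono mult_right_mono) auto
    also have "\<dots> = L * \<beta>" by (simp add: L_def algebra_simps)
    finally show ?thesis .
  qed
  have ros: "T.ros_bound p a2 ap \<le> ros_factor p A * (\<beta>\<^sup>2) powr p"
    unfolding b(2)
  proof (rule T.ros_bound_le[OF p _ A0 npos(1) _ npos(2)])
    show "n * a2 \<le> A * t\<^sup>2" using n_pos by (simp add: a2_def A_def mult_right_mono)
    show "n * ap \<le> A * t powr p" using n_pos by (simp add: ap_def A_def mult_right_mono)
  qed (use t in simp)
  have "a powr p * (T.ros_bound p a2 ap + (cov_err + n * a3 / s) powr p)
    \<le> a powr p * (ros_factor p A * (\<beta>\<^sup>2) powr p) + a powr p * (cov_err + n * a3 / s) powr p"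
    unfolding distrib_left[symmetric] by (intro mult_left_mono add_right_mono ros) simp
  also have "\<dots> = ros_factor p A * (a * \<beta>\<^sup>2) powr p + (a * (cov_err + n * a3 / s)) powr p" by (simp add: powr_mult)
  also have "\<dots> \<le> ros_factor p A * \<beta> powr p + (L * \<beta>) powr p"
    using p a b(1) ab2 L ros_factor_nonneg[OF A0] ce0 npos s by (intro add_mono mult_left_mono powr_mono2) auto
  also have "\<dots> = (ros_factor p A + L powr p) * \<beta> powr p" by (simp add: powr_mult algebra_simps)
  finally have main: "a powr p * (T.ros_bound p a2 ap + (cov_err + n * a3 / s) powr p) \<le> (ros_factor p A + L powr p) * \<beta> powr p" .
  have sp: "s powr p \<le> 4 powr p * \<beta> powr p" using s p by (simp add: powr_mult[symmetric] powr_mono2)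
  define C1 where "C1 = 3 powr (p - 1) * (2 * (4 powr p * Z) + 4 powr p + 3 powr (p - 1) * (H * (2 powr p * (ros_factor p A + L powr p))))"
  have C1: "0 \<le> C1" unfolding C1_def using HZ ros_factor_nonneg[OF A0] by (intro mult_nonneg_nonneg add_nonneg_nonneg) auto
  have "3 powr (p - 1) * (2 * (s powr p * Z) + s powr p + 3 powr (p - 1) * (a powr p * (H * (2 powr p * (T.ros_bound p a2 ap + (cov_err + n * a3 / s) powr p)))))
    = 3 powr (p - 1) * (2 * (s powr p * Z) + s powr p + 3 powr (p - 1) * (H * (2 powr p * (a powr p * (T.ros_bound p a2 ap + (cov_err + n * a3 / s) powr p)))))"
    by (simp only: mult.left_commute)
  also have "\<dots> \<le> 3 powr (p - 1) * (2 * ((4 powr p * \<beta> powr p) * Z) + 4 powr p * \<beta> powr p + 3 powr (p - 1) * (H * (2 powr p * ((ros_factor p A + L powr p) * \<beta> powr p))))"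
    by (intro mult_left_mono add_mono mult_right_mono sp main HZ) auto
  also have "\<dots> = C1 * \<beta> powr p" by (simp add: C1_def algebra_simps)
  finally have cost': "(\<integral>\<^sup>+x. ennreal (norm (T.W (fst (fst (fst x))) - V x) powr p) \<partial>(T.MGG \<Otimes>\<^sub>M Q)) \<le> ennreal (C1 * \<beta> powr p)"
    using cost unfolding a_def by (meson ennreal_leI order_trans)
  interpret PGG: pair_prob_space "P \<Otimes>\<^sub>M (std_gauss :: (real ^ 'd) measure)" "std_gauss :: (real ^ 'd) measure" ..
  interpret Q: prob_space Q by (rule Q)
  interpret PGQ: pair_prob_space T.MGG Q ..
  let ?\<Omega> = "T.MGG \<Otimes>\<^sub>M Q"
  define U where "U x = S (fst (fst (fst x)))" for x :: "(('a \<times> (real ^ 'd)) \<times> (real ^ 'd)) \<times> real \<times> (real ^ 'd)"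
  have U [measurable]: "U \<in> borel_measurable ?\<Omega>" unfolding U_def by measurable
  have lawU: "distr ?\<Omega> borel U = distr P borel S"
    unfolding U_def by (rule distr_pair3_fst[OF prob_space_axioms std_gauss.prob_space_axioms std_gauss.prob_space_axioms Q S_measurable])
  have D: "(\<integral>\<^sup>+x. ennreal (norm (S (fst (fst (fst x))) - T.W (fst (fst (fst x)))) powr p) \<partial>?\<Omega>) \<le> ennreal (ros_factor p 1 * \<beta> powr p)"
  proof -
    have "(\<integral>\<^sup>+x. ennreal (norm (S (fst (fst (fst x))) - T.W (fst (fst (fst x)))) powr p) \<partial>?\<Omega>)
      = (\<integral>\<^sup>+x. ennreal (norm (S (fst (fst x)) - T.W (fst (fst x))) powr p) \<partial>T.MGG)"
      by (rule nn_integral_pair_fst[OF PGG.prob_space_axioms Q]) measurable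
    also have "\<dots> = (\<integral>\<^sup>+x. ennreal (norm (S (fst x) - T.W (fst x)) powr p) \<partial>T.MG)"
      by (rule nn_integral_pair_fst[OF T.pair.prob_space_axioms std_gauss.prob_space_axioms]) measurable
    also have "\<dots> = (\<integral>\<^sup>+x. ennreal (norm (S x - T.W x) powr p) \<partial>P)"
      by (rule nn_integral_pair_fst[OF prob_space_axioms std_gauss.prob_space_axioms]) measurable
    also have "\<dots> = ennreal (expectation (\<lambda>w. norm (S w - T.W w) powr p))"
      unfolding T.W_def by (rule nn_integral_eq_integral) (use tail_sum(1)[OF p] in auto)
    also have "\<dots> \<le> ennreal (ros_factor p 1 * \<beta> powr p)"
      unfolding T.W_def \<beta>_def by (intro ennreal_leI tail_sum(2) p order_refl)
    finally show ?thesis .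
  qed
  have "(\<integral>\<^sup>+x. ennreal (norm (U x - V x) powr p) \<partial>?\<Omega>)
    \<le> (\<integral>\<^sup>+x. ennreal (2 powr p) * (ennreal (norm (S (fst (fst (fst x))) - T.W (fst (fst (fst x)))) powr p) + ennreal (norm (T.W (fst (fst (fst x))) - V x) powr p)) \<partial>?\<Omega>)"
  proof (rule nn_integral_mono)
    fix x :: "(('a \<times> (real ^ 'd)) \<times> (real ^ 'd)) \<times> real \<times> (real ^ 'd)"
    have "norm (U x - V x) powr p \<le> 2 powr p * (norm (S (fst (fst (fst x))) - T.W (fst (fst (fst x)))) powr p + norm (T.W (fst (fst (fst x))) - V x) powr p)"
      using norm_add_powr_bound[of p "S (fst (fst (fst x))) - T.W (fst (fst (fst x)))" "T.W (fst (fst (fst x))) - V x"] p by (simp add: U_def)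
    then show "ennreal (norm (U x - V x) powr p) \<le> ennreal (2 powr p) * (ennreal (norm (S (fst (fst (fst x))) - T.W (fst (fst (fst x)))) powr p) + ennreal (norm (T.W (fst (fst (fst x))) - V x) powr p))"
      by (simp add: ennreal_plus[symmetric] ennreal_mult[symmetric] ennreal_leI del: ennreal_plus)
  qed
  also have "\<dots> = ennreal (2 powr p) * ((\<integral>\<^sup>+x. ennreal (norm (S (fst (fst (fst x))) - T.W (fst (fst (fst x)))) powr p) \<partial>?\<Omega>)
     + (\<integral>\<^sup>+x. ennreal (norm (T.W (fst (fst (fst x))) - V x) powr p) \<partial>?\<Omega>))"
    by (subst nn_integral_cmult, measurable, subst nn_integral_add, measurable)
  also have "\<dots> \<le> ennreal (2 powr p) * (ennreal (ros_factor p 1 * \<beta> powr p) + ennreal (C1 * \<beta> powr p))"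
    by (intro mult_left_mono add_mono D cost') simp
  also have "\<dots> = ennreal (2 powr p * (ros_factor p 1 * \<beta> powr p + C1 * \<beta> powr p))"
    using C1 ros_factor_nonneg[of 1 p] by (simp add: ennreal_plus[symmetric] ennreal_mult[symmetric] del: ennreal_plus)
  also have "2 powr p * (ros_factor p 1 * \<beta> powr p + C1 * \<beta> powr p) = coupling_const TYPE('d) p k * \<beta> powr p"
  proof -
    have "coupling_const TYPE('d) p k = 2 powr p * (ros_factor p 1 + C1)"
      unfolding coupling_const_def C1_def A_def L_def R_def H_def Z_def by simp
    then show ?thesis by (simp add: algebra_simps)
  qed
  finally have "(\<integral>\<^sup>+x. ennreal (norm (U x - V x) powr p) \<partial>?\<Omega>) \<le> ennreal (coupling_const TYPE('d) p k * \<beta> powr p)" .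
  then show thesis unfolding \<beta>_def by (rule that[OF PGQ.prob_space_axioms U V lawU lawV])
qed

end

section \<open>The Wasserstein bound\<close>

lemma ennreal_powr_le:
  assumes "x \<le> ennreal (c powr p)" "0 \<le> c" "0 < p"
  shows "ennreal_powr x (1 / p) \<le> ennreal c"
proof -
  have fin: "x \<noteq> \<infinity>" using assms(1) by (auto simp: top_unique)
  have "enn2real x \<le> c powr p" using assms(1) using enn2real_mono[OF assms(1)] by simp
  then have "enn2real x powr (1 / p) \<le> (c powr p) powr (1 / p)" using assms by (intro powr_mono2) auto
  also have "\<dots> = c" using assms by (simp add: powr_powr)
  finally show ?thesis using fin by (simp add: ennreal_powr_def ennreal_leI)
qed

lemma wasserstein_le:
  fixes U V :: "'b \<Rightarrow> 'v::euclidean_space"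
  assumes [measurable]: "U \<in> borel_measurable \<Omega>" "V \<in> borel_measurable \<Omega>"
    and laws: "distr \<Omega> borel U = \<nu>" "distr \<Omega> borel V = \<mu>"
    and cost: "(\<integral>\<^sup>+x. ennreal (norm (U x - V x) powr p) \<partial>\<Omega>) \<le> ennreal (c powr p)" and c: "0 \<le> c" "0 < p"
  shows "wasserstein p \<nu> \<mu> \<le> ennreal c"
proof -
  let ?\<gamma> = "distr \<Omega> (borel \<Otimes>\<^sub>M borel) (\<lambda>x. (U x, V x))"
  have "?\<gamma> \<in> couplings \<nu> \<mu>"
    unfolding couplings_def using laws by (simp add: distr_distr comp_def)
  moreover have "(\<integral>\<^sup>+z. ennreal (norm (fst z - snd z) powr p) \<partial>?\<gamma>) \<le> ennreal (c powr p)"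
    by (subst nn_integral_distr) (use cost in simp_all)
  ultimately show ?thesis
    unfolding wasserstein_def by (intro INF_lower2[of ?\<gamma>] ennreal_powr_le c)
qed

lemma transpose_covariance: "transpose (covariance_matrix P Y) = covariance_matrix P Y"
  by (simp add: covariance_matrix_def transpose_def vec_eq_iff mult.commute)

lemma covariance_quadratic:
  fixes Y :: "'a \<Rightarrow> real ^ 'd"
  assumes [measurable]: "Y \<in> borel_measurable P" and int2: "integrable P (\<lambda>w. (norm (Y w))\<^sup>2)"
    and mean: "\<And>i. (\<integral>w. Y w $ i \<partial>P) = 0"
  shows "(\<integral>w. (u \<bullet> Y w) * (v \<bullet> Y w) \<partial>P) = u \<bullet> (covariance_matrix P Y *v v)"
proof -
  have int: "integrable P (\<lambda>w. Y w $ i * Y w $ j)" for i j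
  proof (rule Bochner_Integration.integrable_bound[OF int2])
    show "AE w in P. norm (Y w $ i * Y w $ j) \<le> norm ((norm (Y w))\<^sup>2)"
      by (intro AE_I2) (simp add: abs_mult power2_eq_square mult_mono component_le_norm_cart)
    have "(\<lambda>w. (Y w \<bullet> axis i 1) * (Y w \<bullet> axis j 1)) \<in> borel_measurable P" by measurable
    then show "(\<lambda>w. Y w $ i * Y w $ j) \<in> borel_measurable P" by (simp add: inner_axis)
  qed
  have "(\<integral>w. (u \<bullet> Y w) * (v \<bullet> Y w) \<partial>P) = (\<integral>w. (\<Sum>i\<in>UNIV. \<Sum>j\<in>UNIV. u $ i * v $ j * (Y w $ i * Y w $ j)) \<partial>P)"
    by (simp add: inner_vec_def sum_product mult_ac)
  also have "\<dots> = (\<Sum>i\<in>UNIV. \<Sum>j\<in>UNIV. u $ i * v $ j * (\<integral>w. Y w $ i * Y w $ j \<partial>P))"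
    using int by simp
  also have "\<dots> = u \<bullet> (covariance_matrix P Y *v v)"
    by (simp add: covariance_matrix_def mean inner_vec_def matrix_vector_mult_def sum_distrib_left mult_ac)
  finally show ?thesis .
qed

text \<open>The quotient of eigenvalues has two sources: \<open>F\<close> enlarges the summands by
  at most \<open>1 / sqrt (lambda_min A)\<close>, which enters \<open>\<kappa>\<close> and with it
  the truncation level, and \<open>B\<close> maps the coupling back, stretching distances by at most
  \<open>sqrt (lambda_max A)\<close>.\<close>

lemma clt_wasserstein_bound:
  fixes P :: "'a measure" and X :: "nat \<Rightarrow> 'a \<Rightarrow> real ^ 'd" and p q K l0 :: real
  assumes p: "2 \<le> p" and q: "0 < q" "q \<le> 2" and l0: "0 < l0" and P: "prob_space P" and n: "1 \<le> n"
    and meas: "\<And>i. i < n \<Longrightarrow> X i \<in> borel_measurable P" and mdep: "m_dependent P n M X"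
    and mean: "\<And>i. i < n \<Longrightarrow> (\<integral>w. X i w \<partial>P) = 0"
    and int: "\<And>i. i < n \<Longrightarrow> integrable P (\<lambda>w. norm (X i w) powr (p + q))"
    and mom: "\<And>i. i < n \<Longrightarrow> (\<integral>w. norm (X i w) powr (p + q) \<partial>P) \<le> K"
    and lmin: "l0 \<le> lambda_min (Sigma_n P X n)" and K: "0 < K"
  shows "wasserstein p (distr P borel (\<lambda>w. (1 / sqrt (real n)) *\<^sub>R partial_sum X n w)) (centered_gaussian (Sigma_n P X n))
    \<le> ennreal (coupling_const TYPE('d) p (K powr (1 / (p + q)) / sqrt l0) powr (1 / p) * K powr (1 / (p + q))
        * (sqrt (lambda_max (Sigma_n P X n)) / sqrt (lambda_min (Sigma_n P X n)))
        * (real M + 1) * real n powr (- (p + q - 2) / (2 * (2 * p + q - 2))))"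
proof -
  interpret prob_space P by (rule P)
  define A where "A = Sigma_n P X n"
  define l where "l = lambda_min A"
  have l: "l0 \<le> l" "0 < l" using lmin l0 by (simp_all add: l_def A_def)
  have symA: "transpose A = A"
    using transpose_covariance[of P "partial_sum X n"] by (simp add: A_def Sigma_n_def transpose_def vec_eq_iff)
  obtain B F :: "real ^ 'd ^ 'd" where BF: "B ** F = mat 1" "F ** B = mat 1" and BB: "B ** transpose B = A"
    and nB: "\<And>x. norm (B *v x) \<le> sqrt (lambda_max A) * norm x"
    and nF: "\<And>x. norm (F *v x) \<le> 1 / sqrt l * norm x"
    and FAF: "\<And>x y. (transpose F *v x) \<bullet> (A *v (transpose F *v y)) = x \<bullet> y"
    apply (rule covariance_square_root[OF symA l(2)[unfolded l_def], folded l_def])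
    subgoal premises pr for B F by (rule pr(1)[OF pr(2-7)])
    done
  define \<kappa> where "\<kappa> = K powr (1 / (p + q)) / sqrt l"
  \<comment> \<open>The value 0 from index \<open>n\<close> on is there because
    \<open>whitened_sum\<close> asks for measurability at every index, whereas \<open>X\<close> is
    measurable below \<open>n\<close> only.\<close>
  define h where "h i x = (if i < n then F *v ((1 / sqrt (real n)) *\<^sub>R x) else 0)" for i :: nat and x :: "real ^ 'd"
  define \<xi> where "\<xi> i w = h i (X i w)" for i w
  define T where "T = partial_sum X n"
  have hm [measurable]: "h i \<in> borel_measurable borel" for i unfolding h_def by measurable
  have xm: "\<xi> i \<in> borel_measurable P" for i
  proof (cases "i < n")
    case True
    note [measurable] = meas[OF True]
    show ?thesis unfolding \<xi>_def by measurable
  next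
    case False
    then have "\<xi> i = (\<lambda>_. 0)" by (auto simp: \<xi>_def h_def)
    then show ?thesis by simp
  qed
  have iX: "integrable P (X i)" if "i < n" for i
    by (rule integrable_norm_powr_imp[OF meas[OF that] int[OF that]]) (use p q in simp)
  have blin: "bounded_linear (\<lambda>x. F *v ((1 / sqrt (real n)) *\<^sub>R x))"
    by (rule bounded_linear_compose[OF matrix_vector_mul_bounded_linear bounded_linear_scaleR_right])
  have nh: "norm (\<xi> i w) powr (p + q) \<le> (1 / sqrt l * real n powr (- 1 / 2)) powr (p + q) * norm (X i w) powr (p + q)" if "i < n" for i w
  proof -
    have "norm (\<xi> i w) \<le> 1 / sqrt l * norm ((1 / sqrt (real n)) *\<^sub>R X i w)" using that nF[of "(1 / sqrt (real n)) *\<^sub>R X i w"] by (simp add: \<xi>_def h_def)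
    also have "\<dots> = 1 / sqrt l * real n powr (- 1 / 2) * norm (X i w)"
      using n by (simp add: powr_minus_divide powr_half_sqrt)
    finally have "norm (\<xi> i w) powr (p + q) \<le> (1 / sqrt l * real n powr (- 1 / 2) * norm (X i w)) powr (p + q)"
      using p q by (intro powr_mono2) auto
    then show ?thesis by (simp only: powr_mult[of "_ * _" "norm _"])
  qed
  have xint: "integrable P (\<lambda>w. norm (\<xi> i w) powr (p + q))" if "i < n" for i
    by (rule Bochner_Integration.integrable_bound[where f = "\<lambda>w. (1 / sqrt l * real n powr (- 1 / 2)) powr (p + q) * norm (X i w) powr (p + q)"])
       (use nh[OF that] int[OF that] xm in auto)
  interpret Wh: whitened_sum P \<xi> n M p q \<kappa>
  proof
    show "\<xi> i \<in> borel_measurable P" for i by (rule xm)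
    show "m_dependent P n M \<xi>" unfolding \<xi>_def by (rule m_dependent_compose[OF mdep P hm])
    show "expectation (\<xi> i) = 0" if "i < n" for i
      using integral_bounded_linear[OF blin iX[OF that]] mean[OF that] that by (simp add: \<xi>_def[abs_def] h_def)
    show "integrable P (\<lambda>w. norm (\<xi> i w) powr (p + q))" if "i < n" for i by (rule xint[OF that])
    show "expectation (\<lambda>w. norm (\<xi> i w) powr (p + q)) \<le> (\<kappa> * real n powr (- 1 / 2)) powr (p + q)" if "i < n" for i
    proof -
      have "expectation (\<lambda>w. norm (\<xi> i w) powr (p + q))
        \<le> expectation (\<lambda>w. (1 / sqrt l * real n powr (- 1 / 2)) powr (p + q) * norm (X i w) powr (p + q))"
        by (rule integral_mono) (use xint int nh that in auto)
      also have "\<dots> \<le> (1 / sqrt l * real n powr (- 1 / 2)) powr (p + q) * K"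
        using mom[OF that] by (simp add: mult_left_mono)
      also have "K = (K powr (1 / (p + q))) powr (p + q)" using K p q by (simp add: powr_powr)
      also have "(1 / sqrt l * real n powr (- 1 / 2)) powr (p + q) * (K powr (1 / (p + q))) powr (p + q) = (\<kappa> * real n powr (- 1 / 2)) powr (p + q)"
        by (simp only: powr_mult[symmetric]) (simp add: \<kappa>_def mult_ac)
      finally show ?thesis .
    qed
    show "2 \<le> p" "0 < q" "q \<le> 2" "0 < \<kappa>" "0 < n" using p q K l n by (simp_all add: \<kappa>_def)
    fix z
    have Sx: "(\<Sum>i<n. \<xi> i w) = F *v ((1 / sqrt (real n)) *\<^sub>R T w)" for w
      unfolding T_def partial_sum_def linear_sum[OF bounded_linear.linear[OF blin]] by (simp add: \<xi>_def h_def)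
    have uS: "u \<bullet> (\<Sum>i<n. \<xi> i w) = 1 / sqrt (real n) * ((transpose F *v u) \<bullet> T w)" for u w
      unfolding Sx by (simp add: matrix_vector_mult_scaleR inner_matrix_transpose)
    have Tm [measurable]: "T \<in> borel_measurable P" unfolding T_def partial_sum_def using meas by measurable
    have T2: "integrable P (\<lambda>w. (norm (T w))\<^sup>2)"
    proof (rule integrable_norm_power2_imp[OF Tm])
      show "integrable P (\<lambda>w. norm (T w) powr (p + q))"
        unfolding T_def partial_sum_def by (rule integrable_norm_powr_sum) (use meas int p q in auto)
    qed (use p q in simp)
    have T1: "expectation (\<lambda>w. T w $ i) = 0" for i
    proof -
      have "integrable P T" unfolding T_def partial_sum_def using iX by (intro Bochner_Integration.integrable_sum) auto
      then have "expectation (\<lambda>w. T w $ i) = expectation T $ i" by (rule integral_bounded_linear[OF bounded_linear_vec_nth])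
      also have "expectation T = 0" unfolding T_def partial_sum_def using iX mean by (subst Bochner_Integration.integral_sum) auto
      finally show ?thesis by simp
    qed
    define R where "R w = (\<Sum>i<n. \<xi> i w)" for w
    have Rm [measurable]: "R \<in> borel_measurable P" unfolding R_def using xm by measurable
    have R2: "integrable P (\<lambda>w. (norm (R w))\<^sup>2)"
    proof (rule integrable_norm_power2_imp[OF Rm])
      show "integrable P (\<lambda>w. norm (R w) powr (p + q))"
        unfolding R_def by (rule integrable_norm_powr_sum) (use xm xint p q in auto)
    qed (use p q in simp)
    have iR: "integrable P (\<lambda>w. (z \<bullet> R w) *\<^sub>R R w)"
      by (rule integrable_inner_scaleR[OF Rm R2])
    have "y \<bullet> expectation (\<lambda>w. (z \<bullet> R w) *\<^sub>R R w) = y \<bullet> z" for y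
    proof -
      let ?u = "transpose F *v z" and ?v = "transpose F *v y"
      have "y \<bullet> expectation (\<lambda>w. (z \<bullet> R w) *\<^sub>R R w) = expectation (\<lambda>w. y \<bullet> ((z \<bullet> R w) *\<^sub>R R w))"
        by (rule integral_inner_right[OF iR, symmetric])
      also have "\<dots> = expectation (\<lambda>w. 1 / real n * ((?u \<bullet> T w) * (?v \<bullet> T w)))"
        unfolding R_def inner_scaleR_right uS by (simp add: mult_ac)
      also have "\<dots> = 1 / real n * (?u \<bullet> (covariance_matrix P T *v ?v))"
        using covariance_quadratic[OF Tm T2 T1, of ?u ?v] by simp
      also have "\<dots> = ?u \<bullet> (A *v ?v)"
        unfolding A_def Sigma_n_def T_def by (simp add: scaleR_matrix_vector_assoc[symmetric])
      also have "\<dots> = y \<bullet> z" by (simp add: FAF inner_commute)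
      finally show ?thesis .
    qed
    then show "expectation (\<lambda>w. (z \<bullet> (\<Sum>i<n. \<xi> i w)) *\<^sub>R (\<Sum>i<n. \<xi> i w)) = z"
      unfolding R_def[symmetric] by (subst vector_eq_ldot[symmetric]) blast
  qed
  define k where "k = K powr (1 / (p + q)) / sqrt l0"
  define D where "D = coupling_const TYPE('d) p k"
  have D: "0 \<le> D" unfolding D_def by (rule coupling_const_nonneg)
  \<comment> \<open>Inside the constant the smallest eigenvalue is replaced by its lower bound
    \<open>l0\<close>, so that \<open>D\<close> depends on the permitted parameters only. The level
    \<open>tau\<close> keeps the exact \<open>\<kappa>\<close>, which supplies the denominator of
    the eigenvalue quotient.\<close>
  have "\<kappa> \<le> k" unfolding \<kappa>_def k_def using l l0 by (intro divide_left_mono) auto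
  then obtain \<Omega> :: "((('a \<times> (real ^ 'd)) \<times> (real ^ 'd)) \<times> real \<times> (real ^ 'd)) measure" and U V where
    UV [measurable]: "U \<in> borel_measurable \<Omega>" "V \<in> borel_measurable \<Omega>"
    and laws: "distr \<Omega> borel U = distr P borel Wh.S" "distr \<Omega> borel V = std_gauss"
    and cost: "(\<integral>\<^sup>+x. ennreal (norm (U x - V x) powr p) \<partial>\<Omega>) \<le> ennreal (D * (real (M + 1) * Wh.tau) powr p)"
    unfolding D_def by (rule Wh.whitened_coupling) blast
  have BS: "B *v Wh.S w = (1 / sqrt (real n)) *\<^sub>R partial_sum X n w" for w
  proof -
    have "Wh.S w = F *v ((1 / sqrt (real n)) *\<^sub>R partial_sum X n w)"
      unfolding Wh.S_def partial_sum_def linear_sum[OF bounded_linear.linear[OF blin]] by (simp add: \<xi>_def h_def)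
    then show ?thesis by (simp add: matrix_vector_mul_assoc BF)
  qed
  have law1: "distr \<Omega> borel (\<lambda>x. B *v U x) = distr P borel (\<lambda>w. (1 / sqrt (real n)) *\<^sub>R partial_sum X n w)"
  proof -
    have "distr \<Omega> borel (\<lambda>x. B *v U x) = distr (distr \<Omega> borel U) borel ((*v) B)" by (simp add: distr_distr comp_def)
    also have "\<dots> = distr P borel (\<lambda>w. B *v Wh.S w)" unfolding laws by (simp add: distr_distr comp_def)
    finally show ?thesis by (simp add: BS)
  qed
  have law2: "distr \<Omega> borel (\<lambda>x. B *v V x) = centered_gaussian A"
  proof -
    have "distr \<Omega> borel (\<lambda>x. B *v V x) = distr (distr \<Omega> borel V) borel ((*v) B)" by (simp add: distr_distr comp_def)
    then show ?thesis unfolding laws BB[symmetric] by (simp add: distr_std_gauss_matrix[OF BF(1)])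
  qed
  have lmax: "0 \<le> sqrt (lambda_max A)"
    using order_trans[OF norm_ge_zero nB[of "axis undefined 1"]] by simp
  define c where "c = sqrt (lambda_max A) * (D powr (1 / p) * (real (M + 1) * Wh.tau))"
  have c: "0 \<le> c" unfolding c_def using lmax Wh.tau_pos by (intro mult_nonneg_nonneg) auto
  have "wasserstein p (distr P borel (\<lambda>w. (1 / sqrt (real n)) *\<^sub>R partial_sum X n w)) (centered_gaussian A) \<le> ennreal c"
  proof (rule wasserstein_le[OF _ _ law1 law2 _ c])
    have "(\<integral>\<^sup>+x. ennreal (norm (B *v U x - B *v V x) powr p) \<partial>\<Omega>)
      \<le> (\<integral>\<^sup>+x. ennreal (sqrt (lambda_max A) powr p) * ennreal (norm (U x - V x) powr p) \<partial>\<Omega>)"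
    proof (rule nn_integral_mono)
      fix x
      have "norm (B *v U x - B *v V x) powr p \<le> (sqrt (lambda_max A) * norm (U x - V x)) powr p"
        using nB[of "U x - V x"] p by (intro powr_mono2) (auto simp: matrix_vector_mult_diff_distrib)
      then show "ennreal (norm (B *v U x - B *v V x) powr p) \<le> ennreal (sqrt (lambda_max A) powr p) * ennreal (norm (U x - V x) powr p)"
        by (simp add: powr_mult ennreal_mult[symmetric] ennreal_leI)
    qed
    also have "\<dots> = ennreal (sqrt (lambda_max A) powr p) * (\<integral>\<^sup>+x. ennreal (norm (U x - V x) powr p) \<partial>\<Omega>)"
      by (rule nn_integral_cmult) measurable
    also have "\<dots> \<le> ennreal (sqrt (lambda_max A) powr p) * ennreal (D * (real (M + 1) * Wh.tau) powr p)"
      by (rule mult_left_mono[OF cost]) simp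
    also have "\<dots> = ennreal (sqrt (lambda_max A) powr p * (D * (real (M + 1) * Wh.tau) powr p))"
      using D by (simp add: ennreal_mult)
    also have "sqrt (lambda_max A) powr p * (D * (real (M + 1) * Wh.tau) powr p) = c powr p"
    proof -
      have "(D powr (1 / p)) powr p = D" using D p by (simp add: powr_powr)
      then show ?thesis by (simp only: c_def powr_mult)
    qed
    finally show "(\<integral>\<^sup>+x. ennreal (norm (B *v U x - B *v V x) powr p) \<partial>\<Omega>) \<le> ennreal (c powr p)" .
  qed (use p in \<open>measurable, simp\<close>)
  also have "c = D powr (1 / p) * K powr (1 / (p + q)) * (sqrt (lambda_max A) / sqrt l) * (real M + 1) * real n powr (- (p + q - 2) / (2 * (2 * p + q - 2)))"
  proof -
    have "Wh.tau = K powr (1 / (p + q)) / sqrt l * real n powr (- (p + q - 2) / (2 * (2 * p + q - 2)))"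
      unfolding Wh.tau_def Wh.rate_def unfolding \<kappa>_def minus_divide_left by (rule refl)
    then show ?thesis by (simp add: c_def mult_ac add.commute)
  qed
  finally show ?thesis unfolding D_def k_def l_def A_def .
qed

section \<open>Uniform constants and change of the sample space\<close>

lemma clt_constant_exists:
  assumes p: "2 \<le> p" and q: "0 < q" "q \<le> 2" and l0: "0 < l0"
  shows "\<exists>C\<ge>0. wasserstein_clt_constant TYPE('a) TYPE('d::finite) p q K l0 C"
proof -
  \<comment> \<open>\<open>K\<close> is an arbitrary real number; enlarging the moment bound makes
    it positive, so that its root is a usable scale.\<close>
  define K' where "K' = max K 1"
  define C where "C = coupling_const TYPE('d) p (K' powr (1 / (p + q)) / sqrt l0) powr (1 / p) * K' powr (1 / (p + q))"
  have K: "0 < K'" "K \<le> K'" by (simp_all add: K'_def)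
  have C: "0 \<le> C" by (simp add: C_def)
  have "wasserstein_clt_constant TYPE('a) TYPE('d) p q K l0 C"
    unfolding wasserstein_clt_constant_def
  proof (intro allI impI)
    fix P :: "'a measure" and X :: "nat \<Rightarrow> 'a \<Rightarrow> real ^ 'd" and n M :: nat
    let ?e = "1 + (2 - q) / (2 * (2 * p + q - 2))" and ?A = "Sigma_n P X n"
    assume h: "prob_space P \<and> n \<ge> 1 \<and> (\<forall>i<n. X i \<in> borel_measurable P) \<and> m_dependent P n M X \<and> (\<forall>i<n. (\<integral>w. X i w \<partial>P) = 0) \<and>
      (\<forall>i<n. integrable P (\<lambda>w. norm (X i w) powr (p + q)) \<and> (\<integral>w. norm (X i w) powr (p + q) \<partial>P) \<le> K) \<and> lambda_min ?A \<ge> l0"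
    have "wasserstein p (distr P borel (\<lambda>w. (1 / sqrt (real n)) *\<^sub>R partial_sum X n w)) (centered_gaussian ?A)
      \<le> ennreal (C * (sqrt (lambda_max ?A) / sqrt (lambda_min ?A)) * (real M + 1) * real n powr (- (p + q - 2) / (2 * (2 * p + q - 2))))"
      unfolding C_def by (rule clt_wasserstein_bound) (use assms h K in \<open>auto intro: order_trans\<close>)
    also have "\<dots> \<le> ennreal (C * (sqrt (lambda_max ?A) / sqrt (lambda_min ?A)) * (real M + 1) powr ?e * real n powr (- (p + q - 2) / (2 * (2 * p + q - 2))))"
    proof (cases "0 \<le> sqrt (lambda_max ?A) / sqrt (lambda_min ?A)")
      case True
      have "(real M + 1) powr 1 \<le> (real M + 1) powr ?e" using p q by (intro powr_mono) auto
      then show ?thesis using mult_nonneg_nonneg[OF C True] by (intro ennreal_leI mult_right_mono mult_left_mono) auto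
    next
      \<comment> \<open>The real square root is odd, so the quotient might formally be negative.
        Then the bound already proved is \<open>ennreal\<close> of a nonpositive number, that is
        0.\<close>
      case False
      then have "C * (sqrt (lambda_max ?A) / sqrt (lambda_min ?A)) * (real M + 1) * real n powr (- (p + q - 2) / (2 * (2 * p + q - 2))) \<le> 0"
        using C by (intro mult_nonpos_nonneg mult_nonneg_nonpos) auto
      then show ?thesis by (simp add: ennreal_neg)
    qed
    finally show "wasserstein p (distr P borel (\<lambda>w. (1 / sqrt (real n)) *\<^sub>R partial_sum X n w)) (centered_gaussian ?A)
      \<le> ennreal (C * (sqrt (lambda_max ?A) / sqrt (lambda_min ?A)) * (real M + 1) powr ?e * real n powr (- (p + q - 2) / (2 * (2 * p + q - 2))))" .
  qed
  then show ?thesis using C by blast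
qed

text \<open>Only the joint law of \<open>X 0, \<dots>, X (n - 1)\<close> enters the statement, so the sample space may be
  replaced by the space of their values.\<close>

lemma clt_constant_transfer:
  assumes C: "wasserstein_clt_constant TYPE(nat \<Rightarrow> real ^ 'd::finite) TYPE('d) p q K l0 C"
  shows "wasserstein_clt_constant TYPE('a) TYPE('d) p q K l0 C"
  unfolding wasserstein_clt_constant_def
proof (intro allI impI, elim conjE)
  fix P :: "'a measure" and X :: "nat \<Rightarrow> 'a \<Rightarrow> real ^ 'd" and n M :: nat
  assume P: "prob_space P" and n: "1 \<le> n" and meas: "\<forall>i<n. X i \<in> borel_measurable P"
    and mdep: "m_dependent P n M X" and mean: "\<forall>i<n. (\<integral>w. X i w \<partial>P) = 0"
    and mom: "\<forall>i<n. integrable P (\<lambda>w. norm (X i w) powr (p + q)) \<and> (\<integral>w. norm (X i w) powr (p + q) \<partial>P) \<le> K"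
    and lmin: "l0 \<le> lambda_min (Sigma_n P X n)"
  interpret prob_space P by (rule P)
  define N where "N = (\<Pi>\<^sub>M i\<in>{..<n}. borel :: (real ^ 'd) measure)"
  define \<Phi> where "\<Phi> w = (\<lambda>i\<in>{..<n}. X i w)" for w
  define Y where "Y i f = f i" for i and f :: "nat \<Rightarrow> real ^ 'd"
  define P' where "P' = distr P N \<Phi>"
  have \<Phi> [measurable]: "\<Phi> \<in> P \<rightarrow>\<^sub>M N" unfolding \<Phi>_def N_def by (rule measurable_restrict) (use meas in auto)
  interpret P': prob_space P' unfolding P'_def by (rule prob_space_distr) simp
  have [measurable_cong]: "sets P' = sets N" by (simp add: P'_def)
  have Y\<Phi>: "Y i (\<Phi> w) = X i w" if "i < n" for i w using that by (simp add: Y_def \<Phi>_def)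
  have YN: "Y i \<in> borel_measurable N" if "i < n" for i
    unfolding Y_def N_def by (rule measurable_component_singleton) (use that in simp)
  have Ym: "Y i \<in> borel_measurable P'" if "i < n" for i using YN[OF that] by measurable
  have SN [measurable]: "partial_sum Y n \<in> borel_measurable N"
    unfolding partial_sum_def by (rule borel_measurable_sum) (use YN in auto)
  have S\<Phi>: "partial_sum Y n (\<Phi> w) = partial_sum X n w" for w by (simp add: partial_sum_def Y\<Phi>)
  have integral: "(\<integral>f. g f \<partial>P') = (\<integral>w. g (\<Phi> w) \<partial>P)" if "g \<in> borel_measurable N" for g :: "_ \<Rightarrow> 'v::{banach,second_countable_topology}"
    unfolding P'_def by (rule integral_distr[OF \<Phi> that])
  have comp: "(\<lambda>f. partial_sum Y n f $ i) \<in> borel_measurable N" for i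
  proof -
    have "(\<lambda>f. partial_sum Y n f \<bullet> axis i 1) \<in> borel_measurable N" by measurable
    then show ?thesis by (simp add: inner_axis)
  qed
  have "covariance_matrix P' (partial_sum Y n) = covariance_matrix P (partial_sum X n)"
    unfolding covariance_matrix_def integral[OF comp] S\<Phi>
    by (subst integral) (use comp in \<open>simp_all add: S\<Phi>\<close>)
  then have Sig: "Sigma_n P' Y n = Sigma_n P X n" by (simp add: Sigma_n_def)
  have law: "distr P' borel (\<lambda>f. (1 / sqrt (real n)) *\<^sub>R partial_sum Y n f) = distr P borel (\<lambda>w. (1 / sqrt (real n)) *\<^sub>R partial_sum X n w)"
    unfolding P'_def by (subst distr_distr) (simp_all add: comp_def S\<Phi>)
  have dep: "m_dependent P' n M Y"
    unfolding m_dependent_def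
  proof (intro allI impI, elim conjE)
    fix I J assume I: "I \<subseteq> {..<n}" and J: "J \<subseteq> {..<n}" and sep: "\<forall>i\<in>I. \<forall>j\<in>J. int M < \<bar>int i - int j\<bar>"
    let ?N = "\<lambda>I. Pi\<^sub>M I (\<lambda>_. borel :: (real ^ 'd) measure)"
    have rm [measurable]: "(\<lambda>f. \<lambda>i\<in>I. Y i f) \<in> N \<rightarrow>\<^sub>M ?N I" if "I \<subseteq> {..<n}" for I
      by (rule measurable_restrict) (use YN that in auto)
    have r\<Phi>: "(\<lambda>i\<in>I. Y i (\<Phi> w)) = (\<lambda>i\<in>I. X i w)" if "I \<subseteq> {..<n}" for I w
      using that by (intro restrict_ext) (auto simp: Y\<Phi>)
    have "indep_var (?N I) (\<lambda>w. \<lambda>i\<in>I. X i w) (?N J) (\<lambda>w. \<lambda>j\<in>J. X j w)"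
      using mdep I J sep unfolding m_dependent_def by blast
    \<comment> \<open>Independence is expressed as factorisation of the joint law, a property that
      passes to the push-forward under \<open>\<Phi>\<close> by composing the distributions.\<close>
    then have eq: "distr P (?N I) (\<lambda>w. \<lambda>i\<in>I. X i w) \<Otimes>\<^sub>M distr P (?N J) (\<lambda>w. \<lambda>j\<in>J. X j w)
      = distr P (?N I \<Otimes>\<^sub>M ?N J) (\<lambda>w. (\<lambda>i\<in>I. X i w, \<lambda>j\<in>J. X j w))"
      by (simp add: indep_var_distribution_eq)
    have d: "distr P' (?N I) (\<lambda>f. \<lambda>i\<in>I. Y i f) = distr P (?N I) (\<lambda>w. \<lambda>i\<in>I. X i w)" if "I \<subseteq> {..<n}" for I
      unfolding P'_def using rm[OF that] by (subst distr_distr) (simp_all add: comp_def r\<Phi>[OF that])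
    have d2: "distr P' (?N I \<Otimes>\<^sub>M ?N J) (\<lambda>f. (\<lambda>i\<in>I. Y i f, \<lambda>j\<in>J. Y j f)) = distr P (?N I \<Otimes>\<^sub>M ?N J) (\<lambda>w. (\<lambda>i\<in>I. X i w, \<lambda>j\<in>J. X j w))"
      unfolding P'_def using rm[OF I] rm[OF J] by (subst distr_distr) (simp_all add: comp_def r\<Phi>[OF I] r\<Phi>[OF J])
    show "P'.indep_var (?N I) (\<lambda>f. \<lambda>i\<in>I. Y i f) (?N J) (\<lambda>f. \<lambda>j\<in>J. Y j f)"
      unfolding P'.indep_var_distribution_eq d[OF I] d[OF J] d2 using eq rm[OF I] rm[OF J] by simp
  qed
  have mom': "integrable P' (\<lambda>f. norm (Y i f) powr (p + q)) \<and> (\<integral>f. norm (Y i f) powr (p + q) \<partial>P') \<le> K" if i: "i < n" for i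
  proof -
    have m: "(\<lambda>f. norm (Y i f) powr (p + q)) \<in> borel_measurable N" using YN[OF i] by measurable
    have "integrable P' (\<lambda>f. norm (Y i f) powr (p + q)) \<longleftrightarrow> integrable P (\<lambda>w. norm (Y i (\<Phi> w)) powr (p + q))"
      unfolding P'_def by (rule integrable_distr_eq[OF \<Phi> m])
    then show ?thesis using mom i integral[OF m] by (simp add: Y\<Phi>)
  qed
  have mean': "(\<integral>f. Y i f \<partial>P') = 0" if i: "i < n" for i
    using integral[OF YN[OF i]] mean i by (simp add: Y\<Phi>)
  from C[unfolded wasserstein_clt_constant_def, rule_format, of P' n Y M]
  show "wasserstein p (distr P borel (\<lambda>w. (1 / sqrt (real n)) *\<^sub>R partial_sum X n w)) (centered_gaussian (Sigma_n P X n))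
    \<le> ennreal (C * (sqrt (lambda_max (Sigma_n P X n)) / sqrt (lambda_min (Sigma_n P X n)))
         * (real M + 1) powr (1 + (2 - q) / (2 * (2 * p + q - 2)))
         * real n powr (- (p + q - 2) / (2 * (2 * p + q - 2))))"
    unfolding Sig law using P'.prob_space_axioms n Ym dep mean' mom' lmin by blast
qed

text \<open>The first conjunct provides a constant on one sample-space type that can carry the joint
  law of any collection; the second says that each constant valid there is valid for an arbitrary
  type of points. Together they express that the constant does not depend on the probability
  space.\<close>

theorem theorem2:
  fixes p q K l0 :: real
  assumes "p \<ge> 2" and "0 < q" and "q \<le> 2" and "l0 > 0"
  shows "(\<exists>C\<ge>0. wasserstein_clt_constant TYPE(nat \<Rightarrow> real ^ 'd::finite) TYPE('d) p q K l0 C) \<and>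
         (\<forall>C. wasserstein_clt_constant TYPE(nat \<Rightarrow> real ^ 'd) TYPE('d) p q K l0 C \<longrightarrow>
              wasserstein_clt_constant TYPE('a) TYPE('d) p q K l0 C)"
  using clt_constant_exists[OF assms] clt_constant_transfer by blast

end
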